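(* There is a constant $K>1$, and for every compact set $X\subset\mathbb{C}$ there is a constant $B=B(X)>0$ depending only on $X$, such that the following holds. For any admissible sequence of squares $\{P_n\}_{n\ge 1}$ (defined in the context), with $d_n$ denoting the diameter of $P_n$, there is a $K$-quasi-regular branched covering $F:\mathbb{C}\to\mathbb{C}$ satisfying $F^{-1}(\mathbb{D})=\mathbb{D}\cup\bigcup_{n\ge 1}P_n$, and moreover: (1) $F:\mathbb{D}\to\mathbb{D}$ is the square map $z\mapsto z^2$, and $F$ is symmetric about the real axis, that is, $F(\bar z)=\overline{F(z)}$ for all $z\in\mathbb{C}$; (2) for each $n\ge1$, $F:P_n\to\mathbb{D}$ is a branched covering of degree $d_n$, and $P_n$ contains exactly one critical point of $F$ in its interior, which is the center of $P_n$ and is mapped to the origin; (3) the set of all the other critical points of $F$ (that is, those other than $0$ and the centers of the squares) consists of the vertices of the squares $P_n$, $n\ge 1$, which belong to the negative real axis, and these are all mapped to the point $1$; (4) $F$ has no asymptotic values and has exactly two critical values, $0$ and $1$; (5) for every compact set $X\subset\mathbb{C}$, $|F(z)|<B(X)$ for all $z\in X$.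
   Context: $\mathbb{D}$ is the open unit disk. A map $f:\mathbb{C}\to\mathbb{C}$ is called $K$-quasi-regular if $f=g\circ\phi$ for some entire function $g$ and some $K$-quasiconformal map $\phi$ of the plane. Critical points are the points at which the map is not locally injective; critical values are their images. Asymptotic values are understood to be finite: $a\in\mathbb{C}$ is an asymptotic value if the map tends to $a$ along some curve tending to $\infty$. Admissible sequence of squares: $\{P_n\}_{n\ge1}$ is a sequence of open squares, each having one diagonal on the negative real axis and having diameter (length of the diagonal) $d_n$ a positive even integer, placed from right to left next to $\mathbb{D}$ so that consecutive objects touch at one point: the right vertex of $P_1$ is $-1$, and the right vertex of $P_{n+1}$ is the left vertex of $P_n$ for all $n\ge1$. Explicitly, with $s_1=-1$, $s_{n+1}=s_n-d_n$ and $\omega_n=s_n-d_n/2$, $P_n=\{x+iy: |x-\omega_n|+|y|<d_n/2\}$; the center of $P_n$ is $\omega_n$. *)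

theory Defs
  imports "HOL-Analysis.Analysis"
begin

section \<open>Quasiconformal and quasi-regular maps of the plane\<close>

text \<open>Absolute continuity of a function on the interval \<open>[a, b]\<close>; the library only has
  absolute continuity of measures.\<close>

definition abs_continuous_on_interval :: "real \<Rightarrow> real \<Rightarrow> (real \<Rightarrow> complex) \<Rightarrow> bool" where
  "abs_continuous_on_interval a b h \<longleftrightarrow>
     (\<forall>\<epsilon>>0. \<exists>\<delta>>0. \<forall>(N::nat) (u :: nat \<Rightarrow> real) (v :: nat \<Rightarrow> real).
        (\<forall>i<N. a \<le> u i \<and> u i \<le> v i \<and> v i \<le> b) \<and>
        disjoint_family_on (\<lambda>i. {u i<..<v i}) {..<N} \<and>
        (\<Sum>i<N. v i - u i) < \<delta> \<longrightarrow>
        (\<Sum>i<N. norm (h (v i) - h (u i))) < \<epsilon>)"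

text \<open>Absolute continuity on lines: on every closed rectangle with sides parallel to the axes,
  absolute continuity on almost every horizontal and almost every vertical segment.\<close>

definition ACL :: "(complex \<Rightarrow> complex) \<Rightarrow> bool" where
  "ACL f \<longleftrightarrow> (\<forall>a b c d. a < b \<and> c < d \<longrightarrow>
     (AE y in lborel. y \<in> {c..d} \<longrightarrow> abs_continuous_on_interval a b (\<lambda>x. f (Complex x y))) \<and>
     (AE x in lborel. x \<in> {a..b} \<longrightarrow> abs_continuous_on_interval c d (\<lambda>y. f (Complex x y))))"

text \<open>Analytic definition (Ahlfors): an ACL self-homeomorphism of the plane whose partial
  derivatives \<open>p = f\<^sub>x\<close> and \<open>q = f\<^sub>y\<close> satisfy almost everywhere the dilatation inequality between
  the Wirtinger derivatives \<open>(p + \<i> q) / 2\<close> (with respect to the conjugate of \<open>z\<close>) and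
  \<open>(p - \<i> q) / 2\<close> (with respect to \<open>z\<close>). With \<open>K \<ge> 1\<close> this includes preservation of orientation.
  For homeomorphisms, local square integrability of the derivatives follows.\<close>

definition quasiconformal_plane :: "real \<Rightarrow> (complex \<Rightarrow> complex) \<Rightarrow> bool" where
  "quasiconformal_plane K f \<longleftrightarrow>
     1 \<le> K \<and> (\<exists>g. homeomorphism UNIV UNIV f g) \<and> ACL f \<and>
     (AE z in lborel. \<exists>p q.
        ((\<lambda>x. f (Complex x (Im z))) has_vector_derivative p) (at (Re z)) \<and>
        ((\<lambda>y. f (Complex (Re z) y)) has_vector_derivative q) (at (Im z)) \<and>
        norm ((p + \<i> * q) / 2) \<le> (K - 1) / (K + 1) * norm ((p - \<i> * q) / 2))"

definition quasiregular_plane :: "real \<Rightarrow> (complex \<Rightarrow> complex) \<Rightarrow> bool" where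
  "quasiregular_plane K f \<longleftrightarrow>
     (\<exists>g \<phi>. g holomorphic_on UNIV \<and> quasiconformal_plane K \<phi> \<and> f = g \<circ> \<phi>)"

section \<open>Critical points, asymptotic values, branched coverings\<close>

definition critical_point :: "(complex \<Rightarrow> complex) \<Rightarrow> complex \<Rightarrow> bool" where
  "critical_point f z \<longleftrightarrow> \<not> (\<exists>U. open U \<and> z \<in> U \<and> inj_on f U)"

definition critical_value :: "(complex \<Rightarrow> complex) \<Rightarrow> complex \<Rightarrow> bool" where
  "critical_value f w \<longleftrightarrow> (\<exists>z. critical_point f z \<and> f z = w)"

definition asymptotic_value :: "(complex \<Rightarrow> complex) \<Rightarrow> complex \<Rightarrow> bool" where
  "asymptotic_value f a \<longleftrightarrow>
     (\<exists>\<gamma> :: real \<Rightarrow> complex. continuous_on {0..} \<gamma> \<and> filterlim \<gamma> at_infinity at_top \<and>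
        ((\<lambda>t. f (\<gamma> t)) \<longlongrightarrow> a) at_top)"

text \<open>Every point of the target has a neighbourhood \<open>W\<close> such that on each component of the
  preimage of \<open>W\<close> the map is, in suitable topological coordinates, \<open>z \<mapsto> z ^ m\<close> on the unit disk.
  The exponent \<open>m\<close> may vary from component to component.\<close>

definition branched_covering :: "(complex \<Rightarrow> complex) \<Rightarrow> complex set \<Rightarrow> complex set \<Rightarrow> bool" where
  "branched_covering f U V \<longleftrightarrow>
     continuous_on U f \<and> f ` U = V \<and>
     (\<forall>w\<in>V. \<exists>W. open W \<and> w \<in> W \<and> W \<subseteq> V \<and>
        (\<forall>C \<in> components (U \<inter> f -` W). \<exists>m\<ge>1. \<exists>(\<phi> :: complex \<Rightarrow> complex) \<phi>' (\<psi> :: complex \<Rightarrow> complex) \<psi>'.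
           homeomorphism C (ball 0 1) \<phi> \<phi>' \<and> homeomorphism W (ball 0 1) \<psi> \<psi>' \<and>
           \<psi> w = 0 \<and> (\<forall>z\<in>C. \<psi> (f z) = \<phi> z ^ (m::nat))))"

text \<open>The degree is the number of preimages of a point that is not a critical value of the
  restriction of \<open>f\<close> to the (open) set \<open>U\<close>.\<close>

definition branched_covering_of_degree ::
    "nat \<Rightarrow> (complex \<Rightarrow> complex) \<Rightarrow> complex set \<Rightarrow> complex set \<Rightarrow> bool" where
  "branched_covering_of_degree k f U V \<longleftrightarrow>
     branched_covering f U V \<and>
     (\<forall>w \<in> V - f ` {z \<in> U. critical_point f z}.
        finite {z \<in> U. f z = w} \<and> card {z \<in> U. f z = w} = k)"

section \<open>Admissible sequences of squares\<close>

text \<open>Sequences are indexed by \<open>n \<ge> 1\<close>; the value at index \<open>0\<close> is irrelevant.\<close>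

definition right_vertex :: "(nat \<Rightarrow> nat) \<Rightarrow> nat \<Rightarrow> real" where
  "right_vertex d n = - 1 - (\<Sum>k\<in>{1..<n}. real (d k))"

lemma right_vertex_1: "right_vertex d 1 = - 1"
  by (simp add: right_vertex_def)

lemma right_vertex_Suc: "n \<ge> 1 \<Longrightarrow> right_vertex d (Suc n) = right_vertex d n - real (d n)"
  by (simp add: right_vertex_def)

definition square_center :: "(nat \<Rightarrow> nat) \<Rightarrow> nat \<Rightarrow> real" where
  "square_center d n = right_vertex d n - real (d n) / 2"

definition diagonal_square :: "real \<Rightarrow> real \<Rightarrow> complex set" where
  "diagonal_square c \<delta> = {z. \<bar>Re z - c\<bar> + \<bar>Im z\<bar> < \<delta> / 2}"

definition diagonal_square_vertices :: "real \<Rightarrow> real \<Rightarrow> complex set" where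
  "diagonal_square_vertices c \<delta> =
     {Complex (c + \<delta> / 2) 0, Complex (c - \<delta> / 2) 0, Complex c (\<delta> / 2), Complex c (- (\<delta> / 2))}"

definition negative_real_axis :: "complex set" where
  "negative_real_axis = {z. Im z = 0 \<and> Re z < 0}"

definition admissible_squares :: "(nat \<Rightarrow> complex set) \<Rightarrow> (nat \<Rightarrow> nat) \<Rightarrow> bool" where
  "admissible_squares P d \<longleftrightarrow>
     (\<forall>n\<ge>1. 0 < d n \<and> even (d n) \<and> P n = diagonal_square (square_center d n) (real (d n)))"

end

theory Submission
  imports Defs "HOL-Complex_Analysis.Complex_Analysis"
begin

text \<open>
  The map \<open>F\<close> is built together with its factorisation \<open>F = g \<circ> \<phi>\<close>, out of two maps from the upper
  half-plane onto one and the same slit half-plane, the comb domain: the upper half-plane without the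
  horizontal slits \<open>Re \<le> 0\<close> at the heights \<open>h\<^sub>n = \<pi> (2 + d\<^sub>1 + \<dots> + d\<^sub>(\<^sub>n\<^sub>-\<^sub>1\<^sub>))\<close>.

  The first map is conformal. Among real polynomials \<open>x\<^sup>2 \<Prod> (1 - x / a\<^sub>n) ^ d\<^sub>n\<close> with \<open>n \<le> N\<close> there is one all of
  whose local maxima between consecutive zeros are \<open>1\<close> (\<open>unit_maxima_exists\<close>, an extremal problem).
  Its zeros tend to infinity at a rate independent of \<open>N\<close> (\<open>unit_maxima_ge\<close>) and each stays bounded
  (\<open>unit_maxima_bound\<close>), so a subsequence converges to an entire function \<open>g\<close> (after \<open>x = - z\<close>), and
  the logarithms \<open>f\<close> of \<open>g\<close> on the half-plane are injective with image the comb domain (\<open>f_bij\<close>): the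
  argument of \<open>g\<close> jumps by \<open>\<pi> d\<^sub>n\<close> at a zero, and \<open>g\<close> runs from \<open>0\<close> up to \<open>1\<close> and back between two zeros.

  The second map \<open>hlog\<close> is explicit. It is \<open>2 log z\<close> on the half disc, \<open>d\<^sub>n\<close> times the logarithm of a
  piecewise smooth coordinate of the square \<open>P\<^sub>n\<close> in its upper half, and \<open>outer\<close>, after flattening the
  saw-tooth boundary, elsewhere. It is again a bijection onto the comb domain (\<open>hlog_image\<close>) with
  dilatation at most \<open>5000\<close> (\<open>hlog_derivative\<close>), whatever the \<open>d\<^sub>n\<close> are. Then \<open>F\<close>, called \<open>model\<close>, is \<open>exp \<circ> hlog\<close> reflected
  across the real axis, and \<open>\<phi> = f\<^sup>-\<^sup>1 \<circ> hlog\<close> satisfies \<open>g \<circ> \<phi> = F\<close> on the half-plane.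

  Continuity of \<open>\<phi>\<close> up to the real axis needs no geometry of prime ends: the cluster set of \<open>\<phi>\<close> at a real
  point is a connected set of real numbers on which \<open>g\<close> is constant, hence a point
  (\<open>boundary_limit\<close>). The same applies to the inverse, so \<open>\<phi>\<close> extends to a homeomorphism of the plane
  (\<open>reflected_homeomorphism\<close>). Its analytic properties come from \<open>F\<close>: away from a countable set \<open>\<phi>\<close> is locally a
  holomorphic branch of \<open>g\<^sup>-\<^sup>1\<close> after the locally Lipschitz map \<open>F\<close>
  (\<open>quasiconformal_plane_of_factor\<close>).

  All the assertions on \<open>F\<close> are read off from the explicit formula: \<open>F = z\<^sup>2\<close> on the disc and
  \<open>F = (sq_chart n) ^ d\<^sub>n\<close> on the squares; outside, \<open>hlog\<close> and its reflections are coordinates in which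
  \<open>F\<close> is the exponential, and at a tip of a slit the coordinate is the square root of \<open>hlog - \<i> h\<^sub>n\<close>
  (\<open>tip_chart\<close>). As \<open>hlog\<close> is proper, a curve to infinity on which \<open>F\<close> stays bounded and away from \<open>0\<close> must
  have unbounded argument, so no asymptotic values exist.
\<close>

notation LIMSEQ (infix "---->" 60)

section \<open>Polynomials with prescribed zeros on a ray and equal maxima\<close>

locale even_multiplicities =
 fixes d :: "nat => nat"
 assumes d_pos: "n >= 1 ==> 0 < d n" and d_even: "n >= 1 ==> even (d n)"
begin

lemma d_ge_2: "n >= 1 ==> 2 <= d n" using d_pos[of n] d_even[of n] by (cases "d n = 1") auto

definition zpoly :: "nat => (nat => real) => real => real" where
 "zpoly N a x = x^2 * (\<Prod>n\<in>{1..N}. (1 - x / a n) ^ d n)"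

lemma zpoly_nonneg: "0 <= zpoly N a x" unfolding zpoly_def by (intro mult_nonneg_nonneg prod_nonneg zero_le_even_power) (auto simp: d_even)

lemma zpoly_0 [simp]: "zpoly N a 0 = 0" by (simp add: zpoly_def)

lemma zpoly_zero: "[|1 <= k; k <= N; a k ~= 0|] ==> zpoly N a (a k) = 0" unfolding zpoly_def using d_pos[of k] by (auto intro!: bexI[of _ k])

lemma continuous_on_zpoly: "continuous_on A (zpoly N a)" unfolding zpoly_def divide_inverse by (intro continuous_intros)

lemma zpoly_update:
 assumes "1 <= k" "k <= N" "x ~= a k" "a k ~= 0"
 shows "zpoly N (a(k := s)) x = zpoly N a x * ((1 - x / s) / (1 - x / a k)) ^ d k"
proof -
 have 1: "1 - x / a k ~= 0" using assms by auto
 have P1: "(\<Prod>n\<in>{1..N}. (1 - x / (a(k := s)) n) ^ d n)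
   = (1 - x / s) ^ d k * (\<Prod>n\<in>{1..N}-{k}. (1 - x / a n) ^ d n)" by (subst prod.remove[of _ k]) (use assms in "auto intro!: prod.cong")
 have P2: "(\<Prod>n\<in>{1..N}. (1 - x / a n) ^ d n)
   = (1 - x / a k) ^ d k * (\<Prod>n\<in>{1..N}-{k}. (1 - x / a n) ^ d n)" by (subst prod.remove[of _ k]) (use assms in auto)
 have "u * (b * w) = u * (c * w) * (b / c)" if "c ~= 0" for u b c w :: real
  using that by simp
 thus ?thesis
  unfolding zpoly_def P1 P2 power_divide using power_not_zero[OF 1] by blast
qed

text \<open>The constraint set of the extremal problem: the zeros are normalised by \<open>a\<^sub>N = 1\<close>, bounded below by
  \<open>\<delta>\<close>, and the maxima over consecutive gaps increase. Comparing values pointwise instead of maxima keeps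
  the set visibly closed.\<close>

definition increasing_maxima :: "nat => real => (nat => real) set" where
 "increasing_maxima N \<delta> = {a. a 0 = 0 & a N = 1 & (ALL n>N. a n = 1) & (ALL n:{1..N}. \<delta> <= a n & a n <= 1) &
   (ALL n<N. a n <= a (Suc n)) &
   (ALL j. Suc (Suc j) <= N --> (ALL x:{a j..a (Suc j)}. EX y:{a (Suc j)..a (Suc (Suc j))}. zpoly N a x <= zpoly N a y))}"

lemma increasing_maxima_points:
 assumes a: "a \<in> increasing_maxima N \<delta>" and "0 < \<delta>" "1 <= N"
 obtains y where "!!j. j < N ==> a j < y j & y j < a (Suc j) & 0 < zpoly N a (y j)"
  "!!j x. [|j < N; a j <= x; x <= a (Suc j)|] ==> zpoly N a x <= zpoly N a (y j)"
  "!!j. Suc j < N ==> zpoly N a (y j) <= zpoly N a (y (Suc j))"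
proof -
 have mono: "a n <= a (Suc n)" if "n < N" for n using a that by (auto simp: increasing_maxima_def)
 have a0: "a 0 = 0" using a by (auto simp: increasing_maxima_def)
 have pos: "0 < a n" if "1 <= n" for n
 proof (cases "n <= N")
  case True
  hence "\<delta> <= a n" using a that by (auto simp: increasing_maxima_def)
  thus ?thesis using \<open>0 < \<delta>\<close> by linarith
 qed (use a in "auto simp: increasing_maxima_def")
 have "EX y:{a j..a (Suc j)}. ALL x:{a j..a (Suc j)}. zpoly N a x <= zpoly N a y" if "j < N" for j
  using mono[OF that] by (intro continuous_attains_sup continuous_on_zpoly) auto
 then obtain y where y: "!!j. j < N ==> y j \<in> {a j..a (Suc j)}"
  and ymax: "!!j x. [|j < N; a j <= x; x <= a (Suc j)|] ==> zpoly N a x <= zpoly N a (y j)" by (metis atLeastAtMost_iff)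
 have step: "zpoly N a (y j) <= zpoly N a (y (Suc j))" if "Suc j < N" for j
 proof -
  have "EX z:{a (Suc j)..a (Suc (Suc j))}. zpoly N a (y j) <= zpoly N a z" using a y[of j] that by (auto simp: increasing_maxima_def)
  thus ?thesis using ymax[of "Suc j"] that by fastforce
 qed
 have a1: "a 1 <= a n" if "1 <= n" "n <= N" for n
  using that(1,2) by (induction n rule: dec_induct) (use mono in "auto intro: order_trans")
 have "0 < zpoly N a (a 1 / 2)" unfolding zpoly_def
 proof (intro mult_pos_pos prod_pos zero_less_power ballI)
  fix n assume n: "n \<in> {1..N}"
  thus "0 < 1 - a 1 / 2 / a n" using a1[of n] pos[of 1] pos[of n] n by (simp add: field_simps)
 qed (use pos[of 1] in auto)
 hence p0: "0 < zpoly N a (y 0)" using ymax[of 0 "a 1 / 2"] a0 pos[of 1] \<open>1 <= N\<close> by auto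
 have p: "0 < zpoly N a (y j)" if "j < N" for j
  using that by (induction j) (use p0 step in force)+
 have "a j < y j & y j < a (Suc j)" if "j < N" for j
 proof -
  have "zpoly N a (a j) = 0" using zpoly_zero[of j N a] pos[of j] a0 that by (cases "j = 0") auto
  moreover have "zpoly N a (a (Suc j)) = 0" using zpoly_zero[of "Suc j" N a] pos[of "Suc j"] that by auto
  ultimately show ?thesis using y[OF that] p[OF that] by (force simp: le_less)
 qed
 thus ?thesis using that p ymax step by blast
qed

text \<open>If two adjacent maxima differ, the zero between them can be moved to the right. This multiplies the
  earlier maxima by a factor above \<open>1\<close> and the later ones by a factor below \<open>1\<close>, both increasing in \<open>x\<close>,
  which respects their order, and a small move does not reverse the strict inequality.
  So the sum of the zeros was not maximal.\<close>

lemma increasing_maxima_perturb: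
 assumes a: "a \<in> increasing_maxima N \<delta>" and "0 < \<delta>" and k: "k = Suc j" "k < N"
  and y: "!!j. j < N ==> a j < y j & y j < a (Suc j) & 0 < zpoly N a (y j)"
  and ymax: "!!j x. [|j < N; a j <= x; x <= a (Suc j)|] ==> zpoly N a x <= zpoly N a (y j)"
  and ystep: "!!j. Suc j < N ==> zpoly N a (y j) <= zpoly N a (y (Suc j))"
  and less: "zpoly N a (y j) < zpoly N a (y k)"
 obtains \<epsilon> where "\<epsilon> > 0" "a(k := a k + \<epsilon>) \<in> increasing_maxima N \<delta>"
proof -
 define p where "p = zpoly N a"
 have a0: "a 0 = 0" and aN: "a N = 1" and a_gt: "!!n. n > N ==> a n = 1"
  and range: "!!n. [|1 <= n; n <= N|] ==> \<delta> <= a n & a n <= 1" using a by (auto simp: increasing_maxima_def)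
 have smono: "a n < a (Suc n)" if "n < N" for n using y[OF that] by auto
 have lt: "a m < a n" if "m < n" "n <= N" for m n
  using that
 proof (induction n)
  case (Suc n)
  thus ?case using smono[of n] by (cases "m = n") auto
 qed auto
 have le: "a m <= a n" if "m <= n" "n <= N" for m n using lt[of m n] that by (cases "m = n") auto
 have posn: "0 < a n" if "1 <= n" "n <= N" for n using range[OF that] \<open>0 < \<delta>\<close> by auto
 have kN: "1 <= k" "k <= N" using k by auto
 have yk1: "y k < 1" using y[of k] range[of "Suc k"] k by force
 define Q where "Q = (%z. zpoly N (a(k := fst z)) (snd z))"
 define K where "K = {a k..1} \<times> {0..1::real}"
 have c: "continuous_on K (%z. snd z / (a(k := fst z)) n)" if n: "n \<in> {1..N}" for n
  by (cases "n = k") (use posn[of n] posn[OF kN] n in "auto intro!: continuous_intros simp: K_def")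
 have "continuous_on K Q" unfolding Q_def zpoly_def
  by (intro continuous_on_mult continuous_on_power continuous_on_prod continuous_on_diff
    continuous_on_const continuous_on_snd continuous_on_id c)
 moreover have "compact K" unfolding K_def by (intro compact_Times) auto
 ultimately have uc: "uniformly_continuous_on K Q" by (rule compact_uniformly_continuous)
 define e where "e = (p (y k) - p (y j)) / 2"
 have "e > 0" using less by (simp add: e_def p_def)
 then obtain \<eta> where "\<eta> > 0" and \<eta>: "!!z z'. [|z \<in> K; z' \<in> K; dist z' z < \<eta>|] ==> dist (Q z') (Q z) < e"
  using uc unfolding uniformly_continuous_on_def by meson
 define \<epsilon> where "\<epsilon> = min (\<eta> / 3) ((y k - a k) / 2)"
 have \<epsilon>: "0 < \<epsilon>" "2 * \<epsilon> < \<eta>" "a k + \<epsilon> < y k"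
  using \<open>\<eta> > 0\<close> y[of k] k(2) by (auto simp: \<epsilon>_def min_def field_simps)
 define a' where "a' = a(k := a k + \<epsilon>)"
 have Q0: "Q (a k, x) = p x" for x by (simp add: Q_def p_def)
 have Q1: "Q (a k + \<epsilon>, x) = zpoly N a' x" for x by (simp add: Q_def a'_def)
 have near: "dist (Q (a k + \<epsilon>, x)) (Q (a k, x')) < e"
  if "x \<in> {0..1}" "x' \<in> {0..1}" "\<bar>x - x'\<bar> <= \<epsilon>" for x x'
 proof (rule \<eta>)
  have "dist (a k + \<epsilon>, x) (a k, x') <= dist (a k + \<epsilon>) (a k) + dist x x'" by (simp add: dist_Pair_Pair sqrt_sum_squares_le_sum)
  also have "... < \<eta>" using that \<epsilon> by (auto simp: dist_real_def)
  finally show "dist (a k + \<epsilon>, x) (a k, x') < \<eta>" .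
 qed (use that \<epsilon> yk1 range[OF kN] in "auto simp: K_def")
 have upd: "zpoly N a' x = p x * ((1 - x / (a k + \<epsilon>)) / (1 - x / a k)) ^ d k" if "x ~= a k" for x
  unfolding a'_def p_def by (rule zpoly_update) (use kN that posn[OF kN] in auto)
 have ak: "0 < a k" using posn[OF kN] .
 have ratio: "(1 - x / (a k + \<epsilon>)) / (1 - x / a k) = (a k / (a k + \<epsilon>)) * ((a k + \<epsilon> - x) / (a k - x))"
  if "x ~= a k" for x
  using that ak \<epsilon> by (simp add: field_simps)
 have r1: "((1 - x / (a k + \<epsilon>)) / (1 - x / a k)) ^ d k <= ((1 - z / (a k + \<epsilon>)) / (1 - z / a k)) ^ d k"
  if xz: "x <= z" and "z < a k \<or> a k + \<epsilon> <= x" for x z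
 proof -
  have ne: "x ~= a k" "z ~= a k" using that \<epsilon> by auto
  have "(a k + \<epsilon> - x) / (a k - x) = 1 + \<epsilon> / (a k - x)" "(a k + \<epsilon> - z) / (a k - z) = 1 + \<epsilon> / (a k - z)"
   using ne by (auto simp: field_simps)
  moreover have "0 <= (a k + \<epsilon> - x) / (a k - x)" using that \<epsilon> by (auto simp: divide_nonneg_pos divide_nonpos_neg)
  moreover have "\<epsilon> / (a k - x) <= \<epsilon> / (a k - z)"
  proof (cases "z < a k")
   case True thus ?thesis using xz \<epsilon> by (intro divide_left_mono mult_pos_pos) auto
  next
   case False thus ?thesis using that \<epsilon>
    by (intro divide_left_mono mult_neg_neg) auto
  qed
  ultimately have "0 <= (1 - x / (a k + \<epsilon>)) / (1 - x / a k)"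
   "(1 - x / (a k + \<epsilon>)) / (1 - x / a k) <= (1 - z / (a k + \<epsilon>)) / (1 - z / a k)"
   unfolding ratio[OF ne(1)] ratio[OF ne(2)] using ak \<epsilon> by (auto intro!: mult_left_mono mult_nonneg_nonneg divide_right_mono)
  thus ?thesis by (rule power_mono[rotated])
 qed
 have trans: "zpoly N a' x <= zpoly N a' z"
  if "p x <= p z" "x <= z" "z < a k \<or> a k + \<epsilon> <= x" for x z
 proof -
  have ne: "x ~= a k" "z ~= a k" using that \<epsilon> by auto
  show ?thesis unfolding upd[OF ne(1)] upd[OF ne(2)]
   using that r1[of x z] zpoly_nonneg d_even[OF kN(1)]
   by (intro mult_mono) (auto simp: p_def zero_le_even_power)
 qed
 have a'k: "a' k = a k + \<epsilon>" and a'n: "!!n. n ~= k ==> a' n = a n" by (auto simp: a'_def)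
 have "a' \<in> increasing_maxima N \<delta>" unfolding increasing_maxima_def mem_Collect_eq
 proof (intro conjI allI impI ballI)
  show "a' 0 = 0" "a' N = 1" using a0 aN k by (auto simp: a'_def)
  show "a' n = 1" if "n > N" for n using that a_gt k by (auto simp: a'_def)
  show "\<delta> <= a' n" if "n \<in> {1..N}" for n using range[of n] \<epsilon> that by (auto simp: a'_def)
  show "a' n <= 1" if "n \<in> {1..N}" for n using range[of n] \<epsilon> yk1 that by (auto simp: a'_def)
  show "a' n <= a' (Suc n)" if "n < N" for n
   using smono[OF that] \<epsilon> y[of k] k that by (auto simp: a'_def)
  fix i x assume i: "Suc (Suc i) <= N" and x: "x \<in> {a' i..a' (Suc i)}"
  have px: "p x <= p (y (Suc i))" if "a i <= x" "x <= a (Suc i)" using ymax[of i x] ystep[of i] that i by (auto simp: p_def)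
  have y1: "a (Suc i) < y (Suc i)" "y (Suc i) < a (Suc (Suc i))" using y[of "Suc i"] i by auto
  consider "i = j" | "Suc i < k" | "k <= i" using k by linarith
  thus "EX z:{a' (Suc i)..a' (Suc (Suc i))}. zpoly N a' x <= zpoly N a' z"
  proof cases
   case 1
   have aj: "0 <= a j" using le[of 0 j] a0 k by auto
   have x': "a j <= x" "x <= a k + \<epsilon>" using x 1 k a'k a'n by auto
   define x0 where "x0 = min x (a k)"
   have "p x0 <= p (y j)" unfolding p_def
    by (rule ymax) (use x' k smono[of j] in "auto simp: x0_def")
   moreover have "dist (Q (a k + \<epsilon>, x)) (Q (a k, x0)) < e"
    by (rule near) (use x' aj \<epsilon> yk1 ak range[OF kN] in "auto simp: x0_def min_def")
   moreover have "dist (Q (a k + \<epsilon>, y k)) (Q (a k, y k)) < e" by (rule near) (use \<epsilon> yk1 ak in auto)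
   ultimately have "zpoly N a' x <= zpoly N a' (y k)" unfolding Q0 Q1 by (auto simp: e_def dist_real_def abs_if field_simps split: if_splits)
   thus ?thesis using 1 k \<epsilon> y1 a'k a'n by (intro bexI[of _ "y k"]) auto
  next
   case 2
   have x': "a i <= x" "x <= a (Suc i)" using x 2 a'n by auto
   have "zpoly N a' x <= zpoly N a' (y (Suc i))" using y1 le[of "Suc (Suc i)" k] 2 k px[OF x'] x' by (intro trans) auto
   moreover have "a (Suc (Suc i)) <= a' (Suc (Suc i))" using \<epsilon> by (auto simp: a'_def)
   ultimately show ?thesis using 2 y1 a'n by (intro bexI[of _ "y (Suc i)"]) auto
  next
   case 3
   have x': "a i <= x" "x <= a (Suc i)" "a k + \<epsilon> <= x"
   proof -
    show "a i <= x" "x <= a (Suc i)" using x 3 \<epsilon> by (auto simp: a'_def split: if_splits)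
    show "a k + \<epsilon> <= x"
    proof (cases "i = k")
     case False
     hence "a (Suc k) <= a i" using 3 i by (intro le) auto
     thus ?thesis using x 3 False \<epsilon> y[of k] k by (auto simp: a'_def)
    qed (use x in "auto simp: a'_def")
   qed
   hence "zpoly N a' x <= zpoly N a' (y (Suc i))" using px y1 by (intro trans) auto
   thus ?thesis using 3 y1 a'n by (intro bexI[of _ "y (Suc i)"]) auto
  qed
 qed
 thus ?thesis using that \<epsilon> a'_def by blast
qed

lemma increasing_maxima_closed:
 assumes "0 < \<delta>" "1 <= N"
 shows "closed (increasing_maxima N \<delta>)" unfolding closed_sequential_limits
proof (intro allI impI, elim conjE)
 fix A :: "nat => nat => real" and a
 assume A: "ALL i. A i \<in> increasing_maxima N \<delta>" and lim: "A ----> a"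
 have co: "(%i. A i n) ----> a n" for n
  using continuous_on_tendsto_compose[OF continuous_on_product_coordinates lim] by auto
 have A': "A i 0 = 0" "A i N = 1" "n > N ==> A i n = 1" "[|1 <= n; n <= N|] ==> \<delta> <= A i n & A i n <= 1"
  "n < N ==> A i n <= A i (Suc n)" for i n
  using A by (auto simp: increasing_maxima_def)
 have range: "\<delta> <= a n" "a n <= 1" if "1 <= n" "n <= N" for n
  using that A'(4) by (auto intro: LIMSEQ_le_const[OF co] LIMSEQ_le_const2[OF co])
 have mono: "a n <= a (Suc n)" if "n < N" for n
  using A'(5)[OF that] by (auto intro: LIMSEQ_le[OF co co])
 have lz: "(%i. zpoly N (A (r i)) (x i)) ----> zpoly N a l"
  if "strict_mono r" "x ----> l" for r :: "nat => nat" and x l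
  unfolding zpoly_def
 proof (intro tendsto_intros that)
  fix n assume "n \<in> {1..N}"
  thus "a n ~= 0" using range[of n] \<open>0 < \<delta>\<close> by auto
  show "(%i. A (r i) n) ----> a n" using LIMSEQ_subseq_LIMSEQ[OF co that(1)] by (simp add: o_def)
 qed
 show "a \<in> increasing_maxima N \<delta>" unfolding increasing_maxima_def mem_Collect_eq
 proof (intro conjI allI impI ballI)
  show "a 0 = 0" "a N = 1" using LIMSEQ_unique[OF co] A' by (auto simp: tendsto_const)
  show "a n = 1" if "n > N" for n using LIMSEQ_unique[OF co] A'(3)[OF that] by (auto simp: tendsto_const)
  show "\<delta> <= a n" "a n <= 1" if "n \<in> {1..N}" for n using range that by auto
  show "a n <= a (Suc n)" if "n < N" for n using mono that .
  fix j x assume j: "Suc (Suc j) <= N" and x: "x \<in> {a j..a (Suc j)}"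
  define xs where "xs = (%i. max (A i j) (min x (A i (Suc j))))"
  have "xs ----> max (a j) (min x (a (Suc j)))" unfolding xs_def by (intro tendsto_intros co)
  hence xs: "xs ----> x" using x by (auto simp: max_def min_def split: if_splits)
  have "EX y:{A i (Suc j)..A i (Suc (Suc j))}. zpoly N (A i) (xs i) <= zpoly N (A i) y" for i
  proof -
   show ?thesis using A'(5)[of j i] j A by (auto simp: xs_def increasing_maxima_def)
  qed
  then obtain ys where ys: "!!i. A i (Suc j) <= ys i" "!!i. ys i <= A i (Suc (Suc j))"
   "!!i. zpoly N (A i) (xs i) <= zpoly N (A i) (ys i)" by (metis atLeastAtMost_iff)
  have "ys i \<in> {0..1}" for i
   using ys(1)[of i] ys(2)[of i] A'(4)[of "Suc j" i] A'(4)[of "Suc (Suc j)" i] j \<open>0 < \<delta>\<close> by auto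
  then obtain y r where r: "strict_mono (r :: nat => nat)" and y: "(ys \<circ> r) ----> y"
   using compact_Icc[of 0 "1 :: real"] unfolding compact_def by metis
  have y': "(%i. ys (r i)) ----> y" using y by (simp add: o_def)
  have xr: "(%i. xs (r i)) ----> x" using LIMSEQ_subseq_LIMSEQ[OF xs r] by (simp add: o_def)
  have cor: "(%i. A (r i) n) ----> a n" for n
   using LIMSEQ_subseq_LIMSEQ[OF co r] by (simp add: o_def)
  have "a (Suc j) <= y" "y <= a (Suc (Suc j))" using LIMSEQ_le[OF cor y'] LIMSEQ_le[OF y' cor] ys by blast+
  moreover have "zpoly N a x <= zpoly N a y" using LIMSEQ_le[OF lz[OF r xr] lz[OF r y']] ys(3) by blast
  ultimately show "EX y:{a (Suc j)..a (Suc (Suc j))}. zpoly N a x <= zpoly N a y" by auto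
 qed
qed

lemma increasing_maxima_compact:
 assumes "0 < \<delta>" "1 <= N"
 shows "compact (increasing_maxima N \<delta>)"
proof -
 have "compactin (product_topology (%n::nat. euclidean) UNIV) (PiE UNIV (%n. {0..1::real}))" unfolding compactin_PiE by auto
 hence "compact (PiE UNIV (%n::nat. {0..1::real}))" by (simp add: euclidean_product_topology)
 moreover have "increasing_maxima N \<delta> \<subseteq> PiE UNIV (%n. {0..1})"
 proof
  fix a assume a: "a \<in> increasing_maxima N \<delta>"
  have "a n \<in> {0..1}" for n
  proof -
   consider "n = 0" | "n > N" | "n \<in> {1..N}" by force
   thus ?thesis
   proof cases
    case 3
    hence "\<delta> <= a n" "a n <= 1" using a by (auto simp: increasing_maxima_def)
    thus ?thesis using assms by auto
   qed (use a in "auto simp: increasing_maxima_def")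
  qed
  thus "a \<in> PiE UNIV (%n. {0..1})" by auto
 qed
 ultimately show ?thesis
  using increasing_maxima_closed[OF assms] by (metis compact_Int_closed inf.absorb_iff2)
qed

text \<open>For a rapidly growing geometric progression of zeros the maxima grow as well.\<close>

lemma increasing_maxima_nonempty:
 assumes "1 <= N"
 obtains \<delta> a where "0 < \<delta>" "a \<in> increasing_maxima N \<delta>"
proof -
 define D where "D = (\<Sum>n\<in>{1..N}. d n)"
 define t :: real where "t = 2 ^ (D + 2)"
 have t4: "4 <= t" unfolding t_def by (simp add: power_add)
 define a where "a n = (if n = 0 then 0 else if n > N then 1 else 1 / t ^ (N - n))" for n
 have pos: "0 < a n" if "1 <= n" for n using that t4 by (auto simp: a_def)
 have step: "a (Suc n) = t * a n" if "1 <= n" "Suc n <= N" for n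
 proof -
  have "N - n = Suc (N - Suc n)" using that by auto
  thus ?thesis using that t4 by (simp add: a_def)
 qed
 have mono1: "a n <= a (Suc n)" if "n < N" for n
 proof (cases "n = 0")
  case False
  thus ?thesis using step[of n] pos[of n] that t4 mult_right_mono[of 1 t "a n"] by auto
 qed (use pos[of 1] in "simp add: a_def")
 have mono: "a m <= a n" if "m <= n" "n <= N" for m n
  using that by (induction n rule: dec_induct) (use mono1 in "auto intro: order_trans")
 have "a \<in> increasing_maxima N (a 1)" unfolding increasing_maxima_def mem_Collect_eq
 proof (intro conjI allI impI ballI)
  show "a 0 = 0" "a N = 1" using assms by (auto simp: a_def)
  show "a n = 1" if "n > N" for n using that by (auto simp: a_def)
  show "a 1 <= a n" if "n \<in> {1..N}" for n using mono[of 1 n] that by auto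
  show "a n <= 1" if "n \<in> {1..N}" for n using mono[of n N] that by (auto simp: a_def)
  show "a n <= a (Suc n)" if "n < N" for n using mono1 that .
  fix j x assume j: "Suc (Suc j) <= N" and x: "x \<in> {a j..a (Suc j)}"
  define k where "k = Suc j"
  define y where "y = a (Suc k) / 2"
  have k: "1 <= k" "Suc k <= N" using j by (auto simp: k_def)
  have ak: "0 < a k" and x': "0 <= x" "x <= a k" using pos[of k] k x mono[of 0 j] j by (auto simp: k_def a_def)
  have y: "y = t / 2 * a k" using step[OF k] by (simp add: y_def)
  have y2: "2 * a k <= y" unfolding y using t4 ak by (intro mult_right_mono) auto
  have fac: "\<bar>1 - x / a n\<bar> <= 2 * \<bar>1 - y / a n\<bar>" if n: "n \<in> {1..N}" for n
  proof (cases "n <= k")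
   case True
   have an: "0 < a n" "a n <= a k" using pos n mono True k by auto
   have 1: "1 <= a k / a n" using an by simp
   have 2: "0 <= x / a n" "x / a n <= a k / a n" using an x' by (auto intro: divide_right_mono)
   have 3: "2 * (a k / a n) <= y / a n" using divide_right_mono[OF y2, of "a n"] an by simp
   have "\<bar>1 - X\<bar> <= 2 * \<bar>1 - Y\<bar>" if "1 <= A" "0 <= X" "X <= A" "2 * A <= Y" for A X Y :: real
    using that by (auto simp: abs_if)
   from this[OF 1 2 3] show ?thesis .
  next
   case False
   hence an: "0 < a n" "a (Suc k) <= a n" using pos n mono by auto
   have 1: "y / a n <= 1 / 2" using an by (simp add: y_def field_simps)
   have 2: "0 <= x / a n" "x / a n <= 1" using x' mono[of k n] False n an by (auto simp: field_simps)
   have "\<bar>1 - X\<bar> <= 2 * \<bar>1 - Y\<bar>" if "Y <= 1 / 2" "0 <= X" "X <= 1" for X Y :: real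
    using that by (auto simp: abs_if)
   from this[OF 1 2] show ?thesis .
  qed
  have "\<bar>\<Prod>n\<in>{1..N}. (1 - x / a n) ^ d n\<bar> <= (\<Prod>n\<in>{1..N}. (2 * \<bar>1 - y / a n\<bar>) ^ d n)"
   unfolding abs_prod power_abs
   by (intro prod_mono conjI power_mono fac) auto
  also have "... = 2 ^ D * \<bar>\<Prod>n\<in>{1..N}. (1 - y / a n) ^ d n\<bar>"
   by (simp add: power_mult_distrib prod.distrib D_def power_sum abs_prod power_abs)
  finally have P: "\<bar>\<Prod>n\<in>{1..N}. (1 - x / a n) ^ d n\<bar> <= 2 ^ D * \<bar>\<Prod>n\<in>{1..N}. (1 - y / a n) ^ d n\<bar>" .
  have "x\<^sup>2 * 2 ^ D <= y\<^sup>2"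
  proof -
   have "x\<^sup>2 <= (a k)\<^sup>2" using x' by (simp add: power_mono)
   moreover have "(2::real) ^ D <= (t / 2)\<^sup>2"
   proof -
    have "(2::real) ^ D <= 2 ^ (D + 1)" by simp
    also have "... = t / 2" by (simp add: t_def power_add)
    also have "... <= (t / 2)\<^sup>2" using t4 by (simp add: power2_eq_square)
    finally show ?thesis .
   qed
   ultimately have "x\<^sup>2 * 2 ^ D <= (a k)\<^sup>2 * (t / 2)\<^sup>2" by (intro mult_mono) auto
   thus ?thesis by (simp add: y power_mult_distrib power_divide mult.commute)
  qed
  hence "x\<^sup>2 * 2 ^ D * \<bar>\<Prod>n\<in>{1..N}. (1 - y / a n) ^ d n\<bar> <= y\<^sup>2 * \<bar>\<Prod>n\<in>{1..N}. (1 - y / a n) ^ d n\<bar>"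
   by (intro mult_right_mono) auto
  moreover have "x\<^sup>2 * \<bar>\<Prod>n\<in>{1..N}. (1 - x / a n) ^ d n\<bar> <= x\<^sup>2 * (2 ^ D * \<bar>\<Prod>n\<in>{1..N}. (1 - y / a n) ^ d n\<bar>)"
   using P by (intro mult_left_mono) auto
  ultimately have "\<bar>zpoly N a x\<bar> <= \<bar>zpoly N a y\<bar>" by (simp add: zpoly_def abs_mult mult.assoc)
  hence "zpoly N a x <= zpoly N a y" using zpoly_nonneg[of N a x] zpoly_nonneg[of N a y] by simp
  moreover have "y \<in> {a (Suc j)..a (Suc (Suc j))}" using y2 ak pos[of "Suc k"] by (auto simp: y_def k_def)
  ultimately show "EX y:{a (Suc j)..a (Suc (Suc j))}. zpoly N a x <= zpoly N a y" by blast
 qed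
 thus ?thesis using that pos[of 1] by blast
qed

definition unit_maxima :: "nat => (nat => real) => bool" where
 "unit_maxima N a \<longleftrightarrow> a 0 = 0 & (ALL j<N. a j < a (Suc j)) & (ALL x:{0..a N}. zpoly N a x <= 1) &
   (ALL j<N. EX x:{a j<..<a (Suc j)}. zpoly N a x = 1)"

text \<open>Maximising the sum of the zeros over the compact constraint set makes all maxima equal, by
  \<open>increasing_maxima_perturb\<close>; rescaling the variable turns the common value into \<open>1\<close>.\<close>

lemma unit_maxima_exists:
 assumes N: "1 <= N"
 obtains a where "unit_maxima N a"
proof -
 obtain \<delta> a0 where \<delta>: "0 < \<delta>" and a0: "a0 \<in> increasing_maxima N \<delta>" using increasing_maxima_nonempty[OF N] .
 have "continuous_on (increasing_maxima N \<delta>) (%a. \<Sum>n\<in>{1..N}. a n)"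
  by (intro continuous_on_sum continuous_on_subset[OF continuous_on_product_coordinates]) auto
 then obtain a where a: "a \<in> increasing_maxima N \<delta>"
  and amax: "!!a'. a' \<in> increasing_maxima N \<delta> ==> (\<Sum>n\<in>{1..N}. a' n) <= (\<Sum>n\<in>{1..N}. a n)"
  using continuous_attains_sup[OF increasing_maxima_compact[OF \<delta> N]] a0 by blast
 obtain y where y: "!!j. j < N ==> a j < y j & y j < a (Suc j) & 0 < zpoly N a (y j)"
  and ymax: "!!j x. [|j < N; a j <= x; x <= a (Suc j)|] ==> zpoly N a x <= zpoly N a (y j)"
  and ystep: "!!j. Suc j < N ==> zpoly N a (y j) <= zpoly N a (y (Suc j))" using increasing_maxima_points[OF a \<delta> N] by blast
 have eq: "zpoly N a (y (Suc j)) = zpoly N a (y j)" if j: "Suc j < N" for j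
 proof (rule ccontr)
  assume "zpoly N a (y (Suc j)) ~= zpoly N a (y j)"
  hence "zpoly N a (y j) < zpoly N a (y (Suc j))" using ystep[OF j] by simp
  then obtain \<epsilon> where "\<epsilon> > 0" "a(Suc j := a (Suc j) + \<epsilon>) \<in> increasing_maxima N \<delta>"
   using increasing_maxima_perturb[OF a \<delta> refl j y ymax ystep] by blast
  hence "(\<Sum>n\<in>{1..N}. (a(Suc j := a (Suc j) + \<epsilon>)) n) <= (\<Sum>n\<in>{1..N}. a n)" using amax by blast
  moreover have "(\<Sum>n\<in>{1..N}. (a(Suc j := a (Suc j) + \<epsilon>)) n) = (\<Sum>n\<in>{1..N}. a n + (if n = Suc j then \<epsilon> else 0))"
   by (intro sum.cong) auto
  ultimately show False using j \<open>\<epsilon> > 0\<close> by (simp add: sum.distrib)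
 qed
 define M where "M = zpoly N a (y 0)"
 have M: "zpoly N a (y j) = M" if "j < N" for j using that by (induction j) (use eq in "auto simp: M_def")
 have M0: "0 < M" using y[of 0] N by (auto simp: M_def)
 have smono: "a j < a (Suc j)" if "j < N" for j using y[OF that] by auto
 have a00: "a 0 = 0" using a by (auto simp: increasing_maxima_def)
 have cover: "EX j<m. a j <= x & x <= a (Suc j)" if "0 <= x" "x <= a m" "1 <= m" "m <= N" for x m
  using that
 proof (induction m)
  case (Suc m)
  show ?case
  proof (cases "m = 0 \<or> a m <= x")
   case True
   thus ?thesis using Suc.prems a00 by (intro exI[of _ m]) auto
  next
   case False
   thus ?thesis using Suc by (auto intro: less_SucI)
  qed
 qed auto
 have le: "zpoly N a x <= M" if "0 <= x" "x <= a N" for x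
  using cover[OF that N order_refl] ymax M by fastforce
 define s where "s = 1 / sqrt M"
 have s: "0 < s" "s\<^sup>2 * M = 1" using M0 by (auto simp: s_def power_divide)
 have scale: "zpoly N (%n. s * a n) (s * x) = s\<^sup>2 * zpoly N a x" for x
  using s by (simp add: zpoly_def power_mult_distrib)
 have "unit_maxima N (%n. s * a n)" unfolding unit_maxima_def
 proof (intro conjI allI impI ballI)
  show "s * a 0 = 0" using a00 by simp
  show "s * a j < s * a (Suc j)" if "j < N" for j using smono[OF that] s by simp
  show "zpoly N (%n. s * a n) x <= 1" if "x \<in> {0..s * a N}" for x
  proof -
   have "zpoly N a (x / s) <= M" using that s by (intro le) (auto simp: field_simps)
   hence "s\<^sup>2 * zpoly N a (x / s) <= s\<^sup>2 * M" by (intro mult_left_mono) auto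
   thus ?thesis using scale[of "x / s"] s by simp
  qed
  show "EX x:{s * a j<..<s * a (Suc j)}. zpoly N (%n. s * a n) x = 1" if "j < N" for j
   using y[OF that] M[OF that] s scale[of "y j"] by (intro bexI[of _ "s * y j"]) auto
 qed
 thus ?thesis using that by blast
qed

end

section \<open>Bounds for the zeros that are uniform in the degree\<close>

context even_multiplicities
begin

lemma unit_maxima_less:
 assumes "unit_maxima N a" "m < n" "n <= N"
 shows "a m < a n" using assms(2,3)
proof (induction n)
 case (Suc n)
 thus ?case using assms(1) by (cases "m = n") (auto simp: unit_maxima_def intro: less_trans)
qed auto

lemma unit_maxima_pos:
 assumes "unit_maxima N a" "1 <= n" "n <= N"
 shows "0 < a n" using unit_maxima_less[OF assms(1), of 0 n] assms by (auto simp: unit_maxima_def)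

text \<open>At the first maximum \<open>x\<close> the logarithmic derivative vanishes, so that
  \<open>2 / x = \<Sum> d\<^sub>n / (a\<^sub>n - x) \<ge> \<Sum> d\<^sub>n / a\<^sub>n\<close>, and \<open>x \<ge> 1\<close> because the product is at most \<open>1\<close> there.\<close>

lemma unit_maxima_sum_le:
 assumes a: "unit_maxima N a" and N: "1 <= N"
 shows "(\<Sum>n\<in>{1..N}. d n / a n) <= 2"
proof -
 obtain x where x: "0 < x" "x < a 1" "zpoly N a x = 1" using a N by (force simp: unit_maxima_def)
 have pos: "0 < a n" "x < a n" if "n \<in> {1..N}" for n
  using unit_maxima_pos[OF a, of n] unit_maxima_less[OF a, of 1 n] that x by (cases "n = 1", auto)+
 define h where "h = (%t. 2 * ln t + (\<Sum>n\<in>{1..N}. d n * ln (1 - t / a n)))"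
 have exp_h: "exp (h t) = zpoly N a t" if t: "0 < t" "t < a 1" for t
 proof -
  have "0 < 1 - t / a n" if "n \<in> {1..N}" for n
   using unit_maxima_less[OF a, of 1 n] pos[OF that] that t by (cases "n = 1") (auto simp: field_simps)
  thus ?thesis
   using t exp_of_nat_mult[of 2 "ln t"] by (simp add: h_def zpoly_def exp_add exp_sum exp_of_nat_mult)
 qed
 have h_le: "h t <= 0" if t: "0 < t" "t < a 1" for t
 proof -
  have "a 1 <= a N" using unit_maxima_less[OF a, of 1 N] N by (cases "N = 1") auto
  hence "exp (h t) <= 1" unfolding exp_h[OF t] using a t by (auto simp: unit_maxima_def)
  thus ?thesis by simp
 qed
 have hx: "h x = 0" using exp_h[OF x(1,2)] x(3) by (metis exp_eq_one_iff)
 have "(h has_real_derivative (2 / x - (\<Sum>n\<in>{1..N}. d n / (a n - x)))) (at x)"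
 proof -
  have "((%t. d n * ln (1 - t / a n)) has_real_derivative - (d n / (a n - x))) (at x)" if "n \<in> {1..N}" for n
   using pos[OF that] x by (auto intro!: derivative_eq_intros simp: field_simps)
  hence "(h has_real_derivative (2 * (1 / x) + (\<Sum>n\<in>{1..N}. - (d n / (a n - x))))) (at x)"
   unfolding h_def using x by (intro DERIV_add DERIV_cmult DERIV_sum) (auto intro!: derivative_eq_intros)
  thus ?thesis by (simp add: sum_negf)
 qed
 hence "2 / x - (\<Sum>n\<in>{1..N}. d n / (a n - x)) = 0" by (rule DERIV_local_max[where d = "min x (a 1 - x)"]) (use x h_le hx in auto)
 moreover have "(\<Sum>n\<in>{1..N}. d n / a n) <= (\<Sum>n\<in>{1..N}. d n / (a n - x))" using pos x by (intro sum_mono divide_left_mono) auto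
 moreover have "1 <= x"
 proof -
  have "(\<Prod>n\<in>{1..N}. (1 - x / a n) ^ d n) <= 1" using pos x by (intro prod_le_1 conjI zero_le_power power_le_one) (auto intro: less_imp_le)
  hence "zpoly N a x <= x\<^sup>2 * 1" unfolding zpoly_def by (intro mult_left_mono) auto
  thus ?thesis using x by (simp add: power2_nonneg_ge_1_iff power2_ge_1_iff)
 qed
 hence "2 / x <= 2" using x by (simp add: field_simps)
 ultimately show ?thesis by simp
qed

text \<open>As the zeros increase and \<open>d\<^sub>m \<ge> 2\<close>, the sum \<open>\<Sum> d\<^sub>m / a\<^sub>m\<close> is at least \<open>2 n / a\<^sub>n\<close>. This growth makes the
  products converge.\<close>

lemma unit_maxima_ge:
 assumes a: "unit_maxima N a" and n: "1 <= n" "n <= N"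
 shows "real n <= a n"
proof -
 have "real n * (2 / a n) = (\<Sum>m\<in>{1..n}. 2 / a n)" by simp
 also have "... <= (\<Sum>m\<in>{1..n}. d m / a m)"
 proof (intro sum_mono frac_le)
  fix m assume m: "m \<in> {1..n}"
  show "a m <= a n" using unit_maxima_less[OF a, of m n] m n by (cases "m = n") auto
  show "2 <= real (d m)" using d_ge_2[of m] m by auto
  show "0 < a m" using unit_maxima_pos[OF a] m n by auto
 qed auto
 also have "... <= (\<Sum>m\<in>{1..N}. d m / a m)" using n by (intro sum_mono2) (auto intro!: divide_nonneg_pos unit_maxima_pos[OF a])
 also have "... <= 2" using unit_maxima_sum_le[OF a] n by auto
 finally show ?thesis using unit_maxima_pos[OF a n] by (simp add: field_simps)
qed

lemma exp_le_one_minus: "[|0 <= t; t <= 1 / 2|] ==> exp (- 2 * t) <= 1 - (t::real)"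
proof -
 assume t: "0 <= t" "t <= 1 / 2"
 have "- 2 * t <= ln (1 - t)" using t mult_left_mono[of t "1/2" t] ln_one_minus_pos_lower_bound[OF t] by (simp add: power2_eq_square)
 thus ?thesis using t by (subst (asm) ln_ge_iff) auto
qed

text \<open>At \<open>y = 2 A\<close> the value is at most \<open>1\<close> although the zeros up to \<open>a\<^sub>k\<close> contribute a definite amount, so the
  later ones must damp: the sum of \<open>d\<^sub>n / a\<^sub>n\<close> over them is bounded below. If \<open>a\<^sub>K\<close> were very large, this damping would
  beat every power on the next gap, where the maximum is \<open>1\<close>.\<close>

lemma unit_maxima_bound_step:
 assumes A: "1 <= A" "!!N a. [|unit_maxima N a; Suc k <= N|] ==> a k <= A"
 obtains B where "!!N a. [|unit_maxima N a; Suc (Suc k) <= N|] ==> a (Suc k) <= B"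
proof -
 define K where "K = Suc k"
 define y where "y = 2 * A"
 have y: "2 <= y" using A by (simp add: y_def)
 define D where "D = 2 + (\<Sum>n\<in>{1..K}. d n)"
 have "((%x::real. (4 * y) ^ D * (x ^ D / exp x)) \<longlongrightarrow> (4 * y) ^ D * 0) at_top" by (intro tendsto_intros tendsto_power_div_exp_0)
 hence "eventually (%x::real. (4 * y) ^ D * (x ^ D / exp x) < 1) at_top" by (rule order_tendstoD(2)) simp
 then obtain X0 where X0: "!!x. x >= X0 ==> (4 * y) ^ D * (x ^ D / exp x) < 1" by (auto simp: eventually_at_top_linorder)
 define B where "B = max (max (2 * y) (4 * y * d K)) (4 * y * X0)"
 have "a K <= B" if a: "unit_maxima N a" and N: "Suc K <= N" for N a
 proof (rule ccontr)
  assume "\<not> a K <= B"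
  hence aK: "2 * y < a K" "4 * y * d K < a K" "4 * y * X0 < a K" by (auto simp: B_def)
  have pos: "0 < a n" if "n \<in> {1..N}" for n using unit_maxima_pos[OF a] that by auto
  have ge1: "1 <= a n" if "n \<in> {1..N}" for n using unit_maxima_ge[OF a, of n] that by auto
  have le: "a m <= a n" if "m <= n" "n <= N" for m n
   using unit_maxima_less[OF a, of m n] that by (cases "m = n") auto
  have kN: "1 <= K" "K <= N" using N by (auto simp: K_def)
  have split: "{1..N} = {1..k} \<union> {K..N}" "{1..N} = {1..K} \<union> {Suc K..N}" "{K..N} = insert K {Suc K..N}" using kN by (auto simp: K_def)
  define C where "C = (\<Sum>n\<in>{K..N}. d n / a n)"
  define C' where "C' = (\<Sum>n\<in>{Suc K..N}. d n / a n)"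
  have CC: "C = d K / a K + C'" unfolding C_def C'_def split(3) by simp
  have "zpoly N a y <= 1" using a y aK le[of K N] kN by (auto simp: unit_maxima_def)
  moreover have "4 * (1 * exp (- 2 * y * C)) <= zpoly N a y" unfolding zpoly_def
  proof (rule mult_mono)
   show "4 <= y\<^sup>2" using power_mono[OF y, of 2] by simp
   have "1 * exp (- 2 * y * C) <= (\<Prod>n\<in>{1..k}. (1 - y / a n) ^ d n) * (\<Prod>n\<in>{K..N}. (1 - y / a n) ^ d n)"
   proof (rule mult_mono)
    have "1 <= (1 - y / a n) ^ d n" if n: "n \<in> {1..k}" for n
    proof -
     have "a n <= A" using le[of n k] A(2)[OF a] N n kN by (auto simp: K_def)
     moreover have "0 < a n" using pos n kN by (auto simp: K_def)
     ultimately have "2 <= y / a n" by (simp add: y_def field_simps)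
     hence "1 <= \<bar>1 - y / a n\<bar> ^ d n" by (intro one_le_power) auto
     thus ?thesis using d_even[of n] n by (simp add: power_even_abs)
    qed
    thus "1 <= (\<Prod>n\<in>{1..k}. (1 - y / a n) ^ d n)" by (rule prod_ge_1)
    have "exp (- 2 * y * C) = (\<Prod>n\<in>{K..N}. exp (- 2 * (y / a n)) ^ d n)"
     by (simp add: C_def sum_distrib_left exp_sum flip: exp_of_nat_mult sum_negf)
      (simp add: mult_ac)
    also have "... <= (\<Prod>n\<in>{K..N}. (1 - y / a n) ^ d n)"
    proof (intro prod_mono conjI power_mono exp_le_one_minus)
     fix n assume n: "n \<in> {K..N}"
     have an: "0 < a n" "2 * y <= a n" using pos[of n] le[of K n] n kN aK by auto
     show "0 <= y / a n" using an y by simp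
     show "y / a n <= 1 / 2" using an y by (simp add: field_simps)
    qed auto
    finally show "exp (- 2 * y * C) <= (\<Prod>n\<in>{K..N}. (1 - y / a n) ^ d n)" .
   qed (auto intro!: prod_nonneg zero_le_even_power d_even)
   also have "... = (\<Prod>n\<in>{1..N}. (1 - y / a n) ^ d n)" unfolding split(1) by (rule prod.union_disjoint[symmetric]) (auto simp: K_def)
   finally show "1 * exp (- 2 * y * C) <= (\<Prod>n\<in>{1..N}. (1 - y / a n) ^ d n)" .
  qed auto
  ultimately have "4 * exp (- 2 * y * C) <= 1" by simp
  hence "4 <= exp (2 * y * C)" by (simp add: exp_minus field_simps)
  hence "exp 1 <= exp (2 * y * C)" using exp_le by linarith
  hence "1 / (2 * y) <= C" using y by (simp add: field_simps)
  moreover have "d K / a K <= 1 / (4 * y)" using aK(2) pos[of K] kN y by (simp add: field_simps)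
  moreover have "1 / (2 * y) = 1 / (4 * y) + 1 / (4 * y)" using y by (simp add: field_simps)
  ultimately have C': "1 / (4 * y) <= C'" using CC by linarith
  have "EX x:{a K<..<a (Suc K)}. zpoly N a x = 1" using a N unfolding unit_maxima_def by (simp add: Suc_le_lessD)
  then obtain x where x: "a K < x" "x < a (Suc K)" "zpoly N a x = 1" by auto
  have x1: "1 <= x" using x ge1[of K] kN by auto
  have "zpoly N a x <= x\<^sup>2 * (x ^ (D - 2) * exp (- x * C'))" unfolding zpoly_def
  proof (rule mult_left_mono)
   have "(\<Prod>n\<in>{1..N}. (1 - x / a n) ^ d n) = (\<Prod>n\<in>{1..K}. (1 - x / a n) ^ d n) * (\<Prod>n\<in>{Suc K..N}. (1 - x / a n) ^ d n)"
    unfolding split(2) by (rule prod.union_disjoint) auto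
   also have "... <= x ^ (D - 2) * exp (- x * C')"
   proof (rule mult_mono)
    have "(\<Prod>n\<in>{1..K}. (1 - x / a n) ^ d n) <= (\<Prod>n\<in>{1..K}. x ^ d n)"
    proof (intro prod_mono conjI)
     fix n assume n: "n \<in> {1..K}"
     have an: "1 <= a n" "a n <= x" using ge1[of n] le[of n K] n kN x by auto
     have "x / a n <= x" using an x1 by (simp add: field_simps mult_le_cancel_left)
     moreover have "1 <= x / a n" using an by simp
     ultimately have "\<bar>1 - x / a n\<bar> ^ d n <= x ^ d n" by (intro power_mono) auto
     thus "(1 - x / a n) ^ d n <= x ^ d n" using d_even[of n] n by (simp add: power_even_abs)
     show "0 <= (1 - x / a n) ^ d n" using d_even[of n] n by (auto intro: zero_le_even_power)
    qed
    thus "(\<Prod>n\<in>{1..K}. (1 - x / a n) ^ d n) <= x ^ (D - 2)" by (simp add: D_def power_sum)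
    have "(\<Prod>n\<in>{Suc K..N}. (1 - x / a n) ^ d n) <= (\<Prod>n\<in>{Suc K..N}. exp (- (x / a n)) ^ d n)"
    proof (intro prod_mono conjI power_mono)
     fix n assume n: "n \<in> {Suc K..N}"
     show "0 <= 1 - x / a n" using x le[of "Suc K" n] n pos[of n] by auto
     thus "0 <= (1 - x / a n) ^ d n" by simp
     show "1 - x / a n <= exp (- (x / a n))" using exp_ge_add_one_self[of "- (x / a n)"] by simp
    qed
    also have "... = exp (- x * C')" by (simp add: C'_def sum_distrib_left exp_sum flip: exp_of_nat_mult sum_negf)
      (simp add: mult_ac)
    finally show "(\<Prod>n\<in>{Suc K..N}. (1 - x / a n) ^ d n) <= exp (- x * C')" .
   qed (use x1 in "auto intro!: prod_nonneg zero_le_even_power d_even")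
   finally show "(\<Prod>n\<in>{1..N}. (1 - x / a n) ^ d n) <= x ^ (D - 2) * exp (- x * C')" .
  qed auto
  also have "... = x ^ D * exp (- x * C')" by (simp add: D_def power_add power2_eq_square)
  also have "... <= x ^ D * exp (- (x / (4 * y)))"
  proof -
   have "x * (1 / (4 * y)) <= x * C'" using C' x1 by (intro mult_left_mono) auto
   thus ?thesis using x1 by (intro mult_left_mono) auto
  qed
  also have "... = (4 * y) ^ D * ((x / (4 * y)) ^ D / exp (x / (4 * y)))" using y by (simp add: exp_minus power_divide field_simps)
  also have "... < 1"
  proof (rule X0)
   show "X0 <= x / (4 * y)" using x aK(3) y by (simp add: field_simps)
  qed
  finally show False using x(3) by simp
 qed
 thus ?thesis using that by (auto simp: K_def)
qed

lemma unit_maxima_bound: "EX A>0. ALL N a. unit_maxima N a --> Suc k <= N --> a k <= A"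
proof (induction k)
 case 0
 show ?case by (intro exI[of _ 1]) (auto simp: unit_maxima_def)
next
 case (Suc k)
 then obtain A where "ALL N a. unit_maxima N a --> Suc k <= N --> a k <= A" by blast
 hence "1 <= max 1 A" "!!N a. [|unit_maxima N a; Suc k <= N|] ==> a k <= max 1 A" by (auto simp: le_max_iff_disj)
 then obtain B where "!!N a. [|unit_maxima N a; Suc (Suc k) <= N|] ==> a (Suc k) <= B" using unit_maxima_bound_step by metis
 thus ?case by (intro exI[of _ "max 1 B"]) (auto simp: le_max_iff_disj)
qed

end

section \<open>Logarithms of the polynomials on the upper half-plane\<close>

abbreviation uhp :: "complex set" where "uhp \<equiv> {z. 0 < Im z}"

lemma convex_uhp: "convex uhp" by (rule convex_halfspace_Im_gt)
lemma open_uhp: "open uhp" by (simp add: open_halfspace_Im_gt)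
lemma connected_uhp: "connected uhp" using convex_uhp by (rule convex_connected)

text \<open>Along the segment from \<open>w\<close> to \<open>z\<close>: the tool that turns a sign of \<open>Im h'\<close> into injectivity, as in the
  Noshiro-Warschawski theorem.\<close>

lemma uhp_quotient_derivative:
 assumes h: "h holomorphic_on uhp" and z: "z \<in> uhp" and w: "w \<in> uhp" and ne: "z ~= w" and t: "0 <= t" "t <= (1::real)"
 shows "((%t. Im (h (w + of_real t * (z - w)) / (z - w))) has_real_derivative
  Im (deriv h (w + of_real t * (z - w)))) (at t)" and "w + of_real t * (z - w) \<in> uhp"
proof -
 show m: "w + of_real t * (z - w) \<in> uhp" using convexD_alt[OF convex_uhp w z t] by (simp add: scaleR_conv_of_real algebra_simps)
 have "(h has_field_derivative deriv h (w + of_real t * (z - w))) (at (w + of_real t * (z - w)))" using holomorphic_derivI[OF h open_uhp m] .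
 hence "((%s. h (w + s * (z - w)) / (z - w)) has_field_derivative deriv h (w + of_real t * (z - w))) (at (of_real t))"
  using ne by (auto intro!: derivative_eq_intros DERIV_chain2[where f = h])
 hence "((%s. h (w + of_real s * (z - w)) / (z - w)) has_vector_derivative deriv h (w + of_real t * (z - w))) (at t)"
  by (rule has_vector_derivative_real_field)
 thus "((%t. Im (h (w + of_real t * (z - w)) / (z - w))) has_real_derivative
  Im (deriv h (w + of_real t * (z - w)))) (at t)" unfolding has_real_derivative_iff_has_vector_derivative
  by (rule bounded_linear.has_vector_derivative[OF bounded_linear_Im])
qed

lemma Im_quotient_nonpos:
 assumes h: "h holomorphic_on uhp" and d: "!!z. z \<in> uhp ==> Im (deriv h z) <= 0"
  and z: "z \<in> uhp" "w \<in> uhp" "z ~= w"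
 shows "Im ((h z - h w) / (z - w)) <= 0"
proof -
 have "Im (h (w + of_real 1 * (z - w)) / (z - w)) <= Im (h (w + of_real 0 * (z - w)) / (z - w))"
  by (rule DERIV_nonpos_imp_nonincreasing[where f = "%t. Im (h (w + of_real t * (z - w)) / (z - w))"])
   (auto intro!: exI uhp_quotient_derivative[OF h z] d[OF uhp_quotient_derivative(2)[OF h z]])
 thus ?thesis by (simp add: diff_divide_distrib)
qed

lemma Im_quotient_neg:
 assumes h: "h holomorphic_on uhp" and d: "!!z. z \<in> uhp ==> Im (deriv h z) < 0"
  and z: "z \<in> uhp" "w \<in> uhp" "z ~= w"
 shows "Im ((h z - h w) / (z - w)) < 0"
proof -
 have "Im (h (w + of_real 1 * (z - w)) / (z - w)) < Im (h (w + of_real 0 * (z - w)) / (z - w))"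
  by (rule DERIV_neg_imp_decreasing[where f = "%t. Im (h (w + of_real t * (z - w)) / (z - w))"])
   (auto intro!: exI uhp_quotient_derivative[OF h z] d[OF uhp_quotient_derivative(2)[OF h z]])
 thus ?thesis by (simp add: diff_divide_distrib)
qed

lemma one_plus_uhp:
 assumes "z \<in> uhp" "0 <= b"
 shows "1 + complex_of_real b * z \<notin> \<real>\<^sub>\<le>\<^sub>0" "1 + complex_of_real b * z ~= 0"
  "0 <= Im (Ln (1 + of_real b * z))" "Im (Ln (1 + of_real b * z)) <= pi"
proof -
 have "0 <= Im (1 + of_real b * z)" "b = 0 \<or> 0 < Im (1 + of_real b * z)" using assms by (cases "b = 0"; simp)+
 thus 1: "1 + complex_of_real b * z \<notin> \<real>\<^sub>\<le>\<^sub>0" by (auto simp: complex_nonpos_Reals_iff)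
 thus 2: "1 + complex_of_real b * z ~= 0" by force
 show "0 <= Im (Ln (1 + of_real b * z))" "Im (Ln (1 + of_real b * z)) <= pi"
  using Im_Ln_pos_le[OF 2] \<open>0 <= Im (1 + of_real b * z)\<close> by auto
qed

lemma Im_Ln_le_slope:
 assumes "z \<in> uhp" "0 <= b" "0 < \<delta>" "\<delta> <= 1 + b * Re z"
 shows "Im (Ln (1 + of_real b * z)) <= b * Im z / \<delta>"
proof -
 have "Im (Ln (1 + of_real b * z)) = arctan (b * Im z / (1 + b * Re z))" using assms by (subst Im_Ln_eq) (auto simp: one_plus_uhp(2))
 also have "... <= b * Im z / (1 + b * Re z)" using assms by (intro arctan_le_self divide_nonneg_pos) auto
 also have "... <= b * Im z / \<delta>" using assms by (intro divide_left_mono) auto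
 finally show ?thesis .
qed

lemma Im_Ln_ge_pi_quarter:
 assumes "w ~= 0" "0 <= Im w" "Re w <= Im w"
 shows "pi / 4 <= Im (Ln w)"
proof (cases "0 < Re w")
 case True
 hence "Im (Ln w) = arctan (Im w / Re w)" using assms by (subst Im_Ln_eq) auto
 moreover have "arctan 1 <= arctan (Im w / Re w)" using True assms by (subst arctan_le_iff) auto
 ultimately show ?thesis by (simp add: arctan_one)
next
 case False
 hence "pi / 2 <= \<bar>Im (Ln w)\<bar>" using Re_Ln_pos_lt[OF assms(1)] by linarith
 moreover have "0 <= Im (Ln w)" using Im_Ln_pos_le[OF assms(1)] assms by auto
 ultimately show ?thesis using pi_gt_zero by linarith
qed

context even_multiplicities
begin

text \<open>The polynomials \<open>zpoly\<close> at \<open>x = - z\<close>, written in terms of the reciprocals \<open>b = 1 / a\<close>, for which a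
  zero that escapes to infinity is harmless.\<close>

definition cpoly :: "nat => (nat => real) => complex => complex" where
 "cpoly N b z = z^2 * (\<Prod>n\<in>{1..N}. (1 + of_real (b n) * z) ^ d n)"

definition clog_rest :: "nat => (nat => real) => complex => complex" where
 "clog_rest N b z = (\<Sum>n\<in>{1..N}. of_nat (d n) * Ln (1 + of_real (b n) * z))"

definition clog :: "nat => (nat => real) => complex => complex" where
 "clog N b z = 2 * Ln z + clog_rest N b z"

text \<open>The bounds of \<open>unit_maxima_sum_le\<close> and \<open>unit_maxima_ge\<close> in terms of the reciprocals; the estimates for
  the logarithms use only these.\<close>

definition tame :: "nat => (nat => real) => bool" where
 "tame N b \<longleftrightarrow> (ALL n:{1..N}. 0 < b n & b n <= 1 / n) & (ALL m n. 1 <= m --> m <= n --> n <= N --> b n <= b m) &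
   (\<Sum>n\<in>{1..N}. real (d n) * b n) <= 2"

lemma tame_pos: "[|tame N b; n \<in> {1..N}|] ==> 0 < b n" by (simp add: tame_def)
lemma tame_nonneg: "[|tame N b; n \<in> {1..N}|] ==> 0 <= b n" using tame_pos by force

lemma tame_antimono: "[|tame N b; 1 <= m; m <= n; n <= N|] ==> b n <= b m" by (simp add: tame_def)

lemma exp_clog: "[|tame N b; z \<in> uhp|] ==> exp (clog N b z) = cpoly N b z" using exp_of_nat_mult[of 2 "Ln z"] exp_Ln[of z]
 by (cases "z = 0") (auto simp: clog_def clog_rest_def cpoly_def exp_add exp_sum exp_of_nat_mult one_plus_uhp(2) tame_nonneg
   intro!: prod.cong)

lemma clog_rest_holomorphic: "tame N b ==> clog_rest N b holomorphic_on uhp"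
 unfolding clog_rest_def by (intro holomorphic_intros) (use one_plus_uhp(1) tame_nonneg in blast)

lemma Ln_holomorphic_uhp: "Ln holomorphic_on uhp" by (intro holomorphic_intros) (auto simp: complex_nonpos_Reals_iff)

lemma clog_holomorphic: "tame N b ==> clog N b holomorphic_on uhp"
 unfolding clog_def by (intro holomorphic_intros clog_rest_holomorphic) (auto simp: complex_nonpos_Reals_iff)

lemma clog_rest_quotient:
 assumes b: "tame N b" and z: "z \<in> uhp" "w \<in> uhp" "z ~= w"
 shows "Im ((clog_rest N b z - clog_rest N b w) / (z - w)) <= 0"
proof (rule Im_quotient_nonpos[OF clog_rest_holomorphic[OF b] _ z])
 fix u assume u: "u \<in> uhp"
 have "(clog_rest N b has_field_derivative (\<Sum>n\<in>{1..N}. of_nat (d n) * (of_real (b n) / (1 + of_real (b n) * u)))) (at u)"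
  unfolding clog_rest_def
  by (intro DERIV_sum DERIV_cmult)
   (use one_plus_uhp[OF u tame_nonneg[OF b]] in "auto intro!: derivative_eq_intros simp: divide_inverse mult.commute")
 hence "deriv (clog_rest N b) u = (\<Sum>n\<in>{1..N}. of_nat (d n) * (of_real (b n) / (1 + of_real (b n) * u)))" by (rule DERIV_imp_deriv)
 moreover have "Im (of_nat (d n) * (of_real (b n) / (1 + of_real (b n) * u))) <= 0" if "n \<in> {1..N}" for n
 proof -
  have "Im (of_real (b n) / (1 + of_real (b n) * u)) = - ((b n)\<^sup>2 * Im u / (cmod (1 + of_real (b n) * u))\<^sup>2)"
   by (simp add: Im_divide cmod_power2) (simp add: power2_eq_square)
  also have "... <= 0" using u by simp
  finally have "real (d n) * Im (of_real (b n) / (1 + of_real (b n) * u)) <= 0" by (simp add: mult_nonneg_nonpos)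
  moreover have "Im (of_nat m * w) = real m * Im w" for m and w :: complex by simp
  ultimately show ?thesis by (simp only:)
 qed
 ultimately show "Im (deriv (clog_rest N b) u) <= 0" by (simp only: Im_sum sum_nonpos)
qed

lemma Ln_quotient_neg:
 assumes z: "z \<in> uhp" "w \<in> uhp" "z ~= w"
 shows "Im ((Ln z - Ln w) / (z - w)) < 0"
proof (rule Im_quotient_neg[OF Ln_holomorphic_uhp _ z])
 fix u assume u: "u \<in> uhp"
 hence "(Ln has_field_derivative inverse u) (at u)" by (intro has_field_derivative_Ln) (auto simp: complex_nonpos_Reals_iff)
 hence "deriv Ln u = inverse u" by (rule DERIV_imp_deriv)
 thus "Im (deriv Ln u) < 0" using u by (simp add: divide_neg_pos sum_power2_gt_zero_iff)
qed

lemma Im_clog: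
 "Im (clog N b z) = 2 * Im (Ln z) + (\<Sum>n\<in>{1..N}. d n * Im (Ln (1 + of_real (b n) * z)))" by (simp add: clog_def clog_rest_def)

lemma Im_clog_lower:
 assumes b: "tame N b" and z: "z \<in> uhp" and "m <= N"
 shows "2 * Im (Ln z) + (\<Sum>n\<in>{1..m}. d n * Im (Ln (1 + of_real (b n) * z))) <= Im (clog N b z)" unfolding Im_clog
 using assms by (intro add_left_mono sum_mono2) (auto intro!: mult_nonneg_nonneg one_plus_uhp tame_nonneg[OF b])

lemma Im_clog_upper:
 assumes b: "tame N b" and z: "z \<in> uhp" and n: "1 <= n" "n <= N" and "0 < \<delta>" "\<delta> <= 1" "\<delta> <= 1 + b n * Re z"
 shows "Im (clog N b z) <= 2 * Im (Ln z) + (\<Sum>k\<in>{1..<n}. d k * Im (Ln (1 + of_real (b k) * z))) + 2 * Im z / \<delta>"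
proof -
 have split: "{1..N} = {1..<n} \<union> {n..N}" using n by auto
 have "(\<Sum>k\<in>{1..N}. d k * Im (Ln (1 + of_real (b k) * z)))
  = (\<Sum>k\<in>{1..<n}. d k * Im (Ln (1 + of_real (b k) * z))) + (\<Sum>k\<in>{n..N}. d k * Im (Ln (1 + of_real (b k) * z)))"
  unfolding split by (rule sum.union_disjoint) auto
 moreover have "(\<Sum>k\<in>{n..N}. d k * Im (Ln (1 + of_real (b k) * z))) <= (\<Sum>k\<in>{n..N}. d k * (b k * Im z / \<delta>))"
 proof (intro sum_mono mult_left_mono Im_Ln_le_slope)
  fix k assume k: "k \<in> {n..N}"
  have bk: "0 <= b k" "b k <= b n" using k n tame_nonneg[OF b, of k] tame_antimono[OF b, of n k] by auto
  show "0 <= b k" by fact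
  show "\<delta> <= 1 + b k * Re z"
  proof (cases "0 <= Re z")
   case True
   thus ?thesis using bk \<open>\<delta> <= 1\<close> mult_nonneg_nonneg[of "b k" "Re z"] by linarith
  next
   case False
   hence "b n * Re z <= b k * Re z" using bk by (intro mult_right_mono_neg) auto
   thus ?thesis using assms by linarith
  qed
 qed (use assms in auto)
 moreover have "(\<Sum>k\<in>{n..N}. d k * (b k * Im z / \<delta>)) = (\<Sum>k\<in>{n..N}. d k * b k) * (Im z / \<delta>)"
  by (simp add: sum_distrib_right sum_divide_distrib mult.assoc)
 moreover have "(\<Sum>k\<in>{n..N}. d k * b k) * (Im z / \<delta>) <= 2 * (Im z / \<delta>)"
 proof (rule mult_right_mono)
  have "(\<Sum>k\<in>{n..N}. d k * b k) <= (\<Sum>k\<in>{1..N}. d k * b k)"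
   using n by (intro sum_mono2) (auto intro!: mult_nonneg_nonneg tame_nonneg[OF b])
  thus "(\<Sum>k\<in>{n..N}. d k * b k) <= 2" using b by (auto simp: tame_def)
 qed (use z \<open>0 < \<delta>\<close> in auto)
 ultimately show ?thesis unfolding Im_clog by simp
qed

lemma Re_clog_lower:
 assumes b: "tame N b" and z: "z \<in> uhp" "0 <= Re z"
 shows "2 * ln (cmod z) <= Re (clog N b z)"
proof -
 have "0 <= Re (of_nat (d n) * Ln (1 + of_real (b n) * z))" if n: "n \<in> {1..N}" for n
 proof -
  have "1 <= \<bar>Re (1 + of_real (b n) * z)\<bar>" using z tame_nonneg[OF b n] by simp
  also have "... <= cmod (1 + of_real (b n) * z)" by (rule abs_Re_le_cmod)
  finally have "0 <= Re (Ln (1 + of_real (b n) * z))" using one_plus_uhp(2)[OF z(1) tame_nonneg[OF b n]] by simp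
  thus ?thesis by simp
 qed
 hence "0 <= Re (clog_rest N b z)" unfolding clog_rest_def Re_sum by (rule sum_nonneg)
 moreover have "Re (Ln z) = ln (cmod z)" using z by (intro Re_Ln) auto
 ultimately show ?thesis by (simp add: clog_def)
qed

text \<open>The factors with \<open>n > M\<close> have \<open>\<bar>b\<^sub>n z\<bar> \<le> 1 / 2\<close> and contribute at most \<open>2 \<Sum> d\<^sub>n b\<^sub>n \<bar>z\<bar>\<close>.\<close>

lemma Ln_sum_bound:
 fixes C R :: real
 assumes b: "tame N b" and z: "z \<in> uhp" "cmod z <= R" and M: "real M > 2 * R"
  and C: "!!n. n \<in> {1..N} ==> cmod (Ln (1 + of_real (b n) * z)) <= C" and "0 <= C"
 shows "cmod (clog_rest N b z) <= (\<Sum>n\<in>{1..M}. d n * C) + 4 * R"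
proof -
 have R: "0 <= R" using z norm_ge_zero order_trans by blast
 have "cmod (clog_rest N b z) <= (\<Sum>n\<in>{1..N}. cmod (of_nat (d n) * Ln (1 + of_real (b n) * z)))" unfolding clog_rest_def by (rule norm_sum)
 also have "... <= (\<Sum>n\<in>{1..N}. (if n <= M then d n * C else 0) + d n * b n * (2 * R))"
 proof (rule sum_mono)
  fix n assume n: "n \<in> {1..N}"
  have bn: "0 <= b n" "b n <= 1 / n" using b n by (auto simp: tame_def le_less)
  show "cmod (of_nat (d n) * Ln (1 + of_real (b n) * z)) <= (if n <= M then d n * C else 0) + d n * b n * (2 * R)"
  proof (cases "n <= M")
   case True
   have "real (d n) * cmod (Ln (1 + of_real (b n) * z)) <= d n * C" using C[OF n] by (intro mult_left_mono) auto
   from add_increasing2[OF _ this, of "d n * b n * (2 * R)"] show ?thesis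
    using True bn R by (simp add: norm_mult)
  next
   case False
   have "b n * cmod z <= b n * R" using bn z by (intro mult_left_mono) auto
   moreover have "b n * R <= 1 / n * R" using bn R by (intro mult_right_mono) auto
   moreover have "1 / n * R < 1 / 2" using False M by (simp add: field_simps)
   ultimately have 1: "b n * cmod z <= b n * R" "b n * cmod z < 1 / 2" by linarith+
   hence "cmod (Ln (1 + of_real (b n) * z)) <= 2 * cmod (of_real (b n) * z)" by (intro norm_Ln_le) (use bn in "simp add: norm_mult")
   also have "... <= b n * (2 * R)" using 1 bn by (simp add: norm_mult)
   finally have "real (d n) * cmod (Ln (1 + of_real (b n) * z)) <= d n * (b n * (2 * R))" by (intro mult_left_mono) auto
   thus ?thesis using False by (simp add: norm_mult mult.assoc)
  qed
 qed
 also have "... = (\<Sum>n\<in>{1..N}. if n <= M then d n * C else 0) + (\<Sum>n\<in>{1..N}. d n * b n) * (2 * R)"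
  by (simp add: sum.distrib sum_distrib_right)
 also have "... <= (\<Sum>n\<in>{1..M}. d n * C) + 2 * (2 * R)"
 proof (intro add_mono mult_right_mono)
  have "(\<Sum>n\<in>{1..N}. if n <= M then d n * C else 0) = (\<Sum>n\<in>{1..N} \<inter> {..M}. d n * C)"
   by (subst sum.inter_restrict) (auto intro!: sum.cong)
  also have "... <= (\<Sum>n\<in>{1..M}. d n * C)" using \<open>0 <= C\<close> by (intro sum_mono2) auto
  finally show "(\<Sum>n\<in>{1..N}. if n <= M then d n * C else 0) <= (\<Sum>n\<in>{1..M}. d n * C)" .
  show "(\<Sum>n\<in>{1..N}. d n * b n) <= 2" using b by (simp add: tame_def)
 qed (use R in auto)
 finally show ?thesis by simp
qed

lemma clog_locally_bounded:
 assumes K: "compact K" "K \<subseteq> uhp"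
 shows "EX B. ALL N b. tame N b --> (ALL z:K. cmod (clog N b z) <= B)"
proof -
 obtain R where R: "!!z. z \<in> K ==> cmod z <= R" using compact_imp_bounded[OF K(1)] by (auto simp: bounded_iff)
 obtain M :: nat where M: "2 * R < real M" using reals_Archimedean2 by blast
 have "compact ((%p. Ln (1 + of_real (fst p) * snd p)) ` ({0..1::real} \<times> K))"
 proof (rule compact_continuous_image)
  show "continuous_on ({0..1} \<times> K) (%p. Ln (1 + of_real (fst p) * snd p))" by (intro continuous_intros) (use K one_plus_uhp(1) in force)
 qed (use K in "auto intro: compact_Times")
 then obtain C where C: "!!z b. [|z \<in> K; 0 <= b; b <= 1|] ==> cmod (Ln (1 + of_real b * z)) <= C"
  unfolding compact_eq_bounded_closed bounded_iff by fastforce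
 have "compact (Ln ` K)" by (rule compact_continuous_image[OF _ K(1)])
   (use K holomorphic_on_imp_continuous_on[OF Ln_holomorphic_uhp] continuous_on_subset in blast)
 then obtain C' where C': "!!z. z \<in> K ==> cmod (Ln z) <= C'" unfolding compact_eq_bounded_closed bounded_iff by fastforce
 have "cmod (clog N b z) <= 2 * C' + ((\<Sum>n\<in>{1..M}. d n * C) + 4 * R)" if b: "tame N b" and z: "z \<in> K" for N b z
 proof -
  have "cmod (clog_rest N b z) <= (\<Sum>n\<in>{1..M}. d n * C) + 4 * R"
  proof (rule Ln_sum_bound[OF b _ R[OF z] M])
   show "z \<in> uhp" using K z by auto
   show "0 <= C" using C[OF z, of 0] by simp
   fix n assume n: "n \<in> {1..N}"
   hence "b n <= 1 / n" "0 < b n" using b by (auto simp: tame_def)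
   moreover have "1 / real n <= 1" using n by simp
   ultimately show "cmod (Ln (1 + of_real (b n) * z)) <= C" by (intro C[OF z]) auto
  qed
  moreover have "cmod (2 * Ln z) <= 2 * C'" using C'[OF z] by (simp add: norm_mult)
  ultimately show ?thesis unfolding clog_def by (intro norm_triangle_le) auto
 qed
 thus ?thesis by blast
qed

lemma Im_clog_bounded:
 "EX B. ALL N b z. tame N b --> z \<in> uhp --> cmod z <= R --> Im (clog N b z) <= B"
proof -
 obtain M :: nat where M: "2 * R < real M" using reals_Archimedean2 by blast
 have "Im (clog N b z) <= 2 * pi + ((\<Sum>n\<in>{1..M}. d n * pi) + 4 * R)"
  if b: "tame N b" and z: "z \<in> uhp" "cmod z <= R" for N b z
 proof -
  have R: "0 <= R" using z norm_ge_zero order_trans by blast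
  have "(\<Sum>n\<in>{1..N}. d n * Im (Ln (1 + of_real (b n) * z))) <= (\<Sum>n\<in>{1..N}. (if n <= M then d n * pi else 0) + d n * b n * (2 * R))"
  proof (rule sum_mono)
   fix n assume n: "n \<in> {1..N}"
   have bn: "0 <= b n" "b n <= 1 / n" using b n by (auto simp: tame_def le_less)
   show "d n * Im (Ln (1 + of_real (b n) * z)) <= (if n <= M then d n * pi else 0) + d n * b n * (2 * R)"
   proof (cases "n <= M")
    case True
    have "d n * Im (Ln (1 + of_real (b n) * z)) <= d n * pi" using one_plus_uhp(4)[OF z(1) bn(1)] by (intro mult_left_mono) auto
    from add_increasing2[OF _ this, of "d n * b n * (2 * R)"] show ?thesis
     using True bn R by simp
   next
    case False
    have "b n * cmod z <= b n * R" using bn z by (intro mult_left_mono) auto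
    moreover have "b n * R <= 1 / n * R" using bn R by (intro mult_right_mono) auto
    moreover have "1 / n * R < 1 / 2" using False M by (simp add: field_simps)
    ultimately have 1: "b n * cmod z <= b n * R" "b n * cmod z < 1 / 2" by linarith+
    have "Im (Ln (1 + of_real (b n) * z)) <= cmod (Ln (1 + of_real (b n) * z))" using abs_Im_le_cmod abs_le_D1 by blast
    also have "... <= 2 * cmod (of_real (b n) * z)" by (intro norm_Ln_le) (use bn 1 in "simp add: norm_mult")
    also have "... <= b n * (2 * R)" using 1 bn by (simp add: norm_mult)
    finally have "real (d n) * Im (Ln (1 + of_real (b n) * z)) <= d n * (b n * (2 * R))" by (intro mult_left_mono) auto
    thus ?thesis using False by (simp add: mult.assoc)
   qed
  qed
  also have "... = (\<Sum>n\<in>{1..N}. if n <= M then d n * pi else 0) + (\<Sum>n\<in>{1..N}. d n * b n) * (2 * R)"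
   by (simp add: sum.distrib sum_distrib_right)
  also have "... <= (\<Sum>n\<in>{1..M}. d n * pi) + 2 * (2 * R)"
  proof (intro add_mono mult_right_mono)
   have "(\<Sum>n\<in>{1..N}. if n <= M then d n * pi else 0) = (\<Sum>n\<in>{1..N} \<inter> {..M}. d n * pi)"
    by (subst sum.inter_restrict) (auto intro!: sum.cong)
   also have "... <= (\<Sum>n\<in>{1..M}. d n * pi)" by (intro sum_mono2) auto
   finally show "(\<Sum>n\<in>{1..N}. if n <= M then d n * pi else 0) <= (\<Sum>n\<in>{1..M}. d n * pi)" .
   show "(\<Sum>n\<in>{1..N}. d n * b n) <= 2" using b by (simp add: tame_def)
  qed (use R in auto)
  finally have "(\<Sum>n\<in>{1..N}. d n * Im (Ln (1 + of_real (b n) * z))) <= (\<Sum>n\<in>{1..M}. d n * pi) + 4 * R" by simp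
  moreover have "Im (Ln z) <= pi" using Im_Ln_pos_lt_imp[of z] z by auto
  ultimately show ?thesis unfolding Im_clog by linarith
 qed
 thus ?thesis by blast
qed

lemma cpoly_bound:
 assumes b: "tame N b"
 shows "cmod (cpoly N b z) <= (cmod z)\<^sup>2 * exp (2 * cmod z)"
proof -
 have "cmod (\<Prod>n\<in>{1..N}. (1 + of_real (b n) * z) ^ d n) = (\<Prod>n\<in>{1..N}. cmod (1 + of_real (b n) * z) ^ d n)"
  by (simp add: prod_norm[symmetric] norm_power)
 also have "... <= (\<Prod>n\<in>{1..N}. exp (b n * cmod z) ^ d n)"
 proof (intro prod_mono conjI power_mono)
  fix n assume n: "n \<in> {1..N}"
  have "cmod (1 + of_real (b n) * z) <= 1 + b n * cmod z"
   using norm_triangle_ineq[of 1 "of_real (b n) * z"] tame_nonneg[OF b n] by (simp add: norm_mult)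
  also have "... <= exp (b n * cmod z)" by (rule exp_ge_add_one_self)
  finally show "cmod (1 + of_real (b n) * z) <= exp (b n * cmod z)" .
 qed auto
 also have "... = exp ((\<Sum>n\<in>{1..N}. d n * b n) * cmod z)" by (simp add: sum_distrib_right exp_sum mult.assoc flip: exp_of_nat_mult)
 also have "... <= exp (2 * cmod z)" using b by (auto simp: tame_def intro!: mult_right_mono)
 finally have "cmod (\<Prod>n\<in>{1..N}. (1 + of_real (b n) * z) ^ d n) <= exp (2 * cmod z)" .
 thus ?thesis unfolding cpoly_def by (simp add: norm_mult norm_power mult_left_mono)
qed

lemma cpoly_zpoly:
 "cpoly N b (- of_real x) = of_real (zpoly N (%n. 1 / b n) x)" by (simp add: cpoly_def zpoly_def mult.commute)

lemma cpoly_cnj: "cpoly N b (cnj z) = cnj (cpoly N b z)" by (simp add: cpoly_def)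

lemma unit_maxima_tame:
 assumes a: "unit_maxima N a" and "1 <= N"
 shows "tame N (%n. 1 / a n)" unfolding tame_def
proof (intro conjI allI impI ballI)
 show "0 < 1 / a n" if "n \<in> {1..N}" for n using unit_maxima_pos[OF a, of n] that by auto
 show "1 / a n <= 1 / n" if "n \<in> {1..N}" for n
  using unit_maxima_ge[OF a, of n] that by (intro divide_left_mono) (auto intro!: mult_pos_pos unit_maxima_pos[OF a])
 show "1 / a n <= 1 / a m" if "1 <= m" "m <= n" "n <= N" for m n
  using unit_maxima_less[OF a, of m n] unit_maxima_pos[OF a, of m] that
  by (cases "m = n") (auto intro!: divide_left_mono mult_pos_pos)
 show "(\<Sum>n\<in>{1..N}. d n * (1 / a n)) <= 2" using unit_maxima_sum_le[OF assms] by simp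
qed

end

section \<open>The entire limit and the conformal map onto the comb domain\<close>

lemma tendsto_uniform_limit_compose:
 fixes F :: "nat => 'a::metric_space => 'b::metric_space"
 assumes u: "uniform_limit K F g sequentially" and c: "continuous_on K g"
  and x: "x ----> l" "l \<in> K" "eventually (%i. x i \<in> K) sequentially"
 shows "(%i. F i (x i)) ----> g l"
proof (rule tendstoI)
 fix e :: real assume "e > 0"
 have "(%i. g (x i)) ----> g l" using continuous_on_tendsto_compose[OF c x] .
 hence "\<forall>\<^sub>F i in sequentially. dist (g (x i)) (g l) < e / 2" using \<open>e > 0\<close> by (intro tendstoD) auto
 moreover have "\<forall>\<^sub>F i in sequentially. ALL y:K. dist (F i y) (g y) < e / 2"
  using \<open>e > 0\<close> by (intro uniform_limitD[OF u]) auto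
 ultimately show "\<forall>\<^sub>F i in sequentially. dist (F i (x i)) (g l) < e"
  using x(3) by eventually_elim (metis dist_triangle_half_l dist_commute)
qed

lemma closedin_of_sequences:
 fixes S :: "'a::metric_space set"
 assumes "S \<subseteq> T" and seq: "!!x l. [|ALL i. x i \<in> S; x ----> l; l \<in> T|] ==> l \<in> S"
 shows "closedin (top_of_set T) S"
proof -
 have "S = T \<inter> closure S" using assms(1) closure_subset[of S] seq by (auto simp: closure_sequential)
 thus ?thesis by (metis closed_closure closedin_closed_Int)
qed

lemma convergent_norm_bound:
 fixes X :: "nat => 'a::real_normed_vector"
 assumes "X ----> l"
 shows "EX B. ALL i. norm (X i) <= B" using convergent_imp_Bseq[OF convergentI[OF assms]] by (auto simp: Bseq_def)

lemma Im_double: "Im (2 * u) = 2 * Im u" by simp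

lemma Im_Ln_tendsto_pi:
 assumes "z ----> w" "!!i. 0 < Im (z i)" "Re w < 0" "Im w = 0"
 shows "(%i. Im (Ln (z i))) ----> pi"
proof -
 have "(%i. arctan (Im (z i) / Re (z i)) + pi) ----> arctan (Im w / Re w) + pi" using assms by (intro tendsto_intros) auto
 moreover have "\<forall>\<^sub>F i in sequentially. Re (z i) < 0" using tendsto_Re[OF assms(1)] assms(3) by (rule order_tendstoD)
 hence "\<forall>\<^sub>F i in sequentially. arctan (Im (z i) / Re (z i)) + pi = Im (Ln (z i))"
 proof eventually_elim
  case (elim i)
  show ?case using assms(2)[of i] elim by (subst Im_Ln_eq) (auto simp: less_imp_le)
 qed
 ultimately show ?thesis using assms(4) by (auto intro: Lim_transform_eventually)
qed

context even_multiplicities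
begin

lemma tame_cong: "(!!n. n \<in> {1..N} ==> b n = b' n) ==> tame N b \<longleftrightarrow> tame N b'"
 unfolding tame_def by (intro conj_cong arg_cong2[where f = "(<=)"] sum.cong) auto

lemma zpoly_cong: "(!!n. n \<in> {1..N} ==> a n = a' n) ==> zpoly N a x = zpoly N a' x"
 unfolding zpoly_def by (intro arg_cong2[where f = "(*)"] prod.cong) auto

lemma unit_maxima_cong: "(!!n. n <= N ==> a n = a' n) ==> unit_maxima N a \<longleftrightarrow> unit_maxima N a'"
 using zpoly_cong[of N a a'] unfolding unit_maxima_def by (simp add: Suc_le_eq)

definition comb_height :: "nat => real" where
 "comb_height n = pi * (2 + (\<Sum>k\<in>{1..<n}. real (d k)))"

text \<open>The half-plane with slits at the heights that the argument of \<open>g\<close> has on the intervals of the negative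
  axis between consecutive zeros.\<close>

definition comb_domain :: "complex set" where
 "comb_domain = {w. 0 < Im w & \<not> (Re w <= 0 & (EX n>=1. Im w = comb_height n))}"

text \<open>The multiplicities being even, the slits lie over the positive axis.\<close>

lemma exp_comb_height: "exp (\<i> * of_real (comb_height n)) = 1"
proof -
 have "EX m. (\<Sum>k\<in>{1..<n}. real (d k)) = 2 * real m"
 proof (induction n)
  case (Suc n)
  then obtain m where "(\<Sum>k\<in>{1..<n}. real (d k)) = 2 * real m" by blast
  moreover obtain j where "d n = 2 * j" if "1 <= n" using d_even[of n] by (cases "1 <= n") (auto elim: evenE)
  ultimately show ?case
  proof (cases "1 <= n")
   case True
   hence "(\<Sum>k\<in>{1..<Suc n}. real (d k)) = 2 * real (m + j)"
    using \<open>(\<Sum>k\<in>{1..<n}. real (d k)) = 2 * real m\<close> \<open>1 <= n ==> d n = 2 * j\<close> by simp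
   thus ?thesis by blast
  qed (auto intro: exI[of _ 0])
 qed (auto intro: exI[of _ 0])
 then obtain m where "comb_height n = 2 * pi * real (Suc m)" unfolding comb_height_def by (auto simp: algebra_simps)
 hence "\<i> * of_real (comb_height n) = of_nat (Suc m) * (2 * of_real pi * \<i>)" by (simp add: mult_ac)
 thus ?thesis by (simp only: exp_of_nat_mult exp_two_pi_i power_one)
qed

end

text \<open>A limit \<open>g\<close> of the polynomials together with the limit \<open>f\<close> of their logarithms. The data are fixed in a
  locale because every later estimate passes to the limit along the same subsequence.\<close>

locale comb_limit = even_multiplicities +
 fixes N :: "nat => nat" and c :: "nat => nat => real" and \<beta> :: "nat => real" and g f :: "complex => complex"
 assumes N_ge: "Suc i <= N i"
  and unit_max: "unit_maxima (N i) (%n. 1 / c i n)"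
  and tame: "tame (N i) (c i)"
  and \<beta>_lim: "(%i. c i n) ----> \<beta> n"
  and g_lim: "compact K ==> uniform_limit K (%i. cpoly (N i) (c i)) g sequentially"
  and f_lim: "z \<in> uhp ==> (%i. clog (N i) (c i) z) ----> f z"
  and g_holomorphic: "g holomorphic_on UNIV" and f_holomorphic: "f holomorphic_on uhp"
  and c_0: "c i 0 = 0"
begin

lemma ev_N: "eventually (%i. n <= N i) sequentially" using eventually_ge_at_top[of n] by eventually_elim (use N_ge order_trans le_SucI in blast)

lemma cpoly_lim:
 assumes "z ----> l"
 shows "(%i. cpoly (N i) (c i) (z i)) ----> g l"
proof -
 obtain B where B: "!!i. cmod (z i) <= B" using convergent_norm_bound[OF assms] by blast
 show ?thesis using closed_sequentially[OF closed_cball, of z 0 B l] B assms by (intro tendsto_uniform_limit_compose[OF g_lim[OF compact_cball] _ assms, of 0 B]) (auto intro: holomorphic_on_imp_continuous_on holomorphic_on_subset[OF g_holomorphic])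
qed

lemma exp_f: "z \<in> uhp ==> exp (f z) = g z"
proof -
 assume z: "z \<in> uhp"
 have "(%i. exp (clog (N i) (c i) z)) ----> exp (f z)" by (intro tendsto_intros f_lim z)
 moreover have "(%i. exp (clog (N i) (c i) z)) ----> g z" using cpoly_lim[OF tendsto_const] exp_clog[OF tame z] by simp
 ultimately show ?thesis by (rule LIMSEQ_unique)
qed

text \<open>The imaginary part of the difference quotient of \<open>2 Ln z\<close> is negative and that of the remaining terms is not positive;
  the strict sign survives in the limit.\<close>

lemma inj_f: "inj_on f uhp"
proof (rule inj_onI, rule ccontr)
 fix z w assume z: "z \<in> uhp" "w \<in> uhp" "z ~= w" and eq: "f z = f w"
 have "(%i. Im ((clog (N i) (c i) z - clog (N i) (c i) w) / (z - w))) ----> Im ((f z - f w) / (z - w))"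
  by (intro tendsto_intros f_lim) (use z in auto)
 moreover have "Im ((clog (N i) (c i) z - clog (N i) (c i) w) / (z - w)) <= 2 * Im ((Ln z - Ln w) / (z - w))" for i
 proof -
  have "(clog (N i) (c i) z - clog (N i) (c i) w) / (z - w)
    = 2 * ((Ln z - Ln w) / (z - w)) + (clog_rest (N i) (c i) z - clog_rest (N i) (c i) w) / (z - w)"
   by (simp add: clog_def add_divide_distrib diff_divide_distrib)
  thus ?thesis using clog_rest_quotient[OF tame[of i] z] by (simp only: plus_complex.sel Im_double)
 qed
 ultimately have "Im ((f z - f w) / (z - w)) <= 2 * Im ((Ln z - Ln w) / (z - w))" using LIMSEQ_le_const2 by blast
 thus False using Ln_quotient_neg[OF z] eq by simp
qed

lemma g_cnj: "g (cnj z) = cnj (g z)"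
proof -
 have "(%i. cpoly (N i) (c i) (cnj z)) ----> cnj (g z)" unfolding cpoly_cnj by (intro tendsto_intros cpoly_lim)
 thus ?thesis using cpoly_lim[OF tendsto_const[of "cnj z"]] LIMSEQ_unique by blast
qed

lemma \<beta>_0: "\<beta> 0 = 0" using \<beta>_lim[of 0] by (simp add: c_0 LIMSEQ_const_iff)

lemma \<beta>_pos:
 assumes "1 <= n"
 shows "0 < \<beta> n"
proof -
 obtain A where A: "0 < A" "!!N a. [|unit_maxima N a; Suc n <= N|] ==> a n <= A" using unit_maxima_bound[of n] by blast
 have "\<forall>\<^sub>F i in sequentially. 1 / A <= c i n" using ev_N[of "Suc n"]
 proof eventually_elim
  case (elim i)
  thus ?case using A(2)[OF unit_max elim] tame_pos[OF tame, of n i] assms A(1) by (auto simp: field_simps)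
 qed
 hence "1 / A <= \<beta> n" using tendsto_lowerbound[OF \<beta>_lim] by auto
 moreover have "0 < 1 / A" using A(1) by simp
 ultimately show ?thesis by (rule less_le_trans[rotated])
qed

lemma \<beta>_le: "1 <= n ==> \<beta> n <= 1 / n"
 using ev_N[of n] by (intro tendsto_upperbound[OF \<beta>_lim]) (auto elim!: eventually_mono simp: tame[unfolded tame_def])

lemma g_nonpos_axis: "0 <= x ==> g (- of_real x) = of_real (Re (g (- of_real x))) & 0 <= Re (g (- of_real x)) & Re (g (- of_real x)) <= 1"
proof -
 assume x: "0 <= x"
 have lim: "(%i. of_real (zpoly (N i) (%n. 1 / c i n) x)) ----> g (- of_real x)"
  using cpoly_lim[OF tendsto_const[of "- of_real x"]] by (simp add: cpoly_zpoly)
 have "Im (g (- of_real x)) = 0" using tendsto_Im[OF lim] by (simp add: LIMSEQ_const_iff)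
 moreover have re: "(%i. zpoly (N i) (%n. 1 / c i n) x) ----> Re (g (- of_real x))" using tendsto_Re[OF lim] by simp
 moreover have "0 <= Re (g (- of_real x))" by (rule LIMSEQ_le_const[OF re]) (use zpoly_nonneg in blast)
 moreover obtain k :: nat where k: "x <= real k" using real_arch_simple by blast
 have "\<forall>\<^sub>F i in sequentially. zpoly (N i) (%n. 1 / c i n) x <= 1" using ev_N[of "Suc k"]
 proof eventually_elim
  case (elim i)
  thus ?case using unit_maxima_ge[OF unit_max, of "N i" i] k unit_max[of i] x by (auto simp: unit_maxima_def)
 qed
 hence "Re (g (- of_real x)) <= 1" by (intro tendsto_upperbound[OF re]) auto
 ultimately show ?thesis by (simp add: complex_eq_iff)
qed

text \<open>The moduli of the zeros; the value at index \<open>0\<close> is the zero at the origin, since \<open>\<beta> 0 = 0\<close>.\<close>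

definition \<gamma> :: "nat => real" where "\<gamma> n = 1 / \<beta> n"

lemma \<gamma>_0: "\<gamma> 0 = 0" by (simp add: \<gamma>_def \<beta>_0)

lemma \<gamma>_lim: "(%i. 1 / c i n) ----> \<gamma> n"
proof (cases "n = 0")
 case True
 thus ?thesis by (simp add: c_0 \<gamma>_0)
next
 case False
 thus ?thesis unfolding \<gamma>_def using \<beta>_pos[of n] by (intro tendsto_intros \<beta>_lim) auto
qed

lemma \<gamma>_ge: "real n <= \<gamma> n" using \<beta>_le[of n] \<beta>_pos[of n] by (cases "n = 0") (auto simp: \<gamma>_def \<beta>_0 field_simps)

lemma g_zero: "g (- of_real (\<gamma> n)) = 0"
proof -
 have "(%i. cpoly (N i) (c i) (- of_real (1 / c i n))) ----> g (- of_real (\<gamma> n))" by (intro cpoly_lim tendsto_intros \<gamma>_lim)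
 moreover have "\<forall>\<^sub>F i in sequentially. cpoly (N i) (c i) (- of_real (1 / c i n)) = 0" using ev_N[of n]
 proof eventually_elim
  case (elim i)
  show ?case
  proof (cases "n = 0")
   case False
   hence "0 < c i n" using tame_pos[OF tame] elim by auto
   thus ?thesis unfolding cpoly_zpoly
    using zpoly_zero[of n "N i" "%n. 1 / c i n"] False elim by simp
  qed (simp add: c_0 cpoly_def)
 qed
 hence "(%i. cpoly (N i) (c i) (- of_real (1 / c i n))) ----> 0" by (rule tendsto_eventually)
 ultimately show ?thesis by (rule LIMSEQ_unique)
qed

text \<open>The points where the polynomials take the maximum \<open>1\<close> stay in the gap, because \<open>g\<close> vanishes at its end
  points.\<close>

lemma g_one: "EX x. \<gamma> j < x & x < \<gamma> (Suc j) & g (- of_real x) = 1"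
proof -
 have "EX x. 1 / c (i + Suc j) j < x & x < 1 / c (i + Suc j) (Suc j) & zpoly (N (i + Suc j)) (%n. 1 / c (i + Suc j) n) x = 1" for i
 proof -
  have "j < N (i + Suc j)" using N_ge[of "i + Suc j"] by auto
  hence "EX x:{1 / c (i + Suc j) j<..<1 / c (i + Suc j) (Suc j)}. zpoly (N (i + Suc j)) (%n. 1 / c (i + Suc j) n) x = 1"
   using unit_max[of "i + Suc j"] unfolding unit_maxima_def by blast
  thus ?thesis by auto
 qed
 then obtain x where x: "!!i. 1 / c (i + Suc j) j < x i" "!!i. x i < 1 / c (i + Suc j) (Suc j)"
   "!!i. zpoly (N (i + Suc j)) (%n. 1 / c (i + Suc j) n) (x i) = 1" by metis
 have lims: "(%i. 1 / c (i + Suc j) n) ----> \<gamma> n" for n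
  using LIMSEQ_ignore_initial_segment[OF \<gamma>_lim] .
 obtain B1 where B1: "!!i. \<bar>1 / c (i + Suc j) j\<bar> <= B1" using convergent_norm_bound[OF lims[of j]] unfolding real_norm_def by blast
 obtain B2 where B2: "!!i. \<bar>1 / c (i + Suc j) (Suc j)\<bar> <= B2"
  using convergent_norm_bound[OF lims[of "Suc j"]] unfolding real_norm_def by blast
 have "x i \<in> {- B1..B2}" for i
  using x(1,2)[of i] abs_le_D2[OF B1[of i]] abs_le_D1[OF B2[of i]] by auto
 then obtain l r where r: "strict_mono (r :: nat => nat)" and l: "(x \<circ> r) ----> l"
  using compact_Icc[of "- B1" B2] unfolding compact_def by metis
 have l: "(%i. x (r i)) ----> l" using l by (simp add: o_def)
 have limr: "(%i. 1 / c (r i + Suc j) n) ----> \<gamma> n" for n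
  using LIMSEQ_subseq_LIMSEQ[OF lims r] by (simp add: o_def)
 have le: "\<gamma> j <= l" "l <= \<gamma> (Suc j)" using LIMSEQ_le[OF limr l] LIMSEQ_le[OF l limr] x(1,2) by (meson less_imp_le)+
 define s where "s i = r i + Suc j" for i
 have s: "strict_mono s" using r by (auto simp: s_def strict_mono_def)
 define K where "K = cball (0::complex) (max B1 B2)"
 have xK: "- of_real (x (r i)) \<in> K" for i
  using x(1,2)[of "r i"] abs_le_D2[OF B1[of "r i"]] abs_le_D1[OF B2[of "r i"]] by (auto simp: K_def)
 have lz: "(%i. - complex_of_real (x (r i))) ----> - of_real l" by (intro tendsto_intros l)
 have "(%i. cpoly (N (s i)) (c (s i)) (- of_real (x (r i)))) ----> g (- of_real l)"
 proof (rule tendsto_uniform_limit_compose[OF _ _ lz])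
  have "filterlim s sequentially sequentially" using s by (rule filterlim_subseq)
  thus "uniform_limit K (%i. cpoly (N (s i)) (c (s i))) g sequentially" using filterlim_compose[OF g_lim[of K], of s] by (simp add: K_def)
  show "continuous_on K g" by (intro holomorphic_on_imp_continuous_on holomorphic_on_subset[OF g_holomorphic]) auto
  show "- of_real l \<in> K" using closed_sequentially[OF _ xK lz] by (auto simp: K_def)
 qed (use xK in auto)
 moreover have "cpoly (N (s i)) (c (s i)) (- of_real (x (r i))) = 1" for i
  unfolding cpoly_zpoly s_def using x(3)[of "r i"] by simp
 ultimately have "g (- of_real l) = 1" by (simp add: LIMSEQ_const_iff)
 moreover have "\<gamma> j < l" "l < \<gamma> (Suc j)" using le g_zero[of j] g_zero[of "Suc j"] calculation by (auto simp: le_less)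
 ultimately show ?thesis by blast
qed

lemma \<gamma>_less: "\<gamma> j < \<gamma> (Suc j)" using g_one[of j] by auto

lemma \<gamma>_less_iff: "m < n ==> \<gamma> m < \<gamma> n" using \<gamma>_less by (rule lift_Suc_mono_less)

lemma Im_f_lower:
 assumes z: "z \<in> uhp"
 shows "2 * Im (Ln z) + (\<Sum>n\<in>{1..m}. d n * Im (Ln (1 + of_real (\<beta> n) * z))) <= Im (f z)"
proof (rule tendsto_le[OF _ tendsto_Im[OF f_lim[OF z]]])
 show "(%i. 2 * Im (Ln z) + (\<Sum>n\<in>{1..m}. d n * Im (Ln (1 + of_real (c i n) * z)))) ---->
   2 * Im (Ln z) + (\<Sum>n\<in>{1..m}. d n * Im (Ln (1 + of_real (\<beta> n) * z)))"
  by (intro tendsto_intros \<beta>_lim one_plus_uhp(1)[OF z]) (use \<beta>_pos in "auto simp: less_imp_le")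
 show "\<forall>\<^sub>F i in sequentially. 2 * Im (Ln z) + (\<Sum>n\<in>{1..m}. d n * Im (Ln (1 + of_real (c i n) * z)))
   <= Im (clog (N i) (c i) z)" using ev_N[of m] by eventually_elim (intro Im_clog_lower[OF tame z])
qed auto

lemma Im_f_upper:
 assumes z: "z \<in> uhp" and n: "1 <= n" and \<delta>: "0 < \<delta>" "\<delta> <= 1" "\<delta> < 1 + \<beta> n * Re z"
 shows "Im (f z) <= 2 * Im (Ln z) + (\<Sum>k\<in>{1..<n}. d k * Im (Ln (1 + of_real (\<beta> k) * z))) + 2 * Im z / \<delta>"
proof (rule tendsto_le[OF _ _ tendsto_Im[OF f_lim[OF z]]])
 show "(%i. 2 * Im (Ln z) + (\<Sum>k\<in>{1..<n}. d k * Im (Ln (1 + of_real (c i k) * z))) + 2 * Im z / \<delta>) ---->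
   2 * Im (Ln z) + (\<Sum>k\<in>{1..<n}. d k * Im (Ln (1 + of_real (\<beta> k) * z))) + 2 * Im z / \<delta>"
  by (intro tendsto_intros \<beta>_lim one_plus_uhp(1)[OF z]) (use \<beta>_pos \<delta> in "auto simp: less_imp_le")
 have "(%i. 1 + c i n * Re z) ----> 1 + \<beta> n * Re z" by (intro tendsto_intros \<beta>_lim)
 hence "\<forall>\<^sub>F i in sequentially. \<delta> < 1 + c i n * Re z" using \<delta>(3) by (rule order_tendstoD)
 thus "\<forall>\<^sub>F i in sequentially. Im (clog (N i) (c i) z)
   <= 2 * Im (Ln z) + (\<Sum>k\<in>{1..<n}. d k * Im (Ln (1 + of_real (c i k) * z))) + 2 * Im z / \<delta>"
  using ev_N[of n] by eventually_elim (intro Im_clog_upper[OF tame z n]; use \<delta> in simp)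
qed auto

lemma Re_f_lower:
 assumes z: "z \<in> uhp" "0 <= Re z"
 shows "2 * ln (cmod z) <= Re (f z)" using LIMSEQ_le_const[OF tendsto_Re[OF f_lim[OF z(1)]]] Re_clog_lower[OF tame z] by blast

lemma Im_f_bounded: "EX B. ALL z:uhp. cmod z <= R --> Im (f z) <= B"
proof -
 obtain B where B: "!!N b z. [|tame N b; z \<in> uhp; cmod z <= R|] ==> Im (clog N b z) <= B" using Im_clog_bounded by blast
 have "Im (f z) <= B" if "z \<in> uhp" "cmod z <= R" for z
  using LIMSEQ_le_const2[OF tendsto_Im[OF f_lim[OF that(1)]]] B[OF tame that] by blast
 thus ?thesis by blast
qed

lemma Im_f_pos: "z \<in> uhp ==> 0 < Im (f z)" using Im_f_lower[of z 0] Im_Ln_pos_lt_imp[of z] by simp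

text \<open>A large \<open>z\<close> with bounded real part of \<open>f\<close> must pass many zeros, each of which adds to the argument.\<close>

lemma f_proper: "EX R. ALL z:uhp. Re (f z) <= M & Im (f z) <= M --> cmod z <= R"
proof -
 obtain m :: nat where m: "M < real m" using reals_Archimedean2 by blast
 define R where "R = max (exp (M / 2)) (2 * \<gamma> (Suc m))"
 have "cmod z <= R" if z: "z \<in> uhp" and M: "Re (f z) <= M" "Im (f z) <= M" for z
 proof (rule ccontr)
  assume "\<not> cmod z <= R"
  hence R: "exp (M / 2) < cmod z" "2 * \<gamma> (Suc m) < cmod z" by (auto simp: R_def)
  show False
  proof (cases "0 <= Re z")
   case True
   have "M / 2 < ln (cmod z)" using R(1) by (metis exp_gt_zero less_trans ln_exp ln_less_cancel_iff)
   thus False using Re_f_lower[OF z True] M by linarith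
  next
   case False
   have "real (d n) * Im (Ln (1 + of_real (\<beta> n) * z)) >= 2 * (pi / 4)" if n: "n \<in> {1..m}" for n
   proof (intro mult_mono Im_Ln_ge_pi_quarter)
    show "2 <= real (d n)" using d_ge_2[of n] n by auto
    have b: "0 < \<beta> n" using \<beta>_pos n by auto
    have "2 * \<gamma> n < cmod z" using R(2) \<gamma>_less_iff[of n "Suc m"] n by auto
    hence 2: "2 < \<beta> n * cmod z" using b by (simp add: \<gamma>_def field_simps)
    show "1 + complex_of_real (\<beta> n) * z ~= 0" "0 <= Im (1 + complex_of_real (\<beta> n) * z)" using one_plus_uhp(2)[OF z] b z by auto
    have "\<beta> n * cmod z <= \<beta> n * (\<bar>Re z\<bar> + \<bar>Im z\<bar>)" using b by (intro mult_left_mono cmod_le) auto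
    thus "Re (1 + complex_of_real (\<beta> n) * z) <= Im (1 + complex_of_real (\<beta> n) * z)" using 2 False z b by (simp add: distrib_left right_diff_distrib)
   qed auto
   hence "(\<Sum>n\<in>{1..m}. 2 * (pi / 4)) <= (\<Sum>n\<in>{1..m}. d n * Im (Ln (1 + of_real (\<beta> n) * z)))" by (rule sum_mono)
   moreover have "real m <= (\<Sum>n\<in>{1..m}. 2 * (pi / 4))" using pi_ge_two mult_left_mono[of 1 "pi / 2" "real m"] by simp
   moreover have "0 < Im (Ln z)" using Im_Ln_pos_lt_imp z by auto
   ultimately show False using Im_f_lower[OF z, of m] M m by linarith
  qed
 qed
 thus ?thesis by blast
qed

text \<open>Each zero to the right of \<open>- x\<close> contributes \<open>\<pi> d\<^sub>k\<close> to the argument, the double zero at the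
  origin \<open>2 \<pi>\<close>.\<close>

lemma f_boundary:
 assumes x: "\<gamma> j < x" "x < \<gamma> (Suc j)" and z: "!!i. z i \<in> uhp" "z ----> - of_real x"
 shows "(%i. Im (f (z i))) ----> comb_height (Suc j)"
proof -
 have x0: "0 < x" using x(1) \<gamma>_ge[of j] by linarith
 have L1: "(%i. Im (Ln (z i))) ----> pi" using z x0 by (intro Im_Ln_tendsto_pi) auto
 have L2: "(%i. Im (Ln (1 + of_real (\<beta> k) * z i))) ----> pi" if k: "k \<in> {1..<Suc j}" for k
 proof (rule Im_Ln_tendsto_pi)
  show "(%i. 1 + of_real (\<beta> k) * z i) ----> 1 + of_real (\<beta> k) * (- of_real x)" by (intro tendsto_intros z)
  have b: "0 < \<beta> k" using \<beta>_pos k by auto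
  show "0 < Im (1 + complex_of_real (\<beta> k) * z i)" for i using z(1)[of i] b by simp
  have "\<gamma> k < x" using \<gamma>_less_iff[of k j] k x by (cases "k = j") auto
  thus "Re (1 + complex_of_real (\<beta> k) * - complex_of_real x) < 0" using b by (simp add: \<gamma>_def field_simps)
 qed auto
 have S: "(%i. 2 * Im (Ln (z i)) + (\<Sum>k\<in>{1..<Suc j}. d k * Im (Ln (1 + of_real (\<beta> k) * z i)))) ---->
  2 * pi + (\<Sum>k\<in>{1..<Suc j}. d k * pi)" by (intro tendsto_intros L1 L2)
 have eq: "2 * pi + (\<Sum>k\<in>{1..<Suc j}. d k * pi) = comb_height (Suc j)"
  by (simp add: comb_height_def distrib_left sum_distrib_left mult.commute)
 define \<delta> where "\<delta> = (1 - \<beta> (Suc j) * x) / 2"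
 have b: "0 < \<beta> (Suc j)" using \<beta>_pos by auto
 have \<delta>: "0 < \<delta>" "\<delta> <= 1" "\<delta> < 1 + \<beta> (Suc j) * (- x)"
  using x x0 b by (auto simp: \<delta>_def \<gamma>_def field_simps)
 have "(%i. 1 + \<beta> (Suc j) * Re (z i)) ----> 1 + \<beta> (Suc j) * Re (- of_real x)" by (intro tendsto_intros z)
 hence ev: "\<forall>\<^sub>F i in sequentially. \<delta> < 1 + \<beta> (Suc j) * Re (z i)" using \<delta> by (intro order_tendstoD(1)) auto
 have "(%i. 2 * Im (z i) / \<delta>) ----> 2 * 0 / \<delta>" using tendsto_Im[OF z(2)] \<delta> by (intro tendsto_intros) auto
 from tendsto_add[OF S this]
 have U: "(%i. 2 * Im (Ln (z i)) + (\<Sum>k\<in>{1..<Suc j}. d k * Im (Ln (1 + of_real (\<beta> k) * z i))) + 2 * Im (z i) / \<delta>) ---->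
  comb_height (Suc j)" unfolding eq by simp
 show ?thesis
 proof (rule tendsto_sandwich[OF _ _ S[unfolded eq] U])
  show "\<forall>\<^sub>F i in sequentially. 2 * Im (Ln (z i)) + (\<Sum>k\<in>{1..<Suc j}. d k * Im (Ln (1 + of_real (\<beta> k) * z i))) <= Im (f (z i))"
   using Im_f_lower[OF z(1), where m = j] by (intro always_eventually allI) (simp add: atLeastLessThanSuc_atLeastAtMost)
  show "\<forall>\<^sub>F i in sequentially. Im (f (z i)) <= 2 * Im (Ln (z i)) + (\<Sum>k\<in>{1..<Suc j}. d k * Im (Ln (1 + of_real (\<beta> k) * z i))) + 2 * Im (z i) / \<delta>"
   using ev by eventually_elim (intro Im_f_upper[OF z(1)]; use \<delta> in simp)
 qed
qed

lemma \<gamma>_between: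
 assumes "0 <= x" "!!n. x ~= \<gamma> n"
 obtains j where "\<gamma> j < x" "x < \<gamma> (Suc j)"
proof -
 obtain k :: nat where "x < real k" using reals_Archimedean2 by blast
 hence k: "x < \<gamma> k" using \<gamma>_ge[of k] by linarith
 define n where "n = (LEAST n. x < \<gamma> n)"
 have n: "x < \<gamma> n" unfolding n_def using k by (rule LeastI)
 moreover have "n ~= 0" using n assms(1) \<gamma>_0 by (cases n) auto
 then obtain j where j: "n = Suc j" by (cases n) auto
 moreover have "\<not> x < \<gamma> j" using not_less_Least[of j "%n. x < \<gamma> n"] j by (simp add: n_def)
 ultimately show ?thesis using that[of j] assms(2)[of j] by auto
qed

lemma f_boundary_not_comb:
 assumes z: "!!i. z i \<in> uhp" "z ----> of_real x" and w: "(%i. f (z i)) ----> w"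
 shows "w \<notin> comb_domain"
proof (cases "0 < x")
 case True
 have Ln_lim: "(%i. Im (Ln (z i))) ----> Im (Ln (of_real x))"
  using True z by (intro tendsto_intros) (simp_all add: complex_nonpos_Reals_iff del: nonpos_Reals_of_real_iff)
 have "(%i. 2 * Im (Ln (z i)) + 2 * Im (z i)) ----> 2 * Im (Ln (of_real x)) + 2 * Im (of_real x)"
  by (intro tendsto_add tendsto_mult tendsto_const Ln_lim tendsto_Im z)
 moreover have "\<forall>\<^sub>F i in sequentially. 0 < Re (z i)" using tendsto_Re[OF z(2)] True by (intro order_tendstoD(1)) auto
 hence "\<forall>\<^sub>F i in sequentially. Im (f (z i)) <= 2 * Im (Ln (z i)) + 2 * Im (z i)"
 proof eventually_elim
  case (elim i)
  have b: "0 < \<beta> 1" using \<beta>_pos by auto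
  have "Im (f (z i)) <= 2 * Im (Ln (z i)) + (\<Sum>k\<in>{1..<1}. d k * Im (Ln (1 + of_real (\<beta> k) * z i))) + 2 * Im (z i) / 1"
   by (rule Im_f_upper[OF z(1)]) (use elim b in auto)
  thus ?case by simp
 qed
 ultimately have "Im w <= 2 * Im (Ln (of_real x)) + 2 * Im (complex_of_real x)" using tendsto_le[OF sequentially_bot _ tendsto_Im[OF w]] by blast
 thus ?thesis using True by (simp add: comb_domain_def)
next
 case False
 have "(%i. exp (f (z i))) ----> exp w" by (intro tendsto_intros w)
 moreover have "(%i. g (z i)) ----> g (of_real x)"
  using g_holomorphic z(2) by (intro continuous_on_tendsto_compose[of UNIV g]) (auto intro: holomorphic_on_imp_continuous_on)
 ultimately have gx: "g (of_real x) = exp w" using exp_f[OF z(1)] by (simp add: LIMSEQ_unique)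
 have "cmod (exp w) <= 1"
  using g_nonpos_axis[of "- x"] False gx by (metis abs_of_nonneg add.inverse_inverse linorder_not_le neg_0_le_iff_le norm_of_real of_real_minus)
 hence "Re w <= 0" by simp
 moreover have "- x ~= \<gamma> n" for n using g_zero[of n] gx by (metis add.inverse_inverse exp_not_eq_zero of_real_minus)
 then obtain j where j: "\<gamma> j < - x" "- x < \<gamma> (Suc j)" using \<gamma>_between[of "- x"] False by auto
 have "(%i. Im (f (z i))) ----> comb_height (Suc j)" using f_boundary[OF j z(1)] z(2) by simp
 hence "Im w = comb_height (Suc j)" using LIMSEQ_unique tendsto_Im[OF w] by blast
 ultimately show ?thesis unfolding comb_domain_def by (auto intro!: exI[of _ "Suc j"])
qed

text \<open>The boundary values of \<open>f\<close> on a gap already cover the slit. A further interior point \<open>u\<close> with value on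
  the slit would, \<open>f\<close> being open, be hit near \<open>u\<close> as well as near the boundary, against injectivity.\<close>

lemma f_avoids_slit:
 assumes u: "u \<in> uhp" and "1 <= n" "Im (f u) = comb_height n" "Re (f u) <= 0"
 shows False
proof -
 obtain j where j: "n = Suc j" using assms by (cases n) auto
 obtain y where y: "\<gamma> j < y" "y < \<gamma> (Suc j)" "g (- of_real y) = 1" using g_one by blast
 define p where "p = (%x. Re (g (- of_real x)))"
 have "continuous_on UNIV p" unfolding p_def
  by (intro continuous_intros continuous_on_compose2[OF holomorphic_on_imp_continuous_on[OF g_holomorphic]]) auto
 hence "continuous_on {\<gamma> j..y} p" by (rule continuous_on_subset) auto
 moreover have "p (\<gamma> j) <= exp (Re (f u))" "exp (Re (f u)) <= p y" using assms y g_zero[of j] by (auto simp: p_def)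
 ultimately obtain x where x: "\<gamma> j <= x" "x <= y" "p x = exp (Re (f u))" using IVT'[of p "\<gamma> j" "exp (Re (f u))" y] y by auto
 have "x ~= \<gamma> j" using x(3) g_zero[of j] by (auto simp: p_def)
 hence xj: "\<gamma> j < x" "x < \<gamma> (Suc j)" using x y by auto
 have gx: "g (- of_real x) = of_real (exp (Re (f u)))" using g_nonpos_axis[of x] x(3) xj(1) \<gamma>_ge[of j] by (simp add: p_def)
 define z where "z = (%i. Complex (- x) (1 / real (Suc i)))"
 have z: "z i \<in> uhp" for i by (simp add: z_def)
 have zl: "z ----> - of_real x" using LIMSEQ_inverse_real_of_nat by (simp add: z_def tendsto_complex_iff inverse_eq_divide)
 have im: "(%i. Im (f (z i))) ----> Im (f u)" using f_boundary[OF xj z zl] assms j by simp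
 have "(%i. g (z i)) ----> g (- of_real x)"
  using g_holomorphic zl by (intro continuous_on_tendsto_compose[of UNIV g]) (auto intro: holomorphic_on_imp_continuous_on)
 hence "(%i. ln (cmod (g (z i)))) ----> ln (cmod (g (- of_real x)))" by (intro tendsto_intros) (auto simp: gx)
 moreover have "ln (cmod (g (z i))) = Re (f (z i))" for i unfolding exp_f[OF z, symmetric] by simp
 ultimately have "(%i. Re (f (z i))) ----> Re (f u)" by (simp add: gx)
 with im have lim: "(%i. f (z i)) ----> f u" by (simp add: tendsto_complex_iff)
 obtain e where e: "0 < e" "ball u e \<subseteq> uhp" using open_uhp u by (auto simp: open_contains_ball)
 define U where "U = ball u (min e (Im u / 2))"
 have U: "open U" "u \<in> U" "U \<subseteq> uhp" using e u by (auto simp: U_def)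
 have "open (f ` U)" by (rule open_mapping_thm3[OF holomorphic_on_subset[OF f_holomorphic U(3)] U(1)]) (rule inj_on_subset[OF inj_f U(3)])
 hence "\<forall>\<^sub>F i in sequentially. f (z i) \<in> f ` U" using lim U(2) by (intro topological_tendstoD) auto
 moreover have "\<forall>\<^sub>F i in sequentially. Im (z i) < Im u / 2" using tendsto_Im[OF zl] u by (intro order_tendstoD(2)) auto
 ultimately have "\<forall>\<^sub>F i in sequentially. False"
 proof eventually_elim
  case (elim i)
  then obtain v where v: "v \<in> U" "f (z i) = f v" by auto
  hence "z i = v" using inj_f z U(3) by (auto simp: inj_on_def)
  moreover have "\<bar>Im (u - v)\<bar> < Im u / 2" using v(1) abs_Im_le_cmod[of "u - v"] by (auto simp: U_def dist_norm)
  ultimately show False using elim(2) by (auto simp: abs_if split: if_splits)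
 qed
 thus False by simp
qed

text \<open>The image is open and, since boundary values of \<open>f\<close> avoid the comb domain and \<open>f\<close> is proper, relatively
  closed.\<close>

theorem f_bij:
 assumes "connected comb_domain"
 shows "bij_betw f uhp comb_domain"
proof -
 have sub: "f ` uhp \<subseteq> comb_domain" using Im_f_pos f_avoids_slit unfolding comb_domain_def by blast
 have op: "open (f ` uhp)" by (rule open_mapping_thm3[OF f_holomorphic open_uhp inj_f])
 have "closedin (top_of_set comb_domain) (f ` uhp)"
 proof (rule closedin_of_sequences[OF sub])
  fix ws w assume ws: "ALL i. ws i \<in> f ` uhp" and lim: "ws ----> w" and w: "w \<in> comb_domain"
  then obtain z where z: "!!i. z i \<in> uhp" "!!i. ws i = f (z i)" by (metis image_iff)
  obtain B where B: "!!i. cmod (ws i) <= B" using convergent_norm_bound[OF lim] by blast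
  obtain R where R: "!!z. [|z \<in> uhp; Re (f z) <= B; Im (f z) <= B|] ==> cmod z <= R" using f_proper[of B] by blast
  have "z i \<in> cball 0 R" for i
   using R[OF z(1)] B[of i] z(2)[of i] complex_Re_le_cmod[of "ws i"] abs_Im_le_cmod[of "ws i"] by auto
  then obtain l r where l: "strict_mono (r :: nat => nat)" "(z \<circ> r) ----> l" using compact_cball[of 0 R] unfolding compact_def by metis
  hence zl: "(%i. z (r i)) ----> l" by (simp add: o_def)
  have fl: "(%i. f (z (r i))) ----> w" using LIMSEQ_subseq_LIMSEQ[OF lim l(1)] z(2) by (simp add: o_def)
  have "0 <= Im l" using LIMSEQ_le_const[OF tendsto_Im[OF zl]] z(1) by (auto simp: less_imp_le)
  show "w \<in> f ` uhp"
  proof (cases "Im l = 0")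
   case True
   hence "l = of_real (Re l)" by (simp add: complex_eq_iff)
   thus ?thesis using f_boundary_not_comb[OF z(1) _ fl] zl w by metis
  next
   case False
   hence "l \<in> uhp" using \<open>0 <= Im l\<close> by simp
   thus ?thesis using continuous_on_tendsto_compose[OF holomorphic_on_imp_continuous_on[OF f_holomorphic] zl] z(1) LIMSEQ_unique[OF fl] \<open>l \<in> uhp\<close> by auto
  qed
 qed
 moreover have "openin (top_of_set comb_domain) (f ` uhp)" using op sub by (simp add: open_subset)
 moreover have "f ` uhp ~= {}" by (auto intro: exI[of _ \<i>])
 ultimately have "f ` uhp = comb_domain" using assms unfolding connected_clopen by blast
 thus ?thesis using inj_f by (simp add: bij_betw_def)
qed

lemma g_nonconstant: "\<not> g constant_on UNIV" using g_one[of 0] g_zero[of 0] unfolding constant_on_def by (metis UNIV_I zero_neq_one)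

end

context even_multiplicities
begin

text \<open>Montel's theorem for the logarithms, with a diagonal sequence for the zeros.\<close>

lemma comb_limit_exists:
 obtains N c \<beta> g f where "comb_limit d N c \<beta> g f"
proof -
 have "EX a. unit_maxima (Suc i) a" for i using unit_maxima_exists[of "Suc i"] by auto
 then obtain a where a: "!!i. unit_maxima (Suc i) (a i)" by metis
 define b where "b = (%i n. if n \<in> {1..Suc i} then 1 / a i n else 0)"
 have bt: "tame (Suc i) (b i)" for i
  using unit_maxima_tame[OF a[of i]] tame_cong[of "Suc i" "b i" "%n. 1 / a i n"] by (auto simp: b_def)
 have bu: "unit_maxima (Suc i) (%n. 1 / b i n)" for i
 proof (subst unit_maxima_cong[of _ _ "a i"])
  show "1 / b i n = a i n" if "n <= Suc i" for n
   using a[of i] that by (cases "n = 0") (auto simp: b_def unit_maxima_def)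
 qed (rule a)
 have b01: "b i n \<in> {0..1}" for i n
 proof (cases "n \<in> {1..Suc i}")
  case True
  hence "0 < b i n" "b i n <= 1 / n" using bt[of i] by (auto simp: tame_def)
  moreover have "1 / real n <= 1" using True by simp
  ultimately show ?thesis by auto
 qed (auto simp: b_def)
 have "compactin (product_topology (%n::nat. euclidean) UNIV) (PiE UNIV (%n. {0..1::real}))" unfolding compactin_PiE by auto
 hence "compact (PiE UNIV (%n::nat. {0..1::real}))" by (simp add: euclidean_product_topology)
 then obtain \<beta> r1 where r1: "strict_mono (r1 :: nat => nat)" and \<beta>: "(b \<circ> r1) ----> \<beta>"
  using b01 unfolding compact_eq_seq_compact_metric seq_compact_def by (metis PiE_UNIV_domain UNIV_I Pi_I)
 define G where "G = (%i. cpoly (Suc (r1 i)) (b (r1 i)))"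
 obtain g r2 where g: "g holomorphic_on UNIV" "strict_mono (r2 :: nat => nat)"
  and g_lim: "!!K. [|compact K; K \<subseteq> UNIV|] ==> uniform_limit K (G \<circ> r2) g sequentially"
 proof (rule Montel[of UNIV "range G" G])
  show "h holomorphic_on UNIV" if "h \<in> range G" for h
   using that unfolding G_def cpoly_def by (auto intro!: holomorphic_intros)
  fix K :: "complex set" assume "compact K"
  then obtain R where R: "!!z. z \<in> K ==> cmod z <= R" using compact_imp_bounded[of K] unfolding bounded_iff by blast
  have "cmod (G i z) <= R\<^sup>2 * exp (2 * R)" if "z \<in> K" for i z
  proof -
   have "cmod (G i z) <= (cmod z)\<^sup>2 * exp (2 * cmod z)" unfolding G_def by (rule cpoly_bound[OF bt])
   also have "... <= R\<^sup>2 * exp (2 * R)" using R[OF that] by (intro mult_mono power_mono) auto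
   finally show ?thesis .
  qed
  thus "EX B. ALL h:range G. ALL z:K. cmod (h z) <= B" by blast
 qed auto
 define Fs where "Fs = (%i. clog (Suc (r1 (r2 i))) (b (r1 (r2 i))))"
 obtain f r3 where f: "f holomorphic_on uhp" "strict_mono (r3 :: nat => nat)"
  and f_lim: "!!z. z \<in> uhp ==> (%i. Fs (r3 i) z) ----> f z"
 proof (rule Montel[of uhp "range Fs" Fs])
  show "h holomorphic_on uhp" if "h \<in> range Fs" for h
   using that clog_holomorphic[OF bt] unfolding Fs_def by auto
  fix K assume "compact K" "K \<subseteq> uhp"
  hence "EX B. ALL N b. tame N b --> (ALL z:K. cmod (clog N b z) <= B)" by (rule clog_locally_bounded)
  then obtain B where "!!N b z. [|tame N b; z \<in> K|] ==> cmod (clog N b z) <= B" by blast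
  thus "EX B. ALL h:range Fs. ALL z:K. cmod (h z) <= B" using bt unfolding Fs_def by blast
 qed (auto intro: open_uhp)
 define s where "s i = r1 (r2 (r3 i))" for i
 have s: "strict_mono s" using r1 g(2) f(2) unfolding s_def strict_mono_def by blast
 have "comb_limit d (%i. Suc (s i)) (%i. b (s i)) \<beta> g f"
 proof
  show "Suc i <= Suc (s i)" for i using seq_suble[OF s] by simp
  show "unit_maxima (Suc (s i)) (%n. 1 / b (s i) n)" "tame (Suc (s i)) (b (s i))" for i by (rule bu, rule bt)
  show "(%i. b (s i) n) ----> \<beta> n" for n
  proof -
   show ?thesis using continuous_on_tendsto_compose[OF continuous_on_product_coordinates \<beta>] LIMSEQ_subseq_LIMSEQ[of "%i. (b \<circ> r1) i n" "\<beta> n" "%i. r2 (r3 i)"] g(2) f(2) by (simp add: o_def s_def strict_mono_def)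
  qed
  show "uniform_limit K (%i. cpoly (Suc (s i)) (b (s i))) g sequentially" if "compact K" for K
   using filterlim_compose[OF g_lim[OF that] filterlim_subseq[OF f(2)]] by (simp add: o_def G_def s_def)
  show "(%i. clog (Suc (s i)) (b (s i)) z) ----> f z" if "z \<in> uhp" for z
   using f_lim[OF that] by (simp add: Fs_def s_def)
  show "b (s i) 0 = 0" for i by (simp add: b_def)
 qed (use g f in auto)
 thus ?thesis using that by blast
qed

end

section \<open>Local Lipschitz conditions and absolute continuity on lines\<close>

text \<open>Lipschitz on a neighbourhood of \<open>z\<close> within \<open>S\<close>. The set \<open>S\<close> allows the pieces of a map defined by cases to be
  treated one by one.\<close>

definition lipschitz_near :: "('a::metric_space => 'b::metric_space) => 'a => 'a set => bool" where
 "lipschitz_near f z S \<longleftrightarrow> (EX r>0. EX M>=0. ALL x:ball z r \<inter> S. ALL y:ball z r \<inter> S. dist (f x) (f y) <= M * dist x y)"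

lemma lipschitz_nearI:
 "[|r > 0; M >= 0; !!x y. [|x \<in> S; y \<in> S; dist z x < r; dist z y < r|] ==> dist (f x) (f y) <= M * dist x y|] ==> lipschitz_near f z S"
 unfolding lipschitz_near_def by (intro exI[of _ r] exI[of _ M] conjI) auto

lemma lipschitz_nearE:
 assumes "lipschitz_near f z S"
 obtains r M where "r > 0" "M >= 0"
  "!!x y. [|x \<in> S; y \<in> S; dist z x < r; dist z y < r|] ==> dist (f x) (f y) <= M * dist x y"
 using assms unfolding lipschitz_near_def by (metis IntI mem_ball)

lemma lipschitz_near_subset: "[|lipschitz_near f z S; T \<subseteq> S|] ==> lipschitz_near f z T"
 unfolding lipschitz_near_def by (meson Int_iff subsetD)

lemma lipschitz_near_on:
 assumes "M >= 0" "!!x y. [|x \<in> S; y \<in> S|] ==> dist (f x) (f y) <= M * dist x y"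
 shows "lipschitz_near f z S" by (rule lipschitz_nearI[of 1 M]) (use assms in auto)

lemma lipschitz_near_cong:
 assumes "lipschitz_near g z S" "!!w. w \<in> S ==> f w = g w"
 shows "lipschitz_near f z S"
proof -
 obtain r M where "r > 0" "M >= 0" "!!x y. [|x \<in> S; y \<in> S; dist z x < r; dist z y < r|] ==> dist (g x) (g y) <= M * dist x y"
  using assms(1) by (rule lipschitz_nearE) blast
 thus ?thesis by (intro lipschitz_nearI[of r M]) (use assms(2) in auto)
qed

lemma lipschitz_near_local:
 assumes "lipschitz_near f z (S \<inter> ball z e)" "e > 0"
 shows "lipschitz_near f z S"
proof -
 obtain r M where "r > 0" "M >= 0" "!!x y. [|x \<in> S \<inter> ball z e; y \<in> S \<inter> ball z e; dist z x < r; dist z y < r|] ==> dist (f x) (f y) <= M * dist x y"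
  using assms(1) by (rule lipschitz_nearE) blast
 thus ?thesis by (intro lipschitz_nearI[of "min r e" M]) (use assms(2) in auto)
qed

lemma lipschitz_near_continuous:
 assumes "lipschitz_near f z S" "z \<in> S"
 shows "continuous (at z within S) f"
proof -
 obtain r M where r: "r > 0" "M >= 0" and M: "!!x y. [|x \<in> S; y \<in> S; dist z x < r; dist z y < r|] ==> dist (f x) (f y) <= M * dist x y"
  using assms(1) by (rule lipschitz_nearE) blast
 show ?thesis
  unfolding continuous_within_eps_delta
 proof (intro allI impI)
  fix e :: real assume e: "e > 0"
  have "dist (f x) (f z) < e" if x: "x \<in> S" "dist x z < min r (e / (M + 1))" for x
  proof -
   have "dist (f x) (f z) <= M * dist x z" using M[of x z] x r assms(2) by (auto simp: dist_commute)
   also have "... <= (M + 1) * dist x z" by (intro mult_right_mono) auto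
   also have "... < (M + 1) * (e / (M + 1))" using x r by (intro mult_strict_left_mono) auto
   finally show ?thesis using r by simp
  qed
  thus "EX d>0. ALL x:S. dist x z < d --> dist (f x) (f z) < e" using r e by (intro exI[of _ "min r (e / (M + 1))"]) auto
 qed
qed

lemma lipschitz_near_compose:
 assumes f: "lipschitz_near f z S" and g: "lipschitz_near g (f z) T" and z: "z \<in> S" and sub: "f ` S \<subseteq> T"
 shows "lipschitz_near (%x. g (f x)) z S"
proof -
 obtain r M where r: "r > 0" "M >= 0" and M: "!!x y. [|x \<in> S; y \<in> S; dist z x < r; dist z y < r|] ==> dist (f x) (f y) <= M * dist x y"
  using f by (rule lipschitz_nearE) blast
 obtain q L where q: "q > 0" "L >= 0" and L: "!!x y. [|x \<in> T; y \<in> T; dist (f z) x < q; dist (f z) y < q|] ==> dist (g x) (g y) <= L * dist x y"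
  using g by (rule lipschitz_nearE) blast
 define s where "s = min r (q / (M + 1))"
 have s: "s > 0" "s <= r" "s <= q / (M + 1)" using r q by (auto simp: s_def)
 have near: "dist (f z) (f x) < q" if "x \<in> S" "dist z x < s" for x
 proof -
  have "dist (f z) (f x) <= M * dist z x" using M[of z x] that s r z by auto
  also have "... <= (M + 1) * dist z x" by (intro mult_right_mono) auto
  also have "... < (M + 1) * (q / (M + 1))" using that s r by (intro mult_strict_left_mono) auto
  finally show ?thesis using r by simp
 qed
 show ?thesis
 proof (rule lipschitz_nearI[of s "L * M"])
  fix x y assume xy: "x \<in> S" "y \<in> S" "dist z x < s" "dist z y < s"
  have "dist (g (f x)) (g (f y)) <= L * dist (f x) (f y)" using near xy sub by (intro L) auto
  also have "... <= L * (M * dist x y)" using q M xy s by (intro mult_left_mono) auto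
  finally show "dist (g (f x)) (g (f y)) <= L * M * dist x y" by (simp add: mult.assoc)
 qed (use s r q in auto)
qed

lemma lipschitz_near_const: "lipschitz_near (%x. c) z S" by (rule lipschitz_near_on[of 0]) auto

lemma lipschitz_near_bounded_linear:
 assumes "bounded_linear f"
 shows "lipschitz_near f z S"
proof -
 obtain K where "!!x. norm (f x) <= norm x * K" "0 <= K" using bounded_linear.nonneg_bounded[OF assms] by blast
 thus ?thesis
  by (intro lipschitz_near_on[of K]) (auto simp: dist_norm linear_diff[OF bounded_linear.linear[OF assms], symmetric] mult.commute)
qed

lemma lipschitz_near_add:
 fixes f g :: "'a::metric_space => 'b::real_normed_vector"
 assumes "lipschitz_near f z S" "lipschitz_near g z S"
 shows "lipschitz_near (%x. f x + g x) z S"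
proof -
 obtain r M where r: "r > 0" "M >= 0" and M: "!!x y. [|x \<in> S; y \<in> S; dist z x < r; dist z y < r|] ==> dist (f x) (f y) <= M * dist x y"
  using assms(1) by (rule lipschitz_nearE) blast
 obtain q L where q: "q > 0" "L >= 0" and L: "!!x y. [|x \<in> S; y \<in> S; dist z x < q; dist z y < q|] ==> dist (g x) (g y) <= L * dist x y"
  using assms(2) by (rule lipschitz_nearE) blast
 show ?thesis
 proof (rule lipschitz_nearI[of "min r q" "M + L"])
  fix x y assume xy: "x \<in> S" "y \<in> S" "dist z x < min r q" "dist z y < min r q"
  have "dist (f x + g x) (f y + g y) <= dist (f x) (f y) + dist (g x) (g y)" by (rule dist_triangle_add)
  also have "... <= M * dist x y + L * dist x y" using M L xy by (intro add_mono) auto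
  finally show "dist (f x + g x) (f y + g y) <= (M + L) * dist x y" by (simp add: distrib_right)
 qed (use r q in auto)
qed

lemma lipschitz_near_mult:
 fixes f g :: "'a::metric_space => 'b::real_normed_algebra"
 assumes "lipschitz_near f z S" "lipschitz_near g z S" "z \<in> S"
 shows "lipschitz_near (%x. f x * g x) z S"
proof -
 obtain r M where r: "r > 0" "M >= 0" and M: "!!x y. [|x \<in> S; y \<in> S; dist z x < r; dist z y < r|] ==> dist (f x) (f y) <= M * dist x y"
  using assms(1) by (rule lipschitz_nearE) blast
 obtain q L where q: "q > 0" "L >= 0" and L: "!!x y. [|x \<in> S; y \<in> S; dist z x < q; dist z y < q|] ==> dist (g x) (g y) <= L * dist x y"
  using assms(2) by (rule lipschitz_nearE) blast
 define s where "s = min r q"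
 define A where "A = norm (f z) + M * s"
 define B where "B = norm (g z) + L * s"
 have s: "s > 0" "s <= r" "s <= q" using r q by (auto simp: s_def)
 have fA: "norm (f x) <= A" if "x \<in> S" "dist z x < s" for x
 proof -
  have "norm (f x) <= norm (f z) + dist (f z) (f x)" by (metis dist_norm norm_minus_commute norm_triangle_sub)
  moreover have "dist (f z) (f x) <= M * dist z x" using M[of z x] assms(3) that s r by auto
  moreover have "M * dist z x <= M * s" using that r by (intro mult_left_mono) auto
  ultimately show ?thesis by (simp add: A_def)
 qed
 have gB: "norm (g x) <= B" if "x \<in> S" "dist z x < s" for x
 proof -
  have "norm (g x) <= norm (g z) + dist (g z) (g x)" by (metis dist_norm norm_minus_commute norm_triangle_sub)
  moreover have "dist (g z) (g x) <= L * dist z x" using L[of z x] assms(3) that s q by auto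
  moreover have "L * dist z x <= L * s" using that q by (intro mult_left_mono) auto
  ultimately show ?thesis by (simp add: B_def)
 qed
 show ?thesis
 proof (rule lipschitz_nearI[of s "A * L + M * B"])
  show "A * L + M * B >= 0" using r q s by (auto simp: A_def B_def)
  fix x y assume xy: "x \<in> S" "y \<in> S" "dist z x < s" "dist z y < s"
  have "dist (f x * g x) (f y * g y) = norm (f x * (g x - g y) + (f x - f y) * g y)" by (simp add: dist_norm algebra_simps)
  also have "... <= norm (f x) * dist (g x) (g y) + dist (f x) (f y) * norm (g y)" unfolding dist_norm by (intro norm_triangle_mono norm_mult_ineq)
  also have "... <= A * (L * dist x y) + (M * dist x y) * B" using fA gB xy M L s r q by (intro add_mono mult_mono) (auto simp: A_def)
  finally show "dist (f x * g x) (f y * g y) <= (A * L + M * B) * dist x y" by (simp add: algebra_simps)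
 qed (use s in auto)
qed

lemma lipschitz_near_field_derivative:
 fixes f :: "'a::real_normed_field => 'a"
 assumes "open U" "z \<in> U" and d: "!!w. w \<in> U ==> (f has_field_derivative f' w) (at w)" and c: "continuous_on U f'"
 shows "lipschitz_near f z S"
proof -
 have "isCont f' z" using assms by (simp add: continuous_on_eq_continuous_at)
 then obtain e where e: "e > 0" "!!w. dist w z < e ==> dist (f' w) (f' z) < 1" unfolding continuous_at_eps_delta by (metis zero_less_one)
 obtain r where r: "r > 0" "ball z r \<subseteq> U" using assms openE by blast
 define s where "s = min e r"
 have "norm (f x - f y) <= (norm (f' z) + 1) * norm (x - y)" if "x \<in> ball z s" "y \<in> ball z s" for x y
 proof (rule field_differentiable_bound[where S = "ball z s" and f' = f'])
  fix w assume w: "w \<in> ball z s"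
  thus "(f has_field_derivative f' w) (at w within ball z s)" using r by (intro d[THEN has_field_derivative_at_within]) (auto simp: s_def)
  show "norm (f' w) <= norm (f' z) + 1" using e(2)[of w] w norm_triangle_sub[of "f' w" "f' z"] by (auto simp: s_def dist_commute dist_norm)
 qed (use that in auto)
 thus ?thesis using e r
  by (intro lipschitz_nearI[of s "norm (f' z) + 1"]) (auto simp: s_def dist_norm add_nonneg_nonneg)
qed

lemma lipschitz_near_holomorphic:
 assumes "f holomorphic_on U" "open U" "z \<in> U"
 shows "lipschitz_near f z S" using assms
 by (intro lipschitz_near_field_derivative[of U z f "deriv f"])
  (auto intro: holomorphic_derivI holomorphic_on_imp_continuous_on holomorphic_deriv)

text \<open>A segment between two nearby points is cut at the pieces, so a convex set and a closed cover are needed,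
  but no compatibility of the pieces.\<close>

lemma lipschitz_near_closed_cover:
 fixes f :: "'a::real_normed_vector => 'b::metric_space"
 assumes "convex S" "finite I" "e > 0" "ball z e \<inter> S \<subseteq> (\<Union>i\<in>I. C i)"
  and cl: "!!i. i \<in> I ==> closed (C i)"
  and lip: "!!i. [|i \<in> I; z \<in> C i|] ==> lipschitz_near f z (C i \<inter> S)"
 shows "lipschitz_near f z S"
proof -
 have "EX r M. r > 0 & M >= 0 & (ALL x y. x \<in> C i \<inter> S --> y \<in> C i \<inter> S --> dist z x < r --> dist z y < r --> dist (f x) (f y) <= M * dist x y)"
  if i: "i \<in> I" for i
 proof (cases "z \<in> C i")
  case True
  from lipschitz_nearE[OF lip[OF i True]] show ?thesis by metis
 next
  case False
  then obtain r where "r > 0" "ball z r \<subseteq> - C i" using cl[OF i] open_contains_ball[of "- C i"] by (auto simp: open_Compl)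
  thus ?thesis by (intro exI[of _ r] exI[of _ 0]) auto
 qed
 then obtain r M where r: "!!i. i \<in> I ==> r i > 0" and M0: "!!i. i \<in> I ==> M i >= (0::real)"
  and M: "!!i x y. [|i \<in> I; x \<in> C i; x \<in> S; y \<in> C i; y \<in> S; dist z x < r i; dist z y < r i|] ==> dist (f x) (f y) <= M i * dist x y"
  by (metis IntI)
 define s where "s = Min (insert e (r ` I))"
 define L where "L = Max (insert 0 (M ` I))"
 have s: "s > 0" "s <= e" "!!i. i \<in> I ==> s <= r i" using r assms(2,3) by (auto simp: s_def)
 have L: "0 <= L" "!!i. i \<in> I ==> M i <= L" using assms(2) by (auto simp: L_def)
 have "dist (f x) (f y) <= L * dist x y" if x: "x \<in> S" "dist z x < s" and y: "y \<in> S" "dist z y < s" for x y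
 proof -
  define p where "p = (%t::real. x + t *\<^sub>R (y - x))"
  define U where "U = (%i. {t\<in>{0..1}. p t \<in> C i})"
  have "convex (ball z s \<inter> S)" using assms(1) by (intro convex_Int convex_ball)
  hence "p t \<in> ball z s \<inter> S" if "t \<in> {0..1}" for t
   using convexD_alt[of "ball z s \<inter> S" x y t] x y that by (simp add: p_def algebra_simps)
  hence p: "dist z (p t) < s" "p t \<in> S" if "t \<in> {0..1}" for t using that by auto
  have "(L * norm (y - x))-lipschitz_on {0..1} (%t. f (p t))"
  proof (rule lipschitz_on_closed_Union[where I = I and U = U])
   fix i assume i: "i \<in> I"
   show "closed (U i)"
   proof -
    have "continuous_on {0..1} p" unfolding p_def by (intro continuous_intros)
    hence "closedin (top_of_set {0..1}) ({0..1} \<inter> p -` C i)" using cl[OF i] by (rule continuous_closedin_preimage)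
    moreover have "{0..1} \<inter> p -` C i = U i" by (auto simp: U_def)
    ultimately show ?thesis using closedin_closed_trans by (metis closed_atLeastAtMost)
   qed
   show "(L * norm (y - x))-lipschitz_on (U i) (%t. f (p t))"
   proof (rule lipschitz_onI)
    fix t u assume t: "t \<in> U i" "u \<in> U i"
    have "dist (f (p t)) (f (p u)) <= M i * dist (p t) (p u)" using t p s(3)[OF i] by (intro M i) (auto simp: U_def intro: less_le_trans)
    also have "dist (p t) (p u) = dist t u * norm (y - x)" by (simp add: p_def dist_norm flip: scaleR_diff_left)
    also have "M i * (dist t u * norm (y - x)) <= L * (dist t u * norm (y - x))" using L(2)[OF i] by (intro mult_right_mono) auto
    finally show "dist (f (p t)) (f (p u)) <= L * norm (y - x) * dist t u" by (simp add: mult_ac)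
   qed (use L in auto)
  next
   show "{0..1} \<subseteq> (\<Union>i\<in>I. U i)"
   proof
    fix t :: real assume t: "t \<in> {0..1}"
    hence "p t \<in> ball z e \<inter> S" using p[OF t] s by auto
    thus "t \<in> (\<Union>i\<in>I. U i)" using assms(4) t by (auto simp: U_def)
   qed
  qed (use L assms in auto)
  from lipschitz_onD[OF this, of 0 1] show ?thesis by (simp add: p_def dist_norm norm_minus_commute)
 qed
 thus ?thesis using s L by (intro lipschitz_nearI[of s L]) auto
qed

lemma lipschitz_near_compact_interval:
 fixes h :: "real => 'b::metric_space"
 assumes "!!x. x \<in> {a..b} ==> lipschitz_near h x UNIV"
 obtains M where "M-lipschitz_on {a..b} h"
proof -
 have "EX r M. r > 0 & M >= 0 & (ALL u v. dist x u < r --> dist x v < r --> dist (h u) (h v) <= M * dist u v)" if "x \<in> {a..b}" for x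
  by (rule lipschitz_nearE[OF assms[OF that]]) auto
 then obtain r M where r: "!!x. x \<in> {a..b} ==> r x > 0 & M x >= (0::real)"
  and M: "!!x u v. [|x \<in> {a..b}; dist x u < r x; dist x v < r x|] ==> dist (h u) (h v) <= M x * dist u v" by metis
 obtain D where D: "D \<subseteq> {a..b}" "finite D" "{a..b} \<subseteq> (\<Union>x\<in>D. ball x (r x / 2))"
 proof (rule compactE_image[of "{a..b}" "{a..b}" "%x. ball x (r x / 2)"])
  show "{a..b} \<subseteq> (\<Union>x\<in>{a..b}. ball x (r x / 2))" using r by force
 qed auto
 define L where "L = Max (insert 0 (M ` D))"
 have L: "0 <= L" "!!x. x \<in> D ==> M x <= L" using D(2) by (auto simp: L_def)
 have "L-lipschitz_on {a..b} h"
 proof (rule lipschitz_on_closed_Union[where I = D and U = "%x. cball x (r x / 2)"])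
  fix x assume x: "x \<in> D"
  show "L-lipschitz_on (cball x (r x / 2)) h"
  proof (rule lipschitz_onI)
   fix u v assume uv: "u \<in> cball x (r x / 2)" "v \<in> cball x (r x / 2)"
   have "r x > 0" using r x D(1) by auto
   hence "dist (h u) (h v) <= M x * dist u v" using uv x D(1) by (intro M) auto
   also have "... <= L * dist u v" using L(2)[OF x] by (intro mult_right_mono) auto
   finally show "dist (h u) (h v) <= L * dist u v" .
  qed (use L in auto)
 next
  have "(\<Union>x\<in>D. ball x (r x / 2)) \<subseteq> (\<Union>x\<in>D. cball x (r x / 2))" by (intro UN_mono ball_subset_cball order_refl)
  from subset_trans[OF D(3) this] show "{a..b} \<subseteq> (\<Union>x\<in>D. cball x (r x / 2))" .
 qed (auto intro: D(2) L(1))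
 thus ?thesis using that by blast
qed

lemma abs_continuous_of_lipschitz:
 assumes M: "M-lipschitz_on {a..b} h"
 shows "abs_continuous_on_interval a b h" unfolding abs_continuous_on_interval_def
proof (intro allI impI)
 fix \<epsilon> :: real assume e: "\<epsilon> > 0"
 have M0: "0 <= M" using lipschitz_on_nonneg[OF M] .
 show "EX \<delta>>0. ALL (N::nat) u v. (ALL i<N. a <= u i & u i <= v i & v i <= b) &
    disjoint_family_on (%i. {u i<..<v i}) {..<N} & (\<Sum>i<N. v i - u i) < \<delta> -->
    (\<Sum>i<N. norm (h (v i) - h (u i))) < \<epsilon>"
 proof (intro exI[of _ "\<epsilon> / (M + 1)"] conjI allI impI, goal_cases)
  case 1
  show ?case using e M0 by simp
 next
  case (2 N u v)
  have "(\<Sum>i<N. norm (h (v i) - h (u i))) <= (\<Sum>i<N. M * (v i - u i))"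
  proof (rule sum_mono)
   fix i assume "i \<in> {..<N}"
   hence i: "a <= u i" "u i <= v i" "v i <= b" using 2 by auto
   thus "norm (h (v i) - h (u i)) <= M * (v i - u i)" using lipschitz_onD[OF M, of "v i" "u i"] by (simp add: dist_norm)
  qed
  also have "... = M * (\<Sum>i<N. v i - u i)" by (simp add: sum_distrib_left)
  also have "... <= M * (\<epsilon> / (M + 1))" using 2 M0 by (intro mult_left_mono) auto
  also have "... < \<epsilon>" using e M0 by (simp add: field_simps)
  finally show ?case .
 qed
qed

text \<open>A line that misses the countable set is covered by finitely many Lipschitz pieces on each compact
  segment, and all but countably many lines parallel to an axis miss it.\<close>

lemma ACL_of_lipschitz_near:
 assumes X: "countable X" and f: "!!z. z \<notin> X ==> lipschitz_near f z UNIV"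
 shows "ACL f" unfolding ACL_def
proof (intro allI impI conjI)
 fix a b c d :: real
 have ae: "AE y in lborel. y \<notin> p ` X" for p :: "complex => real" using X by (intro AE_not_in countable_imp_null_set_lborel) auto
 show "AE y in lborel. y \<in> {c..d} --> abs_continuous_on_interval a b (%x. f (Complex x y))" using ae[of Im]
 proof eventually_elim
  case (elim y)
  have "lipschitz_near (%x. f (Complex x y)) x UNIV" for x
  proof (rule lipschitz_near_compose[of "%x. Complex x y" x UNIV f UNIV])
   show "lipschitz_near (%x. Complex x y) x UNIV" by (rule lipschitz_near_on[of 1]) (auto simp: dist_norm cmod_def)
   show "lipschitz_near f (Complex x y) UNIV" using elim by (intro f) force
  qed auto
  then obtain M where "M-lipschitz_on {a..b} (%x. f (Complex x y))" using lipschitz_near_compact_interval by blast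
  thus ?case using abs_continuous_of_lipschitz by blast
 qed
 show "AE x in lborel. x \<in> {a..b} --> abs_continuous_on_interval c d (%y. f (Complex x y))" using ae[of Re]
 proof eventually_elim
  case (elim x)
  have "lipschitz_near (%y. f (Complex x y)) y UNIV" for y
  proof (rule lipschitz_near_compose[of "%y. Complex x y" y UNIV f UNIV])
   show "lipschitz_near (%y. Complex x y) y UNIV" by (rule lipschitz_near_on[of 1]) (auto simp: dist_norm cmod_def)
   show "lipschitz_near f (Complex x y) UNIV" using elim by (intro f) force
  qed auto
  then obtain M where "M-lipschitz_on {c..d} (%y. f (Complex x y))" using lipschitz_near_compact_interval by blast
  thus ?case using abs_continuous_of_lipschitz by blast
 qed
qed

section \<open>Linear maps of bounded dilatation\<close>

text \<open>The determinant of a real linear map of the plane.\<close>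

definition real_det :: "(complex => complex) => real" where
 "real_det A = Im (cnj (A 1) * A \<i>)"

text \<open>In this form (the operator norm squared is at most \<open>K\<close> times the determinant) the bound is stable under
  composition, and \<open>A = 0\<close> is admitted.\<close>

definition dilatation_le :: "real => (complex => complex) => bool" where
 "dilatation_le K A \<longleftrightarrow> linear A & (ALL v. (cmod (A v))\<^sup>2 <= K * real_det A * (cmod v)\<^sup>2)"

lemma linear_complex_eq: "linear A ==> A v = of_real (Re v) * A 1 + of_real (Im v) * A \<i>"
proof -
 assume A: "linear A"
 have "v = Re v *\<^sub>R 1 + Im v *\<^sub>R \<i>" by (simp add: complex_eq_iff)
 hence "A v = A (Re v *\<^sub>R 1 + Im v *\<^sub>R \<i>)" by simp
 also have "... = Re v *\<^sub>R A 1 + Im v *\<^sub>R A \<i>" using A by (simp only: linear_add linear_cmul)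
 finally show ?thesis by (simp add: scaleR_conv_of_real)
qed

lemma real_det_compose:
 assumes "linear A" "linear B"
 shows "real_det (A \<circ> B) = real_det A * real_det B"
 unfolding real_det_def o_def linear_complex_eq[OF assms(1), of "B 1"] linear_complex_eq[OF assms(1), of "B \<i>"]
 by (simp add: algebra_simps)

lemma dilatation_le_compose:
 assumes A: "dilatation_le K A" and B: "dilatation_le L B" and "0 <= K" "0 < L"
 shows "dilatation_le (K * L) (A \<circ> B)" unfolding dilatation_le_def
proof (intro conjI allI)
 show "linear (A \<circ> B)" using A B by (simp add: dilatation_le_def linear_compose)
 fix v
 have "0 <= real_det A \<or> K = 0"
 proof -
  have "0 <= K * real_det A * (cmod 1)\<^sup>2" using A unfolding dilatation_le_def by (metis order_trans zero_le_power2)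
  thus ?thesis using \<open>0 <= K\<close> by (auto simp: zero_le_mult_iff)
 qed
 hence K: "0 <= K * real_det A" using \<open>0 <= K\<close> by auto
 have "(cmod ((A \<circ> B) v))\<^sup>2 <= K * real_det A * (cmod (B v))\<^sup>2" using A by (simp add: dilatation_le_def)
 also have "... <= K * real_det A * (L * real_det B * (cmod v)\<^sup>2)" using B K by (intro mult_left_mono) (auto simp: dilatation_le_def)
 also have "... = K * L * real_det (A \<circ> B) * (cmod v)\<^sup>2" using A B by (simp add: real_det_compose dilatation_le_def)
 finally show "(cmod ((A \<circ> B) v))\<^sup>2 <= K * L * real_det (A \<circ> B) * (cmod v)\<^sup>2" .
qed

lemma dilatation_le_mult: "dilatation_le 1 ((*) c)"
proof -
 have "linear ((*) c)" by (simp add: linear_iff distrib_left)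
 moreover have "real_det ((*) c) = (cmod c)\<^sup>2" by (simp add: real_det_def cmod_power2) (simp add: power2_eq_square algebra_simps)
 ultimately show ?thesis by (simp add: dilatation_le_def norm_mult power_mult_distrib)
qed

lemma dilatation_le_cnj:
 assumes "dilatation_le K A"
 shows "dilatation_le K (%v. cnj (A (cnj v)))"
proof -
 have lin: "linear A" using assms by (simp add: dilatation_le_def)
 have "linear (%v. cnj (A (cnj v)))" using lin by (simp add: linear_iff)
 moreover have "A (- \<i>) = - A \<i>" using lin by (rule linear_neg)
 hence "real_det (%v. cnj (A (cnj v))) = real_det A" by (simp add: real_det_def)
 moreover have "(cmod (A (cnj v)))\<^sup>2 <= K * real_det A * (cmod v)\<^sup>2" for v
  using assms unfolding dilatation_le_def by (metis complex_mod_cnj)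
 ultimately show ?thesis by (simp add: dilatation_le_def)
qed

lemma dilatation_le_bound:
 assumes "linear A" "cmod (A 1) <= M * c" "cmod (A \<i>) <= M' * c" "m * c\<^sup>2 <= real_det A" "0 < m" "(M + M')\<^sup>2 <= K * m" "0 <= K"
 shows "dilatation_le K A" unfolding dilatation_le_def
proof (intro conjI allI)
 fix v
 have "cmod (A v) <= cmod (of_real (Re v) * A 1) + cmod (of_real (Im v) * A \<i>)"
  unfolding linear_complex_eq[OF assms(1), of v] by (rule norm_triangle_ineq)
 also have "... = \<bar>Re v\<bar> * cmod (A 1) + \<bar>Im v\<bar> * cmod (A \<i>)" by (simp add: norm_mult)
 also have "... <= cmod v * (M * c) + cmod v * (M' * c)" using assms abs_Re_le_cmod abs_Im_le_cmod by (intro add_mono mult_mono) auto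
 finally have "cmod (A v) <= cmod v * ((M + M') * c)" by (simp add: algebra_simps)
 hence "(cmod (A v))\<^sup>2 <= (cmod v * ((M + M') * c))\<^sup>2" by (intro power_mono) auto
 also have "... = (M + M')\<^sup>2 * (c\<^sup>2 * (cmod v)\<^sup>2)" by (simp add: power_mult_distrib)
 also have "... <= K * m * (c\<^sup>2 * (cmod v)\<^sup>2)" using assms by (intro mult_right_mono) auto
 also have "... = K * (m * c\<^sup>2) * (cmod v)\<^sup>2" by simp
 also have "... <= K * real_det A * (cmod v)\<^sup>2" using assms by (intro mult_right_mono mult_left_mono) auto
 finally show "(cmod (A v))\<^sup>2 <= K * real_det A * (cmod v)\<^sup>2" .
qed (rule assms)

lemma dilatation_le_mono:
 assumes "dilatation_le K A" "K <= K'" "0 < K"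
 shows "dilatation_le K' A" unfolding dilatation_le_def
proof (intro conjI allI)
 have "0 <= K * real_det A * (cmod 1)\<^sup>2" using assms(1) unfolding dilatation_le_def by (metis order_trans zero_le_power2)
 hence det: "0 <= real_det A" using \<open>0 < K\<close> by (auto simp: zero_le_mult_iff)
 fix v
 have "(cmod (A v))\<^sup>2 <= K * real_det A * (cmod v)\<^sup>2" using assms(1) by (simp add: dilatation_le_def)
 also have "... <= K' * real_det A * (cmod v)\<^sup>2" using assms(2) det by (intro mult_right_mono) auto
 finally show "(cmod (A v))\<^sup>2 <= K' * real_det A * (cmod v)\<^sup>2" .
qed (use assms in "simp add: dilatation_le_def")

text \<open>With \<open>A v = \<alpha> v + \<beta> cnj v\<close> the largest value of \<open>\<bar>A v\<bar>\<close> on unit vectors is \<open>\<bar>\<alpha>\<bar> + \<bar>\<beta>\<bar>\<close> and the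
  determinant is \<open>\<bar>\<alpha>\<bar>\<^sup>2 - \<bar>\<beta>\<bar>\<^sup>2\<close>.\<close>

lemma dilatation_le_wirtinger:
 assumes A: "dilatation_le K A" and K: "1 <= K"
 shows "cmod ((A 1 + \<i> * A \<i>) / 2) <= (K - 1) / (K + 1) * cmod ((A 1 - \<i> * A \<i>) / 2)"
proof -
 define \<alpha> where "\<alpha> = (A 1 - \<i> * A \<i>) / 2"
 define \<beta> where "\<beta> = (A 1 + \<i> * A \<i>) / 2"
 have lin: "linear A" using A by (simp add: dilatation_le_def)
 have Av: "A v = \<alpha> * v + \<beta> * cnj v" for v
  unfolding linear_complex_eq[OF lin, of v] by (simp add: \<alpha>_def \<beta>_def complex_eq_iff) (simp add: field_simps)
 have det: "real_det A = (cmod \<alpha>)\<^sup>2 - (cmod \<beta>)\<^sup>2"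
  by (simp add: real_det_def Av cmod_power2) (simp add: power2_eq_square algebra_simps)
 have main: "(cmod \<alpha> + cmod \<beta>)\<^sup>2 <= K * ((cmod \<alpha>)\<^sup>2 - (cmod \<beta>)\<^sup>2)"
 proof (cases "\<alpha> = 0 \<or> \<beta> = 0")
  case True
  have "(cmod (A 1))\<^sup>2 <= K * real_det A * (cmod 1)\<^sup>2" using A unfolding dilatation_le_def by blast
  thus ?thesis unfolding det Av using True by auto
 next
  case False
  define v where "v = csqrt (sgn \<beta> * cnj (sgn \<alpha>))"
  have "v\<^sup>2 = sgn \<beta> * cnj (sgn \<alpha>)" by (simp add: v_def)
  hence "cmod (v\<^sup>2) = 1" using False by (simp add: norm_mult norm_sgn)
  hence n: "(cmod v)\<^sup>2 = 1" by (simp only: norm_power)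
  have vv: "v * cnj v = 1" unfolding complex_norm_square[symmetric] n by simp
  have sa: "sgn \<alpha> * cnj (sgn \<alpha>) = 1" unfolding complex_norm_square[symmetric] using False by (simp add: norm_sgn)
  have "sgn \<beta> * cnj v = sgn \<beta> * cnj v * (sgn \<alpha> * cnj (sgn \<alpha>))" unfolding sa by simp
  also have "... = (sgn \<beta> * cnj (sgn \<alpha>)) * (sgn \<alpha> * cnj v)" by (simp only: mult_ac)
  also have "... = v\<^sup>2 * (sgn \<alpha> * cnj v)" using \<open>v\<^sup>2 = _\<close> by simp
  also have "... = v * sgn \<alpha> * (v * cnj v)" by (simp only: mult_ac power2_eq_square)
  finally have sv: "sgn \<beta> * cnj v = v * sgn \<alpha>" unfolding vv by simp
  have sgn: "x = of_real (cmod x) * sgn x" for x by (simp add: sgn_eq)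
  have "A v = (of_real (cmod \<alpha>) * sgn \<alpha>) * v + (of_real (cmod \<beta>) * sgn \<beta>) * cnj v"
   unfolding Av sgn[symmetric] by (rule refl)
  hence "A v = of_real (cmod \<alpha>) * (v * sgn \<alpha>) + of_real (cmod \<beta>) * (sgn \<beta> * cnj v)" by (simp only: mult_ac)
  also have "... = of_real (cmod \<alpha> + cmod \<beta>) * (v * sgn \<alpha>)" unfolding sv by (simp add: distrib_right)
  finally have "(cmod (A v))\<^sup>2 = (cmod \<alpha> + cmod \<beta>)\<^sup>2 * (cmod v)\<^sup>2"
   using False by (simp add: norm_mult norm_sgn power_mult_distrib del: of_real_add)
  moreover have "(cmod (A v))\<^sup>2 <= K * real_det A * (cmod v)\<^sup>2" using A unfolding dilatation_le_def by blast
  ultimately show ?thesis by (simp only: n det mult_1_right)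
 qed
 have "cmod \<alpha> + cmod \<beta> <= K * (cmod \<alpha> - cmod \<beta>)"
 proof (cases "cmod \<alpha> + cmod \<beta> = 0")
  case True
  thus ?thesis by (simp add: add_nonneg_eq_0_iff)
 next
  case False
  have "(cmod \<alpha> + cmod \<beta>) * (cmod \<alpha> + cmod \<beta>) <= (K * (cmod \<alpha> - cmod \<beta>)) * (cmod \<alpha> + cmod \<beta>)"
   using main by (simp add: power2_eq_square algebra_simps)
  moreover have "0 < cmod \<alpha> + cmod \<beta>" using False by (simp add: less_le)
  ultimately show ?thesis by (rule mult_right_le_imp_le)
 qed
 hence "cmod \<beta> <= (K - 1) / (K + 1) * cmod \<alpha>" using K by (simp add: field_simps)
 thus ?thesis by (simp add: \<alpha>_def \<beta>_def)
qed

section \<open>Quasiconformality of the topological factor\<close>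

text \<open>Outside the countable set where \<open>F\<close> is not Lipschitz or \<open>\<phi>\<close> meets a critical point of \<open>g\<close>, a local
  holomorphic inverse of \<open>g\<close> gives \<open>\<phi> = g\<^sup>-\<^sup>1 \<circ> F\<close>, and neither the Lipschitz condition nor the dilatation is
  affected by a holomorphic factor.\<close>

theorem quasiconformal_plane_of_factor:
 assumes g: "g holomorphic_on UNIV" "\<not> g constant_on UNIV" and hom: "homeomorphism UNIV UNIV \<phi> \<psi>"
  and F: "!!z. F z = g (\<phi> z)" and X: "countable X" and lip: "!!z. z \<notin> X ==> lipschitz_near F z UNIV"
  and ae: "AE z in lborel. EX A. (F has_derivative A) (at z) & dilatation_le K A" and K: "1 <= K"
 shows "quasiconformal_plane K \<phi>"
proof -
 have dg: "deriv g holomorphic_on UNIV" using g by (intro holomorphic_deriv) auto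
 have "\<not> deriv g constant_on UNIV \<or> (ALL z. deriv g z ~= 0)"
 proof (rule ccontr)
  assume "\<not> ?thesis"
  hence "!!z. (g has_field_derivative 0) (at z)" using holomorphic_derivI[OF g(1) open_UNIV] by (auto simp: constant_on_def)
  hence "g constant_on UNIV" using has_field_derivative_0_imp_constant_on[of UNIV g] by auto
  thus False using g by blast
 qed
 hence "countable {w\<in>UNIV. deriv g w = 0}" using holomorphic_countable_zeros[OF dg] by (auto simp: fsigma_UNIV)
 moreover have "\<phi> -` {w. deriv g w = 0} \<subseteq> \<psi> ` {w. deriv g w = 0}"
 proof
  fix w assume "w \<in> \<phi> -` {w. deriv g w = 0}"
  moreover have "w = \<psi> (\<phi> w)" using hom by (simp add: homeomorphism_def)
  ultimately show "w \<in> \<psi> ` {w. deriv g w = 0}" by blast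
 qed
 ultimately have cX: "countable (X \<union> \<phi> -` {w. deriv g w = 0})" using X by (auto intro: countable_subset)
 have cont: "continuous_on UNIV \<phi>" using hom by (simp add: homeomorphism_def)
 have loc: "EX U k. open U & \<phi> z \<in> U & open (g ` U) & k holomorphic_on g ` U & (ALL w:U. k (g w) = w)"
  if z: "deriv g (\<phi> z) ~= 0" for z
 proof -
  obtain r where r: "r > 0" "open (g ` ball (\<phi> z) r)" "inj_on g (ball (\<phi> z) r)"
   using has_complex_derivative_locally_invertible[OF g(1) _ open_UNIV z] by auto
  obtain k where "k holomorphic_on (g ` ball (\<phi> z) r)" "!!w. w \<in> ball (\<phi> z) r ==> deriv g w * deriv k (g w) = 1"
    "!!w. w \<in> ball (\<phi> z) r ==> k (g w) = w"
   by (rule holomorphic_has_inverse[OF holomorphic_on_subset[OF g(1) subset_UNIV] open_ball r(3)]) (rule that; assumption)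
  thus ?thesis using r by (intro exI[of _ "ball (\<phi> z) r"] exI[of _ k]) auto
 qed
 have "ACL \<phi>"
 proof (rule ACL_of_lipschitz_near[OF cX])
  fix z assume z: "z \<notin> X \<union> \<phi> -` {w. deriv g w = 0}"
  then obtain U k where U: "open U" "\<phi> z \<in> U" "open (g ` U)" "k holomorphic_on g ` U" "ALL w:U. k (g w) = w" using loc[of z] by auto
  have "open (\<phi> -` U)" using cont U(1) by (simp add: open_vimage)
  then obtain e where e: "e > 0" "ball z e \<subseteq> \<phi> -` U" using U(2) openE by (metis vimageI)
  have "lipschitz_near (%w. k (F w)) z (UNIV \<inter> ball z e)"
  proof (rule lipschitz_near_compose[where T = UNIV and f = F and g = k])
   show "lipschitz_near F z (UNIV \<inter> ball z e)" using lip[of z] z by (auto intro: lipschitz_near_subset)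
   show "lipschitz_near k (F z) UNIV" using U F by (intro lipschitz_near_holomorphic[OF U(4,3)]) auto
  qed (use e in auto)
  hence "lipschitz_near \<phi> z (UNIV \<inter> ball z e)" by (rule lipschitz_near_cong) (use U e F in auto)
  thus "lipschitz_near \<phi> z UNIV" using e(1) by (rule lipschitz_near_local)
 qed
 moreover have "AE z in lborel. EX p q. ((%x. \<phi> (Complex x (Im z))) has_vector_derivative p) (at (Re z)) &
    ((%y. \<phi> (Complex (Re z) y)) has_vector_derivative q) (at (Im z)) &
    norm ((p + \<i> * q) / 2) <= (K - 1) / (K + 1) * norm ((p - \<i> * q) / 2)"
 proof -
  have "AE z in lborel. z \<notin> X \<union> \<phi> -` {w. deriv g w = 0}" using cX by (intro AE_not_in countable_imp_null_set_lborel)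
  with ae show ?thesis
  proof eventually_elim
   case (elim z)
   obtain A where A: "(F has_derivative A) (at z)" "dilatation_le K A" using elim by blast
   obtain U k where U: "open U" "\<phi> z \<in> U" "open (g ` U)" "k holomorphic_on g ` U" "ALL w:U. k (g w) = w" using loc[of z] elim by auto
   have "(k has_field_derivative deriv k (F z)) (at (F z))" using U F by (intro holomorphic_derivI[OF U(4,3)]) auto
   hence "(k has_derivative (*) (deriv k (F z))) (at (F z))" by (simp add: has_field_derivative_def)
   hence "((%w. k (F w)) has_derivative (%v. deriv k (F z) * A v)) (at z)" using A(1) by (auto intro: has_derivative_compose)
   hence d: "(\<phi> has_derivative (%v. deriv k (F z) * A v)) (at z)"
    by (rule has_derivative_transform_within_open[of _ _ _ _ "\<phi> -` U"]) (use cont U F in "auto simp: open_vimage")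
   define B where "B = (%v. deriv k (F z) * A v)"
   have B: "dilatation_le (1 * K) B" using dilatation_le_compose[OF dilatation_le_mult[of "deriv k (F z)"] A(2)] K by (auto simp: B_def o_def)
   have zC: "Complex (Re z) (Im z) = z" by simp
   have "((%x. complex_of_real x + \<i> * of_real (Im z)) has_vector_derivative of_real 1 + 0) (at (Re z))"
    by (intro has_vector_derivative_add has_vector_derivative_const has_vector_derivative_of_real DERIV_ident)
   hence "((%x. Complex x (Im z)) has_vector_derivative 1) (at (Re z))" by (simp add: Complex_eq)
   moreover have "((%y. complex_of_real (Re z) + \<i> * of_real y) has_vector_derivative 0 + \<i> * of_real 1) (at (Im z))"
    by (intro has_vector_derivative_add has_vector_derivative_const has_vector_derivative_mult_right
      has_vector_derivative_of_real DERIV_ident)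
   hence "((%y. Complex (Re z) y) has_vector_derivative \<i>) (at (Im z))" by (simp add: Complex_eq)
   ultimately have "((%x. \<phi> (Complex x (Im z))) has_vector_derivative B 1) (at (Re z))"
    "((%y. \<phi> (Complex (Re z) y)) has_vector_derivative B \<i>) (at (Im z))"
    using d vector_derivative_diff_chain_within[of "%x. Complex x (Im z)" 1 "Re z" UNIV \<phi> B]
     vector_derivative_diff_chain_within[of "%y. Complex (Re z) y" \<i> "Im z" UNIV \<phi> B]
    unfolding B_def o_def zC by (auto intro: has_derivative_at_withinI)
   thus ?case using dilatation_le_wirtinger[of K B] B K by auto
  qed
 qed
 ultimately show ?thesis using K hom unfolding quasiconformal_plane_def by blast
qed

section \<open>Lipschitz estimates for elementary functions\<close>

lemma lipschitz_near_Complex: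
 assumes "lipschitz_near f z S" "lipschitz_near g z S" "z \<in> S"
 shows "lipschitz_near (%x. Complex (f x) (g x)) z S"
proof -
 have "lipschitz_near (%x. complex_of_real (f x)) z S" "lipschitz_near (%x. complex_of_real (g x)) z S"
  using assms by (auto intro!: lipschitz_near_compose[where g = complex_of_real and T = UNIV]
    lipschitz_near_bounded_linear bounded_linear_of_real)
 hence "lipschitz_near (%x. complex_of_real (f x) + \<i> * complex_of_real (g x)) z S"
  using assms by (intro lipschitz_near_add lipschitz_near_mult lipschitz_near_const) auto
 thus ?thesis by (simp add: Complex_eq)
qed

lemma lipschitz_near_Re: "lipschitz_near Re z S" by (intro lipschitz_near_bounded_linear bounded_linear_Re)
lemma lipschitz_near_Im: "lipschitz_near Im z S" by (intro lipschitz_near_bounded_linear bounded_linear_Im)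
lemma lipschitz_near_cnj: "lipschitz_near cnj z S" by (intro lipschitz_near_bounded_linear bounded_linear_cnj)

lemma lipschitz_near_abs:
 fixes f :: "'a::metric_space => real"
 assumes "lipschitz_near f z S" "z \<in> S"
 shows "lipschitz_near (%x. \<bar>f x\<bar>) z S" using assms(1) by (rule lipschitz_near_compose[where g = abs and T = UNIV])
  (use assms in "auto intro!: lipschitz_near_on[of 1] simp: dist_real_def")

lemma lipschitz_near_inverse:
 fixes f :: "'a::metric_space => real"
 assumes "lipschitz_near f z S" "z \<in> S" "f z ~= 0"
 shows "lipschitz_near (%x. inverse (f x)) z S"
proof (rule lipschitz_near_compose[OF assms(1) _ assms(2), where T = UNIV])
 show "lipschitz_near inverse (f z) UNIV" by (rule lipschitz_near_field_derivative[of "- {0}" _ _ "%x. - (inverse x ^ 2)"])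
   (use assms in "auto intro!: derivative_eq_intros continuous_intros simp: power2_eq_square")
qed auto

lemma lipschitz_near_ln:
 fixes f :: "'a::metric_space => real"
 assumes "lipschitz_near f z S" "z \<in> S" "0 < f z"
 shows "lipschitz_near (%x. ln (f x)) z S"
proof (rule lipschitz_near_compose[OF assms(1) _ assms(2), where T = UNIV])
 show "lipschitz_near ln (f z) UNIV" by (rule lipschitz_near_field_derivative[of "{0<..}" _ _ inverse])
   (use assms in "auto intro!: derivative_eq_intros continuous_intros simp: divide_inverse")
qed auto

text \<open>Half the harmonic mean: it vanishes on the boundary of the quadrant, is homogeneous of degree
  one, and is smooth away from the corner.\<close>

definition hmean :: "real => real => real" where "hmean a b = a * b / (a + b)"

lemma hmean_lipschitz:
 assumes "0 <= a" "0 <= a'" "0 <= b"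
 shows "\<bar>hmean a b - hmean a' b\<bar> <= \<bar>a - a'\<bar>"
proof (cases "b = 0")
 case False
 hence b: "0 < b" using assms by simp
 have e: "hmean a b - hmean a' b = (a - a') * (b\<^sup>2 / ((a + b) * (a' + b)))" using assms b by (simp add: hmean_def field_simps power2_eq_square)
 moreover have "0 <= b\<^sup>2 / ((a + b) * (a' + b))" using assms by simp
 moreover have "b\<^sup>2 / ((a + b) * (a' + b)) <= 1"
 proof -
  have "b * b <= (a + b) * (a' + b)" using assms by (intro mult_mono) auto
  thus ?thesis using assms b by (simp add: power2_eq_square)
 qed
 ultimately show ?thesis unfolding e abs_mult by (intro mult_left_le) (simp_all only: abs_of_nonneg abs_ge_zero)
qed (use assms in "auto simp: hmean_def")

lemma hmean_commute: "hmean a b = hmean b a" by (simp add: hmean_def mult.commute add.commute)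

lemma hmean_0 [simp]: "hmean 0 b = 0" "hmean a 0 = 0" by (auto simp: hmean_def)

lemma hmean_nonneg: "[|0 <= a; 0 <= b|] ==> 0 <= hmean a b" by (simp add: hmean_def)
lemma hmean_pos: "[|0 < a; 0 < b|] ==> 0 < hmean a b" by (simp add: hmean_def)

lemma hmean_mono:
 assumes "0 <= a" "a <= a'" "0 <= b" "b <= b'"
 shows "hmean a b <= hmean a' b'"
proof -
 have 1: "hmean a b <= hmean a' b" if "0 <= a" "a <= a'" "0 <= b" for a a' b
 proof (cases "b = 0 \<or> a = 0")
  case False
  thus ?thesis using that by (simp add: hmean_def field_simps mult_left_mono)
 qed (use that in "auto intro: hmean_nonneg")
 have "hmean a b <= hmean a' b" using 1 assms by auto
 also have "... <= hmean a' b'" using 1[of b b' a'] assms by (simp add: hmean_commute)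
 finally show ?thesis .
qed

lemma hmean_le: "[|0 <= a; 0 <= b|] ==> hmean a b <= b" by (cases "a + b = 0") (auto simp: hmean_def field_simps add_nonneg_eq_0_iff)

lemma lipschitz_near_hmean:
 assumes f: "lipschitz_near f z S" "!!x. x \<in> S ==> 0 <= f x" and g: "lipschitz_near g z S" "!!x. x \<in> S ==> 0 <= g x"
 shows "lipschitz_near (%x. hmean (f x) (g x)) z S"
proof -
 obtain r M where r: "r > 0" "M >= 0" and M: "!!x y. [|x \<in> S; y \<in> S; dist z x < r; dist z y < r|] ==> dist (f x) (f y) <= M * dist x y"
  using f(1) by (rule lipschitz_nearE) blast
 obtain q L where q: "q > 0" "L >= 0" and L: "!!x y. [|x \<in> S; y \<in> S; dist z x < q; dist z y < q|] ==> dist (g x) (g y) <= L * dist x y"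
  using g(1) by (rule lipschitz_nearE) blast
 show ?thesis
 proof (rule lipschitz_nearI[of "min r q" "M + L"])
  fix x y assume xy: "x \<in> S" "y \<in> S" "dist z x < min r q" "dist z y < min r q"
  have "\<bar>hmean (f x) (g x) - hmean (f y) (g x)\<bar> <= \<bar>f x - f y\<bar>" using f g xy by (intro hmean_lipschitz) auto
  moreover have "\<bar>hmean (g x) (f y) - hmean (g y) (f y)\<bar> <= \<bar>g x - g y\<bar>" using f g xy by (intro hmean_lipschitz) auto
  moreover have "\<bar>f x - f y\<bar> <= M * dist x y" "\<bar>g x - g y\<bar> <= L * dist x y"
   using M[of x y] L[of x y] xy by (auto simp: dist_real_def)
  ultimately show "dist (hmean (f x) (g x)) (hmean (f y) (g y)) <= (M + L) * dist x y"
   by (simp add: dist_real_def hmean_commute[of "f y"] distrib_right)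
 qed (use r q in auto)
qed

section \<open>Angles in the closed upper half-plane\<close>

text \<open>The argument in \<open>[0, \<pi>]\<close> on the closed upper half-plane; the rotation moves the cut of \<open>Ln\<close> to the
  negative imaginary axis.\<close>

definition ang :: "complex => real" where "ang z = pi / 2 + Im (Ln (- \<i> * z))"

definition ang_domain :: "complex set" where "ang_domain = {z. - \<i> * z \<notin> \<real>\<^sub>\<le>\<^sub>0}"

lemma ang_domain: "[|0 <= Im z; z ~= 0|] ==> z \<in> ang_domain"
 by (auto simp: ang_domain_def complex_nonpos_Reals_iff complex_nonneg_Reals_iff complex_eq_iff)

lemma open_ang_domain: "open ang_domain"
proof -
 have "ang_domain = (%z. - \<i> * z) -` (- \<real>\<^sub>\<le>\<^sub>0)" by (auto simp: ang_domain_def)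
 moreover have "open ((%z. - \<i> * z) -` (- \<real>\<^sub>\<le>\<^sub>0))"
  by (intro open_vimage open_Compl closed_nonpos_Reals_complex continuous_intros)
 ultimately show ?thesis by simp
qed

lemma Ln_holomorphic_ang_domain: "(%z. Ln (- \<i> * z)) holomorphic_on ang_domain" by (intro holomorphic_intros) (auto simp: ang_domain_def)

lemma Re_Ln_rotated: "z ~= 0 ==> Re (Ln (- \<i> * z)) = ln (cmod z)" by (subst Re_Ln) (auto simp: norm_mult)

lemma exp_rotated: "exp (of_real l + \<i> * of_real (t - pi / 2)) = - \<i> * (of_real (exp l) * exp (\<i> * of_real t))"
 by (simp add: complex_eq_iff Re_exp Im_exp cos_diff sin_diff)

lemma ang_range:
 assumes "0 <= Im z" "z ~= 0"
 shows "0 <= ang z" "ang z <= pi" using Re_Ln_pos_le[of "- \<i> * z"] assms by (auto simp: ang_def abs_le_iff)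

lemma ang_polar:
 assumes "z ~= 0"
 shows "z = of_real (cmod z) * exp (\<i> * of_real (ang z))"
proof -
 have "- \<i> * z = exp (Ln (- \<i> * z))" using assms by simp
 also have "Ln (- \<i> * z) = of_real (ln (cmod z)) + \<i> * of_real (ang z - pi / 2)"
  using Re_Ln_rotated[OF assms] by (simp add: complex_eq_iff ang_def)
 also have "exp ... = - \<i> * (of_real (cmod z) * exp (\<i> * of_real (ang z)))" unfolding exp_rotated using assms by simp
 finally show ?thesis unfolding mult_cancel_left by simp
qed

lemma ang_Re: "z ~= 0 ==> Re z = cmod z * cos (ang z)"
 and ang_Im: "z ~= 0 ==> Im z = cmod z * sin (ang z)"
 using ang_polar[of z] by (metis Re_complex_of_real Im_complex_of_real cis_conv_exp Re_rcis Im_rcis rcis_def)+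

lemma ang_unique:
 assumes "0 < r" "0 <= t" "t <= pi"
 shows "ang (of_real r * exp (\<i> * of_real t)) = t"
proof -
 have "exp (of_real (ln r) + \<i> * of_real (t - pi / 2)) = - \<i> * (of_real r * exp (\<i> * of_real t))" unfolding exp_rotated using assms by simp
 moreover have "- pi < t - pi / 2" "t - pi / 2 <= pi" using assms pi_gt_zero by linarith+
 ultimately have "Ln (- \<i> * (of_real r * exp (\<i> * of_real t))) = of_real (ln r) + \<i> * of_real (t - pi / 2)"
  using assms by (intro Ln_unique) auto
 thus ?thesis unfolding ang_def by simp
qed

lemma ang_of_real:
 "0 < x ==> ang (of_real x) = 0" "x < 0 ==> ang (of_real x) = pi" using ang_unique[of x 0] ang_unique[of "- x" pi] by auto

lemma ang_pos:
 assumes "0 < Im z"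
 shows "0 < ang z" "ang z < pi"
proof -
 have z: "z ~= 0" using assms by auto
 have "ang z ~= 0" "ang z ~= pi" using ang_Im[OF z] assms by auto
 thus "0 < ang z" "ang z < pi" using ang_range[OF _ z] assms by auto
qed

section \<open>The explicit map of the half-plane to the comb domain\<close>

context even_multiplicities
begin

abbreviation "vertex n \<equiv> right_vertex d n"
abbreviation "center n \<equiv> square_center d n"

lemma comb_height_vertex: "comb_height n = pi * (1 - vertex n)" by (simp add: comb_height_def right_vertex_def)

lemma center_eq: "n >= 1 ==> center n = vertex n - d n / 2" "n >= 1 ==> center n = vertex (Suc n) + d n / 2"
 by (auto simp: square_center_def right_vertex_Suc)

lemma vertex_le: "n >= 1 ==> vertex n <= - real n"
proof (induction n rule: dec_induct)
 case (step n)
 thus ?case using d_ge_2[of n] by (simp add: right_vertex_Suc)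
qed (simp add: right_vertex_def)

lemma vertex_Suc_less: "n >= 1 ==> vertex (Suc n) + 2 <= vertex n" using d_ge_2[of n] by (simp add: right_vertex_Suc)

lemma vertex_antimono:
 assumes "1 <= m" "m <= n"
 shows "vertex n <= vertex m" using assms(2)
proof (induction n rule: dec_induct)
 case (step n)
 thus ?case using vertex_Suc_less[of n] assms(1) by auto
qed auto

lemma center_between: "n >= 1 ==> vertex (Suc n) < center n" "n >= 1 ==> center n < vertex n" using d_ge_2[of n] center_eq[of n] by auto

lemma square_exists:
 assumes "x <= - 1"
 obtains n where "1 <= n" "vertex (Suc n) <= x" "x <= vertex n"
proof -
 obtain k :: nat where "- x <= real k" using real_arch_simple by blast
 hence k: "1 <= Suc k & vertex (Suc (Suc k)) <= x" using vertex_le[of "Suc (Suc k)"] by auto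
 define n where "n = (LEAST m. 1 <= m & vertex (Suc m) <= x)"
 have n: "1 <= n & vertex (Suc n) <= x" unfolding n_def using k by (rule LeastI)
 have "x <= vertex n"
 proof (cases "n = 1")
  case True
  thus ?thesis using assms by (simp add: right_vertex_def)
 next
  case False
  then obtain m where m: "n = Suc m" "1 <= m" using n by (cases n) auto
  show ?thesis using not_less_Least[of m "%m. 1 <= m & vertex (Suc m) <= x"] m by (simp add: n_def)
 qed
 thus ?thesis using that n by blast
qed

definition breakpoints :: "real set" where
 "breakpoints = {-1..} \<union> right_vertex d ` {1..}"

text \<open>The height of the upper boundary of the union of the squares above the real axis.\<close>

definition tent :: "real => real" where "tent x = infdist x breakpoints"

lemma tent_nonneg: "0 <= tent x" by (simp add: tent_def infdist_nonneg)

lemma tent_right: "- 1 <= x ==> tent x = 0" by (simp add: tent_def breakpoints_def)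

lemma tent_lipschitz: "\<bar>tent x - tent y\<bar> <= \<bar>x - y\<bar>"
 using infdist_triangle_abs[of x breakpoints y] by (simp add: tent_def dist_real_def)

lemma tent_le: "tent x <= \<bar>x\<bar>" using infdist_le[of 0 breakpoints x] by (simp add: tent_def breakpoints_def dist_real_def)

lemma tent_square:
 assumes n: "1 <= n" and x: "vertex (Suc n) <= x" "x <= vertex n"
 shows "tent x = d n / 2 - \<bar>x - center n\<bar>"
proof (rule antisym)
 show "tent x <= d n / 2 - \<bar>x - center n\<bar>" using infdist_le[of "vertex n" breakpoints x] infdist_le[of "vertex (Suc n)" breakpoints x] n x center_eq[OF n] by (auto simp: tent_def breakpoints_def dist_real_def)
 have "d n / 2 - \<bar>x - center n\<bar> <= dist x y" if y: "y \<in> breakpoints" for y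
 proof -
  have "vertex n <= y \<or> y <= vertex (Suc n)"
  proof (cases "y >= -1")
   case True
   thus ?thesis using vertex_antimono[of 1 n] n by (simp add: right_vertex_def)
  next
   case False
   then obtain m where "1 <= m" "y = vertex m" using y by (auto simp: breakpoints_def)
   thus ?thesis using vertex_antimono[of m n] vertex_antimono[of "Suc n" m] n by (cases "m <= n") auto
  qed
  thus ?thesis using x center_eq[OF n] by (auto simp: dist_real_def)
 qed
 moreover have "breakpoints ~= {}" by (auto simp: breakpoints_def)
 ultimately show "d n / 2 - \<bar>x - center n\<bar> <= tent x" unfolding tent_def by (subst infdist_notempty) (auto intro!: cINF_greatest)
qed

text \<open>Vertical shear that carries the region above the squares to the half-plane.\<close>

definition flat :: "complex => complex" where "flat z = Complex (Re z) (Im z - tent (Re z))"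

text \<open>A quasiconformal map of the exterior half disc onto a quarter plane. The imaginary part is \<open>\<pi> (1 + r)\<close> on
  the negative axis, so that the side of \<open>P\<^sub>n\<close> has the height that the inner logarithm gives it, and the
  real part vanishes exactly on the unit circle and the negative axis and is large on the positive axis.\<close>

definition outer :: "complex => complex" where
 "outer z = Complex (cmod z * hmean (cmod z - 1) (pi - ang z)) ((1 + cmod z) * ang z)"

definition inner_radius :: "nat => complex => real" where
 "inner_radius n z = (\<bar>Re z - center n\<bar> + Im z) * 2 / d n"

text \<open>\<open>d\<^sub>n\<close> times a logarithm on the upper half of \<open>P\<^sub>n\<close>: the modulus is measured by the norm whose unit ball is the
  square, the argument is piecewise linear along its sides.\<close>

definition inner_log :: "nat => complex => complex" where
 "inner_log n z = Complex (d n * ln (inner_radius n z)) (pi * (1 - center n - (Re z - center n) / inner_radius n z))"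

definition sq_index :: "real => nat" where "sq_index x = (LEAST n. 1 <= n & vertex (Suc n) < x)"

text \<open>On the common boundaries of the pieces the formulas agree: see \<open>hlog_disc\<close>, \<open>hlog_outer\<close> and
  \<open>hlog_tri\<close>.\<close>

definition hlog :: "complex => complex" where
 "hlog z = (if cmod z <= 1 then 2 * Ln (- \<i> * z) + \<i> * of_real pi
   else if tent (Re z) <= Im z then outer (flat z) else inner_log (sq_index (Re z)) z)"

definition cl_disc :: "complex set" where "cl_disc = {z. 0 <= Im z & cmod z <= 1}"
definition cl_outer :: "complex set" where "cl_outer = {z. tent (Re z) <= Im z & 1 <= cmod z}"
definition cl_tri :: "nat => complex set" where "cl_tri n = {z. 0 <= Im z & \<bar>Re z - center n\<bar> + Im z <= d n / 2}"

lemma cl_outer_Im: "z \<in> cl_outer ==> 0 <= Im z" using tent_nonneg order_trans by (auto simp: cl_outer_def)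

lemma cl_tri_Re: "[|1 <= n; z \<in> cl_tri n|] ==> vertex (Suc n) <= Re z & Re z <= vertex n"
 using center_eq[of n] unfolding cl_tri_def by (auto simp: abs_if split: if_splits)

lemma cl_tri_tent: "[|1 <= n; z \<in> cl_tri n|] ==> Im z <= tent (Re z)" using tent_square[of n "Re z"] cl_tri_Re[of n z] by (auto simp: cl_tri_def)

lemma closed_upper_cover:
 assumes "0 <= Im z"
 shows "z \<in> cl_disc \<or> z \<in> cl_outer \<or> (EX n>=1. z \<in> cl_tri n)"
proof (cases "tent (Re z) <= Im z \<or> cmod z <= 1")
 case True
 thus ?thesis using assms by (auto simp: cl_disc_def cl_outer_def)
next
 case False
 hence "Re z < - 1" using tent_right[of "Re z"] assms by force
 then obtain n where n: "1 <= n" "vertex (Suc n) <= Re z" "Re z <= vertex n" using square_exists[of "Re z"] by (metis less_imp_le)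
 thus ?thesis using False assms tent_square[OF n] n by (auto simp: cl_tri_def)
qed

lemma closed_cl_disc: "closed cl_disc" unfolding cl_disc_def by (intro closed_Collect_conj closed_Collect_le continuous_intros)

lemma continuous_on_tent: "continuous_on UNIV tent" unfolding tent_def by (intro continuous_intros)

lemma closed_cl_outer: "closed cl_outer"
proof -
 have "continuous_on UNIV (%z. tent (Re z))" by (intro continuous_on_compose2[OF continuous_on_tent] continuous_intros) auto
 hence "closed {z. tent (Re z) <= Im z}" "closed {z::complex. 1 <= cmod z}" by (intro closed_Collect_le continuous_intros; simp)+
 thus ?thesis by (simp add: cl_outer_def closed_Collect_conj)
qed

lemma closed_cl_tri: "closed (cl_tri n)" unfolding cl_tri_def by (intro closed_Collect_conj closed_Collect_le continuous_intros)

lemma outer_negative_real: "x <= - 1 ==> outer (of_real x) = Complex 0 (pi * (1 - x))"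
 by (simp add: outer_def ang_of_real complex_eq_iff algebra_simps)

lemma flat_right: "- 1 <= Re z ==> flat z = z" by (simp add: flat_def tent_right)

lemma disc_log: "z ~= 0 ==> 2 * Ln (- \<i> * z) + \<i> * of_real pi = Complex (2 * ln (cmod z)) (2 * ang z)"
 using Re_Ln_rotated[of z] by (simp add: complex_eq_iff ang_def)

lemma hlog_disc: "z \<in> cl_disc ==> hlog z = 2 * Ln (- \<i> * z) + \<i> * of_real pi" by (simp add: hlog_def cl_disc_def)

lemma hlog_outer:
 assumes "z \<in> cl_outer"
 shows "hlog z = outer (flat z)"
proof (cases "cmod z <= 1")
 case True
 hence 1: "cmod z = 1" using assms by (auto simp: cl_outer_def)
 hence "- 1 <= Re z" using abs_Re_le_cmod[of z] by auto
 hence "flat z = z" by (rule flat_right)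
 moreover have "z ~= 0" using 1 by auto
 ultimately show ?thesis using 1 disc_log[of z] by (simp add: hlog_def outer_def)
qed (use assms in "auto simp: hlog_def cl_outer_def")

lemma sq_index_eq:
 assumes "1 <= n" "vertex (Suc n) < x" "x < vertex n"
 shows "sq_index x = n" unfolding sq_index_def
proof (rule Least_equality)
 fix m assume m: "1 <= m & vertex (Suc m) < x"
 show "n <= m"
 proof (rule ccontr)
  assume "\<not> n <= m"
  hence "vertex n <= vertex (Suc m)" using m by (intro vertex_antimono) auto
  thus False using m assms by auto
 qed
qed (use assms in auto)

lemma cl_tri_norm:
 assumes "1 <= n" "z \<in> cl_tri n"
 shows "1 <= cmod z" "cmod z = 1 ==> z = - 1"
proof -
 have "Re z <= - 1" using cl_tri_Re[OF assms] vertex_antimono[of 1 n] assms(1) by (simp add: right_vertex_def)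
 thus "1 <= cmod z" using abs_Re_le_cmod[of z] by auto
 assume 1: "cmod z = 1"
 hence "Re z = - 1" using abs_Re_le_cmod[of z] \<open>Re z <= - 1\<close> by auto
 moreover from this have "Im z = 0" using 1 cmod_power2[of z] by simp
 ultimately show "z = - 1" by (simp add: complex_eq_iff)
qed

lemma hlog_tri:
 assumes n: "1 <= n" and z: "z \<in> cl_tri n"
 shows "hlog z = inner_log n z"
proof (cases "tent (Re z) <= Im z")
 case True
 have e: "Im z = tent (Re z)" using True cl_tri_tent[OF n z] by simp
 hence t: "\<bar>Re z - center n\<bar> + Im z = d n / 2" using tent_square[OF n] cl_tri_Re[OF n z] by simp
 hence \<rho>: "inner_radius n z = 1" using d_pos[OF n] by (simp add: inner_radius_def)
 have "Re z <= - 1" using cl_tri_Re[OF n z] vertex_antimono[of 1 n] n by (simp add: right_vertex_def)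
 moreover have "flat z = of_real (Re z)" using e by (simp add: flat_def complex_eq_iff)
 ultimately have "outer (flat z) = Complex 0 (pi * (1 - Re z))" by (simp only: outer_negative_real)
 moreover have "z \<in> cl_outer" using True cl_tri_norm[OF n z] by (auto simp: cl_outer_def)
 ultimately show ?thesis using \<rho> by (simp add: hlog_outer inner_log_def)
next
 case False
 hence s: "vertex (Suc n) < Re z" "Re z < vertex n" using tent_square[OF n, of "Re z"] cl_tri_Re[OF n z] z center_eq[OF n] by (auto simp: cl_tri_def)
 moreover have "\<not> cmod z <= 1"
 proof
  assume "cmod z <= 1"
  hence "z = -1" using cl_tri_norm[OF n z] by auto
  thus False using s vertex_antimono[of 1 n] n by (simp add: right_vertex_def)
 qed
 ultimately show ?thesis using False sq_index_eq[OF n s] by (simp add: hlog_def)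
qed

section \<open>The logarithm of the model map is locally Lipschitz\<close>

definition zeros :: "complex set" where "zeros = insert 0 ((%n. of_real (center n)) ` {1..})"

abbreviation "cuhp \<equiv> {z::complex. 0 <= Im z}"

lemma flat_lipschitz: "lipschitz_near flat z S"
proof (rule lipschitz_near_on[of 2])
 fix x y
 have "flat x - flat y = (x - y) - \<i> * of_real (tent (Re x) - tent (Re y))" by (simp add: flat_def complex_eq_iff)
 hence "cmod (flat x - flat y) <= cmod (x - y) + cmod (\<i> * of_real (tent (Re x) - tent (Re y)))" by (simp only: norm_triangle_ineq4)
 also have "cmod (\<i> * of_real (tent (Re x) - tent (Re y))) = \<bar>tent (Re x) - tent (Re y)\<bar>" unfolding norm_mult norm_of_real by simp
 also have "\<bar>tent (Re x) - tent (Re y)\<bar> <= cmod (x - y)" using tent_lipschitz[of "Re x" "Re y"] abs_Re_le_cmod[of "x - y"] by simp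
 finally show "dist (flat x) (flat y) <= 2 * dist x y" by (simp add: dist_norm)
qed auto

lemma flat_cl_outer:
 assumes "z \<in> cl_outer"
 shows "0 <= Im (flat z)" "1 <= cmod (flat z)"
proof -
 show "0 <= Im (flat z)" using assms by (auto simp: flat_def cl_outer_def)
 show "1 <= cmod (flat z)"
 proof (cases "- 1 <= Re z")
  case True
  thus ?thesis using assms by (simp add: flat_right cl_outer_def)
 next
  case False
  thus ?thesis using abs_Re_le_cmod[of "flat z"] by (simp add: flat_def)
 qed
qed

lemma outer_lipschitz:
 assumes S: "S = {z. 0 <= Im z & 1 <= cmod z}" and z: "z \<in> S"
 shows "lipschitz_near outer z S"
proof -
 have c: "lipschitz_near (%w. cmod w + c) z S" for c
  by (rule lipschitz_near_on[of 1]) (auto simp: dist_norm norm_triangle_ineq3)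
 have L: "lipschitz_near (%w. Im (Ln (- \<i> * w))) z S"
 proof (rule lipschitz_near_compose[where g = Im and T = UNIV])
  have "z \<in> ang_domain" using z S by (intro ang_domain) auto
  thus "lipschitz_near (%w. Ln (- \<i> * w)) z S" by (rule lipschitz_near_holomorphic[OF Ln_holomorphic_ang_domain open_ang_domain])
 qed (use z in "auto intro: lipschitz_near_Im")
 have A: "lipschitz_near (%w. c * ang w) z S" "lipschitz_near (%w. pi - ang w) z S" for c
 proof -
  show "lipschitz_near (%w. c * ang w) z S" unfolding ang_def by (intro lipschitz_near_mult lipschitz_near_add lipschitz_near_const L z)
  have "lipschitz_near (%w. pi + (-1) * (pi / 2 + Im (Ln (- \<i> * w)))) z S"
   by (intro lipschitz_near_mult lipschitz_near_add lipschitz_near_const L z)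
  thus "lipschitz_near (%w. pi - ang w) z S" by (simp add: ang_def)
 qed
 have rng: "0 <= cmod w + - 1" "0 <= pi - ang w" if "w \<in> S" for w
  using ang_range[of w] that S by force+
 have "lipschitz_near (%w. Complex ((cmod w + 0) * hmean (cmod w + - 1) (pi - ang w)) ((cmod w + 1) * (1 * ang w))) z S"
  by (intro lipschitz_near_Complex lipschitz_near_mult lipschitz_near_hmean c A z rng)
 thus ?thesis by (rule lipschitz_near_cong) (simp add: outer_def add.commute)
qed

lemma inner_log_lipschitz:
 assumes n: "1 <= n" and z: "z \<in> S" and pos: "0 < inner_radius n z"
 shows "lipschitz_near (inner_log n) z S"
proof -
 have R: "lipschitz_near (%w. Re w + c) z S" for c
  by (intro lipschitz_near_add lipschitz_near_Re lipschitz_near_const)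
 have "lipschitz_near (%w. (\<bar>Re w + (- center n)\<bar> + Im w) * (2 / d n)) z S"
  by (intro lipschitz_near_add lipschitz_near_mult lipschitz_near_abs lipschitz_near_Im lipschitz_near_const z R)
 hence \<rho>: "lipschitz_near (inner_radius n) z S" by (rule lipschitz_near_cong) (simp add: inner_radius_def)
 have "lipschitz_near (%w. Complex (d n * ln (inner_radius n w))
   (pi * ((1 - center n) + (-1) * ((Re w + (- center n)) * inverse (inner_radius n w))))) z S"
  using pos by (intro lipschitz_near_Complex lipschitz_near_mult lipschitz_near_add lipschitz_near_ln
    lipschitz_near_inverse lipschitz_near_const \<rho> z R) auto
 thus ?thesis by (rule lipschitz_near_cong) (simp add: inner_log_def divide_inverse)
qed

lemma hlog_lipschitz:
 assumes z: "z \<in> cuhp" "z \<notin> zeros"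
 shows "lipschitz_near hlog z cuhp"
proof -
 obtain m :: nat where m: "- (Re z - 1) <= real m" using real_arch_simple by blast
 define C where "C i = (if i = 0 then cl_disc else if i = Suc m then cl_outer else cl_tri i)" for i
 show ?thesis
 proof (rule lipschitz_near_closed_cover[where I = "{0..Suc m}" and C = C and e = 1])
  show "convex cuhp" by (simp add: convex_halfspace_Im_ge)
  show "ball z 1 \<inter> cuhp \<subseteq> (\<Union>i\<in>{0..Suc m}. C i)"
  proof
   fix w assume w: "w \<in> ball z 1 \<inter> cuhp"
   hence "- real m < Re w" using abs_Re_le_cmod[of "z - w"] m by (auto simp: dist_norm)
   consider "w \<in> cl_disc" | "w \<in> cl_outer" | n where "1 <= n" "w \<in> cl_tri n" using closed_upper_cover w by blast
   thus "w \<in> (\<Union>i\<in>{0..Suc m}. C i)"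
   proof cases
    case 3
    show ?thesis using cl_tri_Re[OF 3] vertex_le[OF 3(1)] \<open>- real m < Re w\<close> 3 by (intro UN_I[of n]) (auto simp: C_def)
   qed (force simp: C_def)+
  qed
  show "closed (C i)" for i by (auto simp: C_def closed_cl_disc closed_cl_outer closed_cl_tri)
  fix i assume i: "i \<in> {0..Suc m}" "z \<in> C i"
  consider "i = 0" | "i = Suc m" | "i ~= 0" "i ~= Suc m" by blast
  thus "lipschitz_near hlog z (C i \<inter> cuhp)"
  proof cases
   case 1
   have "z \<in> ang_domain" using z by (intro ang_domain) (auto simp: zeros_def)
   hence "lipschitz_near (%w. 2 * Ln (- \<i> * w) + \<i> * of_real pi) z (C i \<inter> cuhp)"
    by (intro lipschitz_near_holomorphic[OF _ open_ang_domain] holomorphic_intros Ln_holomorphic_ang_domain)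
   thus ?thesis by (rule lipschitz_near_cong) (use 1 in "auto simp: C_def hlog_disc")
  next
   case 2
   hence zo: "z \<in> cl_outer" using i by (auto simp: C_def)
   have "lipschitz_near (%w. outer (flat w)) z (C i \<inter> cuhp)" by (rule lipschitz_near_compose[where T = "{z. 0 <= Im z & 1 <= cmod z}"])
     (use 2 i z flat_cl_outer zo in "auto simp: C_def intro!: flat_lipschitz outer_lipschitz")
   thus ?thesis by (rule lipschitz_near_cong) (use 2 in "auto simp: C_def hlog_outer")
  next
   case 3
   hence n: "1 <= i" "z \<in> cl_tri i" using i by (auto simp: C_def)
   have "z ~= of_real (center i)" using z n by (auto simp: zeros_def)
   hence "0 < \<bar>Re z - center i\<bar> + Im z" using z(1) by (auto simp: complex_eq_iff)
   hence "0 < inner_radius i z" using d_pos[OF n(1)] by (simp only: inner_radius_def) simp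
   hence "lipschitz_near (inner_log i) z (C i \<inter> cuhp)" using n i z by (intro inner_log_lipschitz) auto
   thus ?thesis by (rule lipschitz_near_cong) (use 3 n in "auto simp: C_def hlog_tri")
  qed
 qed auto
qed

end

section \<open>Dilatation of the explicit map\<close>

lemma hmean_has_derivative:
 assumes a: "(a has_derivative a') (at w)" and b: "(b has_derivative b') (at w)" and ne: "a w + b w ~= 0"
 shows "((%w. hmean (a w) (b w)) has_derivative
  (%v. (b w)\<^sup>2 / (a w + b w)\<^sup>2 * a' v + (a w)\<^sup>2 / (a w + b w)\<^sup>2 * b' v)) (at w)"
proof -
 have "((%w. a w * b w / (a w + b w)) has_derivative
  (%v. ((a w * b' v + a' v * b w) * (a w + b w) - a w * b w * (a' v + b' v)) / ((a w + b w) * (a w + b w)))) (at w)"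
  by (intro has_derivative_divide' has_derivative_mult has_derivative_add a b ne)
 moreover have "((a w * b' v + a' v * b w) * (a w + b w) - a w * b w * (a' v + b' v)) / ((a w + b w) * (a w + b w))
   = (b w)\<^sup>2 / (a w + b w)\<^sup>2 * a' v + (a w)\<^sup>2 / (a w + b w)\<^sup>2 * b' v" for v
 proof -
  show ?thesis by (auto simp: algebra_simps power2_eq_square add_divide_distrib power2_eq_square)
 qed
 ultimately show ?thesis by (simp add: hmean_def)
qed

lemma has_derivative_Complex_pair:
 assumes "(f has_derivative f') (at w)" "(g has_derivative g') (at w)"
 shows "((%w. Complex (f w) (g w)) has_derivative (%v. Complex (f' v) (g' v))) (at w)" unfolding Complex_eq
 by (intro has_derivative_add has_derivative_mult_right has_derivative_of_real assms)

text \<open>\<open>outer\<close> in a logarithmic coordinate, which is conformal and hence free for the dilatation.\<close>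

definition outer_chart :: "complex => complex" where
 "outer_chart w = Complex (exp (Re w) * hmean (exp (Re w) - 1) (pi / 2 - Im w)) ((1 + exp (Re w)) * (pi / 2 + Im w))"

text \<open>The off-diagonal partial derivatives have opposite signs, so that both products in the
  determinant are nonnegative; their sum dominates the squares of all the entries.\<close>

lemma outer_chart_derivative:
 assumes w: "0 < Re w" "- pi / 2 < Im w" "Im w < pi / 2"
 shows "EX A. (outer_chart has_derivative A) (at w) & dilatation_le 512 A"
proof -
 define r where "r = exp (Re w)"
 define a where "a = r - 1"
 define \<eta> where "\<eta> = pi / 2 - Im w"
 define \<theta> where "\<theta> = pi / 2 + Im w"
 define s where "s = a + \<eta>"
 define gx where "gx = r * (hmean a \<eta> + r * (\<eta>\<^sup>2 / s\<^sup>2))"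
 define gy where "gy = - (r * (a\<^sup>2 / s\<^sup>2))"
 define A where "A v = Complex (gx * Re v + gy * Im v) (r * \<theta> * Re v + (1 + r) * Im v)" for v
 have r: "1 < r" and a: "0 < a" using w by (auto simp: r_def a_def)
 have \<eta>: "0 < \<eta>" "\<eta> < pi" and \<theta>: "0 < \<theta>" "\<theta> < pi" "\<theta> = pi - \<eta>"
  unfolding \<eta>_def \<theta>_def using w by (auto simp: field_simps)
 have s: "0 < s" using a \<eta> by (simp add: s_def)
 have E: "((%w. exp (Re w)) has_derivative (%v. r * Re v)) (at w)"
  unfolding r_def by (rule has_derivative_eq_rhs, (rule derivative_intros)+) (simp add: mult.commute)
 have E1: "((%w. exp (Re w) - 1) has_derivative (%v. r * Re v)) (at w)" using has_derivative_diff[OF E has_derivative_const[of 1]] by simp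
 have N: "((%w. pi / 2 - Im w) has_derivative (%v. - Im v)) (at w)"
  using has_derivative_diff[OF has_derivative_const[of "pi / 2"] has_derivative_Im[OF has_derivative_ident]] by simp
 have T: "((%w. pi / 2 + Im w) has_derivative (%v. Im v)) (at w)"
  using has_derivative_add[OF has_derivative_const[of "pi / 2"] has_derivative_Im[OF has_derivative_ident]] by simp
 have H: "((%w. hmean (exp (Re w) - 1) (pi / 2 - Im w)) has_derivative
   (%v. \<eta>\<^sup>2 / s\<^sup>2 * (r * Re v) + a\<^sup>2 / s\<^sup>2 * (- Im v))) (at w)"
  using hmean_has_derivative[OF E1 N] s by (simp add: s_def a_def \<eta>_def r_def)
 have "((%w. exp (Re w) * hmean (exp (Re w) - 1) (pi / 2 - Im w)) has_derivative
   (%v. r * (\<eta>\<^sup>2 / s\<^sup>2 * (r * Re v) + a\<^sup>2 / s\<^sup>2 * (- Im v)) + r * Re v * hmean a \<eta>)) (at w)"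
  using has_derivative_mult[OF E H] by (simp add: a_def \<eta>_def r_def)
 moreover have "((%w. (1 + exp (Re w)) * (pi / 2 + Im w)) has_derivative (%v. (1 + r) * Im v + r * Re v * \<theta>)) (at w)"
  using has_derivative_mult[OF has_derivative_add[OF has_derivative_const[of 1] E] T] by (simp add: \<theta>_def r_def)
 ultimately have "(outer_chart has_derivative (%v. Complex (r * (\<eta>\<^sup>2 / s\<^sup>2 * (r * Re v) + a\<^sup>2 / s\<^sup>2 * (- Im v)) + r * Re v * hmean a \<eta>)
    ((1 + r) * Im v + r * Re v * \<theta>))) (at w)" unfolding outer_chart_def by (rule has_derivative_Complex_pair)
 moreover have "(%v. Complex (r * (\<eta>\<^sup>2 / s\<^sup>2 * (r * Re v) + a\<^sup>2 / s\<^sup>2 * (- Im v)) + r * Re v * hmean a \<eta>)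
    ((1 + r) * Im v + r * Re v * \<theta>)) = A" by (intro ext) (simp add: A_def gx_def gy_def algebra_simps)
 ultimately have D: "(outer_chart has_derivative A) (at w)" by simp
 have h: "0 < hmean a \<eta>" "hmean a \<eta> <= \<eta>" using a \<eta> by (auto intro: hmean_pos hmean_le)
 have q1: "\<eta>\<^sup>2 / s\<^sup>2 <= 1" "a\<^sup>2 / s\<^sup>2 <= 1"
  using a \<eta> s power_mono[of \<eta> s 2] power_mono[of a s 2] by (auto simp: s_def)
 have q2: "r * (\<eta>\<^sup>2 / s\<^sup>2) <= 1 + \<eta>"
 proof -
  have "a * (\<eta>\<^sup>2 / s\<^sup>2) = (a / s) * (\<eta> / s) * \<eta>" by (simp add: power2_eq_square)
  also have "... <= 1 * 1 * \<eta>" using a \<eta> s by (intro mult_mono) (auto simp: s_def)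
  finally have "a * (\<eta>\<^sup>2 / s\<^sup>2) <= \<eta>" by simp
  moreover have "r * (\<eta>\<^sup>2 / s\<^sup>2) = \<eta>\<^sup>2 / s\<^sup>2 + a * (\<eta>\<^sup>2 / s\<^sup>2)"
   by (simp only: a_def left_diff_distrib)
  ultimately show ?thesis using q1 by linarith
 qed
 have q0: "0 <= \<eta>\<^sup>2 / s\<^sup>2" "0 <= a\<^sup>2 / s\<^sup>2" by auto
 have gx0: "0 <= gx" using h q0 r by (auto simp: gx_def)
 have pi4: "pi < 4" by (rule pi_less_4)
 have A1: "cmod (A 1) <= 13 * r"
 proof -
  have "cmod (A 1) <= \<bar>gx\<bar> + \<bar>r * \<theta>\<bar>" using cmod_le[of "A 1"] by (simp add: A_def)
  moreover have "gx <= r * (\<eta> + (1 + \<eta>))" unfolding gx_def using h q2 r by (intro mult_left_mono) auto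
  moreover have "r * (\<eta> + (1 + \<eta>)) <= r * 9" "r * \<theta> <= r * 4" using r \<eta> \<theta> pi4 by (auto intro!: mult_left_mono)
  moreover have "0 <= r * \<theta>" using r \<theta> by simp
  ultimately show ?thesis using gx0 by simp
 qed
 have Ai: "cmod (A \<i>) <= 3 * r"
 proof -
  have "cmod (A \<i>) <= \<bar>gy\<bar> + \<bar>1 + r\<bar>" using cmod_le[of "A \<i>"] by (simp add: A_def)
  moreover have "\<bar>gy\<bar> = r * (a\<^sup>2 / s\<^sup>2)" using r by (simp add: gy_def abs_mult)
  moreover have "r * (a\<^sup>2 / s\<^sup>2) <= r * 1" using q1 r by (intro mult_left_mono) auto
  ultimately show ?thesis using r by simp
 qed
 have half: "1 / 2 <= \<eta>\<^sup>2 / s\<^sup>2 + a\<^sup>2 / s\<^sup>2"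
 proof -
  have "s\<^sup>2 <= 2 * (\<eta>\<^sup>2 + a\<^sup>2)" using zero_le_power2[of "a - \<eta>"] by (simp add: s_def power2_sum power2_diff)
  thus ?thesis using s by (simp add: add_divide_distrib[symmetric] field_simps)
 qed
 have key: "1 / 2 <= hmean a \<eta> + \<eta>\<^sup>2 / s\<^sup>2 + \<theta> * (a\<^sup>2 / s\<^sup>2)"
 proof (cases "1 <= \<theta>")
  case True
  thus ?thesis using mult_right_mono[OF True q0(2)] half h by linarith
 next
  case False
  hence "1 <= \<eta>" using \<theta>(3) pi_ge_two by linarith
  have "a * 1 <= (a + \<eta>) * \<eta>" using \<open>1 <= \<eta>\<close> a by (intro mult_mono) auto
  hence "a / s <= \<eta>" using s by (simp add: s_def field_simps)
  hence "(a / s) * (a / s) <= (a / s) * \<eta>" using a s by (intro mult_left_mono) auto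
  hence "a\<^sup>2 / s\<^sup>2 <= hmean a \<eta>" by (simp add: hmean_def s_def power2_eq_square)
  moreover have "0 <= \<theta> * (a\<^sup>2 / s\<^sup>2)" using \<theta> q0 by simp
  ultimately show ?thesis using half by linarith
 qed
 have det: "1 / 2 * r\<^sup>2 <= real_det A"
 proof -
  have "real_det A = gx * (1 + r) + r * \<theta> * (r * (a\<^sup>2 / s\<^sup>2))" by (simp add: real_det_def A_def gy_def)
  also have "... = (r * (1 + r)) * (hmean a \<eta> + r * (\<eta>\<^sup>2 / s\<^sup>2)) + r\<^sup>2 * (\<theta> * (a\<^sup>2 / s\<^sup>2))"
   unfolding gx_def by (simp add: power2_eq_square algebra_simps)
  also have "... >= (r * r) * (hmean a \<eta> + 1 * (\<eta>\<^sup>2 / s\<^sup>2)) + r\<^sup>2 * (\<theta> * (a\<^sup>2 / s\<^sup>2))"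
   using r h q0 by (intro add_mono mult_mono order_refl) auto
  finally have "r\<^sup>2 * (hmean a \<eta> + \<eta>\<^sup>2 / s\<^sup>2 + \<theta> * (a\<^sup>2 / s\<^sup>2)) <= real_det A"
   by (simp add: power2_eq_square distrib_left)
  moreover have "r\<^sup>2 * (1 / 2) <= r\<^sup>2 * (hmean a \<eta> + \<eta>\<^sup>2 / s\<^sup>2 + \<theta> * (a\<^sup>2 / s\<^sup>2))"
   using key by (intro mult_left_mono) auto
  ultimately show ?thesis by linarith
 qed
 have "dilatation_le 512 A" by (rule dilatation_le_bound[OF has_derivative_linear[OF D] A1 Ai det]) auto
 thus ?thesis using D by blast
qed

context even_multiplicities
begin

text \<open>A null set that contains all the lines along which the formulas change.\<close>

definition kinks :: "complex set" where
 "kinks = {z. Im z = 0 \<or> cmod z = 1 \<or> (EX n>=1. Re z = center n \<or> Re z = vertex n \<or> \<bar>Re z - center n\<bar> + \<bar>Im z\<bar> = d n / 2)}"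

lemma tent_derivative:
 assumes x: "!!n. n >= 1 ==> x ~= center n & x ~= vertex n"
 shows "EX \<sigma>. \<bar>\<sigma>\<bar> <= 1 & (tent has_real_derivative \<sigma>) (at x)"
proof (cases "- 1 < x")
 case True
 have "(tent has_real_derivative 0) (at x)" by (rule has_field_derivative_transform_within_open[of _ _ _ "{-1<..}"]) (use True in "auto simp: tent_right")
 thus ?thesis by (intro exI[of _ 0]) auto
next
 case False
 then obtain n where n: "1 <= n" "vertex (Suc n) <= x" "x <= vertex n" using square_exists[of x] by auto
 hence s: "vertex (Suc n) < x" "x < vertex n" "x ~= center n" using x[of n] x[of "Suc n"] by (auto simp: less_le)
 define U where "U = (if x < center n then {vertex (Suc n)<..<center n} else {center n<..<vertex n})"
 define \<sigma> :: real where "\<sigma> = (if x < center n then 1 else -1)"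
 have "((%y. d n / 2 + \<sigma> * (y - center n)) has_real_derivative \<sigma>) (at x)" by (auto intro!: derivative_eq_intros)
 hence "(tent has_real_derivative \<sigma>) (at x)"
 proof (rule has_field_derivative_transform_within_open[of _ _ _ U])
  show "open U" "x \<in> U" using s by (auto simp: U_def)
  fix y assume y: "y \<in> U"
  thus "d n / 2 + \<sigma> * (y - center n) = tent y" using center_between[OF n(1)] y tent_square[OF n(1)] by (auto simp: U_def \<sigma>_def split: if_splits)
 qed
 thus ?thesis by (intro exI[of _ \<sigma>]) (auto simp: \<sigma>_def)
qed

lemma flat_derivative:
 assumes "!!n. n >= 1 ==> Re z ~= center n & Re z ~= vertex n"
 shows "EX A. (flat has_derivative A) (at z) & dilatation_le 9 A"
proof -
 obtain \<sigma> where \<sigma>: "\<bar>\<sigma>\<bar> <= 1" and t: "(tent has_real_derivative \<sigma>) (at (Re z))" using tent_derivative[OF assms] by blast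
 define A where "A v = v - \<i> * of_real (\<sigma> * Re v)" for v
 have "((%w. tent (Re w)) has_derivative (%v. \<sigma> * Re v)) (at z)"
  using has_derivative_compose[OF has_derivative_Re[OF has_derivative_ident] t[unfolded has_field_derivative_def]] by simp
 hence "((%w. w - \<i> * of_real (tent (Re w))) has_derivative A) (at z)"
  unfolding A_def by (intro has_derivative_diff has_derivative_ident has_derivative_mult_right has_derivative_of_real)
 moreover have "(%w. w - \<i> * of_real (tent (Re w))) = flat" by (intro ext) (simp add: flat_def complex_eq_iff)
 ultimately have D: "(flat has_derivative A) (at z)" by simp
 have A1: "cmod (A 1) <= 2 * 1" using norm_triangle_ineq4[of 1 "\<i> * of_real \<sigma>"] \<sigma> by (simp add: A_def norm_mult)
 have Ai: "cmod (A \<i>) <= 1 * 1" by (simp add: A_def)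
 have det: "1 * 1\<^sup>2 <= real_det A" by (simp add: A_def real_det_def)
 have "dilatation_le 9 A" by (rule dilatation_le_bound[OF has_derivative_linear[OF D] A1 Ai det]) auto
 thus ?thesis using D by blast
qed

lemma outer_chart: "z ~= 0 ==> outer z = outer_chart (Ln (- \<i> * z))" using Re_Ln_rotated[of z] by (simp add: outer_def outer_chart_def ang_def)

lemma outer_derivative:
 assumes z: "0 < Im z" "1 < cmod z"
 shows "EX A. (outer has_derivative A) (at z) & dilatation_le 512 A"
proof -
 have z0: "z ~= 0" using z by auto
 have zd: "z \<in> ang_domain" using z z0 by (intro ang_domain) auto
 define w where "w = Ln (- \<i> * z)"
 have "0 < Re w" unfolding w_def Re_Ln_rotated[OF z0] using z(2) by (rule ln_gt_zero)
 moreover have "- pi / 2 < Im w" "Im w < pi / 2" using ang_pos[OF z(1)] unfolding ang_def w_def by (auto simp: field_simps)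
 ultimately obtain B where B: "(outer_chart has_derivative B) (at w)" "dilatation_le 512 B" using outer_chart_derivative by blast
 define c where "c = deriv (%z. Ln (- \<i> * z)) z"
 have "((%z. Ln (- \<i> * z)) has_derivative (*) c) (at z)"
  using holomorphic_derivI[OF Ln_holomorphic_ang_domain open_ang_domain zd] unfolding c_def has_field_derivative_def .
 from has_derivative_compose[OF this B(1)[unfolded w_def]]
 have "((%z. outer_chart (Ln (- \<i> * z))) has_derivative (%v. B (c * v))) (at z)" .
 hence "(outer has_derivative (%v. B (c * v))) (at z)" by (rule has_derivative_transform_within_open[of _ _ _ _ "- {0}"]) (use z0 outer_chart in auto)
 moreover have "dilatation_le (512 * 1) (B \<circ> (*) c)" using B by (intro dilatation_le_compose dilatation_le_mult) auto
 ultimately show ?thesis by (auto simp: o_def)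
qed

lemma inner_log_derivative:
 assumes n: "1 <= n" and z: "0 < Im z" "Re z ~= center n"
 shows "EX A. (inner_log n has_derivative A) (at z) & dilatation_le 24 A"
proof -
 define s :: real where "s = sgn (Re z - center n)"
 define \<rho> where "\<rho> = (%w. s * (Re w - center n) + Im w)"
 define x where "x = Re z - center n"
 define c where "c = d n / \<rho> z"
 define X where "X = x / \<rho> z"
 have dn: "0 < real (d n)" using d_pos[OF n] by simp
 have s: "s * x = \<bar>x\<bar>" "\<bar>s\<bar> = 1" using z by (auto simp: s_def x_def sgn_if)
 have \<rho>: "\<bar>x\<bar> < \<rho> z" "0 < \<rho> z" using z s by (auto simp: \<rho>_def x_def)
 have sX: "0 <= s * X" "s * X <= 1" "\<bar>X\<bar> <= 1" using s \<rho> by (auto simp: X_def abs_mult)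
 define A where "A v = of_real c * Complex (s * Re v + Im v) (- (pi / 2) * (Re v - X * (s * Re v + Im v)))" for v
 have dR: "((%w. Re w - center n) has_derivative Re) (at z)"
  using has_derivative_diff[OF has_derivative_Re[OF has_derivative_ident] has_derivative_const] by simp
 have d\<rho>: "(\<rho> has_derivative (%v. s * Re v + Im v)) (at z)"
  unfolding \<rho>_def by (intro has_derivative_add has_derivative_mult_right dR has_derivative_Im has_derivative_ident)
 have 1: "((%w. d n * (ln (\<rho> w) + ln (2 / d n))) has_derivative (%v. d n * (inverse (\<rho> z) * (s * Re v + Im v) + 0))) (at z)"
  using has_derivative_compose[OF d\<rho> DERIV_ln[OF \<rho>(2), unfolded has_field_derivative_def]]
  by (intro has_derivative_mult_right has_derivative_add has_derivative_const)
 have 2: "((%w. pi * (1 - center n) - pi * (d n / 2) * ((Re w - center n) / \<rho> w)) has_derivative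
   (%v. 0 - pi * (d n / 2) * ((Re v * \<rho> z - x * (s * Re v + Im v)) / (\<rho> z * \<rho> z)))) (at z)"
  using has_derivative_divide'[OF dR d\<rho>] \<rho>
  by (intro has_derivative_mult_right has_derivative_diff has_derivative_const) (auto simp: x_def)
 have "(%v. Complex (d n * (inverse (\<rho> z) * (s * Re v + Im v) + 0))
   (0 - pi * (d n / 2) * ((Re v * \<rho> z - x * (s * Re v + Im v)) / (\<rho> z * \<rho> z)))) = A"
  using \<rho>(2) by (intro ext) (simp add: A_def c_def X_def complex_eq_iff field_simps)
 hence "((%w. Complex (d n * (ln (\<rho> w) + ln (2 / d n))) (pi * (1 - center n) - pi * (d n / 2) * ((Re w - center n) / \<rho> w)))
   has_derivative A) (at z)" using has_derivative_Complex_pair[OF 1 2] by simp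
 hence D: "(inner_log n has_derivative A) (at z)"
 proof (rule has_derivative_transform_within_open[of _ _ _ _ "{w. 0 < Im w & 0 < s * (Re w - center n)}"])
  show "open {w. 0 < Im w & 0 < s * (Re w - center n)}" by (intro open_Collect_conj open_Collect_less continuous_intros)
  show "z \<in> {w. 0 < Im w & 0 < s * (Re w - center n)}" using z s by (auto simp: x_def)
  fix w assume "w \<in> {w. 0 < Im w & 0 < s * (Re w - center n)}"
  hence w: "0 < Im w" "0 < s * (Re w - center n)" by auto
  have "s * (Re w - center n) = \<bar>Re w - center n\<bar>"
   using w(2) s(2) z(2) unfolding s_def by (cases "Re z < center n") (auto simp: sgn_if abs_if)
  hence e: "inner_radius n w = \<rho> w * (2 / d n)" by (simp add: inner_radius_def \<rho>_def)
  moreover have "0 < \<rho> w" using w by (simp add: \<rho>_def)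
  ultimately show "Complex (d n * (ln (\<rho> w) + ln (2 / d n))) (pi * (1 - center n) - pi * (d n / 2) * ((Re w - center n) / \<rho> w)) = inner_log n w"
   unfolding inner_log_def e using dn by (simp add: ln_mult ln_div right_diff_distrib field_simps)
 qed
 have c: "0 < c" using dn \<rho> by (simp add: c_def)
 have p2: "pi < 4" by (rule pi_less_4)
 have A1: "cmod (A 1) <= 3 * c"
 proof -
  have "cmod (A 1) <= c * (\<bar>s\<bar> + \<bar>- (pi / 2) * (1 - X * s)\<bar>)"
   using c cmod_le[of "Complex s (- (pi / 2) * (1 - X * s))"] by (simp add: A_def norm_mult mult_left_mono)
  also have "\<bar>- (pi / 2) * (1 - X * s)\<bar> = pi / 2 * (1 - s * X)" using sX by (simp add: abs_mult mult.commute)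
  also have "c * (\<bar>s\<bar> + pi / 2 * (1 - s * X)) <= c * 3"
  proof -
   have "pi / 2 * (1 - s * X) <= 2 * 1" using sX p2 by (intro mult_mono) auto
   thus ?thesis using s c by (intro mult_left_mono) auto
  qed
  finally show ?thesis by simp
 qed
 have Ai: "cmod (A \<i>) <= 3 * c"
 proof -
  have "cmod (A \<i>) <= c * (1 + \<bar>pi / 2 * X\<bar>)" using c cmod_le[of "Complex 1 (pi / 2 * X)"] by (simp add: A_def norm_mult mult_left_mono)
  also have "... <= c * 3"
  proof -
   have "\<bar>pi / 2 * X\<bar> <= 2 * 1" unfolding abs_mult using sX p2 by (intro mult_mono) auto
   thus ?thesis using c by (intro mult_left_mono) auto
  qed
  finally show ?thesis by simp
 qed
 have "real_det A = pi / 2 * c\<^sup>2" by (simp add: real_det_def A_def power2_eq_square) (simp add: algebra_simps)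
 hence det: "3 / 2 * c\<^sup>2 <= real_det A" using pi_gt3 by (simp add: mult_right_mono)
 have "dilatation_le 24 A" by (rule dilatation_le_bound[OF has_derivative_linear[OF D] A1 Ai det]) auto
 thus ?thesis using D by blast
qed

text \<open>The largest constant that occurs is \<open>512 * 9\<close>, for \<open>outer\<close> after the shear \<open>flat\<close>.\<close>

lemma hlog_derivative:
 assumes z: "0 < Im z" "z \<notin> kinks"
 shows "EX A. (hlog has_derivative A) (at z) & dilatation_le 5000 A"
proof -
 have ne: "Re z ~= center n & Re z ~= vertex n" if "n >= 1" for n using z that by (auto simp: kinks_def)
 have c1: "cmod z ~= 1" using z by (auto simp: kinks_def)
 consider "cmod z < 1" | "1 < cmod z" "tent (Re z) < Im z" | "1 < cmod z" "Im z <= tent (Re z)" using c1 by linarith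
 thus ?thesis
 proof cases
  case 1
  have "z \<in> ang_domain" using z by (intro ang_domain) auto
  hence "((%z. Ln (- \<i> * z)) has_field_derivative deriv (%z. Ln (- \<i> * z)) z) (at z)"
   by (intro holomorphic_derivI[OF Ln_holomorphic_ang_domain open_ang_domain])
  hence "((%z. 2 * Ln (- \<i> * z) + \<i> * of_real pi) has_field_derivative 2 * deriv (%z. Ln (- \<i> * z)) z + 0) (at z)"
   by (intro DERIV_add DERIV_cmult DERIV_const)
  hence "((%z. 2 * Ln (- \<i> * z) + \<i> * of_real pi) has_derivative (*) (2 * deriv (%z. Ln (- \<i> * z)) z)) (at z)"
   by (simp add: has_field_derivative_def)
  hence "(hlog has_derivative (*) (2 * deriv (%z. Ln (- \<i> * z)) z)) (at z)"
   by (rule has_derivative_transform_within_open[of _ _ _ _ "ball 0 1 \<inter> uhp"])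
    (use z 1 in "auto simp: hlog_disc cl_disc_def open_uhp")
  thus ?thesis using dilatation_le_mono[OF dilatation_le_mult] by fastforce
 next
  case 2
  define U where "U = {w. tent (Re w) < Im w & 1 < cmod w}"
  have "continuous_on UNIV (%z. tent (Re z))" by (intro continuous_on_compose2[OF continuous_on_tent] continuous_intros) auto
  hence U: "open U" unfolding U_def by (intro open_Collect_conj open_Collect_less continuous_intros) auto
  obtain A where A: "(flat has_derivative A) (at z)" "dilatation_le 9 A" using flat_derivative[OF ne] by blast
  have "0 < Im (flat z)" using 2 by (simp add: flat_def)
  moreover have "1 < cmod (flat z)"
  proof (cases "- 1 <= Re z")
   case True
   thus ?thesis using 2 by (simp add: flat_right)
  next
   case False
   thus ?thesis using abs_Re_le_cmod[of "flat z"] by (simp add: flat_def)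
  qed
  ultimately obtain B where B: "(outer has_derivative B) (at (flat z))" "dilatation_le 512 B" using outer_derivative by blast
  have "((%w. outer (flat w)) has_derivative (%v. B (A v))) (at z)" using A(1) B(1) by (rule has_derivative_compose)
  hence "(hlog has_derivative (%v. B (A v))) (at z)" by (rule has_derivative_transform_within_open[of _ _ _ _ U])
    (use U 2 in "auto simp: hlog_outer cl_outer_def U_def")
  moreover have "dilatation_le (512 * 9) (B \<circ> A)" using A B by (intro dilatation_le_compose) auto
  hence "dilatation_le 5000 (B \<circ> A)" by (rule dilatation_le_mono) auto
  ultimately show ?thesis by (auto simp: o_def)
 next
  case 3
  hence "Re z < - 1" using tent_right[of "Re z"] z by force
  then obtain n where n: "1 <= n" "vertex (Suc n) <= Re z" "Re z <= vertex n" using square_exists[of "Re z"] by (metis less_imp_le)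
  have t: "\<bar>Re z - center n\<bar> + Im z < d n / 2" using z n 3 tent_square[OF n] by (auto simp: kinks_def)
  obtain A where A: "(inner_log n has_derivative A) (at z)" "dilatation_le 24 A" using inner_log_derivative[OF n(1) z(1)] ne[OF n(1)] by blast
  have "open {w. \<bar>Re w - center n\<bar> + Im w < d n / 2 & 0 < Im w}" by (intro open_Collect_conj open_Collect_less continuous_intros)
  hence "(hlog has_derivative A) (at z)" by (intro has_derivative_transform_within_open[OF A(1)])
    (use z t hlog_tri[OF n(1)] in "auto simp: cl_tri_def")
  moreover have "dilatation_le 5000 A" using A(2) by (rule dilatation_le_mono) auto
  ultimately show ?thesis by blast
 qed
qed

lemma AE_not_kinks: "AE z in lborel. z \<notin> kinks"
proof -
 have neg: "AE z in lborel. z \<notin> S" if "negligible S" for S :: "complex set"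
  using that by (metis AE_completion_iff AE_not_in negligible_iff_null_sets)
 have Re: "AE z in lborel. Re z ~= c" for c :: real
  using AE_lborel_inner_neq[of "1::complex" c] by (simp add: inner_complex_def Basis_complex_def)
 have Im: "AE z in lborel. Im z ~= c" for c :: real
  using AE_lborel_inner_neq[of "\<i>::complex" c] by (simp add: inner_complex_def Basis_complex_def)
 have slant: "AE z in lborel. Re z + \<sigma> * Im z ~= c" for c \<sigma> :: real
 proof -
  have "Complex 1 \<sigma> ~= 0" by (simp add: complex_eq_iff)
  hence "negligible {z. Complex 1 \<sigma> \<bullet> z = c}" by (intro negligible_hyperplane) auto
  from neg[OF this] show ?thesis by (simp add: inner_complex_def)
 qed
 have sph: "AE z in lborel. z \<notin> sphere (0::complex) 1" by (rule neg[OF negligible_sphere])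
 have "AE z in lborel. ALL n. Re z ~= center n & Re z ~= vertex n & Re z + 1 * Im z ~= center n + d n / 2 & Re z + 1 * Im z ~= center n - d n / 2 &
   Re z + (-1) * Im z ~= center n + d n / 2 & Re z + (-1) * Im z ~= center n - d n / 2" unfolding AE_all_countable by (intro allI AE_conjI Re slant)
 with sph Im[of 0] show ?thesis
 proof eventually_elim
  case (elim z)
  have "\<bar>Re z - center n\<bar> + \<bar>Im z\<bar> ~= d n / 2" for n
   using elim(3)[rule_format, of n] by (auto simp: abs_if split: if_splits)
  thus ?case using elim by (auto simp: kinks_def)
 qed
qed

end

section \<open>The explicit map is a bijection onto the comb domain\<close>

context even_multiplicities
begin

lemma flat_tent_inverse: "flat (z + \<i> * of_real (tent (Re z))) = z" by (simp add: flat_def complex_eq_iff)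

lemma flat_inj: "inj flat" by (rule injI) (auto simp: flat_def complex_eq_iff)

lemma unflat_cl_outer:
 assumes "0 <= Im w" "1 <= cmod w"
 shows "w + \<i> * of_real (tent (Re w)) \<in> cl_outer"
proof -
 have "(cmod w)\<^sup>2 <= (cmod (w + \<i> * of_real (tent (Re w))))\<^sup>2" using assms tent_nonneg[of "Re w"] by (simp add: cmod_power2 power_mono)
 thus ?thesis using assms by (simp add: cl_outer_def)
qed

lemma outer_inj:
 assumes z: "0 <= Im z" "1 <= cmod z" and w: "0 <= Im w" "1 <= cmod w" and eq: "outer z = outer w"
 shows "z = w"
proof -
 have nz: "z ~= 0" "w ~= 0" using z w by auto
 note rng = ang_range[OF z(1) nz(1)] ang_range[OF w(1) nz(2)]
 have I: "(1 + cmod z) * ang z = (1 + cmod w) * ang w" and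
  R: "cmod z * hmean (cmod z - 1) (pi - ang z) = cmod w * hmean (cmod w - 1) (pi - ang w)" using eq by (auto simp: outer_def)
 have False if *: "(1 + r) * t = (1 + r') * t'" "r * hmean (r - 1) (pi - t) = r' * hmean (r' - 1) (pi - t')"
  "1 <= r" "r < r'" "0 <= t" "t <= pi" "0 <= t'" "t' <= pi" for r r' t t' :: real
 proof -
  have "(1 + r') * t' <= (1 + r') * t" unfolding *(1)[symmetric] using * by (intro mult_right_mono) auto
  hence t: "t' <= t" using * by (simp add: mult_le_cancel_left)
  show False
  proof (cases "t' = pi")
   case True
   hence "t = pi" using t * by simp
   thus False using * True pi_gt_zero by auto
  next
   case False
   hence pos: "0 < hmean (r' - 1) (pi - t')" using * by (intro hmean_pos) auto
   have "r * hmean (r - 1) (pi - t) <= r * hmean (r' - 1) (pi - t')" using * t by (intro mult_left_mono hmean_mono) auto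
   also have "... < r' * hmean (r' - 1) (pi - t')" using * pos by (intro mult_strict_right_mono) auto
   finally show False using *(2) by simp
  qed
 qed
 from this[OF I R z(2) _ rng] this[OF I[symmetric] R[symmetric] w(2) _ rng(3,4,1,2)]
 have "cmod z = cmod w" by force
 moreover from this I have "ang z = ang w" using norm_ge_zero[of w] by (simp add: add_nonneg_eq_0_iff)
 ultimately show ?thesis using ang_polar[OF nz(1)] ang_polar[OF nz(2)] by metis
qed

lemma outer_range:
 assumes z: "0 <= Im z" "1 <= cmod z"
 shows "0 <= Re (outer z)" "0 <= Im (outer z)"
proof -
 have "z ~= 0" using z by auto
 thus "0 <= Re (outer z)" "0 <= Im (outer z)" using ang_range[of z] z by (auto simp: outer_def intro!: mult_nonneg_nonneg hmean_nonneg)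
qed

lemma outer_surj:
 assumes X: "0 <= X" and Y: "0 <= Y"
 obtains z where "0 <= Im z" "1 <= cmod z" "outer z = Complex X Y"
proof -
 define r0 where "r0 = max 1 (Y / pi - 1)"
 define \<phi> where "\<phi> = (%r. r * hmean (r - 1) (pi - Y / (1 + r)))"
 define r1 where "r1 = max (max 2 Y) (max r0 (2 * X))"
 have r0: "1 <= r0" "Y / (1 + r0) <= pi"
 proof -
  show "1 <= r0" by (simp add: r0_def)
  have "Y / pi <= 1 + r0" by (simp add: r0_def)
  thus "Y / (1 + r0) <= pi" using \<open>1 <= r0\<close> by (simp add: field_simps)
 qed
 have le: "Y / (1 + r) <= pi" if "r0 <= r" for r
 proof -
  have "Y / (1 + r) <= Y / (1 + r0)" using that r0 Y by (intro divide_left_mono) auto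
  thus ?thesis using r0 by simp
 qed
 have "\<phi> r0 = 0"
 proof (cases "r0 = 1")
  case False
  hence r: "r0 = Y / pi - 1" by (auto simp: r0_def max_def split: if_splits)
  hence "pi - Y / (1 + r0) = 0" using r0 r by auto
  thus ?thesis unfolding \<phi>_def by (simp only: hmean_0 mult_zero_right)
 qed (simp add: \<phi>_def)
 moreover have "X <= \<phi> r1"
 proof -
  have r1: "2 <= r1" "Y <= r1" "2 * X <= r1" by (auto simp: r1_def)
  have "Y / (1 + r1) <= 1" using r1 by simp
  hence "1 <= pi - Y / (1 + r1)" using pi_ge_two by linarith
  hence "hmean 1 1 <= hmean (r1 - 1) (pi - Y / (1 + r1))" using r1 by (intro hmean_mono) auto
  hence "r1 * (1 / 2) <= \<phi> r1" unfolding \<phi>_def using r1 by (intro mult_left_mono) (auto simp: hmean_def)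
  thus ?thesis using r1 by simp
 qed
 moreover have "continuous_on {r0..r1} \<phi>" unfolding continuous_on_eq_continuous_within
 proof
  fix x assume x: "x \<in> {r0..r1}"
  have id: "lipschitz_near (%r. c + r) x {r0..r1}" for c :: real
   by (rule lipschitz_near_on[of 1]) auto
  have "lipschitz_near (%r. pi + (- Y) * inverse (1 + r)) x {r0..r1}"
   using x r0 by (intro lipschitz_near_add lipschitz_near_mult lipschitz_near_inverse lipschitz_near_const id) auto
  hence g: "lipschitz_near (%r. pi - Y / (1 + r)) x {r0..r1}" by (simp add: divide_inverse)
  have "lipschitz_near (%r. (0 + r) * hmean (- 1 + r) (pi - Y / (1 + r))) x {r0..r1}"
   using le r0 by (intro lipschitz_near_mult lipschitz_near_hmean id g x) auto
  hence "lipschitz_near \<phi> x {r0..r1}" by (simp add: \<phi>_def)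
  thus "continuous (at x within {r0..r1}) \<phi>" using x by (rule lipschitz_near_continuous)
 qed
 ultimately obtain r where r: "r0 <= r" "r <= r1" "\<phi> r = X"
 proof -
  have "r0 <= r1" by (simp add: r1_def)
  with \<open>\<phi> r0 = 0\<close> \<open>X <= \<phi> r1\<close> \<open>continuous_on {r0..r1} \<phi>\<close> X show ?thesis
   using IVT'[of \<phi> r0 X r1] that by auto
 qed
 define t where "t = Y / (1 + r)"
 have t: "0 <= t" "t <= pi" using le[OF r(1)] Y r r0 by (auto simp: t_def)
 define z where "z = of_real r * exp (\<i> * of_real t)"
 have c: "cmod z = r" using r r0 by (simp add: z_def norm_mult)
 have a: "ang z = t" unfolding z_def using r r0 t by (intro ang_unique) auto
 have "0 <= Im z" using r r0 t sin_ge_zero[of t] by (simp add: z_def Im_exp)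
 moreover have "outer z = Complex X Y" using r r0 by (simp add: outer_def c a) (simp add: \<phi>_def t_def)
 ultimately show ?thesis using that c r r0 by auto
qed

lemma hlog_cl_outer:
 "[|z \<in> cl_outer|] ==> 0 <= Re (hlog z)" using outer_range(1)[OF flat_cl_outer] by (simp add: hlog_outer)

definition op_disc :: "complex set" where "op_disc = {z. 0 < Im z & cmod z < 1}"
definition op_tri :: "nat => complex set" where "op_tri n = {z. 0 < Im z & \<bar>Re z - center n\<bar> + Im z < d n / 2}"

lemma uhp_cases:
 assumes "z \<in> uhp"
 shows "z \<in> op_disc \<or> z \<in> cl_outer \<or> (EX n>=1. z \<in> op_tri n)"
proof -
 have "z \<in> op_disc \<or> z \<in> cl_outer" if "z \<in> cl_disc" using that assms tent_right[of "Re z"] abs_Re_le_cmod[of z]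
  by (cases "cmod z = 1") (auto simp: cl_disc_def op_disc_def cl_outer_def)
 moreover have "z \<in> op_tri n \<or> z \<in> cl_outer" if n: "n >= 1" "z \<in> cl_tri n" for n
  using n assms tent_square[of n "Re z"] cl_tri_Re[OF n] cl_tri_norm[OF n] by (auto simp: cl_tri_def op_tri_def cl_outer_def)
 ultimately show ?thesis using closed_upper_cover[of z] assms by auto
qed

lemma op_disc_hlog:
 assumes "z \<in> op_disc"
 shows "hlog z = Complex (2 * ln (cmod z)) (2 * ang z)" "Re (hlog z) < 0" "0 < Im (hlog z)" "Im (hlog z) < comb_height 1"
proof -
 have z: "z ~= 0" "0 < cmod z" "0 < Im z" "cmod z < 1" using assms by (auto simp: op_disc_def)
 thus e: "hlog z = Complex (2 * ln (cmod z)) (2 * ang z)" using disc_log[of z] assms by (simp add: hlog_disc cl_disc_def op_disc_def)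
 show "Re (hlog z) < 0" using z by (simp add: e)
 show "0 < Im (hlog z)" "Im (hlog z) < comb_height 1" using ang_pos[OF z(3)] by (auto simp: e comb_height_def)
qed

lemma op_tri_hlog:
 assumes n: "n >= 1" and z: "z \<in> op_tri n"
 shows "hlog z = inner_log n z" "0 < inner_radius n z" "Re (hlog z) < 0" "comb_height n < Im (hlog z)" "Im (hlog z) < comb_height (Suc n)"
proof -
 show e: "hlog z = inner_log n z" using z by (intro hlog_tri n) (auto simp: cl_tri_def op_tri_def)
 have dn: "0 < real (d n)" using d_pos[OF n] by simp
 define \<rho> where "\<rho> = inner_radius n z"
 have "0 < \<bar>Re z - center n\<bar> + Im z" using z by (auto simp: op_tri_def)
 hence \<rho>: "0 < \<rho>" "\<rho> < 1" using z dn by (auto simp: \<rho>_def inner_radius_def op_tri_def field_simps)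
 thus "0 < inner_radius n z" by (simp add: \<rho>_def)
 show "Re (hlog z) < 0" using \<rho> dn by (simp add: e inner_log_def mult_pos_neg flip: \<rho>_def)
 have "\<bar>Re z - center n\<bar> < \<rho> * (d n / 2)" using z dn by (simp add: \<rho>_def inner_radius_def op_tri_def)
 hence X: "\<bar>(Re z - center n) / \<rho>\<bar> < d n / 2" using \<rho> \<rho> by (simp add: field_simps)
 have "1 - vertex n < 1 - center n - (Re z - center n) / \<rho>" "1 - center n - (Re z - center n) / \<rho> < 1 - vertex (Suc n)"
  using X center_eq[OF n] by linarith+
 thus "comb_height n < Im (hlog z)" "Im (hlog z) < comb_height (Suc n)" by (simp_all add: e inner_log_def comb_height_vertex flip: \<rho>_def)
qed

lemma op_tri_surj:
 assumes n: "n >= 1" and w: "Re w < 0" "comb_height n < Im w" "Im w < comb_height (Suc n)"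
 obtains z where "z \<in> op_tri n" "hlog z = w"
proof -
 have dn: "0 < real (d n)" using d_pos[OF n] by simp
 define \<rho> where "\<rho> = exp (Re w / d n)"
 define X where "X = 1 - center n - Im w / pi"
 have \<rho>: "0 < \<rho>" "\<rho> < 1" using w dn by (auto simp: \<rho>_def divide_neg_pos)
 have "1 - vertex n < Im w / pi" "Im w / pi < 1 - vertex (Suc n)" using w by (auto simp: comb_height_vertex field_simps)
 hence X: "\<bar>X\<bar> < d n / 2" using center_eq[OF n] unfolding X_def by linarith
 define z where "z = Complex (center n + \<rho> * X) (\<rho> * (d n / 2 - \<bar>X\<bar>))"
 have s: "\<bar>Re z - center n\<bar> + Im z = \<rho> * (d n / 2)" using \<rho> by (simp add: z_def abs_mult right_diff_distrib)
 have zt: "z \<in> op_tri n" using \<rho> dn s \<rho> X by (simp add: op_tri_def z_def)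
 have r: "inner_radius n z = \<rho>" using s dn by (simp add: inner_radius_def)
 have "hlog z = Complex (d n * ln \<rho>) (pi * (1 - center n - \<rho> * X / \<rho>))"
  using op_tri_hlog(1)[OF n zt] by (simp add: inner_log_def r) (simp add: z_def)
 also have "... = w" using \<rho> dn by (simp add: complex_eq_iff \<rho>_def X_def)
 finally show ?thesis using that zt by blast
qed

lemma op_tri_inj:
 assumes n: "n >= 1" and z: "z \<in> op_tri n" and w: "w \<in> op_tri n" and eq: "hlog z = hlog w"
 shows "z = w"
proof -
 have dn: "0 < real (d n)" using d_pos[OF n] by simp
 note pz = op_tri_hlog(1,2)[OF n z] and pw = op_tri_hlog(1,2)[OF n w]
 have r: "inner_radius n z = inner_radius n w" using eq dn pz pw by (simp add: pz pw inner_log_def)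
 have "Re z = Re w" using eq r pw by (simp add: pz pw inner_log_def)
 moreover from this r dn have "Im z = Im w" by (simp add: inner_radius_def)
 ultimately show ?thesis by (simp add: complex_eq_iff)
qed

lemma comb_height_less: "[|1 <= m; m < n|] ==> comb_height m < comb_height n"
 using vertex_antimono[of "Suc m" n] vertex_Suc_less[of m] by (simp add: comb_height_vertex)

lemma comb_height_le: "[|1 <= m; m <= n|] ==> comb_height m <= comb_height n" using vertex_antimono[of m n] by (simp add: comb_height_vertex)

lemma comb_height_ge: "1 <= n ==> pi * (1 + real n) <= comb_height n" using vertex_le[of n] by (simp add: comb_height_vertex)

lemma strip_unique:
 assumes "1 <= m" "1 <= n" "comb_height m < y" "y < comb_height (Suc m)" "comb_height n < y" "y < comb_height (Suc n)"
 shows "m = n"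
proof (rule ccontr)
 assume "m ~= n"
 then consider "Suc m <= n" | "Suc n <= m" by linarith
 thus False
  using comb_height_le[of "Suc m" n] comb_height_le[of "Suc n" m] assms by cases auto
qed

lemma hlog_inj: "inj_on hlog uhp"
proof (rule inj_onI)
 fix z w assume zw: "z \<in> uhp" "w \<in> uhp" and eq: "hlog z = hlog w"
 show "z = w"
 proof (cases "0 <= Re (hlog z)")
  case True
  hence zwo: "z \<in> cl_outer" "w \<in> cl_outer" using uhp_cases[OF zw(1)] uhp_cases[OF zw(2)] op_disc_hlog(2) op_tri_hlog(3) eq by fastforce+
  hence "outer (flat z) = outer (flat w)" using eq by (simp add: hlog_outer)
  hence "flat z = flat w" by (rule outer_inj[OF flat_cl_outer[OF zwo(1)] flat_cl_outer[OF zwo(2)]])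
  thus ?thesis using flat_inj by (simp add: inj_eq)
 next
  case False
  hence out: "z \<notin> cl_outer" "w \<notin> cl_outer" using hlog_cl_outer eq by fastforce+
  show ?thesis
  proof (cases "Im (hlog z) < comb_height 1")
   case True
   have no: "u \<in> op_disc" if "u \<in> uhp" "u \<notin> cl_outer" "Im (hlog u) < comb_height 1" for u
    using uhp_cases[OF that(1)] that op_tri_hlog(4) comb_height_le[of 1] by fastforce
   have o: "z \<in> op_disc" "w \<in> op_disc" using no zw out True eq by auto
   have nz: "z ~= 0" "w ~= 0" using zw by auto
   show ?thesis using op_disc_hlog(1)[OF o(1)] op_disc_hlog(1)[OF o(2)] eq nz ang_polar[OF nz(1)] ang_polar[OF nz(2)] by auto
  next
   case False
   have "EX n>=1. u \<in> op_tri n" if "u \<in> uhp" "u \<notin> cl_outer" "\<not> Im (hlog u) < comb_height 1" for u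
    using uhp_cases[OF that(1)] that op_disc_hlog(4) by blast
   then obtain m n where mn: "1 <= m" "z \<in> op_tri m" "1 <= n" "w \<in> op_tri n" using zw out False eq by metis
   hence "m = n" using op_tri_hlog(4,5)[OF mn(1,2)] op_tri_hlog(4,5)[OF mn(3,4)] eq strip_unique[of m n] by simp
   thus ?thesis using op_tri_inj mn eq by blast
  qed
 qed
qed

lemma Im_outer_pos:
 assumes "z \<in> cl_outer" "0 < Im z"
 shows "0 < Im (outer (flat z))"
proof -
 have f: "0 <= Im (flat z)" "1 <= cmod (flat z)" using flat_cl_outer assms by auto
 hence nz: "flat z ~= 0" by auto
 have "ang (flat z) ~= 0"
 proof
  assume a: "ang (flat z) = 0"
  have "Im z = tent (Re z)" "1 <= Re z" using ang_Im[OF nz] ang_Re[OF nz] a f by (auto simp: flat_def)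
  thus False using assms tent_right[of "Re z"] by auto
 qed
 thus ?thesis using ang_range(1)[OF f(1) nz] f by (simp add: outer_def add_pos_nonneg)
qed

lemma outer_tip:
 assumes f: "0 <= Im w" "1 <= cmod w" and n: "1 <= n" and eq: "outer w = Complex 0 (comb_height n)"
 shows "w = of_real (vertex n)"
proof (rule outer_inj[OF f])
 have v: "vertex n <= - 1" using vertex_antimono[of 1 n] n by (simp add: right_vertex_def)
 show "outer w = outer (of_real (vertex n))" unfolding eq outer_negative_real[OF v] comb_height_vertex ..
 show "1 <= cmod (of_real (vertex n))" using v unfolding norm_of_real by simp
qed simp

lemma tent_vertex: "1 <= n ==> tent (vertex n) = 0"
 using tent_nonneg[of "vertex n"] infdist_le[of "vertex n" breakpoints "vertex n"] by (auto simp: tent_def breakpoints_def)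

text \<open>The three pieces of the half-plane cover the left half-strips below the first slit, the half-strips between consecutive
  slits, and the right half of the comb domain.\<close>

theorem hlog_image: "hlog ` uhp = comb_domain"
proof (intro equalityI subsetI)
 fix w assume "w \<in> hlog ` uhp"
 then obtain z where z: "z \<in> uhp" "w = hlog z" by auto
 consider "z \<in> op_disc" | "z \<in> cl_outer" | n where "1 <= n" "z \<in> op_tri n" using uhp_cases[OF z(1)] by blast
 thus "w \<in> comb_domain"
 proof cases
  case 1
  have "Im w ~= comb_height n" if "1 <= n" for n using op_disc_hlog[OF 1] comb_height_le[of 1 n] that z by auto
  thus ?thesis using op_disc_hlog[OF 1] z by (auto simp: comb_domain_def)
 next
  case 2
  have "False" if n: "Re w <= 0" "1 <= n" "Im w = comb_height n" for n
  proof -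
   have e: "flat z = of_real (vertex n)" using n hlog_cl_outer[OF 2] z outer_tip[OF flat_cl_outer[OF 2] n(2)] by (simp add: complex_eq_iff hlog_outer[OF 2])
   hence "Re z = vertex n" "Im z = tent (Re z)" by (auto simp: flat_def complex_eq_iff)
   thus False using tent_vertex[OF n(2)] z by simp
  qed
  thus ?thesis using Im_outer_pos[OF 2] z by (auto simp: comb_domain_def hlog_outer[OF 2])
 next
  case (3 n)
  have "Im w ~= comb_height m" if "1 <= m" for m
   using op_tri_hlog(4,5)[OF 3] comb_height_le[of m n] comb_height_le[of "Suc n" m] that 3 z by (cases "m <= n") auto
  moreover have "0 < comb_height n" using comb_height_ge[OF 3(1)] pi_gt_zero by (auto intro: less_le_trans[rotated])
  ultimately show ?thesis using op_tri_hlog(4)[OF 3] z by (auto simp: comb_domain_def)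
 qed
next
 fix w assume w: "w \<in> comb_domain"
 show "w \<in> hlog ` uhp"
 proof (cases "0 <= Re w")
  case True
  obtain u where u: "0 <= Im u" "1 <= cmod u" "outer u = w" using outer_surj[OF True, of "Im w"] w by (auto simp: comb_domain_def)
  define z where "z = u + \<i> * of_real (tent (Re u))"
  have zo: "z \<in> cl_outer" unfolding z_def using u by (intro unflat_cl_outer)
  have fz: "flat z = u" unfolding z_def by (rule flat_tent_inverse)
  hence hz: "hlog z = w" using hlog_outer[OF zo] u by simp
  have "0 < Im z"
  proof (rule ccontr)
   assume "\<not> 0 < Im z"
   hence "Im u = 0" "tent (Re u) = 0" using u tent_nonneg[of "Re u"] by (auto simp: z_def)
   hence ur: "u = of_real (Re u)" and t: "tent (Re u) = 0" by (auto simp: complex_eq_iff)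
   show False
   proof (cases "0 < Re u")
    case True
    hence "ang u = 0" using ur ang_of_real(1) by metis
    thus False using w u by (auto simp: outer_def comb_domain_def)
   next
    case False
    have r1: "1 <= \<bar>Re u\<bar>" using u(2) ur by (metis norm_of_real)
    hence le: "Re u <= - 1" using False by auto
    then obtain n where n: "1 <= n" "vertex (Suc n) <= Re u" "Re u <= vertex n" using square_exists by blast
    hence "Re u = vertex n \<or> Re u = vertex (Suc n)" using tent_square[OF n] t center_eq[OF n(1)] by (auto simp: abs_if split: if_splits)
    then obtain m where m: "1 <= m" "Re u = vertex m" using n(1) by force
    have "w = Complex 0 (comb_height m)" using outer_negative_real[OF le] u ur m by (metis comb_height_vertex)
    thus False using w m by (auto simp: comb_domain_def)
   qed
  qed
  thus ?thesis using hz by blast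
 next
  case False
  have Imw: "0 < Im w" "!!n. 1 <= n ==> Im w ~= comb_height n" using w False by (auto simp: comb_domain_def)
  show ?thesis
  proof (cases "Im w < comb_height 1")
   case True
   define z where "z = of_real (exp (Re w / 2)) * exp (\<i> * of_real (Im w / 2))"
   have t: "0 < Im w / 2" "Im w / 2 < pi" using Imw True by (auto simp: comb_height_def)
   have a: "ang z = Im w / 2" unfolding z_def using t by (intro ang_unique) auto
   have c: "cmod z = exp (Re w / 2)" by (simp add: z_def norm_mult)
   have z: "z \<in> op_disc" using sin_gt_zero[OF t] c False by (auto simp: z_def Im_exp op_disc_def)
   show ?thesis using op_disc_hlog(1)[OF z] a c z by (auto simp: op_disc_def)
  next
   case False': False
   obtain k :: nat where "Im w < real k" using reals_Archimedean2 by blast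
   moreover have "real k <= pi * (1 + real (Suc k))" using pi_ge_two mult_mono[of 1 pi "real k" "1 + real (Suc k)"] by simp
   ultimately have k: "Im w < comb_height (Suc k)" using comb_height_ge[of "Suc k"] by linarith
   define n where "n = (LEAST m. Im w < comb_height (Suc m))"
   have n: "Im w < comb_height (Suc n)" unfolding n_def using k by (rule LeastI)
   have "n ~= 0" using n False' by (intro notI) simp
   then obtain m where m: "n = Suc m" by (cases n) auto
   have "comb_height n < Im w" using not_less_Least[of m "%m. Im w < comb_height (Suc m)"] m Imw(2)[of n] by (simp add: n_def)
   then obtain z where "z \<in> op_tri n" "hlog z = w" using op_tri_surj[of n w] n m False by auto
   thus ?thesis by (auto simp: op_tri_def)
  qed
 qed
qed

text \<open>Points of the square \<open>P\<^sub>n\<close> have height at least \<open>h\<^sub>n\<close>; outside the squares real and imaginary part of \<open>outer\<close>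
  cannot both be small compared with \<open>\<bar>z\<bar>\<close>.\<close>

lemma hlog_proper: "EX R. ALL z:cuhp. Re (hlog z) <= M & Im (hlog z) <= M --> cmod z <= R"
proof -
 obtain m :: nat where m: "M < real m" using reals_Archimedean2 by blast
 define R where "R = max (3 * max 2 (2 * \<bar>M\<bar>)) (- vertex (Suc (Suc m)) * 2)"
 have "cmod z <= R" if z: "z \<in> cuhp" and M: "Re (hlog z) <= M" "Im (hlog z) <= M" for z
 proof -
  consider "z \<in> cl_disc" | "z \<in> cl_outer" | n where "1 <= n" "z \<in> cl_tri n" "z \<notin> cl_outer" using closed_upper_cover z by blast
  thus ?thesis
  proof cases
   case 1
   thus ?thesis by (auto simp: cl_disc_def R_def)
  next
   case 2
   define u where "u = flat z"
   have u: "0 <= Im u" "1 <= cmod u" "u ~= 0" using flat_cl_outer[OF 2] by (auto simp: u_def)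
   have Mo: "cmod u * hmean (cmod u - 1) (pi - ang u) <= M" "(1 + cmod u) * ang u <= M" using M hlog_outer[OF 2] by (auto simp: u_def outer_def)
   have "cmod u <= max 2 (2 * \<bar>M\<bar>)"
   proof (cases "pi / 2 <= ang u")
    case True
    have "cmod u * 1 <= (1 + cmod u) * ang u" using True pi_ge_two by (intro mult_mono) auto
    thus ?thesis using Mo by auto
   next
    case False
    show ?thesis
    proof (cases "cmod u <= 2")
     case False': False
     have "hmean 1 1 <= hmean (cmod u - 1) (pi - ang u)" using False False' pi_ge_two by (intro hmean_mono) auto
     hence "cmod u * (1 / 2) <= cmod u * hmean (cmod u - 1) (pi - ang u)" by (intro mult_left_mono) (auto simp: hmean_def)
     thus ?thesis using Mo by auto
    qed auto
   qed
   moreover have "cmod z <= 3 * cmod u"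
   proof -
    have "z = u + \<i> * of_real (tent (Re u))" by (simp add: u_def flat_def complex_eq_iff)
    hence "cmod z <= cmod u + cmod (\<i> * of_real (tent (Re u)))" by (metis norm_triangle_ineq)
    moreover have "cmod (\<i> * of_real (tent (Re u))) = tent (Re u)" using tent_nonneg[of "Re u"] by (simp add: norm_mult)
    ultimately show ?thesis using tent_le[of "Re u"] abs_Re_le_cmod[of u] by linarith
   qed
   ultimately show ?thesis by (auto simp: R_def)
  next
   case (3 n)
   have n: "n <= m"
   proof (rule ccontr)
    assume "\<not> n <= m"
    have "comb_height n <= Im (hlog z)"
    proof -
     have X: "(Re z - center n) / inner_radius n z <= d n / 2"
     proof (cases "inner_radius n z = 0")
      case False
      have "0 <= (\<bar>Re z - center n\<bar> + Im z) * 2 / d n" using z by (intro divide_nonneg_nonneg) auto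
      hence "0 < inner_radius n z" using False unfolding inner_radius_def[symmetric] by linarith
      moreover have e: "inner_radius n z * (d n / 2) = \<bar>Re z - center n\<bar> + Im z" using d_pos[OF 3(1)] by (simp add: inner_radius_def)
      have "0 <= Im z" using z by simp
      hence "Re z - center n <= inner_radius n z * (d n / 2)" unfolding e by linarith
      ultimately show ?thesis by (simp add: field_simps)
     qed auto
     have "1 - vertex n <= 1 - center n - (Re z - center n) / inner_radius n z" using X center_eq(1)[OF 3(1)] by linarith
     thus ?thesis unfolding hlog_tri[OF 3(1,2)] inner_log_def comb_height_vertex
      by (simp add: mult_left_mono)
    qed
    moreover have "real m * 1 <= (1 + real n) * pi" using \<open>\<not> n <= m\<close> pi_ge_two by (intro mult_mono) auto
    ultimately show False using comb_height_ge[OF 3(1)] M m by (simp add: mult.commute)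
   qed
   have v: "vertex (Suc (Suc m)) <= vertex (Suc n)" using n by (intro vertex_antimono) auto
   have v1: "vertex n <= -1" using vertex_le[OF 3(1)] 3(1) by linarith
   have "\<bar>Re z - center n\<bar> + Im z <= d n / 2" using 3(2) by (simp add: cl_tri_def)
   hence "Im z <= d n / 2" by linarith
   moreover have "vertex (Suc n) <= Re z" "Re z <= vertex n" using cl_tri_Re[OF 3(1,2)] by auto
   moreover have "real (d n) = vertex n - vertex (Suc n)" using 3 by (simp add: right_vertex_Suc)
   ultimately show ?thesis using v v1 z cmod_le[of z] by (simp add: R_def)
  qed
 qed
 thus ?thesis by blast
qed

end

section \<open>The map from the square to the disc\<close>

text \<open>The coordinate of the square whose power is the model map. It is linear on rays, turns the boundary of the unit
  diamond into the unit circle, and its argument is piecewise linear along the sides, to match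
  \<open>inner_log\<close>.\<close>

definition dia :: "complex => complex" where
 "dia z = (let \<rho> = \<bar>Re z\<bar> + \<bar>Im z\<bar> in Complex (\<rho> * sin (pi / 2 * (Re z / \<rho>))) (\<rho> * sin (pi / 2 * (Im z / \<rho>))))"

lemma dia_0 [simp]: "dia 0 = 0" by (simp add: dia_def complex_eq_iff)

lemma dia_cnj: "dia (cnj z) = cnj (dia z)" by (simp add: dia_def complex_eq_iff Let_def)

lemma dia_polar:
 assumes "0 <= Im z" "z ~= 0"
 shows "dia z = of_real (\<bar>Re z\<bar> + Im z) * exp (\<i> * of_real (pi / 2 * (1 - Re z / (\<bar>Re z\<bar> + Im z))))"
proof -
 define \<rho> where "\<rho> = \<bar>Re z\<bar> + Im z"
 have \<rho>: "0 < \<rho>" using assms by (auto simp: \<rho>_def complex_eq_iff)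
 have "sin (pi / 2 * (Im z / \<rho>)) = cos (pi / 2 * (Re z / \<rho>))"
 proof -
  have "sin (pi / 2 * (Im z / \<rho>)) = sin (pi / 2 - pi / 2 * (\<bar>Re z\<bar> / \<rho>))" using \<rho> by (simp add: \<rho>_def field_simps)
  also have "... = cos (pi / 2 * (\<bar>Re z\<bar> / \<rho>))" by (simp add: sin_diff)
  also have "... = cos \<bar>pi / 2 * (Re z / \<rho>)\<bar>" using \<rho> by (simp add: abs_mult)
  also have "... = cos (pi / 2 * (Re z / \<rho>))" by (rule cos_abs_real)
  finally show ?thesis .
 qed
 hence "dia z = Complex (\<rho> * sin (pi / 2 * (Re z / \<rho>))) (\<rho> * cos (pi / 2 * (Re z / \<rho>)))"
  using assms by (simp add: dia_def flip: \<rho>_def)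
 also have "... = of_real \<rho> * exp (\<i> * of_real (pi / 2 - pi / 2 * (Re z / \<rho>)))"
  by (simp add: complex_eq_iff Re_exp Im_exp cos_diff sin_diff)
 finally show ?thesis by (simp add: right_diff_distrib flip: \<rho>_def)
qed

lemma norm_dia: "cmod (dia z) = \<bar>Re z\<bar> + \<bar>Im z\<bar>"
proof -
 have 1: "cmod (dia z) = \<bar>Re z\<bar> + \<bar>Im z\<bar>" if "0 <= Im z" for z
 proof (cases "z = 0")
  case False
  thus ?thesis unfolding dia_polar[OF that False] norm_mult norm_exp_i_times norm_of_real using that by simp
 qed simp
 show ?thesis
 proof (cases "0 <= Im z")
  case False
  thus ?thesis using 1[of "cnj z"] by (simp add: dia_cnj)
 qed (rule 1)
qed

lemma sin_quarter_inj:
 assumes "\<bar>x\<bar> <= 1" "\<bar>y\<bar> <= 1" "sin (pi / 2 * x) = sin (pi / 2 * y)"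
 shows "x = y"
proof -
 have "\<bar>pi / 2 * x\<bar> <= pi / 2 * 1" "\<bar>pi / 2 * y\<bar> <= pi / 2 * 1" unfolding abs_mult using assms by (auto intro!: mult_mono)
 hence "- (pi / 2) <= pi / 2 * x" "pi / 2 * x <= pi / 2" "- (pi / 2) <= pi / 2 * y" "pi / 2 * y <= pi / 2"
  by (simp_all only: abs_le_iff mult_1_right) linarith+
 hence "pi / 2 * x = pi / 2 * y" using assms(3) by (rule sin_inj_pi)
 thus ?thesis by simp
qed

lemma inj_dia: "inj dia"
proof (rule injI)
 fix z w assume eq: "dia z = dia w"
 define \<rho> where "\<rho> = \<bar>Re z\<bar> + \<bar>Im z\<bar>"
 have \<rho>w: "\<rho> = \<bar>Re w\<bar> + \<bar>Im w\<bar>" using eq norm_dia[of z] norm_dia[of w] by (simp add: \<rho>_def)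
 show "z = w"
 proof (cases "\<rho> = 0")
  case False
  hence pos: "0 < \<rho>" by (simp add: \<rho>_def less_le)
  have "sin (pi / 2 * (Re z / \<rho>)) = sin (pi / 2 * (Re w / \<rho>))" "sin (pi / 2 * (Im z / \<rho>)) = sin (pi / 2 * (Im w / \<rho>))"
   using eq False unfolding dia_def Let_def \<rho>_def[symmetric] \<rho>w[symmetric] by auto
  moreover have "\<bar>Re z / \<rho>\<bar> <= 1" "\<bar>Re w / \<rho>\<bar> <= 1" "\<bar>Im z / \<rho>\<bar> <= 1" "\<bar>Im w / \<rho>\<bar> <= 1"
   using pos \<rho>w by (auto simp: \<rho>_def abs_divide)
  ultimately have "Re z / \<rho> = Re w / \<rho>" "Im z / \<rho> = Im w / \<rho>" using sin_quarter_inj by blast+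
  thus ?thesis using pos by (simp add: complex_eq_iff)
 qed (use \<rho>w in "auto simp: \<rho>_def complex_eq_iff")
qed

lemma dia_image: "dia ` {z. \<bar>Re z\<bar> + \<bar>Im z\<bar> < 1} = ball 0 1"
proof (intro equalityI subsetI)
 fix w :: complex assume w: "w \<in> ball 0 1"
 show "w \<in> dia ` {z. \<bar>Re z\<bar> + \<bar>Im z\<bar> < 1}"
 proof (cases "w = 0")
  case True
  thus ?thesis by (intro image_eqI[of _ _ 0]) auto
 next
  case False
  define s where "s = cmod w"
  have s: "0 < s" "s < 1" using False w by (auto simp: s_def)
  define x where "x = Re w / s"
  define y where "y = Im w / s"
  have "x\<^sup>2 + y\<^sup>2 = ((Re w)\<^sup>2 + (Im w)\<^sup>2) / s\<^sup>2" by (simp add: x_def y_def power_divide add_divide_distrib)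
  also have "... = 1" unfolding cmod_power2[symmetric] s_def[symmetric] using s by simp
  finally have xy: "x\<^sup>2 + y\<^sup>2 = 1" .
  have "x\<^sup>2 <= 1\<^sup>2" "y\<^sup>2 <= 1\<^sup>2" using xy zero_le_power2[of x] zero_le_power2[of y] unfolding one_power2 by linarith+
  hence x1: "\<bar>x\<bar> <= 1" "\<bar>y\<bar> <= 1" using abs_le_square_iff[of x 1] abs_le_square_iff[of y 1] by auto
  define z where "z = Complex (s * (2 / pi * arcsin x)) (s * (2 / pi * arcsin y))"
  have ab: "\<bar>arcsin t\<bar> = arcsin \<bar>t\<bar>" if "\<bar>t\<bar> <= 1" for t
  proof (cases "0 <= t")
   case True
   thus ?thesis using that arcsin_le_arcsin[of 0 t] by auto
  next
   case False
   thus ?thesis using that arcsin_minus[of t] arcsin_le_arcsin[of 0 "- t"] by auto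
  qed
  have "arcsin \<bar>x\<bar> + arcsin \<bar>y\<bar> = pi / 2"
  proof -
   have "1 - \<bar>x\<bar>\<^sup>2 = y\<^sup>2" using xy by simp
   hence "\<bar>y\<bar> = sqrt (1 - \<bar>x\<bar>\<^sup>2)" by (simp only: real_sqrt_abs)
   also have "... = sin (arccos \<bar>x\<bar>)" using x1 by (simp add: sin_arccos)
   finally have "arcsin \<bar>y\<bar> = arcsin (sin (arccos \<bar>x\<bar>))" by simp
   also have "... = arccos \<bar>x\<bar>"
   proof (rule arcsin_sin)
    have "0 <= arccos \<bar>x\<bar>" using x1 by (intro arccos_lbound) auto
    thus "- (pi / 2) <= arccos \<bar>x\<bar>" using pi_gt_zero by linarith
    show "arccos \<bar>x\<bar> <= pi / 2" using x1 by (intro arccos_le_pi2) auto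
   qed
   also have "... = pi / 2 - arcsin \<bar>x\<bar>" using x1 by (intro arccos_arcsin_eq) auto
   finally show ?thesis by simp
  qed
  moreover have "\<bar>Re z\<bar> = s * (2 / pi * arcsin \<bar>x\<bar>)" "\<bar>Im z\<bar> = s * (2 / pi * arcsin \<bar>y\<bar>)"
   unfolding ab[OF x1(1), symmetric] ab[OF x1(2), symmetric] z_def complex.sel abs_mult using s by simp_all
  ultimately have r: "\<bar>Re z\<bar> + \<bar>Im z\<bar> = s" by (simp only: distrib_left[symmetric]) simp
  have "dia z = w" unfolding dia_def Let_def r using s x1 by (simp add: z_def complex_eq_iff) (simp add: x_def y_def)
  thus ?thesis using r s by (intro image_eqI[of _ _ z]) auto
 qed
qed (auto simp: norm_dia)

lemma continuous_on_dia: "continuous_on UNIV dia"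
proof -
 have "continuous_on (- {0}) dia" unfolding dia_def Let_def Complex_eq
  by (intro continuous_intros) (auto simp: complex_eq_iff add_nonneg_eq_0_iff)
 hence "isCont dia z" if "z ~= 0" for z
  using that open_Compl[OF closed_singleton[of "0::complex"]] by (metis Compl_iff continuous_on_eq_continuous_at singletonD)
 moreover have "isCont dia 0" unfolding continuous_at
 proof (rule tendsto_norm_zero_cancel[of "dia", THEN tendsto_eq_rhs])
  have "((%z. \<bar>Re z\<bar> + \<bar>Im z\<bar>) \<longlongrightarrow> \<bar>Re 0\<bar> + \<bar>Im 0\<bar>) (at 0)" by (intro tendsto_intros)
  thus "((%z. cmod (dia z)) \<longlongrightarrow> 0) (at 0)" by (simp add: norm_dia)
 qed simp
 ultimately show ?thesis unfolding continuous_on_eq_continuous_at[OF open_UNIV] by (metis UNIV_I)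
qed

lemma dia_homeomorphism:
 assumes "0 < \<delta>"
 shows "EX \<psi>. homeomorphism (diagonal_square c \<delta>) (ball 0 1) (%z. dia ((z - of_real c) * of_real (2 / \<delta>))) \<psi>"
proof -
 define q where "q = (%z. (z - of_real c) * complex_of_real (2 / \<delta>))"
 have q: "Re (q z) = (Re z - c) * (2 / \<delta>)" "Im (q z) = Im z * (2 / \<delta>)" for z by (auto simp: q_def)
 have mem: "z \<in> diagonal_square c \<delta> \<longleftrightarrow> \<bar>Re (q z)\<bar> + \<bar>Im (q z)\<bar> < 1" for z
 proof -
  have "\<bar>Re (q z)\<bar> + \<bar>Im (q z)\<bar> = (\<bar>Re z - c\<bar> + \<bar>Im z\<bar>) * (2 / \<delta>)"
   using assms by (simp only: q abs_mult distrib_right) simp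
  thus ?thesis using assms by (simp only: diagonal_square_def mem_Collect_eq) (simp add: pos_less_divide_eq pos_divide_less_eq)
 qed
 have "open (diagonal_square c \<delta>)" unfolding diagonal_square_def
  by (intro open_Collect_less continuous_intros)
 moreover have "continuous_on (diagonal_square c \<delta>) (%z. dia (q z))"
  unfolding q_def by (intro continuous_on_compose2[OF continuous_on_dia] continuous_intros) auto
 moreover have "inj_on (%z. dia (q z)) (diagonal_square c \<delta>)"
 proof (rule inj_onI)
  fix x y assume "dia (q x) = dia (q y)"
  hence "q x = q y" using inj_dia by (simp add: inj_eq)
  thus "x = y" using assms unfolding q_def mult_cancel_right by simp
 qed
 moreover have "(%z. dia (q z)) ` diagonal_square c \<delta> = ball 0 1"
 proof -
  have "q ` diagonal_square c \<delta> = {z. \<bar>Re z\<bar> + \<bar>Im z\<bar> < 1}"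
  proof (intro equalityI subsetI)
   fix w assume "w \<in> {z. \<bar>Re z\<bar> + \<bar>Im z\<bar> < 1}"
   moreover have "q (w * of_real (\<delta> / 2) + of_real c) = w" using assms by (simp add: q_def)
   ultimately show "w \<in> q ` diagonal_square c \<delta>" using mem by (metis (mono_tags, lifting) image_eqI mem_Collect_eq)
  qed (use mem in auto)
  hence "dia ` (q ` diagonal_square c \<delta>) = ball 0 1" by (simp only: dia_image)
  thus ?thesis by (simp only: image_image)
 qed
 ultimately have "EX \<psi>. homeomorphism (diagonal_square c \<delta>) (ball 0 1) (%z. dia (q z)) \<psi>"
  by (metis invariance_of_domain_homeomorphism order_refl)
 thus ?thesis by (simp only: q_def)
qed

section \<open>The model map\<close>

definition fold :: "complex => complex" where "fold z = Complex (Re z) \<bar>Im z\<bar>"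

lemma continuous_on_fold: "continuous_on A fold" unfolding fold_def Complex_eq by (intro continuous_intros)

context even_multiplicities
begin

text \<open>The zeros have to be excluded as \<open>hlog\<close> is a logarithm there.\<close>

definition model :: "complex => complex" where
 "model z = (if z \<in> zeros then 0 else if 0 <= Im z then exp (hlog z) else cnj (exp (hlog (cnj z))))"

lemma cnj_zeros: "cnj z \<in> zeros \<longleftrightarrow> z \<in> zeros"
proof -
 have "ALL z:zeros. cnj z = z" by (auto simp: zeros_def)
 thus ?thesis by (metis complex_cnj_cnj)
qed

lemma zeros_real: "z \<in> zeros ==> Im z = 0" by (auto simp: zeros_def)

abbreviation "square n \<equiv> diagonal_square (center n) (real (d n))"

definition sq_chart :: "nat => complex => complex" where
 "sq_chart n z = dia ((z - of_real (center n)) * of_real (2 / real (d n)))"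

lemma exp_inner_log:
 assumes n: "1 <= n" and z: "0 <= Im z" "z ~= of_real (center n)"
 shows "exp (inner_log n z) = sq_chart n z ^ d n"
proof -
 have dn: "0 < real (d n)" using d_pos[OF n] by simp
 define u where "u = (z - of_real (center n)) * of_real (2 / real (d n))"
 have u: "Re u = (Re z - center n) * (2 / d n)" "Im u = Im z * (2 / d n)" by (auto simp: u_def)
 have "0 <= Im u" unfolding u using z by simp
 moreover have "u ~= 0" unfolding u_def mult_eq_0_iff of_real_eq_0_iff using z dn by simp
 ultimately have u0: "0 <= Im u" "u ~= 0" by auto
 define \<rho> where "\<rho> = inner_radius n z"
 have \<rho>: "\<bar>Re u\<bar> + Im u = \<rho>" by (simp only: u \<rho>_def inner_radius_def abs_mult) (simp add: add_divide_distrib)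
 have \<rho>0: "0 < \<rho>" using u0 unfolding \<rho>[symmetric] by (auto simp: complex_eq_iff)
 have "sq_chart n z = of_real \<rho> * exp (\<i> * of_real (pi / 2 * (1 - Re u / \<rho>)))"
  unfolding sq_chart_def u_def[symmetric] dia_polar[OF u0] \<rho> ..
 hence "sq_chart n z ^ d n = of_real (\<rho> ^ d n) * exp (of_nat (d n) * (\<i> * of_real (pi / 2 * (1 - Re u / \<rho>))))"
  by (simp only: power_mult_distrib exp_of_nat_mult of_real_power)
 also have "of_nat (d n) * (\<i> * of_real (pi / 2 * (1 - Re u / \<rho>))) = \<i> * of_real (pi * (d n / 2) - pi * ((Re z - center n) / \<rho>))"
  using dn \<rho>0 by (simp add: u complex_eq_iff field_simps)
 also have "exp ... = exp ... * exp (\<i> * of_real (comb_height n))" by (simp add: exp_comb_height)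
 also have "... = exp (\<i> * of_real (pi * (d n / 2) - pi * ((Re z - center n) / \<rho>)) + \<i> * of_real (comb_height n))"
  by (rule exp_add[symmetric])
 also have "\<i> * of_real (pi * (d n / 2) - pi * ((Re z - center n) / \<rho>)) + \<i> * of_real (comb_height n)
   = \<i> * of_real (pi * (1 - center n - (Re z - center n) / \<rho>))"
  by (simp add: complex_eq_iff comb_height_vertex center_eq(1)[OF n] algebra_simps)
 also have "of_real (\<rho> ^ d n) = exp (complex_of_real (d n * ln \<rho>))" unfolding exp_of_real exp_of_nat_mult using \<rho>0 by simp
 finally show ?thesis by (simp add: inner_log_def Complex_eq exp_add \<rho>_def)
qed

lemma closed_square_Im:
 "\<bar>Re z - center n\<bar> + \<bar>Im z\<bar> <= d n / 2 ==> 0 <= Im z ==> z \<in> cl_tri n" by (simp add: cl_tri_def)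

lemma sq_chart_cnj: "sq_chart n (cnj z) = cnj (sq_chart n z)" by (simp add: sq_chart_def flip: dia_cnj)

lemma center_inj:
 assumes "1 <= m" "1 <= n" "vertex (Suc n) <= center m" "center m <= vertex n"
 shows "m = n"
proof (rule ccontr)
 assume "m ~= n"
 then consider "Suc m <= n" | "Suc n <= m" by linarith
 thus False
  using vertex_antimono[of "Suc m" n] vertex_antimono[of "Suc n" m] center_between[of m] assms by cases auto
qed

lemma zeros_in_square:
 assumes n: "1 <= n" and z: "z \<in> cl_tri n" "z \<in> zeros"
 shows "z = of_real (center n)"
proof -
 have "Re z <= vertex n" "vertex (Suc n) <= Re z" using cl_tri_Re[OF n z(1)] by auto
 moreover have "vertex n <= -1" using vertex_antimono[of 1 n] n by (simp add: right_vertex_def)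
 moreover obtain m where m: "1 <= m" "z = of_real (center m)" using z(2) calculation by (auto simp: zeros_def)
 ultimately show ?thesis using center_inj[OF m(1) n] m by simp
qed

lemma model_square:
 assumes n: "1 <= n" and z: "\<bar>Re z - center n\<bar> + \<bar>Im z\<bar> <= d n / 2"
 shows "model z = sq_chart n z ^ d n"
proof -
 have up: "model z = sq_chart n z ^ d n" if z: "z \<in> cl_tri n" for z
 proof (cases "z \<in> zeros")
  case True
  thus ?thesis using zeros_in_square[OF n z] True d_pos[OF n] by (simp add: model_def sq_chart_def)
 next
  case False
  show ?thesis using False n z exp_inner_log[OF n, of z] hlog_tri[OF n z] by (auto simp: zeros_def model_def cl_tri_def)
 qed
 show ?thesis
 proof (cases "0 <= Im z")
  case True
  thus ?thesis using up closed_square_Im z by blast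
 next
  case False
  hence c: "cnj z \<in> cl_tri n" using z by (simp add: cl_tri_def)
  show ?thesis using False zeros_real[of z] cnj_zeros[of z] up[OF c] by (auto simp: model_def sq_chart_cnj)
 qed
qed

lemma model_disc:
 assumes "cmod z <= 1"
 shows "model z = z\<^sup>2"
proof -
 have center: "center n < -1" if "n >= 1" for n
  using center_between(2)[OF that] vertex_antimono[of 1 n] that by (simp add: right_vertex_def)
 have nz: "z ~= 0 ==> z \<notin> zeros"
 proof
  assume "z ~= 0" "z \<in> zeros"
  then obtain n where "1 <= n" "z = of_real (center n)" by (auto simp: zeros_def)
  thus False using center[of n] assms by simp
 qed
 have up: "exp (hlog z) = z\<^sup>2" if "0 <= Im z" "cmod z <= 1" "z ~= 0" for z
 proof -
  have "exp (hlog z) = exp (2 * Ln (- \<i> * z)) * exp (\<i> * of_real pi)" using that by (simp only: hlog_disc cl_disc_def mem_Collect_eq exp_add)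
  also have "exp (2 * Ln (- \<i> * z)) = (- \<i> * z)\<^sup>2" using that exp_of_nat_mult[of 2 "Ln (- \<i> * z)"] by simp
  also have "exp (\<i> * of_real pi) = -1" by (simp add: mult.commute)
  finally show ?thesis by (simp add: power_mult_distrib)
 qed
 show ?thesis
 proof (cases "z = 0")
  case True
  thus ?thesis by (simp add: model_def zeros_def)
 next
  case False
  thus ?thesis using up[of z] up[of "cnj z"] nz assms by (auto simp: model_def)
 qed
qed

end

section \<open>Critical points of the model map\<close>

lemma not_critical_exp:
 assumes "open U" "z \<in> U" "continuous_on U h" "inj_on h U" "!!w. w \<in> U ==> f w = exp (h w)"
 shows "\<not> critical_point f z"
proof -
 have "open (U \<inter> h -` ball (h z) 1)" using assms(1,3) by (auto intro: continuous_open_preimage)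
 moreover have "inj_on f (U \<inter> h -` ball (h z) 1)"
 proof (rule inj_onI)
  fix x y assume x: "x \<in> U \<inter> h -` ball (h z) 1" and y: "y \<in> U \<inter> h -` ball (h z) 1" and eq: "f x = f y"
  have "\<bar>Im (h x) - Im (h y)\<bar> < 2 * pi" using x y abs_Im_le_cmod[of "h x - h z"] abs_Im_le_cmod[of "h y - h z"] pi_gt3 by (auto simp: dist_norm norm_minus_commute)
  moreover have "exp (h x) = exp (h y)" using eq assms(5) x y by auto
  ultimately have "h x = h y" by (metis exp_complex_eqI)
  thus "x = y" using assms(4) x y by (auto simp: inj_on_def)
 qed
 ultimately show ?thesis unfolding critical_point_def using assms(2) by (metis IntI centre_in_ball vimageI zero_less_one)
qed

lemma not_critical_power:
 assumes U: "open U" "z \<in> U" "continuous_on U \<phi>" "inj_on \<phi> U" and f: "!!w. w \<in> U ==> f w = \<phi> w ^ m" and m: "1 <= m" and ne: "\<phi> z ~= 0"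
 shows "\<not> critical_point f z"
proof -
 have "((%w. w ^ m) has_field_derivative of_nat m * \<phi> z ^ (m - 1)) (at (\<phi> z))" by (auto intro!: derivative_eq_intros)
 hence "deriv (%w. w ^ m) (\<phi> z) ~= 0" using m ne by (simp add: DERIV_imp_deriv)
 moreover have "(%w. w ^ m) holomorphic_on UNIV" by (intro holomorphic_intros)
 ultimately obtain r where r: "r > 0" "inj_on (%w. w ^ m) (ball (\<phi> z) r)"
  using has_complex_derivative_locally_injective[of "%w. w ^ m" UNIV "\<phi> z"] by auto
 have "open (U \<inter> \<phi> -` ball (\<phi> z) r)" using U by (auto intro: continuous_open_preimage)
 moreover have "inj_on f (U \<inter> \<phi> -` ball (\<phi> z) r)" using U(4) r(2) f by (auto simp: inj_on_def)
 ultimately show ?thesis unfolding critical_point_def using U(2) r(1) by (metis IntI centre_in_ball vimageI)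
qed

lemma critical_even_power:
 assumes U: "open U" "z \<in> U" "continuous_on U \<phi>" "inj_on \<phi> U" and f: "!!w. w \<in> U ==> f w = \<phi> w ^ m" and m: "even m" and z0: "\<phi> z = 0"
 shows "critical_point f z" unfolding critical_point_def
proof
 assume "EX V. open V & z \<in> V & inj_on f V"
 then obtain V where V: "open V" "z \<in> V" "inj_on f V" by blast
 have "open (\<phi> ` (U \<inter> V))" by (rule invariance_of_domain) (use U V in "auto intro: continuous_on_subset inj_on_subset")
 then obtain e where e: "e > 0" "ball 0 e \<subseteq> \<phi> ` (U \<inter> V)" using U V z0 by (metis IntI image_eqI openE)
 have "of_real (e / 2) \<in> \<phi> ` (U \<inter> V)" "- of_real (e / 2) \<in> \<phi> ` (U \<inter> V)" using e by (auto intro!: subsetD[OF e(2)])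
 then obtain x y where x: "x \<in> U \<inter> V" "\<phi> x = of_real (e / 2)" and y: "y \<in> U \<inter> V" "\<phi> y = - of_real (e / 2)" by (metis imageE)
 have "f x = f y" unfolding f[OF IntD1[OF x(1)]] f[OF IntD1[OF y(1)]] x(2) y(2) power_minus_even[OF m] ..
 hence "x = y" using inj_onD[OF V(3)] x y by blast
 thus False using x y e(1) by simp
qed

lemma not_inj_at_strict_max:
 fixes h :: "real => real"
 assumes c: "continuous_on {v - e..v + e} h" and e: "0 < e" and max: "!!x. [|\<bar>x - v\<bar> <= e; x ~= v|] ==> h x < h v"
 obtains x y where "v - e <= x" "x < v" "v < y" "y <= v + e" "h x = h y"
proof (cases "h (v - e) <= h (v + e)")
 case True
 have "continuous_on {v - e..v} h" by (rule continuous_on_subset[OF c]) (use e in auto)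
 moreover have "h (v + e) <= h v" using max[of "v + e"] e by auto
 ultimately obtain x where x: "v - e <= x" "x <= v" "h x = h (v + e)" using IVT'[of h "v - e" "h (v + e)" v] True e by auto
 moreover have "x ~= v" using x(3) max[of "v + e"] e by auto
 ultimately show ?thesis using that[of x "v + e"] e by auto
next
 case False
 have "continuous_on {v..v + e} h" by (rule continuous_on_subset[OF c]) (use e in auto)
 moreover have "h (v - e) <= h v" using max[of "v - e"] e by auto
 ultimately obtain y where y: "v <= y" "y <= v + e" "h y = h (v - e)" using IVT2'[of h "v + e" "h (v - e)" v] False e by auto
 moreover have "y ~= v" using y(3) max[of "v - e"] e by auto
 ultimately show ?thesis using that[of "v - e" y] e by auto
qed

context even_multiplicities
begin

lemma cl_square_cases:
 "z \<in> cball 0 1 \<or> fold z \<in> cl_outer \<or> (EX n>=1. \<bar>Re z - center n\<bar> + \<bar>Im z\<bar> <= d n / 2)"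
 using closed_upper_cover[of "fold z"] by (auto simp: fold_def cl_disc_def cl_tri_def cmod_def)

lemma real_cases:
 assumes "Im z = 0"
 shows "cmod z <= 1 \<or> (EX n>=1. \<bar>Re z - center n\<bar> + \<bar>Im z\<bar> <= d n / 2) \<or> 1 <= Re z"
proof (cases "Re z <= - 1")
 case True
 then obtain n where n: "1 <= n" "vertex (Suc n) <= Re z" "Re z <= vertex n" using square_exists by blast
 hence "\<bar>Re z - center n\<bar> <= d n / 2" using center_eq[OF n(1)] unfolding abs_le_iff by linarith
 thus ?thesis using n(1) assms by auto
next
 case False
 thus ?thesis using cmod_eq_Re[OF assms] by auto
qed

lemma outer_real_ge_1: "[|Im z = 0; 1 <= Re z|] ==> z \<in> cl_outer & hlog z = Complex (Re z * hmean (Re z - 1) pi) 0"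
proof -
 assume z: "Im z = 0" "1 <= Re z"
 hence e: "z = of_real (Re z)" by (simp add: complex_eq_iff)
 hence a: "ang z = 0" using ang_of_real(1)[of "Re z"] z by simp
 have c: "cmod z = Re z" using z cmod_eq_Re[OF z(1)] by simp
 have o: "z \<in> cl_outer" using z c tent_right[of "Re z"] by (simp add: cl_outer_def)
 thus ?thesis using hlog_outer[OF o] flat_right[of z] z a c by (simp add: outer_def)
qed

lemma not_zeros_right: "0 < Re z ==> z \<notin> zeros"
proof
 assume "0 < Re z" "z \<in> zeros"
 then obtain n where "1 <= n" "z = of_real (center n)" by (auto simp: zeros_def)
 thus False using center_between(2)[of n] vertex_le[of n] \<open>0 < Re z\<close> by simp
qed

lemma model_upper: "[|0 <= Im z; z \<notin> zeros|] ==> model z = exp (hlog z)" by (simp add: model_def)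

lemma dia_real: "Im z = 0 ==> Im (dia z) = 0" by (simp add: dia_def Let_def)

lemma norm_sq_chart: "1 <= n ==> cmod (sq_chart n z) = (\<bar>Re z - center n\<bar> + \<bar>Im z\<bar>) * (2 / d n)"
proof -
 assume n: "1 <= n"
 have "Re ((z - of_real (center n)) * of_real (2 / real (d n))) = (Re z - center n) * (2 / d n)"
  "Im ((z - of_real (center n)) * of_real (2 / real (d n))) = Im z * (2 / d n)" by auto
 thus ?thesis unfolding sq_chart_def norm_dia using d_pos[OF n]
  by (simp only: abs_mult distrib_right) simp
qed

lemma even_power_real:
 assumes "Im w = 0" "even m"
 shows "w ^ m = of_real (cmod w ^ m)"
proof -
 have w: "w = of_real (Re w)" using assms by (simp add: complex_eq_iff)
 have "w ^ m = of_real (Re w ^ m)" by (subst w) simp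
 also have "Re w ^ m = \<bar>Re w\<bar> ^ m" using assms(2) by (simp add: power_even_abs)
 finally show ?thesis using cmod_eq_Re[OF assms(1)] by simp
qed

lemma model_real:
 assumes "Im z = 0"
 shows "model z = of_real (cmod (model z))" using real_cases[OF assms]
proof (elim disjE exE conjE)
 assume "cmod z <= 1"
 thus ?thesis using even_power_real[OF assms, of 2] by (simp add: model_disc norm_power)
next
 fix n assume n: "1 <= n" "\<bar>Re z - center n\<bar> + \<bar>Im z\<bar> <= d n / 2"
 have "Im (sq_chart n z) = 0" unfolding sq_chart_def using assms by (intro dia_real) simp
 thus ?thesis using even_power_real d_even[OF n(1)] unfolding model_square[OF n] norm_power by blast
next
 assume "1 <= Re z"
 thus ?thesis using outer_real_ge_1[OF assms] not_zeros_right[of z] assms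
  by (simp add: model_upper complex_eq_iff Re_exp Im_exp)
qed

lemma model_cnj: "model (cnj z) = cnj (model z)"
proof -
 consider "Im z = 0" | "0 < Im z" | "Im z < 0" by linarith
 thus ?thesis
 proof cases
  case 1
  hence "cnj z = z" by (simp add: complex_eq_iff)
  thus ?thesis using model_real[OF 1] by (metis complex_cnj_complex_of_real)
 qed (use zeros_real[of z] cnj_zeros[of z] in "auto simp: model_def")
qed

lemma zeros_isolated:
 obtains e where "e > 0" "ball z e \<inter> zeros \<subseteq> {z}"
proof -
 obtain m :: nat where m: "- (Re z - 1) <= real m" using real_arch_simple by blast
 define A where "A = insert 0 ((%n. complex_of_real (center n)) ` {1..m}) - {z}"
 have "finite A" by (simp add: A_def)
 hence "open (ball z 1 - A)" by (intro open_Diff finite_imp_closed) auto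
 then obtain e where e: "e > 0" "ball z e \<subseteq> ball z 1 - A" using openE[of "ball z 1 - A" z] by (auto simp: A_def)
 have "w = z" if w: "w \<in> ball z e" "w \<in> zeros" for w
 proof (rule ccontr)
  assume "w ~= z"
  have "- real m < Re w" using w e abs_Re_le_cmod[of "z - w"] m by (auto simp: dist_norm)
  moreover have "n < Suc m" if "1 <= n" "w = of_real (center n)" for n
   using that vertex_le[OF that(1)] center_between(2)[OF that(1)] \<open>- real m < Re w\<close> by auto
  ultimately have "w \<in> A" using w(2) \<open>w ~= z\<close> unfolding A_def zeros_def by fastforce
  thus False using w e by blast
 qed
 thus ?thesis using that e(1) by blast
qed

lemma model_lipschitz:
 assumes "z \<notin> zeros"
 shows "lipschitz_near model z UNIV"
proof -
 have up: "lipschitz_near model z cuhp" if z: "z \<notin> zeros" "z \<in> cuhp" for z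
 proof -
  obtain e where e: "e > 0" "ball z e \<inter> zeros \<subseteq> {z}" using zeros_isolated[of z] by blast
  have "lipschitz_near (%w. exp (hlog w)) z (cuhp \<inter> ball z e)" by (rule lipschitz_near_compose[where T = UNIV and f = hlog and g = exp])
    (use z e in "auto intro: lipschitz_near_subset[OF hlog_lipschitz] lipschitz_near_holomorphic[of exp UNIV] holomorphic_intros")
  hence "lipschitz_near model z (cuhp \<inter> ball z e)" by (rule lipschitz_near_cong) (use e z in "auto intro!: model_upper")
  thus ?thesis using e(1) by (rule lipschitz_near_local)
 qed
 show ?thesis
 proof (rule lipschitz_near_closed_cover[where I = UNIV and C = "%b. if b then cuhp else {z. Im z <= 0}" and e = 1])
  show "closed (if b then cuhp else {z. Im z <= 0})" for b by (simp add: closed_halfspace_Im_ge closed_halfspace_Im_le)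
  fix b assume z: "z \<in> (if b then cuhp else {z. Im z <= 0})"
  show "lipschitz_near model z ((if b then cuhp else {z. Im z <= 0}) \<inter> UNIV)"
  proof (cases b)
   case True
   thus ?thesis using up[OF assms] z by simp
  next
   case False
   have "lipschitz_near (%w. model (cnj w)) z {z. Im z <= 0}"
   proof (rule lipschitz_near_compose[where T = cuhp and f = cnj and g = model])
    show "lipschitz_near model (cnj z) cuhp" using up[of "cnj z"] z False assms cnj_zeros by auto
    show "lipschitz_near cnj z {z. Im z <= 0}" by (rule lipschitz_near_cnj)
   qed (use z False in auto)
   hence "lipschitz_near (%w. cnj (model (cnj w))) z {z. Im z <= 0}"
    by (rule lipschitz_near_compose[where T = UNIV and g = cnj]) (use z False in "auto intro: lipschitz_near_cnj")
   thus ?thesis using False by (auto intro!: lipschitz_near_cong simp: model_cnj)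
  qed
 qed (auto simp: linear)
qed

lemma open_square: "open (square n)" unfolding diagonal_square_def by (intro open_Collect_less continuous_intros)

lemma square_model: "[|1 <= n; z \<in> square n|] ==> model z = sq_chart n z ^ d n" by (intro model_square) (auto simp: diagonal_square_def)

lemma continuous_on_sq_chart: "continuous_on A (sq_chart n)"
 unfolding sq_chart_def by (intro continuous_on_compose2[OF continuous_on_dia] continuous_intros) auto

lemma inj_sq_chart: "1 <= n ==> inj_on (sq_chart n) A"
proof (rule inj_onI)
 fix x y assume n: "1 <= n" and "sq_chart n x = sq_chart n y"
 hence "(x - of_real (center n)) * complex_of_real (2 / real (d n)) = (y - of_real (center n)) * of_real (2 / real (d n))"
  unfolding sq_chart_def using inj_dia by (simp only: inj_eq)
 thus "x = y" using d_pos[OF n] unfolding mult_cancel_right by simp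
qed

lemma center_in_square: "1 <= n ==> of_real (center n) \<in> square n" using d_pos[of n] by (simp add: diagonal_square_def)

lemma sq_chart_0: "1 <= n ==> sq_chart n z = 0 \<longleftrightarrow> z = of_real (center n)"
 using inj_sq_chart[of n UNIV] by (auto simp: inj_on_def sq_chart_def)

lemma isCont_model: "isCont model z"
proof (cases "z \<in> zeros")
 case True
 then consider "z = 0" | n where "1 <= n" "z = of_real (center n)" by (auto simp: zeros_def)
 thus ?thesis
 proof cases
  case 1
  have "isCont (%w. w\<^sup>2) z" by (intro continuous_intros)
  moreover have "eventually (%w. w \<in> ball 0 1) (nhds z)" using 1 by (intro eventually_nhds_in_open) auto
  hence "eventually (%w. model w = w\<^sup>2) (nhds z)" by eventually_elim (auto simp: model_disc)
  ultimately show ?thesis by (simp add: isCont_cong)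
 next
  case 2
  have "isCont (%w. sq_chart n w ^ d n) z"
   using continuous_on_sq_chart[of UNIV n] by (intro continuous_intros) (auto simp: continuous_on_eq_continuous_at)
  moreover have "eventually (%w. w \<in> square n) (nhds z)" using 2 center_in_square open_square by (intro eventually_nhds_in_open) auto
  hence "eventually (%w. model w = sq_chart n w ^ d n) (nhds z)" by eventually_elim (rule square_model[OF 2(1)])
  ultimately show ?thesis by (simp add: isCont_cong)
 qed
next
 case False
 thus ?thesis using lipschitz_near_continuous[OF model_lipschitz] by auto
qed

lemma continuous_on_model: "continuous_on A model" using isCont_model by (simp add: continuous_at_imp_continuous_on)

lemma model_derivative:
 assumes "z \<notin> kinks"
 shows "EX A. (model has_derivative A) (at z) & dilatation_le 5000 A"
proof -
 have up: "EX A. (model has_derivative A) (at z) & dilatation_le 5000 A" if z: "z \<notin> kinks" "0 < Im z" for z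
 proof -
  obtain A where A: "(hlog has_derivative A) (at z)" "dilatation_le 5000 A" using hlog_derivative z by blast
  have "(exp has_derivative (*) (exp (hlog z))) (at (hlog z))" using DERIV_exp[of "hlog z"] by (simp add: has_field_derivative_def)
  from has_derivative_compose[OF A(1) this]
  have "((%w. exp (hlog w)) has_derivative (%v. exp (hlog z) * A v)) (at z)" .
  hence "(model has_derivative (%v. exp (hlog z) * A v)) (at z)" by (rule has_derivative_transform_within_open[of _ _ _ _ uhp])
    (use z zeros_real open_uhp in "auto simp: model_def")
  moreover have "dilatation_le (1 * 5000) ((*) (exp (hlog z)) \<circ> A)" using A by (intro dilatation_le_compose dilatation_le_mult) auto
  ultimately show ?thesis by (auto simp: o_def)
 qed
 have "Im z ~= 0" using assms by (simp add: kinks_def)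
 show ?thesis
 proof (cases "0 < Im z")
  case False
  hence z: "0 < Im (cnj z)" "cnj z \<notin> kinks" using \<open>Im z ~= 0\<close> assms by (auto simp: kinks_def)
  then obtain A where A: "(model has_derivative A) (at (cnj z))" "dilatation_le 5000 A" using up by blast
  have c: "(cnj has_derivative cnj) (at w)" for w by (rule bounded_linear_imp_has_derivative[OF bounded_linear_cnj])
  have "((%w. cnj (model (cnj w))) has_derivative (%v. cnj (A (cnj v)))) (at z)"
   by (intro has_derivative_compose[OF has_derivative_compose[OF c A(1)] c])
  hence "(model has_derivative (%v. cnj (A (cnj v)))) (at z)" by (simp add: model_cnj)
  thus ?thesis using dilatation_le_cnj[OF A(2)] by blast
 qed (use up assms in blast)
qed

lemma model_outer_ge: "fold z \<in> cl_outer ==> 1 <= cmod (model z)"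
proof -
 have up: "1 <= cmod (model z)" if z: "z \<in> cl_outer" "z \<notin> zeros" for z
  using model_upper[OF cl_outer_Im[OF z(1)] z(2)] hlog_cl_outer[OF z(1)] by simp
 have nz: "z \<notin> zeros" if z: "z \<in> cl_outer" for z
 proof
  assume "z \<in> zeros"
  then consider "z = 0" | n where "1 <= n" "z = of_real (center n)" by (auto simp: zeros_def)
  thus False
  proof cases
   case 2
   thus False using z tent_square[OF 2(1), of "center n"] center_between[OF 2(1)] d_pos[OF 2(1)] by (auto simp: cl_outer_def)
  qed (use z in "auto simp: cl_outer_def")
 qed
 assume z: "fold z \<in> cl_outer"
 show ?thesis
 proof (cases "0 <= Im z")
  case True
  thus ?thesis using up nz z by (simp add: fold_def complex_eq_iff)
 next
  case False
  hence "fold z = cnj z" by (simp add: fold_def complex_eq_iff)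
  thus ?thesis using up[of "cnj z"] nz[of "cnj z"] z by (simp add: model_cnj)
 qed
qed

lemma model_square_lt: "[|1 <= n; \<bar>Re z - center n\<bar> + \<bar>Im z\<bar> <= d n / 2|] ==> cmod (model z) < 1 \<longleftrightarrow> z \<in> square n"
proof -
 assume n: "1 <= n" and z: "\<bar>Re z - center n\<bar> + \<bar>Im z\<bar> <= d n / 2"
 have "cmod (model z) < 1 \<longleftrightarrow> cmod (sq_chart n z) < 1"
  unfolding model_square[OF n z] norm_power using d_pos[OF n] by (simp add: power_less_one_iff)
 also have "... \<longleftrightarrow> z \<in> square n" unfolding norm_sq_chart[OF n] diagonal_square_def using d_pos[OF n] by (simp add: field_simps)
 finally show ?thesis .
qed

lemma model_disc_lt: "cmod z <= 1 ==> cmod (model z) < 1 \<longleftrightarrow> z \<in> ball 0 1"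
 by (simp add: model_disc norm_power power_less_one_iff)

lemma model_preimage_disc: "model -` ball 0 1 = ball 0 1 \<union> (\<Union>n\<in>{1..}. square n)"
proof (intro equalityI subsetI)
 fix z assume "z \<in> model -` ball 0 1"
 thus "z \<in> ball 0 1 \<union> (\<Union>n\<in>{1..}. square n)" using cl_square_cases[of z] model_outer_ge[of z] model_square_lt model_disc_lt[of z] by fastforce
next
 fix z assume "z \<in> ball 0 1 \<union> (\<Union>n\<in>{1..}. square n)"
 thus "z \<in> model -` ball 0 1"
 proof
  assume "z \<in> (\<Union>n\<in>{1..}. square n)"
  then obtain n where n: "1 <= n" "z \<in> square n" by auto
  thus ?thesis using model_square_lt[OF n(1), of z] by (auto simp: diagonal_square_def)
 qed (use model_disc_lt[of z] in auto)
qed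

text \<open>The bound is uniform in the squares, because \<open>\<bar>flat z\<bar> \<le> \<bar>z\<bar>\<close> and \<open>outer\<close> does not depend on
  them, while on the disc and the squares the model map is bounded by \<open>1\<close>.\<close>

lemma model_bound: "cmod (model z) <= exp (pi * cmod z)"
proof -
 have one: "1 <= exp (pi * cmod z)" by simp
 have up: "cmod (model z) <= exp (pi * cmod z)" if z: "z \<in> cl_outer" for z
 proof (cases "z \<in> zeros")
  case False
  have f: "0 <= Im (flat z)" "1 <= cmod (flat z)" using flat_cl_outer[OF z] by auto
  hence nz: "flat z ~= 0" by auto
  have "Re (hlog z) = cmod (flat z) * hmean (cmod (flat z) - 1) (pi - ang (flat z))" by (simp add: hlog_outer[OF z] outer_def)
  also have "... <= cmod (flat z) * pi"
  proof (rule mult_left_mono)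
   have "hmean (cmod (flat z) - 1) (pi - ang (flat z)) <= pi - ang (flat z)" using f ang_range[OF f(1) nz] by (intro hmean_le) auto
   thus "hmean (cmod (flat z) - 1) (pi - ang (flat z)) <= pi" using ang_range(1)[OF f(1) nz] by linarith
  qed auto
  also have "cmod (flat z) <= cmod z"
  proof -
   have "(Im (flat z))\<^sup>2 <= (Im z)\<^sup>2" using f tent_nonneg[of "Re z"] by (intro power_mono) (auto simp: flat_def)
   hence "(cmod (flat z))\<^sup>2 <= (cmod z)\<^sup>2" unfolding cmod_power2 by (simp add: flat_def)
   thus ?thesis by (rule power2_le_imp_le) auto
  qed
  finally have "Re (hlog z) <= pi * cmod z" by (simp add: mult.commute mult_left_mono)
  thus ?thesis using model_upper[OF cl_outer_Im[OF z] False] by simp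
 qed (simp add: model_def)
 show ?thesis
 proof (cases "fold z \<in> cl_outer")
  case True
  show ?thesis
  proof (cases "0 <= Im z")
   case True
   thus ?thesis using up \<open>fold z \<in> cl_outer\<close> by (simp add: fold_def complex_eq_iff)
  next
   case False
   hence "fold z = cnj z" by (simp add: fold_def complex_eq_iff)
   thus ?thesis using up[of "cnj z"] \<open>fold z \<in> cl_outer\<close> by (simp add: model_cnj)
  qed
 next
  case False
  have "cmod (model z) <= 1"
  proof (cases "cmod z <= 1")
   case True
   thus ?thesis by (simp add: model_disc norm_power power_le_one)
  next
   case False
   then obtain n where n: "1 <= n" "\<bar>Re z - center n\<bar> + \<bar>Im z\<bar> <= d n / 2" using cl_square_cases[of z] \<open>fold z \<notin> cl_outer\<close> by auto
   have "cmod (sq_chart n z) <= 1" unfolding norm_sq_chart[OF n(1)] using n(2) d_pos[OF n(1)] by (simp add: field_simps)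
   thus ?thesis unfolding model_square[OF n] norm_power by (intro power_le_one) auto
  qed
  thus ?thesis using one by linarith
 qed
qed

lemma continuous_on_hlog: "continuous_on (cuhp - zeros) hlog" unfolding continuous_on_eq_continuous_within
 using lipschitz_near_continuous[OF hlog_lipschitz] by (auto intro: continuous_within_subset)

text \<open>Reflection of the logarithm across the positive axis, a logarithm of the model map on the right
  half-plane.\<close>

definition sym_log :: "complex => complex" where
 "sym_log z = (if 0 <= Im z then hlog z else cnj (hlog (cnj z)))"

lemma hlog_pos_real:
 assumes "Im z = 0" "0 < Re z"
 shows "Im (hlog z) = 0" "Re z <= 1 ==> hlog z = of_real (2 * ln (Re z))" "1 <= Re z ==> z \<in> cl_outer"
proof -
 have e: "z = of_real (Re z)" using assms by (simp add: complex_eq_iff)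
 hence a: "ang z = 0" using ang_of_real(1)[OF assms(2)] by simp
 have c: "cmod z = Re z" using assms cmod_eq_Re by simp
 have z0: "z ~= 0" using assms by auto
 show 1: "hlog z = of_real (2 * ln (Re z))" if "Re z <= 1" using disc_log[OF z0] that a c assms by (simp add: hlog_disc cl_disc_def complex_eq_iff)
 show "z \<in> cl_outer" if "1 <= Re z" using outer_real_ge_1 that assms by blast
 show "Im (hlog z) = 0"
 proof (cases "Re z <= 1")
  case True
  thus ?thesis using 1 by simp
 qed (use outer_real_ge_1[of z] assms in auto)
qed

lemma hlog_pos_real_inj:
 assumes z: "Im z = 0" "0 < Re z" and w: "Im w = 0" "0 < Re w" and eq: "hlog z = hlog w"
 shows "z = w"
proof -
 have out: "z = w" if "1 <= Re z" "1 <= Re w"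
 proof -
  have o: "z \<in> cl_outer" "w \<in> cl_outer" using hlog_pos_real(3) z w that by auto
  have "flat z = z" "flat w = w" using that by (auto simp: flat_right)
  thus ?thesis using eq hlog_outer o outer_inj[OF flat_cl_outer[OF o(1)] flat_cl_outer[OF o(2)]] \<open>flat z = z\<close> \<open>flat w = w\<close> by simp
 qed
 have mixed: "z = w" if "Re z < 1" "1 <= Re w" "hlog z = hlog w" "0 < Re z" "Im z = 0" "Im w = 0" for z w
 proof -
  have "Re (hlog z) < 0" using hlog_pos_real(2)[of z] that by simp
  moreover have "0 <= Re (hlog w)" using hlog_cl_outer hlog_pos_real(3)[of w] that by auto
  ultimately show ?thesis using that by simp
 qed
 consider "1 <= Re z" "1 <= Re w" | "Re z < 1" "1 <= Re w" | "1 <= Re z" "Re w < 1" | "Re z < 1" "Re w < 1" by linarith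
 thus ?thesis
 proof cases
  case 4
  hence "Re z = Re w" using hlog_pos_real(2) eq z w by (simp flip: of_real_mult)
  thus ?thesis using z w by (simp add: complex_eq_iff)
 qed (use out mixed[of z w] mixed[of w z] eq z w in auto)
qed

lemma continuous_on_sym_log: "continuous_on {z. 0 < Re z} sym_log"
proof -
 have "{z. 0 < Re z} = {z. 0 < Re z & 0 <= Im z} \<union> {z. 0 < Re z & Im z <= 0}" by auto
 moreover have "continuous_on ({z. 0 < Re z & 0 <= Im z} \<union> {z. 0 < Re z & Im z <= 0}) sym_log" (is "continuous_on ?T _")
  unfolding sym_log_def
 proof (rule continuous_on_cases_local)
  show "closedin (top_of_set ({z. 0 < Re z & 0 <= Im z} \<union> {z. 0 < Re z & Im z <= 0})) {z. 0 < Re z & 0 <= Im z}"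
   using closedin_closed_Int[OF closed_halfspace_Im_ge[of 0], of "?T"] by (rule back_subst) auto
  show "closedin (top_of_set ({z. 0 < Re z & 0 <= Im z} \<union> {z. 0 < Re z & Im z <= 0})) {z. 0 < Re z & Im z <= 0}"
   using closedin_closed_Int[OF closed_halfspace_Im_le[of 0], of "?T"] by (rule back_subst) auto
  show "continuous_on {z. 0 < Re z & 0 <= Im z} hlog" by (rule continuous_on_subset[OF continuous_on_hlog]) (use not_zeros_right in auto)
  show "continuous_on {z. 0 < Re z & Im z <= 0} (%z. cnj (hlog (cnj z)))"
   by (intro continuous_on_cnj continuous_on_compose2[OF continuous_on_hlog] continuous_intros) (use not_zeros_right in auto)
  fix z assume "z \<in> {z. 0 < Re z & 0 <= Im z} & \<not> 0 <= Im z \<or> z \<in> {z. 0 < Re z & Im z <= 0} & 0 <= Im z"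
  hence z: "Im z = 0" "0 < Re z" by auto
  hence "cnj z = z" by (simp add: complex_eq_iff)
  thus "hlog z = cnj (hlog (cnj z))" using hlog_pos_real(1)[OF z] unfolding \<open>cnj z = z\<close> by (simp add: complex_eq_iff)
 qed
 ultimately show ?thesis by simp
qed

lemma Im_hlog_pos: "z \<in> uhp ==> 0 < Im (hlog z)" using hlog_image by (auto simp: comb_domain_def)

lemma sym_log_cnj: "0 < Re z ==> sym_log (cnj z) = cnj (sym_log z)"
proof (cases "Im z = 0")
 case True
 assume "0 < Re z"
 have "cnj z = z" using True by (simp add: complex_eq_iff)
 thus ?thesis using hlog_pos_real(1)[OF True \<open>0 < Re z\<close>] True unfolding \<open>cnj z = z\<close> by (simp add: sym_log_def complex_eq_iff)
qed (auto simp: sym_log_def)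

lemma inj_sym_log: "inj_on sym_log {z. 0 < Re z}"
proof (rule inj_onI)
 fix z w assume zw: "z \<in> {z. 0 < Re z}" "w \<in> {z. 0 < Re z}" and eq: "sym_log z = sym_log w"
 have sgn: "0 < Im (sym_log u) \<longleftrightarrow> 0 < Im u" "Im (sym_log u) < 0 \<longleftrightarrow> Im u < 0" if "0 < Re u" for u
  using Im_hlog_pos[of u] Im_hlog_pos[of "cnj u"] hlog_pos_real(1)[of u] that by (cases "Im u = 0"; cases "0 < Im u"; auto simp: sym_log_def)+
 have up: "z = w" if "0 < Im z" "0 < Im w" "sym_log z = sym_log w" for z w
  using that hlog_inj by (auto simp: inj_on_def sym_log_def)
 consider "0 < Im z" "0 < Im w" | "Im z < 0" "Im w < 0" | "Im z = 0" "Im w = 0"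
  using sgn[of z] sgn[of w] zw eq by (metis linorder_neqE_linordered_idom mem_Collect_eq)
 thus "z = w"
 proof cases
  case 2
  thus ?thesis using up[of "cnj z" "cnj w"] eq zw by (simp add: sym_log_cnj)
 next
  case 3
  thus ?thesis using hlog_pos_real_inj zw eq by (auto simp: sym_log_def)
 qed (use up eq in blast)
qed

lemma exp_sym_log: "0 < Re z ==> model z = exp (sym_log z)" using not_zeros_right[of z] by (auto simp: model_def sym_log_def exp_cnj)

lemma critical_cnj: "critical_point model z ==> critical_point model (cnj z)" unfolding critical_point_def
proof (erule contrapos_nn)
 assume "EX U. open U & cnj z \<in> U & inj_on model U"
 then obtain U where U: "open U" "cnj z \<in> U" "inj_on model U" by blast
 have "open (cnj -` U)" using U(1) by (intro open_vimage continuous_intros)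
 moreover have "inj_on model (cnj -` U)"
 proof (rule inj_onI)
  fix x y assume "x \<in> cnj -` U" "y \<in> cnj -` U" "model x = model y"
  hence "model (cnj x) = model (cnj y)" "cnj x \<in> U" "cnj y \<in> U" by (auto simp: model_cnj)
  hence "cnj x = cnj y" using inj_onD[OF U(3)] by blast
  thus "x = y" by simp
 qed
 ultimately show "EX U. open U & z \<in> U & inj_on model U" using U(2) by (intro exI[of _ "cnj -` U"]) auto
qed

lemma not_critical:
 assumes "z \<notin> zeros" "!!n. 1 <= n ==> z ~= of_real (vertex n)"
 shows "\<not> critical_point model z"
proof -
 have up: "\<not> critical_point model z" if "0 < Im z" for z
  by (rule not_critical_exp[of uhp z hlog])
   (use that open_uhp hlog_inj zeros_real in "auto simp: model_def intro!: continuous_on_subset[OF continuous_on_hlog]")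
 consider "0 < Im z" | "Im z < 0" | "Im z = 0" by linarith
 thus ?thesis
 proof cases
  case 2
  thus ?thesis using up[of "cnj z"] critical_cnj[of z] by auto
 next
  case 3
  hence zr: "z = of_real (Re z)" by (simp add: complex_eq_iff)
  have right: "\<not> critical_point model z" if "0 < Re z" by (rule not_critical_exp[of "{z. 0 < Re z}" z sym_log])
    (use that inj_sym_log continuous_on_sym_log exp_sym_log in "auto simp: open_halfspace_Re_gt")
  have disc: "\<not> critical_point model z" if "cmod z < 1"
   by (rule not_critical_power[of "ball 0 1" z "%w. w" model 2]) (use that assms(1) in "auto simp: model_disc zeros_def")
  from real_cases[OF 3] show ?thesis
  proof (elim disjE exE conjE)
   assume "cmod z <= 1"
   moreover have "z ~= -1" using assms(2)[of 1] by (simp add: right_vertex_def)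
   ultimately show ?thesis using zr cmod_eq_Re[OF 3] right disc by (cases "0 < Re z") (auto simp: less_le complex_eq_iff)
  next
   fix n assume n: "1 <= n" "\<bar>Re z - center n\<bar> + \<bar>Im z\<bar> <= d n / 2"
   have "Re z ~= vertex n" "Re z ~= vertex (Suc n)" using assms(2)[of n] assms(2)[of "Suc n"] n(1) zr by (metis, metis le_SucI)
   hence "\<bar>Re z - center n\<bar> ~= d n / 2" using center_eq[OF n(1)] by (auto simp: abs_if split: if_splits)
   hence zs: "z \<in> square n" using n(2) 3 by (simp add: diagonal_square_def)
   have "z ~= of_real (center n)" using assms(1) n(1) by (auto simp: zeros_def)
   thus ?thesis
    using zs n(1) d_pos[OF n(1)] by (intro not_critical_power[of "square n" z "sq_chart n" model "d n"])
     (auto simp: open_square continuous_on_sq_chart inj_sq_chart square_model sq_chart_0)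
  qed (use right in auto)
 qed (use up in blast)
qed

lemma critical_zero:
 assumes "z \<in> zeros"
 shows "critical_point model z"
proof -
 consider "z = 0" | n where "1 <= n" "z = of_real (center n)" using assms by (auto simp: zeros_def)
 thus ?thesis
 proof cases
  case 1
  thus ?thesis by (intro critical_even_power[of "ball 0 1" z "%w. w" model 2]) (auto simp: model_disc)
 next
  case (2 n)
  thus ?thesis by (intro critical_even_power[of "square n" z "sq_chart n" model "d n"])
   (auto simp: open_square continuous_on_sq_chart inj_sq_chart square_model sq_chart_0 center_in_square d_even)
 qed
qed

lemma model_vertex:
 assumes "1 <= n"
 shows "model (of_real (vertex n)) = 1"
proof -
 have s: "\<bar>Re (complex_of_real (vertex n)) - center n\<bar> + \<bar>Im (complex_of_real (vertex n))\<bar> = d n / 2"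
  using center_eq[OF assms] by simp
 have "cmod (sq_chart n (of_real (vertex n))) = 1" unfolding norm_sq_chart[OF assms] s using d_pos[OF assms] by simp
 thus ?thesis using model_square[OF assms] s model_real[of "of_real (vertex n)"] by (simp add: norm_power)
qed

lemma real_near_vertex:
 assumes n: "1 <= n" and x: "\<bar>x - vertex n\<bar> <= 1" "x ~= vertex n"
 shows "cmod (model (of_real x)) < 1"
proof -
 have in_sq: "cmod (model (of_real x)) < 1" if m: "1 <= m" "vertex (Suc m) < x" "x < vertex m" for m
 proof -
  have "of_real x \<in> square m" using m center_eq[OF m(1)] by (auto simp: abs_if diagonal_square_def)
  thus ?thesis using model_preimage_disc m(1) by (auto simp: set_eq_iff)
 qed
 show ?thesis
 proof (cases "x < vertex n")
  case True
  thus ?thesis using in_sq[OF n] vertex_Suc_less[OF n] x by auto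
 next
  case False
  show ?thesis
  proof (cases "n = 1")
   case True
   thus ?thesis using x False model_disc_lt[of "of_real x"] by (simp add: right_vertex_def)
  next
   case False': False
   then obtain m where m: "n = Suc m" "1 <= m" using n by (cases n) auto
   thus ?thesis using in_sq[OF m(2)] vertex_Suc_less[OF m(2)] x False by auto
  qed
 qed
qed

text \<open>On the real axis the model map is positive, and less than its value \<open>1\<close> on both sides of the vertex.\<close>

lemma critical_vertex:
 assumes n: "1 <= n"
 shows "critical_point model (of_real (vertex n))" unfolding critical_point_def
proof
 assume "EX V. open V & of_real (vertex n) \<in> V & inj_on model V"
 then obtain V where V: "open V" "of_real (vertex n) \<in> V" "inj_on model V" by blast
 then obtain r where r: "r > 0" "ball (of_real (vertex n)) r \<subseteq> V" using openE by blast
 define e where "e = min 1 (r / 2)"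
 define h where "h x = cmod (model (of_real x))" for x :: real
 have "continuous_on {vertex n - e..vertex n + e} h"
  unfolding h_def by (intro continuous_intros continuous_on_compose2[OF continuous_on_model[of UNIV]]) auto
 moreover have "0 < e" using r by (simp add: e_def)
 moreover have "h x < h (vertex n)" if "\<bar>x - vertex n\<bar> <= e" "x ~= vertex n" for x
  using real_near_vertex[OF n _ that(2)] that model_vertex[OF n] by (simp add: h_def e_def)
 ultimately obtain x y where xy: "vertex n - e <= x" "x < vertex n" "vertex n < y" "y <= vertex n + e" "h x = h y"
  using not_inj_at_strict_max[of "vertex n" e h] by metis
 have "model (of_real x) = model (of_real y)" using xy(5) model_real[of "of_real x"] model_real[of "of_real y"] by (simp add: h_def)
 moreover have "of_real x \<in> V" "of_real y \<in> V" using xy r by (auto intro!: subsetD[OF r(2)] simp: e_def dist_norm simp flip: of_real_diff)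
 ultimately have "complex_of_real x = of_real y" using inj_onD[OF V(3)] by blast
 thus False using xy by simp
qed

lemma critical_iff:
 "critical_point model z \<longleftrightarrow> z \<in> zeros \<or> (EX n>=1. z = of_real (vertex n))"
 using not_critical critical_zero critical_vertex by blast

end

section \<open>Boundary values of a map between half-planes\<close>

lemma half_plane_approximation:
 assumes "0 <= Im z" "0 < e"
 obtains w where "w \<in> uhp" "dist w z < e"
proof
 show "z + \<i> * of_real (e / 2) \<in> uhp" "dist (z + \<i> * of_real (e / 2)) z < e" using assms by (auto simp: dist_norm norm_mult)
qed

text \<open>The cluster set of \<open>\<phi>\<close> at \<open>x\<close> is the intersection of a nested sequence of compact connected sets, hence connected.
  It contains no point of the open half-plane, since \<open>\<psi>\<close> is continuous there and would send it to \<open>x\<close>. So it is a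
  real interval on which \<open>g\<close> is constant.\<close>

lemma boundary_limit:
 fixes \<phi> \<psi> F g :: "complex => complex" and x :: real
 assumes hom: "homeomorphism uhp uhp \<phi> \<psi>" and F: "continuous_on UNIV F" and g: "continuous_on UNIV g"
  and eq: "!!z. z \<in> uhp ==> g (\<phi> z) = F z"
  and bdd: "!!R. EX M. ALL z:uhp. cmod z <= R --> cmod (\<phi> z) <= M"
  and disc: "!!a b :: real. !!w. a < b ==> EX t:{a..b}. g (of_real t) ~= w"
 shows "EX y. Im y = 0 & (ALL u. (ALL i. u i \<in> uhp) & u ----> of_real x --> (%i. \<phi> (u i)) ----> y)"
proof -
 have \<phi>: "continuous_on uhp \<phi>" "!!z. z \<in> uhp ==> \<phi> z \<in> uhp" and \<psi>: "continuous_on uhp \<psi>" "!!z. z \<in> uhp ==> \<psi> z \<in> uhp"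
  and inv: "!!z. z \<in> uhp ==> \<psi> (\<phi> z) = z" using hom by (auto simp: homeomorphism_def)
 define A where "A n = ball (of_real x) (1 / real (Suc n)) \<inter> uhp" for n
 have A_mono: "A n \<subseteq> A m" if "m <= n" for m n
 proof -
  have "1 / real (Suc n) <= 1 / real (Suc m)" using that by (intro divide_left_mono) auto
  thus ?thesis by (auto simp: A_def)
 qed
 have A_ne: "A n ~= {}" for n
 proof -
  obtain w where "w \<in> uhp" "dist w (of_real x) < 1 / real (Suc n)" using half_plane_approximation[of "of_real x" "1 / real (Suc n)"] by auto
  hence "w \<in> A n" by (simp add: A_def dist_commute)
  thus ?thesis by blast
 qed
 have A_con: "connected (A n)" for n
  unfolding A_def by (intro convex_connected convex_Int convex_ball convex_uhp)
 have A_conv: "u ----> of_real x" if u: "!!n. u n \<in> A n" for u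
 proof (rule LIMSEQ_I)
  fix r :: real assume "0 < r"
  then obtain n where n: "1 / real (Suc n) < r" using nat_approx_posE by blast
  have "norm (u m - of_real x) < r" if "n <= m" for m
  proof -
   have "u m \<in> A n" using u[of m] A_mono[OF that] by blast
   thus ?thesis using n by (simp add: A_def dist_norm norm_minus_commute)
  qed
  thus "EX n. ALL m>=n. norm (u m - of_real x) < r" by blast
 qed
 define S where "S n = closure (\<phi> ` A n)" for n
 have S_mono: "S n \<subseteq> S m" if "m <= n" for m n
  unfolding S_def by (intro closure_mono image_mono A_mono that)
 obtain M where M: "!!z. [|z \<in> uhp; cmod z <= \<bar>x\<bar> + 1|] ==> cmod (\<phi> z) <= M" using bdd by blast
 have S_compact: "compact (S n)" for n
 proof -
  have "\<phi> ` A 0 \<subseteq> cball 0 M"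
  proof
   fix w assume "w \<in> \<phi> ` A 0"
   then obtain z where z: "w = \<phi> z" "z \<in> uhp" "cmod (of_real x - z) < 1" by (auto simp: A_def dist_norm)
   thus "w \<in> cball 0 M" using norm_triangle_sub[of z "of_real x"] M z by (simp add: norm_minus_commute)
  qed
  moreover have "\<phi> ` A n \<subseteq> \<phi> ` A 0" by (intro image_mono A_mono) simp
  ultimately have "\<phi> ` A n \<subseteq> cball 0 M" by (rule order_trans[rotated])
  thus ?thesis unfolding S_def by (metis bounded_cball bounded_subset compact_closure)
 qed
 have S_con: "connected (S n)" for n
  unfolding S_def
  by (intro connected_imp_connected_closure connected_continuous_image A_con continuous_on_subset[OF \<phi>(1)]) (auto simp: A_def)
 define C where "C = \<Inter> (range S)"
 have C_ne: "C ~= {}" unfolding C_def by (rule compact_nest[OF S_compact _ S_mono]) (auto simp: S_def A_ne)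
 have C_con: "connected C" unfolding C_def by (rule connected_nest[OF S_compact S_con S_mono])
 have C_seq: "EX u. (ALL n. u n \<in> A n) & (%n. \<phi> (u n)) ----> w" if "w \<in> C" for w
 proof -
  have "EX z. z \<in> A n & dist (\<phi> z) w < 1 / real (Suc n)" for n
  proof -
   have "w \<in> closure (\<phi> ` A n)" using that by (auto simp: C_def S_def)
   thus ?thesis unfolding closure_approachable by (auto dest!: spec[of _ "1 / real (Suc n)"])
  qed
  then obtain u where u: "!!n. u n \<in> A n" "!!n. dist (\<phi> (u n)) w < 1 / real (Suc n)" by metis
  have "(%n. dist (\<phi> (u n)) w) ----> 0"
   by (rule tendsto_sandwich[OF _ _ tendsto_const LIMSEQ_Suc[OF lim_1_over_n]]) (use u(2) in "auto intro!: always_eventually less_imp_le")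
  thus ?thesis using u(1) tendsto_dist_iff by blast
 qed
 have C_real: "Im w = 0" and C_val: "g w = F (of_real x)" if w: "w \<in> C" for w
 proof -
  obtain u where u: "!!n. u n \<in> A n" "(%n. \<phi> (u n)) ----> w" using C_seq[OF w] by blast
  have up: "u n \<in> uhp" for n using u(1)[of n] by (simp add: A_def)
  have ux: "u ----> of_real x" using A_conv u(1) .
  have "(%n. g (\<phi> (u n))) ----> g w" using g u(2) by (auto simp: continuous_on_sequentially o_def)
  moreover have "(%n. F (u n)) ----> F (of_real x)" using F ux by (auto simp: continuous_on_sequentially o_def)
  moreover have "g (\<phi> (u n)) = F (u n)" for n using eq[OF up] .
  ultimately show "g w = F (of_real x)" using LIMSEQ_unique by simp blast
  have "(%n. Im (\<phi> (u n))) ----> Im w" using u(2) by (rule tendsto_Im)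
  moreover have "0 <= Im (\<phi> (u n))" for n using \<phi>(2)[OF up[of n]] by simp
  ultimately have "0 <= Im w" using LIMSEQ_le_const by blast
  moreover have "\<not> 0 < Im w"
  proof
   assume "0 < Im w"
   hence "(%n. \<psi> (\<phi> (u n))) ----> \<psi> w" using \<psi>(1) u(2) \<phi>(2)[OF up] by (auto simp: continuous_on_sequentially o_def)
   hence "u ----> \<psi> w" using inv up by simp
   hence "\<psi> w = of_real x" using ux LIMSEQ_unique by blast
   thus False using \<psi>(2)[of w] \<open>0 < Im w\<close> by simp
  qed
  ultimately show "Im w = 0" by simp
 qed
 obtain y where y: "y \<in> C" using C_ne by blast
 have single: "w = y" if w: "w \<in> C" for w
 proof (rule ccontr)
  assume "w ~= y"
  define a b where "a = min (Re w) (Re y)" and "b = max (Re w) (Re y)"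
  have "a < b" using \<open>w ~= y\<close> C_real[OF w] C_real[OF y] by (auto simp: a_def b_def complex_eq_iff)
  then obtain t where t: "t \<in> {a..b}" "g (of_real t) ~= F (of_real x)" using disc by blast
  have "connected (Re ` C)" using C_con by (intro connected_continuous_image continuous_intros)
  moreover have "Re w \<in> Re ` C" "Re y \<in> Re ` C" using w y by auto
  moreover have "a \<in> Re ` C" "b \<in> Re ` C" using w y by (auto simp: a_def b_def min_def max_def)
  ultimately have "t \<in> Re ` C" using t(1) connectedD_interval[of "Re ` C" a b t] by simp
  then obtain c where "c \<in> C" "t = Re c" by blast
  hence "c = of_real t" using C_real[of c] by (simp add: complex_eq_iff)
  thus False using C_val[OF \<open>c \<in> C\<close>] t(2) by simp
 qed
 have nbhd: "EX n. S n \<subseteq> V" if V: "open V" "y \<in> V" for V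
 proof (rule ccontr)
  assume "\<nexists>n. S n \<subseteq> V"
  hence "\<Inter> (range (%n. S n - V)) ~= {}" by (intro compact_nest compact_diff S_compact V) (use S_mono in blast)+
  then obtain w where "w \<in> C" "w \<notin> V" by (auto simp: C_def)
  thus False using single V by blast
 qed
 have "(%i. \<phi> (u i)) ----> y" if u: "!!i. u i \<in> uhp" "u ----> of_real x" for u
 proof (rule topological_tendstoI)
  fix V assume V: "open V" "y \<in> V"
  then obtain n where n: "S n \<subseteq> V" using nbhd by blast
  have "eventually (%i. u i \<in> ball (of_real x) (1 / real (Suc n))) sequentially" by (rule topological_tendstoD[OF u(2)]) auto
  thus "eventually (%i. \<phi> (u i) \<in> V) sequentially"
  proof eventually_elim
   case (elim i)
   hence "u i \<in> A n" using u(1)[of i] by (simp add: A_def)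
   hence "\<phi> (u i) \<in> S n" unfolding S_def by (intro subsetD[OF closure_subset] imageI)
   thus ?case using n by blast
  qed
 qed
 thus ?thesis using C_real[OF y] by blast
qed

lemma half_plane_sequence:
 assumes "0 <= Im z"
 obtains u where "!!i. u i \<in> uhp" "u ----> z"
proof -
 have "EX w. w \<in> uhp & dist w z < 1 / real (Suc i)" for i
  using half_plane_approximation[OF assms, of "1 / real (Suc i)"] by (metis of_nat_0_less_iff zero_less_Suc zero_less_divide_1_iff)
 then obtain u where u: "!!i. u i \<in> uhp" "!!i. dist (u i) z < 1 / real (Suc i)" by metis
 have "(%n. dist (u n) z) ----> 0"
  by (rule tendsto_sandwich[OF _ _ tendsto_const LIMSEQ_Suc[OF lim_1_over_n]]) (use u(2) in "auto intro!: always_eventually less_imp_le")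
 thus ?thesis using that u(1) tendsto_dist_iff by blast
qed

text \<open>Continuity of the extension at a boundary point is tested along sequences of interior points, by a
  diagonal choice.\<close>

lemma boundary_extension:
 fixes \<phi> \<psi> F g :: "complex => complex"
 assumes hom: "homeomorphism uhp uhp \<phi> \<psi>" and F: "continuous_on UNIV F" and g: "continuous_on UNIV g"
  and eq: "!!z. z \<in> uhp ==> g (\<phi> z) = F z"
  and bdd: "!!R. EX M. ALL z:uhp. cmod z <= R --> cmod (\<phi> z) <= M"
  and disc: "!!a b :: real. !!w. a < b ==> EX t:{a..b}. g (of_real t) ~= w"
 shows "EX \<Phi>. continuous_on {z. 0 <= Im z} \<Phi> & (ALL z:uhp. \<Phi> z = \<phi> z) & (ALL z. Im z = 0 --> Im (\<Phi> z) = 0)"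
proof -
 have \<phi>: "continuous_on uhp \<phi>" "!!z. z \<in> uhp ==> \<phi> z \<in> uhp" using hom by (auto simp: homeomorphism_def)
 define lim where "lim z y \<longleftrightarrow> (ALL u. (ALL i. u i \<in> uhp) & u ----> z --> (%i. \<phi> (u i)) ----> y)" for z y
 have "EX y. Im y = 0 & lim (of_real x) y" for x
  unfolding lim_def by (rule boundary_limit[OF hom F g eq bdd disc])
 then obtain E where E: "!!x. Im (E x) = 0" "!!x. lim (of_real x) (E x)" by metis
 define \<Phi> where "\<Phi> z = (if 0 < Im z then \<phi> z else E (Re z))" for z
 have lim: "lim z (\<Phi> z)" if "0 <= Im z" for z
 proof (cases "0 < Im z")
  case True
  thus ?thesis using \<phi>(1) by (auto simp: lim_def \<Phi>_def continuous_on_sequentially o_def)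
 next
  case False
  hence "z = of_real (Re z)" using that by (simp add: complex_eq_iff)
  thus ?thesis using E(2)[of "Re z"] False by (simp add: \<Phi>_def)
 qed
 have "continuous_on {z. 0 <= Im z} \<Phi>" unfolding continuous_on_sequentially o_def
 proof (intro allI ballI impI, elim conjE)
  fix z u assume z: "z \<in> {z. 0 <= Im z}" and u: "ALL n. u n \<in> {z. 0 <= Im z}" "u ----> z"
  have "EX w. w \<in> uhp & dist w (u n) < 1 / real (Suc n) & dist (\<phi> w) (\<Phi> (u n)) < 1 / real (Suc n)" for n
  proof -
   obtain v where v: "!!i. v i \<in> uhp" "v ----> u n" using half_plane_sequence u(1) by blast
   hence "(%i. \<phi> (v i)) ----> \<Phi> (u n)" using lim[of "u n"] u(1) by (auto simp: lim_def)
   hence "eventually (%i. dist (\<phi> (v i)) (\<Phi> (u n)) < 1 / real (Suc n)) sequentially" by (rule tendstoD) simp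
   moreover have "eventually (%i. dist (v i) (u n) < 1 / real (Suc n)) sequentially" using v(2) by (rule tendstoD) simp
   ultimately have "eventually (%i. dist (\<phi> (v i)) (\<Phi> (u n)) < 1 / real (Suc n) & dist (v i) (u n) < 1 / real (Suc n)) sequentially"
    by eventually_elim blast
   thus ?thesis using v(1) eventually_happens'[OF sequentially_bot] by blast
  qed
  then obtain w where w: "!!n. w n \<in> uhp" "!!n. dist (w n) (u n) < 1 / real (Suc n)" "!!n. dist (\<phi> (w n)) (\<Phi> (u n)) < 1 / real (Suc n)" by metis
  have small: "(%n. 1 / real (Suc n)) ----> 0" by (rule LIMSEQ_Suc[OF lim_1_over_n])
  have "(%n. w n - u n) ----> 0" "(%n. \<Phi> (u n) - \<phi> (w n)) ----> 0"
   by (rule Lim_null_comparison[OF _ small]; use w(2,3) in "auto intro!: always_eventually less_imp_le simp: dist_norm norm_minus_commute")+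
  hence "(%n. (w n - u n) + u n) ----> 0 + z" using u(2) by (intro tendsto_add)
  hence "(%n. \<phi> (w n)) ----> \<Phi> z" using lim[of z] z w(1) by (auto simp: lim_def)
  hence "(%n. (\<Phi> (u n) - \<phi> (w n)) + \<phi> (w n)) ----> 0 + \<Phi> z"
   using \<open>(%n. \<Phi> (u n) - \<phi> (w n)) ----> 0\<close> by (intro tendsto_add)
  thus "(%n. \<Phi> (u n)) ----> \<Phi> z" by simp
 qed
 thus ?thesis using E(1) by (intro exI[of _ \<Phi>]) (auto simp: \<Phi>_def)
qed

lemma half_plane_agree:
 assumes "continuous_on {z. 0 <= Im z} f" "continuous_on {z. 0 <= Im z} h" "!!z. z \<in> uhp ==> f z = h z" "0 <= Im z"
 shows "f z = (h z :: complex)"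
proof -
 obtain u where u: "!!i. u i \<in> uhp" "u ----> z" using half_plane_sequence[OF assms(4)] by blast
 have cu: "0 <= Im (u i)" for i using u(1)[of i] by simp
 have "(%i. f (u i)) ----> f z" "(%i. h (u i)) ----> h z" using assms(1,2,4) u(2) cu by (auto simp: continuous_on_sequentially o_def)
 thus ?thesis using assms(3)[OF u(1)] LIMSEQ_unique by auto
qed

lemma half_plane_reflection:
 fixes \<Phi> :: "complex => complex"
 assumes c: "continuous_on {z. 0 <= Im z} \<Phi>" and r: "!!z. Im z = 0 ==> Im (\<Phi> z) = 0"
 shows "continuous_on UNIV (%z. if 0 <= Im z then \<Phi> z else cnj (\<Phi> (cnj z)))"
proof -
 have U: "UNIV = {z. 0 <= Im z} \<union> {z. Im z <= 0}" by auto
 show ?thesis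
  unfolding U
 proof (rule continuous_on_cases)
  show "continuous_on {z. Im z <= 0} (%z. cnj (\<Phi> (cnj z)))" by (intro continuous_on_cnj continuous_on_compose2[OF c] continuous_intros) auto
  show "ALL z. z \<in> {z. 0 <= Im z} & \<not> 0 <= Im z \<or> z \<in> {z. Im z <= 0} & 0 <= Im z --> \<Phi> z = cnj (\<Phi> (cnj z))"
  proof (intro allI impI)
   fix z assume "z \<in> {z. 0 <= Im z} & \<not> 0 <= Im z \<or> z \<in> {z. Im z <= 0} & 0 <= Im z"
   hence z: "Im z = 0" by auto
   hence "cnj z = z" by (simp add: complex_eq_iff)
   thus "\<Phi> z = cnj (\<Phi> (cnj z))" using r[OF z] unfolding \<open>cnj z = z\<close> by (simp add: complex_eq_iff)
  qed
 qed (use c in "auto simp: closed_halfspace_Im_ge closed_halfspace_Im_le")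
qed

text \<open>The assumptions are symmetric in \<open>(\<phi>, g)\<close> and \<open>(\<psi>, F)\<close>, so both maps extend, and the extensions are
  inverse to each other because this holds on a dense set.\<close>

lemma reflected_homeomorphism:
 fixes \<phi> \<psi> F g :: "complex => complex"
 assumes hom: "homeomorphism uhp uhp \<phi> \<psi>" and F: "continuous_on UNIV F" and g: "continuous_on UNIV g"
  and eq: "!!z. z \<in> uhp ==> g (\<phi> z) = F z"
  and bdd: "!!R. EX M. ALL z:uhp. cmod z <= R --> cmod (\<phi> z) <= M" "!!R. EX M. ALL z:uhp. cmod z <= R --> cmod (\<psi> z) <= M"
  and disc: "!!a b :: real. !!w. a < b ==> EX t:{a..b}. g (of_real t) ~= w" "!!a b :: real. !!w. a < b ==> EX t:{a..b}. F (of_real t) ~= w"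
  and cnj: "!!z. g (cnj z) = cnj (g z)" "!!z. F (cnj z) = cnj (F z)"
 shows "EX \<Phi> \<Psi>. homeomorphism UNIV UNIV \<Phi> \<Psi> & (ALL z. F z = g (\<Phi> z))"
proof -
 have inv: "!!z. z \<in> uhp ==> \<psi> (\<phi> z) = z" "!!z. z \<in> uhp ==> \<phi> (\<psi> z) = z"
  and up: "!!z. z \<in> uhp ==> \<phi> z \<in> uhp" "!!z. z \<in> uhp ==> \<psi> z \<in> uhp" using hom by (auto simp: homeomorphism_def)
 obtain \<Phi> where \<Phi>: "continuous_on {z. 0 <= Im z} \<Phi>" "!!z. z \<in> uhp ==> \<Phi> z = \<phi> z" "!!z. Im z = 0 ==> Im (\<Phi> z) = 0"
  using boundary_extension[OF hom F g eq bdd(1) disc(1)] by blast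
 have eq': "F (\<psi> z) = g z" if "z \<in> uhp" for z using eq[OF up(2)[OF that]] inv(2)[OF that] by simp
 obtain \<Psi> where \<Psi>: "continuous_on {z. 0 <= Im z} \<Psi>" "!!z. z \<in> uhp ==> \<Psi> z = \<psi> z" "!!z. Im z = 0 ==> Im (\<Psi> z) = 0"
  using boundary_extension[OF homeomorphism_symD[OF hom] g F eq' bdd(2) disc(2)] by blast
 have pos: "0 < Im (\<Phi> z)" "0 < Im (\<Psi> z)" if "0 < Im z" for z
  using \<Phi>(2)[of z] \<Psi>(2)[of z] up[of z] that by auto
 have nn: "0 <= Im (\<Phi> z)" "0 <= Im (\<Psi> z)" if "0 <= Im z" for z
  using that pos[of z] \<Phi>(3)[of z] \<Psi>(3)[of z] by (cases "Im z = 0"; simp)+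
 have i1: "\<Psi> (\<Phi> z) = z" if "0 <= Im z" for z
  by (rule half_plane_agree[where h = "%z. z"]) (use that \<Phi> \<Psi> nn up inv in "auto intro!: continuous_on_compose2[OF \<Psi>(1) \<Phi>(1)]")
 have i2: "\<Phi> (\<Psi> z) = z" if "0 <= Im z" for z
  by (rule half_plane_agree[where h = "%z. z"]) (use that \<Phi> \<Psi> nn up inv in "auto intro!: continuous_on_compose2[OF \<Phi>(1) \<Psi>(1)]")
 have i3: "g (\<Phi> z) = F z" if "0 <= Im z" for z
  by (rule half_plane_agree[where h = F]) (use that \<Phi> eq in "auto intro!: continuous_on_compose2[OF g \<Phi>(1)] continuous_on_subset[OF F]")
 define \<Phi>' where "\<Phi>' z = (if 0 <= Im z then \<Phi> z else cnj (\<Phi> (cnj z)))" for z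
 define \<Psi>' where "\<Psi>' z = (if 0 <= Im z then \<Psi> z else cnj (\<Psi> (cnj z)))" for z
 have "continuous_on UNIV \<Phi>'" "continuous_on UNIV \<Psi>'"
  unfolding \<Phi>'_def \<Psi>'_def by (intro half_plane_reflection \<Phi> \<Psi>; assumption)+
 moreover have "\<Psi>' (\<Phi>' z) = z" for z
 proof (cases "0 <= Im z")
  case True
  thus ?thesis using i1 nn by (simp add: \<Phi>'_def \<Psi>'_def)
 next
  case False
  thus ?thesis using i1[of "cnj z"] pos[of "cnj z"] by (simp add: \<Phi>'_def \<Psi>'_def)
 qed
 moreover have "\<Phi>' (\<Psi>' z) = z" for z
 proof (cases "0 <= Im z")
  case True
  thus ?thesis using i2 nn by (simp add: \<Phi>'_def \<Psi>'_def)
 next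
  case False
  thus ?thesis using i2[of "cnj z"] pos[of "cnj z"] by (simp add: \<Phi>'_def \<Psi>'_def)
 qed
 ultimately have "homeomorphism UNIV UNIV \<Phi>' \<Psi>'" by (intro homeomorphismI) auto
 moreover have "F z = g (\<Phi>' z)" for z
  using i3[of z] i3[of "cnj z"] by (auto simp: \<Phi>'_def cnj)
 ultimately show ?thesis by blast
qed

section \<open>Quasi-regularity\<close>

context even_multiplicities
begin

lemma Im_hlog_bounded: "EX B. ALL z:uhp. cmod z <= R --> Im (hlog z) <= B"
proof -
 define m where "m = Suc (nat \<lceil>R\<rceil>)"
 have "Im (hlog z) <= max (comb_height m) ((1 + R) * pi)" if z: "z \<in> uhp" "cmod z <= R" for z
  using uhp_cases[OF z(1)]
 proof (elim disjE exE conjE)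
  assume "z \<in> op_disc"
  hence "Im (hlog z) < comb_height 1" by (rule op_disc_hlog)
  also have "... <= comb_height m" by (rule comb_height_le) (auto simp: m_def)
  finally show ?thesis by simp
 next
  assume o: "z \<in> cl_outer"
  have "\<bar>Im (flat z)\<bar> <= \<bar>Im z\<bar>" using o tent_nonneg[of "Re z"] by (simp add: flat_def cl_outer_def)
  hence "cmod (flat z) <= cmod z" by (auto simp: cmod_def flat_def power2_eq_iff intro!: power_mono abs_le_square_iff[THEN iffD1])
  hence "(1 + cmod (flat z)) * ang (flat z) <= (1 + R) * pi"
   using z ang_range[of "flat z"] flat_cl_outer[OF o] norm_ge_zero[of z] by (intro mult_mono; cases "flat z = 0"; simp)
  thus ?thesis by (simp add: hlog_outer[OF o] outer_def)
 next
  fix n assume n: "1 <= n" "z \<in> op_tri n"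
  have "\<bar>Re z - center n\<bar> < d n / 2" using n by (auto simp: op_tri_def)
  hence "real n < R" using center_eq[OF n(1)] vertex_le[OF n(1)] abs_Re_le_cmod[of z] z(2) by linarith
  hence "Suc n <= m" unfolding m_def by linarith
  hence "comb_height (Suc n) <= comb_height m" by (intro comb_height_le) auto
  thus ?thesis using op_tri_hlog(5)[OF n] by simp
 qed
 thus ?thesis by blast
qed

lemma countable_zeros: "countable zeros" by (simp add: zeros_def)

text \<open>On an interval of constancy every point would be critical, but there are only countably many critical points.\<close>

lemma model_real_nonconstant:
 fixes a b :: real
 assumes "a < b"
 shows "EX t:{a..b}. model (of_real t) ~= w"
proof (rule ccontr)
 assume "\<not> ?thesis"
 hence const: "!!t. t \<in> {a..b} ==> model (of_real t) = w" by blast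
 have "critical_point model (of_real t)" if t: "t \<in> {a<..<b}" for t
  unfolding critical_point_def
 proof
  assume "EX U. open U & complex_of_real t \<in> U & inj_on model U"
  then obtain U where U: "open U" "complex_of_real t \<in> U" "inj_on model U" by blast
  then obtain e where e: "e > 0" "ball (of_real t) e \<subseteq> U" using openE by blast
  define s where "s = min b (t + e / 2)"
  have s: "t < s" "s <= b" "s - t < e" using t e(1) by (auto simp: s_def)
  have "cmod (complex_of_real t - of_real s) < e" using s by (simp flip: of_real_diff)
  hence "of_real s \<in> U" using e(2) by (auto simp: dist_norm)
  moreover have "model (of_real s) = model (of_real t)" using const[of s] const[of t] s t by simp
  ultimately have "complex_of_real s = of_real t" using inj_onD[OF U(3)] U(2) by blast
  thus False using s by simp
 qed
 hence "complex_of_real ` {a<..<b} \<subseteq> zeros \<union> (%n. of_real (vertex n)) ` {1..}" using critical_iff by fastforce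
 moreover have "countable (zeros \<union> (%n. complex_of_real (vertex n)) ` {1..})" using countable_zeros by simp
 ultimately have "countable (complex_of_real ` {a<..<b})" by (rule countable_subset)
 hence "countable {a<..<b}" by (rule countable_image_inj_on) (simp add: inj_on_def)
 thus False using uncountable_open_interval[of a b] assms by blast
qed

lemma continuous_on_hlog_uhp: "continuous_on uhp hlog" by (rule continuous_on_subset[OF continuous_on_hlog]) (auto dest: zeros_real)

lemma connected_comb_domain: "connected comb_domain"
 unfolding hlog_image[symmetric] by (intro connected_continuous_image continuous_on_hlog_uhp connected_uhp)

end

context comb_limit
begin

lemma g_real_nonconstant:
 fixes a b :: real
 assumes "a < b"
 shows "EX t:{a..b}. g (of_real t) ~= w"
proof (rule ccontr)
 assume "\<not> ?thesis"
 hence const: "!!t. t \<in> {a..b} ==> g (of_real t) = w" by blast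
 have lim: "complex_of_real a islimpt complex_of_real ` {a..b}" using islimpt_Icc[OF assms, of a] assms islimpt_isCont_image[of a "{a..b}" complex_of_real] by (auto simp: eventually_at_filter)
 have "g z - w = 0" for z
  by (rule analytic_continuation[OF _ open_UNIV connected_UNIV _ UNIV_I lim])
   (use const in "auto intro!: holomorphic_intros g_holomorphic")
 hence "g constant_on UNIV" by (auto simp: constant_on_def)
 thus False using g_nonconstant by blast
qed

text \<open>Local bounds for \<open>\<phi>\<close> and its inverse come from properness of \<open>f\<close> and \<open>hlog\<close>: the real part is the
  logarithm of the modulus of the common value.\<close>

lemma quasiregular_model: "quasiregular_plane 5000 model"
proof -
 have cf: "continuous_on uhp f" using f_holomorphic by (rule holomorphic_on_imp_continuous_on)
 have cg: "continuous_on A g" for A using g_holomorphic holomorphic_on_imp_continuous_on continuous_on_subset by blast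
 have bij: "f ` uhp = comb_domain" using f_bij[OF connected_comb_domain] by (simp add: bij_betw_def)
 obtain f' where f': "homeomorphism uhp comb_domain f f'" using invariance_of_domain_homeomorphism[OF open_uhp cf _ inj_f] bij by auto
 obtain h' where h': "homeomorphism uhp comb_domain hlog h'"
  using invariance_of_domain_homeomorphism[OF open_uhp continuous_on_hlog_uhp _ hlog_inj] hlog_image by auto
 have hom: "homeomorphism uhp uhp (f' \<circ> hlog) (h' \<circ> f)" using homeomorphism_compose[OF h' homeomorphism_symD[OF f']] .
 have up: "f' (hlog z) \<in> uhp" "h' (f z) \<in> uhp" if "z \<in> uhp" for z
  using homeomorphism_image1[OF hom] homeomorphism_image2[OF hom] that by (auto simp: o_def)
 have ff: "f (f' (hlog z)) = hlog z" if "z \<in> uhp" for z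
  using homeomorphism_apply2[OF f', of "hlog z"] hlog_image that by blast
 have hh: "hlog (h' (f z)) = f z" if "z \<in> uhp" for z
  using homeomorphism_apply2[OF h', of "f z"] bij that by blast
 have exph: "exp (hlog z) = model z" if "z \<in> uhp" for z
  by (rule model_upper[symmetric]) (use that zeros_real[of z] in auto)
 have "EX \<Phi> \<Psi>. homeomorphism UNIV UNIV \<Phi> \<Psi> & (ALL z. model z = g (\<Phi> z))"
 proof (rule reflected_homeomorphism[OF hom continuous_on_model cg])
  show "g ((f' \<circ> hlog) z) = model z" if "z \<in> uhp" for z
   using exp_f[OF up(1)[OF that]] ff[OF that] exph[OF that] by simp
  show "EX M. ALL z:uhp. cmod z <= R --> cmod ((f' \<circ> hlog) z) <= M" for R
  proof -
   obtain B where B: "!!z. [|z \<in> uhp; cmod z <= R|] ==> Im (hlog z) <= B" using Im_hlog_bounded by blast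
   obtain M where M: "!!z. [|z \<in> uhp; Re (f z) <= max B (pi * R); Im (f z) <= max B (pi * R)|] ==> cmod z <= M" using f_proper by blast
   have "cmod (f' (hlog z)) <= M" if z: "z \<in> uhp" "cmod z <= R" for z
   proof -
    have "exp (Re (hlog z)) <= exp (pi * cmod z)" using model_bound[of z] exph[OF z(1)] by (metis norm_exp_eq_Re)
    hence "Re (hlog z) <= pi * cmod z" by simp
    also have "... <= pi * R" using z(2) by simp
    finally show ?thesis using M[OF up(1)[OF z(1)]] ff[OF z(1)] B[OF z] by simp
   qed
   thus ?thesis by auto
  qed
  show "EX M. ALL z:uhp. cmod z <= R --> cmod ((h' \<circ> f) z) <= M" for R
  proof -
   obtain B where B: "!!z. [|z \<in> uhp; cmod z <= R|] ==> Im (f z) <= B" using Im_f_bounded by blast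
   have "compact (g ` cball 0 R)" by (intro compact_continuous_image cg compact_cball)
   hence "bounded (g ` cball 0 R)" by (rule compact_imp_bounded)
   then obtain C where C: "ALL w:g ` cball 0 R. cmod w <= C" unfolding bounded_iff ..
   obtain M where M: "ALL z:cuhp. Re (hlog z) <= max B C & Im (hlog z) <= max B C --> cmod z <= M" using hlog_proper[of "max B C"] by blast
   have "cmod (h' (f z)) <= M" if z: "z \<in> uhp" "cmod z <= R" for z
   proof -
    have "cmod (g z) <= C" using C z(2) by simp
    hence "exp (Re (f z)) <= C" using exp_f[OF z(1)] by (metis norm_exp_eq_Re)
    hence "Re (f z) <= C" using exp_ge_add_one_self[of "Re (f z)"] by linarith
    thus ?thesis using bspec[OF M, of "h' (f z)"] up(2)[OF z(1)] hh[OF z(1)] B[OF z] by (simp add: le_max_iff_disj)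
   qed
   thus ?thesis by auto
  qed
 qed (use g_real_nonconstant model_real_nonconstant g_cnj model_cnj in blast)+
 then obtain \<Phi> \<Psi> where \<Phi>: "homeomorphism UNIV UNIV \<Phi> \<Psi>" "!!z. model z = g (\<Phi> z)" by blast
 have "quasiconformal_plane 5000 \<Phi>"
 proof (rule quasiconformal_plane_of_factor[OF g_holomorphic g_nonconstant \<Phi> countable_zeros])
  show "AE z in lborel. EX A. (model has_derivative A) (at z) & dilatation_le 5000 A" using AE_not_kinks by eventually_elim (rule model_derivative)
 qed (auto intro: model_lipschitz)
 thus ?thesis unfolding quasiregular_plane_def using g_holomorphic \<Phi>(2) by (intro exI[of _ g] exI[of _ \<Phi>]) (auto simp: fun_eq_iff)
qed

end

lemma (in even_multiplicities) quasiregular_plane_model: "quasiregular_plane 5000 model"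
proof -
 obtain N c \<beta> g f where "comb_limit d N c \<beta> g f" using comb_limit_exists by blast
 thus ?thesis by (rule comb_limit.quasiregular_model)
qed

section \<open>Branched coverings from charts\<close>

definition disc_chart :: "(complex => complex) => (complex => complex) => complex set => bool" where
 "disc_chart f \<psi> C \<longleftrightarrow> (EX m>=1. EX \<phi> \<phi>'. homeomorphism C (ball 0 1) \<phi> \<phi>' & (ALL z:C. \<psi> (f z) = \<phi> z ^ m))"

text \<open>A point has a relatively clopen neighbourhood in \<open>P\<close> that is a disc in suitable coordinates. As discs
  are connected, this neighbourhood is the component, so components need not be identified beforehand.\<close>

definition clopen_charts :: "(complex => complex) => (complex => complex) => complex set => bool" where
 "clopen_charts f \<psi> P \<longleftrightarrow>
   (ALL z:P. EX C. z \<in> C & openin (top_of_set P) C & closedin (top_of_set P) C & disc_chart f \<psi> C)"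

lemma disc_chart_connected: "disc_chart f \<psi> C ==> connected C" unfolding disc_chart_def
 by (metis connected_ball homeomorphic_connectedness homeomorphic_def)

lemma clopen_charts_component:
 assumes nice: "clopen_charts f \<psi> P" and K: "K \<in> components P"
 shows "disc_chart f \<psi> K"
proof -
 have K': "K ~= {}" "K \<subseteq> P" "connected K" using K in_components_nonempty in_components_subset in_components_connected by blast+
 then obtain z where z: "z \<in> K" "z \<in> P" by blast
 then obtain C where C: "z \<in> C" "openin (top_of_set P) C" "closedin (top_of_set P) C" "disc_chart f \<psi> C"
  using nice unfolding clopen_charts_def by blast
 have "openin (top_of_set K) C" "closedin (top_of_set K) C" using C(2) openin_imp_subset components_maximal[OF K disc_chart_connected[OF C(4)]] C(1) z(1) openin_subset_trans[OF C(2) _ K'(2)] closedin_subset_trans[OF C(3) _ K'(2)] by blast+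
 hence "C = K" using K'(3) C(1) unfolding connected_clopen by blast
 thus ?thesis using C(4) by simp
qed

lemma branched_coveringI:
 assumes "continuous_on U f" "f ` U = V"
  and W: "!!w. w \<in> V ==> EX W \<psi> \<psi>'. open W & w \<in> W & W \<subseteq> V & homeomorphism W (ball 0 1) \<psi> \<psi>' & \<psi> w = 0
        & clopen_charts f \<psi> (U \<inter> f -` W)"
 shows "branched_covering f U V" unfolding branched_covering_def
proof (intro conjI ballI assms(1,2))
 fix w assume "w \<in> V"
 then obtain W \<psi> \<psi>' where W: "open W" "w \<in> W" "W \<subseteq> V" "homeomorphism W (ball 0 1) \<psi> \<psi>'" "\<psi> w = 0"
  and nice: "clopen_charts f \<psi> (U \<inter> f -` W)" using assms(3)[OF \<open>w \<in> V\<close>] by blast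
 have charts: "EX m>=1. EX (\<phi> :: complex => complex) \<phi>' (\<psi> :: complex => complex) \<psi>'.
      homeomorphism C (ball 0 1) \<phi> \<phi>' & homeomorphism W (ball 0 1) \<psi> \<psi>' &
      \<psi> w = 0 & (ALL z:C. \<psi> (f z) = \<phi> z ^ (m::nat))" if C: "C \<in> components (U \<inter> f -` W)" for C
  using clopen_charts_component[OF nice C] W(4,5) unfolding disc_chart_def by blast
 show "EX W. open W & w \<in> W & W \<subseteq> V &
    (ALL C: components (U \<inter> f -` W). EX m>=1. EX (\<phi> :: complex => complex) \<phi>' (\<psi> :: complex => complex) \<psi>'.
      homeomorphism C (ball 0 1) \<phi> \<phi>' & homeomorphism W (ball 0 1) \<psi> \<psi>' &
      \<psi> w = 0 & (ALL z:C. \<psi> (f z) = \<phi> z ^ m))" by (intro exI[of _ W] conjI ballI W(1-3) charts)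
qed

lemma disc_chartI:
 assumes C: "open C" "continuous_on C \<phi>" "inj_on \<phi> C" "\<phi> ` C = ball 0 1" and m: "1 <= m"
  and eq: "!!z. z \<in> C ==> \<psi> (f z) = \<phi> z ^ m"
 shows "disc_chart f \<psi> C"
proof -
 obtain \<phi>' where "homeomorphism C (\<phi> ` C) \<phi> \<phi>'" using invariance_of_domain_homeomorphism[OF C(1,2) _ C(3)] by auto
 thus ?thesis unfolding disc_chart_def using C(4) m eq by metis
qed

lemma clopen_chartsI:
 assumes "!!z. z \<in> P ==> EX C. z \<in> C & open C & C \<subseteq> P & open (P - C) & disc_chart f \<psi> C"
 shows "clopen_charts f \<psi> P" unfolding clopen_charts_def
proof
 fix z assume "z \<in> P"
 then obtain C where C: "z \<in> C" "open C" "C \<subseteq> P" "open (P - C)" "disc_chart f \<psi> C" using assms by blast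
 have "closedin (top_of_set P) C" using C(4) C(3) by (auto simp: open_subset closedin_def)
 thus "EX C. z \<in> C & openin (top_of_set P) C & closedin (top_of_set P) C & disc_chart f \<psi> C" using C open_subset by blast
qed

text \<open>The image of a continuous section is the set where \<open>S (f z) = z\<close>, hence relatively closed, and it is
  open by invariance of domain. So it is a component over which \<open>f\<close> is a homeomorphism.\<close>

lemma section_chart:
 fixes f S :: "complex => complex"
 assumes P: "open P" and f: "continuous_on P f" and W: "open W" and hom: "homeomorphism W (ball 0 1) \<psi> \<psi>'"
  and S: "continuous_on W S" and sec: "!!u. u \<in> W ==> S u \<in> P & f (S u) = u" and PW: "!!z. z \<in> P ==> f z \<in> W"
 shows "open (S ` W) & S ` W \<subseteq> P & open (P - S ` W) & disc_chart f \<psi> (S ` W)"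
proof (intro conjI)
 have "inj_on S W" using sec by (metis inj_onI)
 thus op: "open (S ` W)" by (rule invariance_of_domain[OF S W])
 show "S ` W \<subseteq> P" using sec by blast
 have mem: "z \<in> S ` W \<longleftrightarrow> S (f z) = z" if "z \<in> P" for z using sec PW[OF that] by (metis imageE imageI)
 have eq: "P - S ` W = P \<inter> (%z. S (f z) - z) -` (- {0})"
 proof (rule set_eqI)
  fix z show "z \<in> P - S ` W \<longleftrightarrow> z \<in> P \<inter> (%z. S (f z) - z) -` (- {0})"
   using mem[of z] by (cases "z \<in> P") (simp_all del: image_iff)
 qed
 show "open (P - S ` W)" unfolding eq
  by (intro continuous_open_preimage P continuous_on_diff continuous_on_compose2[OF S f] continuous_on_id) (use PW in auto)
 have img: "f ` S ` W = W" using sec by force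
 show "disc_chart f \<psi> (S ` W)"
 proof (rule disc_chartI[OF op, where \<phi> = "\<psi> \<circ> f" and m = 1])
  show "continuous_on (S ` W) (\<psi> \<circ> f)"
   using sec by (intro continuous_on_compose continuous_on_subset[OF f]) (auto simp: img homeomorphism_cont1[OF hom])
  show "inj_on (\<psi> \<circ> f) (S ` W)" using sec homeomorphism_apply1[OF hom] by (auto intro!: inj_onI) metis
  show "(\<psi> \<circ> f) ` S ` W = ball 0 1" unfolding image_comp[symmetric] img by (rule homeomorphism_image1[OF hom])
 qed auto
qed

text \<open>The logarithmic coordinate on a neighbourhood \<open>exp ` ball l e\<close> of \<open>exp l\<close>, scaled to the unit
  disc. It inverts the exponential on every translate of the ball by a period.\<close>

definition log_chart :: "complex => real => complex => complex" where
 "log_chart l e u = Ln (u / exp l) / of_real e"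

text \<open>The periods of the exponential function.\<close>

abbreviation turn :: "int => complex" where "turn k \<equiv> of_real (2 * pi * of_int k) * \<i>"

lemma exp_eq_imp: "exp (v::complex) = exp u ==> EX k::int. v = u + turn k" unfolding exp_eq by (auto simp: mult_ac)

lemma exp_shift: "exp (v + turn k) = exp v" by (subst exp_eq) (auto simp: mult_ac intro!: exI[of _ k])

lemma log_chart_exp:
 assumes "cmod (v - (l + turn k)) < 1"
 shows "log_chart l e (exp v) = (v - (l + turn k)) / of_real e"
proof -
 define u where "u = v - (l + turn k)"
 have "exp v = exp (u + l)" using exp_shift[of "u + l" k] by (simp add: u_def algebra_simps)
 hence "exp v / exp l = exp u" by (simp add: exp_add)
 moreover have "Ln (exp u) = u" using assms abs_Im_le_cmod[of u] pi_gt3 by (simp add: u_def)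
 ultimately show ?thesis by (simp add: log_chart_def u_def)
qed

lemma exp_ball_inj:
 assumes "cmod (v - l) < 1" "cmod (u - l) < 1" "exp v = exp u"
 shows "v = u"
proof -
 have "log_chart l 1 (exp v) = v - l" "log_chart l 1 (exp u) = u - l" using log_chart_exp[of v l 0 1] log_chart_exp[of u l 0 1] assms(1,2) by simp_all
 hence "v - l = u - l" using assms(3) by metis
 thus ?thesis by simp
qed

lemma exp_ball_open: "e <= 1 ==> open (exp ` ball l e :: complex set)"
 by (rule invariance_of_domain) (auto intro!: continuous_intros inj_onI exp_ball_inj[of _ l] simp: dist_norm norm_minus_commute)

lemma log_chart_homeomorphism:
 assumes e: "0 < e" "e <= 1"
 shows "homeomorphism (exp ` ball l e) (ball 0 1) (log_chart l e) (%s. exp (l + of_real e * s))"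
proof (rule homeomorphismI)
 have lc: "log_chart l e (exp v) = (v - l) / of_real e" if "v \<in> ball l e" for v
  using log_chart_exp[of v l 0 e] that e by (simp add: dist_norm norm_minus_commute)
 have into: "exp (l + of_real e * s) \<in> exp ` ball l e" if "s \<in> ball 0 1" for s
  using that e by (intro imageI) (simp add: dist_norm norm_mult)
 show "continuous_on (exp ` ball l e) (log_chart l e)" unfolding log_chart_def
 proof (intro continuous_intros continuous_on_Ln)
  fix u assume "u \<in> (exp ` ball l e)"
  then obtain v where v: "v \<in> ball l e" "u = exp v" by blast
  have "\<bar>Im (v - l)\<bar> < 1" using v e abs_Im_le_cmod[of "v - l"] by (simp add: dist_norm norm_minus_commute)
  hence "0 < cos (Im (v - l))" using pi_gt3 by (intro cos_gt_zero_pi) auto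
  hence "0 < Re (u / exp l)" unfolding v(2) exp_diff[symmetric] Re_exp by simp
  thus "u / exp l \<notin> \<real>\<^sub>\<le>\<^sub>0" by (auto simp: complex_nonpos_Reals_iff)
 qed (use e in auto)
 show "continuous_on (ball 0 1) (%s. exp (l + of_real e * s))" by (intro continuous_intros)
 show "log_chart l e ` exp ` ball l e \<subseteq> ball 0 1"
 proof clarify
  fix v assume v: "v \<in> ball l e"
  show "log_chart l e (exp v) \<in> ball 0 1" unfolding lc[OF v] using v e by (simp add: norm_divide dist_norm norm_minus_commute)
 qed
 show "(%s. exp (l + of_real e * s)) ` ball 0 1 \<subseteq> exp ` ball l e" using into by blast
 show "exp (l + of_real e * log_chart l e u) = u" if u: "u \<in> exp ` ball l e" for u
 proof -
  obtain v where v: "v \<in> ball l e" "u = exp v" using u by blast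
  show ?thesis unfolding v(2) lc[OF v(1)] using e by simp
 qed
 show "log_chart l e (exp (l + of_real e * s)) = s" if s: "s \<in> ball 0 1" for s
 proof -
  show ?thesis using s e lc[of "l + of_real e * s"] by (simp add: dist_norm norm_mult)
 qed
qed

lemma log_chart_center: "log_chart l e (exp l) = 0" by (simp add: log_chart_def)

text \<open>Radii up to \<open>1\<close> are small compared with the period \<open>2 \<pi>\<close>; the closed ball is allowed for one of the two
  in order to show that preimages of balls are relatively closed.\<close>

lemma shifted_balls_disjoint:
 assumes "cmod (v - (l + turn k)) <= e" "cmod (v - (l + turn j)) < e" "e <= 1"
 shows "j = k"
proof (rule ccontr)
 assume "j ~= k"
 have "\<bar>Im (v - (l + turn k))\<bar> <= 1" "\<bar>Im (v - (l + turn j))\<bar> <= 1" using assms abs_Im_le_cmod order_trans less_imp_le by metis+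
 hence "\<bar>2 * pi * of_int k - 2 * pi * of_int j\<bar> <= 2" by simp
 hence "2 * pi * \<bar>real_of_int (k - j)\<bar> <= 2" by (simp only: abs_mult right_diff_distrib[symmetric] of_int_diff) simp
 moreover have "2 * pi * 1 <= 2 * pi * \<bar>real_of_int (k - j)\<bar>" using \<open>j ~= k\<close> by (intro mult_left_mono) auto
 ultimately show False using pi_gt3 by linarith
qed

lemma exp_ball_log:
 assumes "exp v \<in> exp ` ball l e"
 shows "EX k::int. cmod (v - (l + turn k)) < e"
proof -
 obtain u where u: "u \<in> ball l e" "exp v = exp u" using assms by blast
 then obtain k :: int where "v = u + turn k" using exp_eq_imp by blast
 thus ?thesis using u(1) by (intro exI[of _ k]) (simp add: dist_norm norm_minus_commute algebra_simps)
qed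

section \<open>Power maps\<close>

text \<open>One neighbourhood \<open>W\<close> has to serve all squares at once, hence all exponents \<open>m\<close>: the disc itself at
  \<open>w = 0\<close>, and otherwise a small ball, over which every root has continuous branches.\<close>

lemma power_charts:
 assumes w: "w \<in> ball 0 1"
 shows "EX W \<psi> \<psi>'. open W & w \<in> W & W \<subseteq> ball 0 1 & homeomorphism W (ball 0 1) \<psi> \<psi>' & \<psi> w = 0
  & (ALL U \<Phi> f m. open U & continuous_on U \<Phi> & inj_on \<Phi> U & \<Phi> ` U = ball 0 1 & 1 <= m & (ALL z:U. f z = \<Phi> z ^ m)
     --> clopen_charts f \<psi> (U \<inter> f -` W))"
proof (cases "w = 0")
 case True
 have "clopen_charts f (%z. z) (U \<inter> f -` ball 0 1)"
  if U: "open U" "continuous_on U \<Phi>" "inj_on \<Phi> U" "\<Phi> ` U = ball 0 1" and m: "1 <= m" and f: "ALL z:U. f z = \<Phi> z ^ m" for U \<Phi> f m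
 proof -
  have "f z \<in> ball 0 1" if "z \<in> U" for z
  proof -
   have "\<Phi> z \<in> ball 0 1" using U(4) that by blast
   thus ?thesis using f that m by (simp add: norm_power power_less_one_iff)
  qed
  hence P: "U \<inter> f -` ball 0 1 = U" by blast
  have "disc_chart f (%z. z) U" using f by (intro disc_chartI[OF U m]) auto
  thus ?thesis unfolding clopen_charts_def P by (intro ballI exI[of _ U]) auto
 qed
 thus ?thesis using True by (intro exI[of _ "ball 0 1"] exI[of _ "%z. z"] conjI allI impI) (auto simp: homeomorphism_def)
next
 case False
 define e where "e = min (cmod w / 3) (1 - cmod w)"
 have e: "e <= cmod w / 3" "e <= 1 - cmod w" unfolding e_def by (rule min.cobounded1, rule min.cobounded2)
 have e0: "0 < e" using False w by (simp add: e_def)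
 define \<psi> where "\<psi> u = (u - w) / of_real e" for u
 have hom: "homeomorphism (ball w e) (ball 0 1) \<psi> (%s. w + of_real e * s)" unfolding \<psi>_def using e0
  by (intro homeomorphismI continuous_intros) (auto simp: dist_norm norm_mult norm_divide norm_minus_commute)
 have sub: "ball w e \<subseteq> ball 0 1"
 proof
  fix u assume "u \<in> ball w e"
  thus "u \<in> ball 0 1" using norm_triangle_ineq[of "u - w" w] e(2) by (simp add: dist_norm norm_minus_commute)
 qed
 have "clopen_charts f \<psi> (U \<inter> f -` ball w e)"
  if U: "open U" "continuous_on U \<Phi>" "inj_on \<Phi> U" "\<Phi> ` U = ball 0 1" and m: "1 <= m" and f: "ALL z:U. f z = \<Phi> z ^ m"
  for U and \<Phi> f :: "complex => complex" and m
 proof (rule clopen_chartsI)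
  have cf: "continuous_on U f" using continuous_on_power[OF U(2), of m] f by (simp cong: continuous_on_cong_simp)
  obtain \<Phi>' where \<Phi>': "homeomorphism U (ball 0 1) \<Phi> \<Phi>'" using invariance_of_domain_homeomorphism[OF U(1,2) _ U(3)] U(4) by auto
  have op: "open (U \<inter> f -` ball w e)" using U(1) cf by (auto intro: continuous_open_preimage)
  fix z assume z: "z \<in> U \<inter> f -` ball w e"
  define v where "v = f z"
  have v: "v \<in> ball w e" "v = \<Phi> z ^ m" using z f by (auto simp: v_def)
    \<comment> \<open>the branch of the \<open>m\<close>-th root with the value \<open>\<Phi> z\<close> at \<open>v\<close>\<close>
  define h where "h u = \<Phi> z * exp (Ln (u / v) / of_nat m)" for u
  have near: "cmod (u / v - 1) < 1" if u: "u \<in> ball w e" for u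
  proof -
   have "cmod (u - v) <= cmod (u - w) + cmod (v - w)" using norm_triangle_ineq4[of "u - w" "v - w"] by simp
   moreover have "cmod w <= cmod v + cmod (v - w)" using norm_triangle_ineq4[of v "v - w"] by simp
   ultimately have "cmod (u - v) < cmod v" using u v(1) e(1) by (simp add: dist_norm norm_minus_commute)
   moreover from this have "0 < cmod v" using norm_ge_zero[of "u - v"] by linarith
   ultimately have "cmod ((u - v) / v) < 1" by (simp add: norm_divide)
   moreover have "(u - v) / v = u / v - 1" using \<open>0 < cmod v\<close> by (simp add: diff_divide_distrib)
   ultimately show ?thesis by simp
  qed
  have Re_pos: "0 < Re (u / v)" if "u \<in> ball w e" for u
   using near[OF that] abs_Re_le_cmod[of "u / v - 1"] by simp
  have v0: "v ~= 0" using Re_pos[OF v(1)] by auto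
  have h_pow: "h u ^ m = u" if u: "u \<in> ball w e" for u
  proof -
   have "u / v ~= 0" using Re_pos[OF u] by auto
   hence "exp (Ln (u / v) / of_nat m) ^ m = u / v" using m by (simp flip: exp_of_nat_mult)
   thus ?thesis using v0 by (simp add: h_def power_mult_distrib flip: v(2))
  qed
  have h_ball: "h u \<in> ball 0 1" if u: "u \<in> ball w e" for u
  proof -
   have "cmod (h u) ^ m < 1" using sub u h_pow[OF u] by (auto simp flip: norm_power)
   thus ?thesis using m by (simp add: power_less_one_iff)
  qed
  have "continuous_on (ball w e) h" unfolding h_def
   using v0 m Re_pos by (intro continuous_intros continuous_on_Ln) (force simp: complex_nonpos_Reals_iff)+
  hence cS: "continuous_on (ball w e) (\<Phi>' \<circ> h)"
   using h_ball by (intro continuous_on_compose continuous_on_subset[OF homeomorphism_cont2[OF \<Phi>']]) auto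
  have sec: "(\<Phi>' \<circ> h) u \<in> U \<inter> f -` ball w e & f ((\<Phi>' \<circ> h) u) = u" if u: "u \<in> ball w e" for u
  proof -
   show ?thesis using homeomorphism_image2[OF \<Phi>'] homeomorphism_apply2[OF \<Phi>'] h_ball[OF u] f h_pow[OF u] u by auto
  qed
  have "(\<Phi>' \<circ> h) v = z" using homeomorphism_apply1[OF \<Phi>', of z] z v0 by (simp add: h_def)
  thus "EX C. z \<in> C & open C & C \<subseteq> U \<inter> f -` ball w e & open (U \<inter> f -` ball w e - C) & disc_chart f \<psi> C" using v(1) section_chart[OF op continuous_on_subset[OF cf] open_ball hom cS sec] by blast
 qed
 hence "ALL U \<Phi> f m. open U & continuous_on U \<Phi> & inj_on \<Phi> U & \<Phi> ` U = ball 0 1 & 1 <= m & (ALL z:U. f z = \<Phi> z ^ m)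
   --> clopen_charts f \<psi> (U \<inter> f -` ball w e)" by blast
 moreover have "\<psi> w = 0" by (simp add: \<psi>_def)
 ultimately show ?thesis using hom sub e0 by (intro exI[of _ "ball w e"]) (metis centre_in_ball open_ball)
qed

lemma power_covering:
 assumes U: "open U" "continuous_on U \<Phi>" "inj_on \<Phi> U" "\<Phi> ` U = ball 0 1" and m: "1 <= m" and f: "!!z. z \<in> U ==> f z = \<Phi> z ^ m"
 shows "branched_covering f U (ball 0 1)"
proof (rule branched_coveringI)
 show "continuous_on U f" using continuous_on_power[OF U(2), of m] f by (simp cong: continuous_on_cong_simp)
 show img: "f ` U = ball 0 1"
 proof
  show "f ` U \<subseteq> ball 0 1"
  proof clarify
   fix z assume z: "z \<in> U"
   hence "\<Phi> z \<in> ball 0 1" using U(4) by blast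
   thus "f z \<in> ball 0 1" using f[OF z] m by (simp add: norm_power power_less_one_iff)
  qed
  show "ball 0 1 \<subseteq> f ` U"
  proof
   fix w :: complex assume w: "w \<in> ball 0 1"
   obtain t where t: "t ^ m = w" using exists_complex_root[of m w] m by auto
   hence "cmod t ^ m < 1" using w by (simp flip: norm_power)
   hence "t \<in> ball 0 1" using m by (simp add: power_less_one_iff)
   then obtain z where "z \<in> U" "t = \<Phi> z" using U(4) by blast
   thus "w \<in> f ` U" using f t by auto
  qed
 qed
 fix w :: complex assume "w \<in> ball 0 1"
 thus "EX W \<psi> \<psi>'. open W & w \<in> W & W \<subseteq> ball 0 1 & homeomorphism W (ball 0 1) \<psi> \<psi>' & \<psi> w = 0
        & clopen_charts f \<psi> (U \<inter> f -` W)" using power_charts[of w] U m f by blast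
qed

lemma power_covering_degree:
 assumes U: "open U" "continuous_on U \<Phi>" "inj_on \<Phi> U" "\<Phi> ` U = ball 0 1" and m: "1 <= m" and f: "!!z. z \<in> U ==> f z = \<Phi> z ^ m"
  and crit: "c \<in> U" "critical_point f c" "f c = 0"
 shows "branched_covering_of_degree m f U (ball 0 1)" unfolding branched_covering_of_degree_def
proof (intro conjI ballI power_covering[OF U m f])
 fix w assume w: "w \<in> ball 0 1 - f ` {z \<in> U. critical_point f z}"
 have w0: "w ~= 0" using w crit by auto
 have "bij_betw \<Phi> {z \<in> U. f z = w} {t. t ^ m = w}"
 proof (rule bij_betw_imageI)
  show "inj_on \<Phi> {z \<in> U. f z = w}" using U(3) by (rule inj_on_subset) auto
  show "\<Phi> ` {z \<in> U. f z = w} = {t. t ^ m = w}"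
  proof
   show "\<Phi> ` {z \<in> U. f z = w} \<subseteq> {t. t ^ m = w}" using f by auto
   show "{t. t ^ m = w} \<subseteq> \<Phi> ` {z \<in> U. f z = w}"
   proof
    fix t assume "t \<in> {t. t ^ m = w}"
    hence t: "t ^ m = w" by simp
    hence "cmod t ^ m < 1" using w by (simp flip: norm_power)
    hence "t \<in> ball 0 1" using m by (simp add: power_less_one_iff)
    then obtain z where "z \<in> U" "t = \<Phi> z" using U(4) by blast
    thus "t \<in> \<Phi> ` {z \<in> U. f z = w}" using f t by auto
   qed
  qed
 qed
 moreover have "card {t. t ^ m = w} = m" using card_nth_roots[OF w0, of m] m by simp
 moreover have "finite {t. t ^ m = w}" using finite_nth_roots[of m w] m by simp
 ultimately show "card {z \<in> U. f z = w} = m" "finite {z \<in> U. f z = w}"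
  using bij_betw_same_card[of \<Phi>] bij_betw_finite[of \<Phi>] by fastforce+
qed

section \<open>Charts of the model near the points outside the unit disc\<close>

lemma fold_cases: "fold z = (if 0 <= Im z then z else cnj z)" by (simp add: fold_def complex_eq_iff)

lemma Im_fold [simp]: "0 <= Im (fold z)" by (simp add: fold_def)

lemma continuous_on_lim:
 "[|continuous_on S f; !!i. u i \<in> S; x \<in> S; u ----> x|] ==> (%i. f (u i)) ----> f (x :: complex)"
 by (auto simp: continuous_on_sequentially o_def)

lemma exp_in_ball: "cmod (v - (l + turn k)) < e ==> exp v \<in> exp ` ball l e"
proof -
 assume v: "cmod (v - (l + turn k)) < e"
 have "exp v = exp (v - turn k)" using exp_shift[of "v - turn k" k] by simp
 also have "... \<in> exp ` ball l e"
 proof (rule imageI)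
  have "(v - turn k) - l = v - (l + turn k)" by (simp add: algebra_simps)
  thus "v - turn k \<in> ball l e" using v by (metis dist_norm dist_commute mem_ball)
 qed
 finally show ?thesis .
qed

lemma cnj_exp_ball: "w \<in> exp ` ball l e ==> cnj w \<in> exp ` ball (cnj l) e"
proof (elim imageE)
 fix v assume v: "w = exp v" "v \<in> ball l e"
 have "cmod (cnj v - cnj l) = cmod (v - l)" by (metis complex_cnj_diff complex_mod_cnj)
 hence "cnj v \<in> ball (cnj l) e" using v(2) by (simp add: dist_norm norm_minus_commute)
 thus ?thesis unfolding v(1) exp_cnj by (rule imageI)
qed

context even_multiplicities
begin

lemma fold_zeros: "fold z \<in> zeros \<longleftrightarrow> z \<in> zeros" by (simp add: fold_cases cnj_zeros)

definition half_log :: "complex => complex" where "half_log z = hlog (fold z)"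

lemma continuous_on_half_log: "continuous_on (- zeros) half_log" unfolding half_log_def
 by (rule continuous_on_compose2[OF continuous_on_hlog continuous_on_fold]) (auto simp: fold_zeros)

lemma model_eq_0: "model z = 0 \<longleftrightarrow> z \<in> zeros" by (simp add: model_def)

lemma open_nonzeros: "open (- zeros)"
proof -
 have "- zeros = model -` (- {0})" using model_eq_0 by auto
 thus ?thesis using continuous_on_model[of UNIV] by (metis open_Compl closed_singleton open_vimage)
qed

lemma model_half_log:
 assumes "z \<notin> zeros"
 shows "0 <= Im z ==> model z = exp (half_log z)" "Im z < 0 ==> model z = cnj (exp (half_log z))"
 using assms by (simp_all add: model_def half_log_def fold_cases)

text \<open>Values of \<open>hlog\<close> can be continued to limits because \<open>hlog\<close> is proper; the limit point is not a zero because the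
  model map has a nonzero value there.\<close>

lemma hlog_limit:
 assumes z: "!!i. z i \<in> cuhp - zeros" and lim: "(%i. hlog (z i)) ----> v"
 shows "EX x r. x \<in> cuhp - zeros & hlog x = v & strict_mono r & (z \<circ> r) ----> x"
proof -
 obtain M where M: "!!i. cmod (hlog (z i)) <= M" using convergent_imp_Bseq[OF convergentI[OF lim]] by (auto simp: Bseq_def)
 obtain R where R: "ALL z:cuhp. Re (hlog z) <= M & Im (hlog z) <= M --> cmod z <= R" using hlog_proper by blast
 have "z i \<in> cball 0 R" for i
  using bspec[OF R, of "z i"] z[of i] M[of i] complex_Re_le_cmod[of "hlog (z i)"] abs_Im_le_cmod[of "hlog (z i)"] by simp
 then obtain x r where r: "strict_mono r" "(z \<circ> r) ----> x" using compact_cball[of "0::complex" R] unfolding compact_def by blast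
 have "closed cuhp" by (simp add: closed_halfspace_Im_ge)
 hence x: "x \<in> cuhp" using closed_sequentially[OF _ _ r(2)] z by auto
 have lim': "(%i. hlog (z (r i))) ----> v" using LIMSEQ_subseq_LIMSEQ[OF lim r(1)] by (simp add: o_def)
 have "(%i. model (z (r i))) ----> model x" using isCont_tendsto_compose[OF isCont_model] r(2) by (auto simp: o_def)
 moreover have "(%i. model (z (r i))) = (%i. exp (hlog (z (r i))))" using model_upper z by (auto simp: fun_eq_iff)
 moreover have "(%i. exp (hlog (z (r i)))) ----> exp v" using lim' by (rule tendsto_exp)
 ultimately have "model x = exp v" by (metis LIMSEQ_unique)
 hence "x \<notin> zeros" using model_eq_0 by (metis exp_not_eq_zero)
 hence "(%i. hlog (z (r i))) ----> hlog x" using x z r(2) by (intro continuous_on_lim[OF continuous_on_hlog]) (auto simp: o_def)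
 thus ?thesis using lim' LIMSEQ_unique x \<open>x \<notin> zeros\<close> r by blast
qed

lemma comb_domain_dense:
 assumes "0 <= Im v" "0 < e"
 shows "EX w:comb_domain. dist w v < e"
proof -
 have "uncountable {Im v<..<Im v + e}" using assms(2) uncountable_open_interval by simp
 moreover have "countable (range comb_height)" by simp
 ultimately obtain y where y: "y \<in> {Im v<..<Im v + e}" "y \<notin> range comb_height" using countable_subset by (metis subsetI)
 have "dist (Complex (Re v) y) v < e" using y(1) by (simp add: dist_complex_def cmod_def)
 moreover have "Complex (Re v) y \<in> comb_domain" using y assms(1) by (auto simp: comb_domain_def)
 ultimately show ?thesis by blast
qed

text \<open>By density of the comb domain and \<open>hlog_limit\<close>.\<close>

lemma hlog_onto:
 assumes "0 <= Im v"
 shows "EX z:cuhp - zeros. hlog z = v"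
proof -
 have "EX w. w \<in> comb_domain & dist w v < 1 / real (Suc i)" for i
  using comb_domain_dense[OF assms, of "1 / real (Suc i)"] by auto
 then obtain w where w: "!!i. w i \<in> comb_domain" "!!i. dist (w i) v < 1 / real (Suc i)" by metis
 hence "EX z. z \<in> uhp & hlog z = w i" for i using hlog_image by (metis imageE)
 then obtain z where z: "!!i. z i \<in> uhp" "!!i. hlog (z i) = w i" by metis
 have "(%n. dist (w n) v) ----> 0"
  by (rule tendsto_sandwich[OF _ _ tendsto_const LIMSEQ_Suc[OF lim_1_over_n]]) (use w(2) in "auto intro!: always_eventually less_imp_le")
 hence "(%i. hlog (z i)) ----> v" unfolding z(2) by (rule tendsto_dist_iff[THEN iffD2])
 moreover have "z i \<in> cuhp - zeros" for i using z(1)[of i] zeros_real[of "z i"] by auto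
 ultimately show ?thesis using hlog_limit[of z v] by blast
qed

text \<open>The inverse of \<open>hlog\<close> is continuous on the comb domain, so real points cannot have values there.\<close>

lemma hlog_boundary:
 assumes z: "0 <= Im z" "z \<notin> zeros" "hlog z \<in> comb_domain"
 shows "0 < Im z"
proof -
 obtain h' where h': "homeomorphism uhp comb_domain hlog h'"
  using invariance_of_domain_homeomorphism[OF open_uhp continuous_on_hlog_uhp _ hlog_inj] hlog_image by auto
 obtain u where u: "!!i. u i \<in> uhp" "u ----> z" using half_plane_sequence[OF z(1)] by blast
 have uc: "u i \<in> cuhp - zeros" for i using u(1)[of i] zeros_real[of "u i"] by auto
 have "(%i. hlog (u i)) ----> hlog z" using z(1,2) uc u(2) by (intro continuous_on_lim[OF continuous_on_hlog]) auto
 moreover have "hlog (u i) \<in> comb_domain" for i using u(1)[of i] hlog_image by blast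
 ultimately have "u ----> h' (hlog z)" using continuous_on_lim[OF homeomorphism_cont2[OF h'], of "%i. hlog (u i)" "hlog z"] z(3) homeomorphism_apply1[OF h' u(1)] by simp
 thus ?thesis using u(2) LIMSEQ_unique homeomorphism_image2[OF h'] z(3) by blast
qed

lemma comb_height_multiple: "EX k::int. comb_height n = 2 * pi * of_int k"
proof -
 obtain k :: int where "Im (\<i> * of_real (comb_height n)) = of_int (2 * k) * pi" using exp_comb_height[of n] unfolding exp_eq_1 by blast
 thus ?thesis by (intro exI[of _ k]) simp
qed

lemma multiples_close: "\<bar>2 * pi * of_int j - 2 * pi * of_int k\<bar> < 2 ==> j = (k::int)"
proof (rule ccontr)
 assume a: "\<bar>2 * pi * of_int j - 2 * pi * of_int k\<bar> < 2" "j ~= k"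
 have "2 * pi * 1 <= 2 * pi * \<bar>real_of_int (j - k)\<bar>" using a(2) by (intro mult_left_mono) auto
 moreover have "\<bar>2 * pi * of_int j - 2 * pi * of_int k\<bar> = 2 * pi * \<bar>real_of_int (j - k)\<bar>"
  by (simp add: abs_mult flip: right_diff_distrib)
 ultimately show False using a(1) pi_gt3 by linarith
qed

abbreviation near :: "complex => real => complex set" where "near l e \<equiv> model -` exp ` ball l e"

text \<open>Openness of \<open>C\<close> and of its complement in the open preimage: a form of being clopen that is easily
  transported by conjugation.\<close>

definition has_chart :: "complex => real => complex => bool" where
 "has_chart l e z \<longleftrightarrow> (EX C. z \<in> C & open C & C \<subseteq> near l e & open (near l e - C)
   & disc_chart model (log_chart l e) C)"

lemma open_preimage: "e <= 1 ==> open (near l e)" using exp_ball_open continuous_on_model[of UNIV] by (metis open_vimage)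

lemma preimage_nonzero: "near l e \<subseteq> - zeros"
proof
 fix z assume "z \<in> near l e"
 hence "model z ~= 0" by auto
 thus "z \<in> - zeros" using model_eq_0 by simp
qed

lemma section_has_chart:
 assumes e: "0 < e" "e <= 1" and S: "continuous_on (exp ` ball l e) S" and sec: "!!u. u \<in> exp ` ball l e ==> model (S u) = u"
  and z: "z \<in> near l e" "S (model z) = z"
 shows "has_chart l e z"
proof -
 have "z \<in> S ` exp ` ball l e" using z by (metis imageI vimageE)
 moreover have "S u \<in> near l e & model (S u) = u" if "u \<in> exp ` ball l e" for u using sec[OF that] that by simp
 note section_chart[OF open_preimage[OF e(2)] continuous_on_model exp_ball_open[OF e(2)] log_chart_homeomorphism[OF e] S this]
 ultimately show ?thesis unfolding has_chart_def by (intro exI[of _ "S ` exp ` ball l e"]) blast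
qed

text \<open>By symmetry only components that meet the closed upper half-plane have to be considered.\<close>

lemma has_chart_cnj:
 assumes e: "0 < e" "e <= 1" and z: "has_chart (cnj l) e (cnj z)"
 shows "has_chart l e z"
proof -
 obtain C where C: "cnj z \<in> C" "open C" "C \<subseteq> near (cnj l) e" "open (near (cnj l) e - C)"
  "disc_chart model (log_chart (cnj l) e) C" using z unfolding has_chart_def by blast
 have P: "u \<in> near l e \<longleftrightarrow> cnj u \<in> near (cnj l) e" for u
  using cnj_exp_ball[of "model u" l e] cnj_exp_ball[of "cnj (model u)" "cnj l" e] by (auto simp: model_cnj simp del: image_iff)
 have op: "open (cnj -` S)" if "open S" for S using that by (intro open_vimage continuous_intros)
 obtain m \<phi> \<phi>' where m: "1 <= m" and hom: "homeomorphism C (ball 0 1) \<phi> \<phi>'"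
  and eq: "!!u. u \<in> C ==> log_chart (cnj l) e (model u) = \<phi> u ^ m" using C(5) unfolding disc_chart_def by blast
 have "disc_chart model (log_chart l e) (cnj -` C)"
 proof (rule disc_chartI[OF op[OF C(2)], where \<phi> = "%u. cnj (\<phi> (cnj u))", OF _ _ _ m])
  show "continuous_on (cnj -` C) (%u. cnj (\<phi> (cnj u)))"
   by (intro continuous_on_cnj continuous_on_compose2[OF homeomorphism_cont1[OF hom]] continuous_intros) auto
  have "inj_on \<phi> C" using hom by (metis homeomorphism_apply1 inj_on_inverseI)
  thus "inj_on (%u. cnj (\<phi> (cnj u))) (cnj -` C)" unfolding inj_on_def by (metis complex_cnj_cancel_iff vimageE)
  have "(%u. cnj (\<phi> (cnj u))) ` (cnj -` C) = cnj ` \<phi> ` (cnj ` (cnj -` C))" unfolding image_image ..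
  also have "cnj ` (cnj -` C) = C" by (metis complex_cnj_cnj surj_def surj_image_vimage_eq)
  also have "\<phi> ` C = ball 0 1" by (rule homeomorphism_image1[OF hom])
  also have "cnj ` ball 0 1 = ball 0 1"
  proof
   show "ball 0 1 \<subseteq> cnj ` ball 0 1"
   proof
    fix u :: complex assume "u \<in> ball 0 1"
    hence "u = cnj (cnj u)" "cnj u \<in> ball 0 1" by auto
    thus "u \<in> cnj ` ball 0 1" by (rule image_eqI)
   qed
  qed auto
  finally show "(%u. cnj (\<phi> (cnj u))) ` (cnj -` C) = ball 0 1" .
  fix u assume u: "u \<in> cnj -` C"
  hence "model (cnj u) \<in> exp ` ball (cnj l) e" using C(3) by auto
  then obtain v where v: "v \<in> ball (cnj l) e" "model (cnj u) = exp v" by blast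
  have mu: "model u = exp (cnj v)" using v(2) model_cnj[of "cnj u"] by (simp add: exp_cnj)
  have v1: "cmod (v - cnj l) < 1" using v(1) e by (simp add: dist_norm norm_minus_commute)
  have "cmod (cnj v - l) = cmod (v - cnj l)" by (metis complex_cnj_cnj complex_cnj_diff complex_mod_cnj)
  hence "log_chart l e (model u) = (cnj v - l) / of_real e" using log_chart_exp[of "cnj v" l 0 e] v1 unfolding mu by simp
  also have "... = cnj ((v - cnj l) / of_real e)" by simp
  also have "(v - cnj l) / of_real e = log_chart (cnj l) e (model (cnj u))" using log_chart_exp[of v "cnj l" 0 e] v1 unfolding v(2) by simp
  also have "... = \<phi> (cnj u) ^ m" using eq u by simp
  finally show "log_chart l e (model u) = cnj (\<phi> (cnj u)) ^ m" by simp
 qed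
 moreover have "cnj -` C \<subseteq> near l e"
 proof
  fix u assume "u \<in> cnj -` C"
  thus "u \<in> near l e" unfolding P using C(3) by blast
 qed
 moreover have "near l e - cnj -` C = cnj -` (near (cnj l) e - C)" using P by blast
 hence "open (near l e - cnj -` C)" using op[OF C(4)] by simp
 ultimately show ?thesis unfolding has_chart_def using C(1) op[OF C(2)] by (intro exI[of _ "cnj -` C"]) simp
qed

text \<open>The inverse of \<open>hlog\<close> on a ball inside the comb domain, composed with a logarithm, is a section of the
  model map.\<close>

lemma upper_chart:
 fixes k :: int
 assumes e: "0 < e" "e <= 1" and c: "c = l + turn k" and sub: "ball c e \<subseteq> comb_domain"
  and z0: "0 < Im z0" "hlog z0 \<in> ball c e"
 shows "has_chart l e z0"
proof -
 obtain h' where h': "homeomorphism uhp comb_domain hlog h'"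
  using invariance_of_domain_homeomorphism[OF open_uhp continuous_on_hlog_uhp _ hlog_inj] hlog_image by auto
 note lc = log_chart_homeomorphism[OF e, of l]
 define S where "S u = h' (c + of_real e * log_chart l e u)" for u
 have b: "c + of_real e * log_chart l e u \<in> comb_domain" if "u \<in> exp ` ball l e" for u
 proof -
  have "log_chart l e u \<in> ball 0 1" using homeomorphism_image1[OF lc] that by blast
  thus ?thesis using sub e(1) by (intro subsetD[OF sub]) (simp add: dist_norm norm_mult)
 qed
 have mod: "model z = exp (hlog z)" if "z \<in> uhp" for z by (rule model_upper) (use that zeros_real[of z] in auto)
 have z0': "cmod (hlog z0 - c) < e" using z0(2) by (simp add: dist_norm norm_minus_commute)
 show ?thesis
 proof (rule section_has_chart[OF e, of l S])
  show "continuous_on (exp ` ball l e) S" unfolding S_def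
   by (intro continuous_on_compose2[OF homeomorphism_cont2[OF h']] continuous_intros homeomorphism_cont1[OF lc]) (use b in blast)
  show "model (S u) = u" if u: "u \<in> exp ` ball l e" for u
  proof -
   have "S u \<in> uhp" "hlog (S u) = c + of_real e * log_chart l e u"
    unfolding S_def using b[OF u] homeomorphism_image2[OF h'] homeomorphism_apply2[OF h'] by blast+
   hence "model (S u) = exp ((l + of_real e * log_chart l e u) + turn k)" using mod by (simp add: c add_ac)
   also have "... = u" unfolding exp_shift using homeomorphism_apply1[OF lc u] .
   finally show ?thesis .
  qed
  show "z0 \<in> near l e" using mod[of z0] z0(1) exp_in_ball[OF z0'[unfolded c]] by simp
  show "S (model z0) = z0" using log_chart_exp[of "hlog z0" l k e] z0' e(2) mod[of z0] z0(1) homeomorphism_apply1[OF h', of z0] e(1) by (auto simp: c S_def)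
 qed
qed

lemma real_preimage:
 assumes l: "Im l = 0" and z: "z \<notin> zeros"
 shows "model z \<in> exp ` ball l e \<longleftrightarrow> exp (half_log z) \<in> exp ` ball l e"
proof (cases "0 <= Im z")
 case True
 thus ?thesis using model_half_log(1)[OF z] by simp
next
 case False
 have "cnj l = l" using l by (simp add: complex_eq_iff)
 thus ?thesis
  using model_half_log(2)[OF z] False cnj_exp_ball[of "exp (half_log z)" l e] cnj_exp_ball[of "model z" l e] unfolding \<open>cnj l = l\<close> by auto
qed

text \<open>When the target neighbourhood is symmetric about the real axis, folding describes both halves of a
  symmetric component at once.\<close>

lemma symmetric_piece:
 fixes k :: int
 assumes e: "0 < e" "e <= 1" and l: "Im l = 0" and c: "c = l + turn k"
  and C: "C = {z. z \<notin> zeros & half_log z \<in> ball c e}"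
 shows "open C" "C \<subseteq> near l e" "open (near l e - C)"
proof -
 have "C = - zeros \<inter> half_log -` ball c e" unfolding C by auto
 thus "open C" using continuous_open_preimage[OF continuous_on_half_log open_nonzeros open_ball] by simp
 show CP: "C \<subseteq> near l e"
 proof
  fix z assume "z \<in> C"
  hence z: "z \<notin> zeros" "cmod (half_log z - c) < e" by (auto simp: C dist_norm norm_minus_commute)
  thus "z \<in> near l e" using exp_in_ball real_preimage[OF l z(1)] unfolding c by simp
 qed
 have "near l e \<inter> half_log -` cball c e = C"
 proof
  show "C \<subseteq> near l e \<inter> half_log -` cball c e" using CP by (auto simp: C)
  show "near l e \<inter> half_log -` cball c e \<subseteq> C"
  proof
   fix z assume z: "z \<in> near l e \<inter> half_log -` cball c e"
   hence z': "z \<notin> zeros" "cmod (half_log z - c) <= e" using preimage_nonzero[of l e] by (auto simp: dist_norm norm_minus_commute)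
   have "exp (half_log z) \<in> exp ` ball l e" using z real_preimage[OF l z'(1)] by simp
   then obtain j :: int where j: "cmod (half_log z - (l + turn j)) < e" using exp_ball_log by blast
   have "j = k" by (rule shifted_balls_disjoint[OF z'(2)[unfolded c] j e(2)])
   thus "z \<in> C" using j z'(1) unfolding c C by (simp add: dist_norm norm_minus_commute)
  qed
 qed
 hence "near l e - C = near l e \<inter> half_log -` (- cball c e)" by blast
 thus "open (near l e - C)"
  using continuous_open_preimage[OF continuous_on_subset[OF continuous_on_half_log preimage_nonzero] open_preimage[OF e(2)] open_Compl[OF closed_cball[of c e]]] by simp
qed

lemma cl_tri_hlog:
 assumes n: "1 <= n" and z: "z \<in> cl_tri n" "z \<notin> zeros"
 shows "comb_height n <= Im (hlog z)" "Im (hlog z) <= comb_height (Suc n)"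
proof -
 have dn: "0 < real (d n)" using d_pos[OF n] by simp
 define \<rho> where "\<rho> = inner_radius n z"
 have "z ~= of_real (center n)" using z(2) n by (auto simp: zeros_def)
 hence "0 < \<bar>Re z - center n\<bar> + Im z" using z by (auto simp: cl_tri_def complex_eq_iff)
 hence \<rho>: "0 < \<rho>" using dn by (simp add: \<rho>_def inner_radius_def)
 have "\<bar>Re z - center n\<bar> <= \<rho> * (d n / 2)" using z dn by (simp add: \<rho>_def inner_radius_def cl_tri_def)
 hence X: "\<bar>(Re z - center n) / \<rho>\<bar> <= d n / 2" using \<rho> \<rho> by (simp add: pos_divide_le_eq mult.commute)
 have "1 - vertex n <= 1 - center n - (Re z - center n) / \<rho>" "1 - center n - (Re z - center n) / \<rho> <= 1 - vertex (Suc n)"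
  using X center_eq[OF n] unfolding abs_le_iff by linarith+
 thus "comb_height n <= Im (hlog z)" "Im (hlog z) <= comb_height (Suc n)"
  by (simp_all add: hlog_tri[OF n z(1)] inner_log_def comb_height_vertex flip: \<rho>_def)
qed

lemma comb_height_1: "1 <= n ==> 2 * pi <= comb_height n" using comb_height_le[of 1 n] by (simp add: comb_height_def)

lemma hlog_cl_disc:
 assumes "z \<in> cl_disc" "z ~= 0"
 shows "hlog z = Complex (2 * ln (cmod z)) (2 * ang z)" using disc_log[OF assms(2)] assms(1) by (simp add: hlog_disc cl_disc_def)

text \<open>Heights below \<open>1\<close> belong to the right half-plane, where \<open>sym_log\<close> is a coordinate.\<close>

lemma Re_pos_of_small_Im:
 assumes z: "0 <= Im z" "z \<notin> zeros" "Im (hlog z) < 1"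
 shows "0 < Re z"
proof -
 have pos: "0 < Re w" if w: "0 <= Im w" "w ~= 0" "ang w < 1" for w
 proof -
  have "0 < cos (ang w)" using ang_range[OF w(1,2)] w(3) pi_gt3 by (intro cos_gt_zero_pi) auto
  thus ?thesis using ang_Re[OF w(2)] w(2) by simp
 qed
 have z0: "z ~= 0" using z(2) by (auto simp: zeros_def)
 from closed_upper_cover[OF z(1)] show ?thesis
 proof (elim disjE exE conjE)
  assume "z \<in> cl_disc"
  thus ?thesis using hlog_cl_disc[of z] z0 z(3) pos[OF z(1) z0] by simp
 next
  assume o: "z \<in> cl_outer"
  have f: "0 <= Im (flat z)" "1 <= cmod (flat z)" using flat_cl_outer[OF o] by auto
  hence f0: "flat z ~= 0" by auto
  have "(1 + cmod (flat z)) * ang (flat z) < 1" using z(3) by (simp add: hlog_outer[OF o] outer_def)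
  moreover have "1 * ang (flat z) <= (1 + cmod (flat z)) * ang (flat z)" using ang_range[OF f(1) f0] by (intro mult_right_mono) auto
  ultimately show ?thesis using pos[OF f(1) f0] by (simp add: flat_def)
 next
  fix n assume "1 <= n" "z \<in> cl_tri n"
  thus ?thesis using cl_tri_hlog(1)[of n z] z(2) comb_height_1[of n] z(3) pi_gt3 by linarith
 qed
qed

text \<open>The same with the reflected logarithm \<open>sym_log\<close>, which takes all values near the real axis.\<close>

lemma real_chart:
 assumes e: "0 < e" "e <= 1" and l: "Im l = 0" and z0: "z0 \<notin> zeros" "half_log z0 \<in> ball l e"
 shows "has_chart l e z0"
proof -
 have lcnj: "cnj l = l" using l by (simp add: complex_eq_iff)
 have ball_cnj: "cnj v \<in> ball l e \<longleftrightarrow> v \<in> ball l e" for v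
 proof -
  have "cmod (l - cnj v) = cmod (l - v)" by (metis lcnj complex_cnj_diff complex_mod_cnj)
  thus ?thesis by (simp add: dist_norm)
 qed
 have small: "Im v < 1" if "v \<in> ball l e" for v
  using abs_Im_le_cmod[of "v - l"] that l e by (simp add: dist_norm norm_minus_commute)
 define H where "H = {z. 0 < Re z}"
 obtain j where j: "homeomorphism H (sym_log ` H) sym_log j"
  using invariance_of_domain_homeomorphism[of H sym_log] continuous_on_sym_log inj_sym_log by (auto simp: H_def open_halfspace_Re_gt)
 have onto: "ball l e \<subseteq> sym_log ` H"
 proof
  fix v assume b: "v \<in> ball l e"
  have up: "EX z. 0 <= Im z & z \<in> H & hlog z = u" if u: "u \<in> ball l e" "0 <= Im u" for u
  proof -
   obtain z where z: "z \<in> cuhp - zeros" "hlog z = u" using hlog_onto u(2) by blast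
   thus ?thesis using Re_pos_of_small_Im[of z] small[OF u(1)] by (auto simp: H_def)
  qed
  show "v \<in> sym_log ` H"
  proof (cases "0 <= Im v")
   case True
   then obtain z where "0 <= Im z" "z \<in> H" "hlog z = v" using up[OF b] by blast
   thus ?thesis by (intro image_eqI[of _ _ z]) (auto simp: sym_log_def)
  next
   case False
   then obtain z where z: "0 <= Im z" "z \<in> H" "hlog z = cnj v" using up[of "cnj v"] b ball_cnj by (auto simp del: mem_ball)
   hence "sym_log (cnj z) = v" using sym_log_cnj[of z] by (simp add: sym_log_def H_def)
   thus ?thesis using z(2) by (intro image_eqI[of _ _ "cnj z"]) (auto simp: H_def)
  qed
 qed
 note lc = log_chart_homeomorphism[OF e, of l]
 define S where "S u = j (l + of_real e * log_chart l e u)" for u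
 have b: "l + of_real e * log_chart l e u \<in> sym_log ` H" if "u \<in> exp ` ball l e" for u
 proof -
  have "log_chart l e u \<in> ball 0 1" using homeomorphism_image1[OF lc] that by blast
  thus ?thesis using e(1) by (intro subsetD[OF onto]) (simp add: dist_norm norm_mult)
 qed
 have "Im (hlog (fold z0)) < 1" using small[OF z0(2)] by (simp add: half_log_def)
 hence "0 < Re (fold z0)" using z0(1) by (intro Re_pos_of_small_Im) (auto simp: fold_zeros)
 hence z0H: "z0 \<in> H" by (simp add: H_def fold_def)
 have "sym_log z0 = half_log z0 \<or> sym_log z0 = cnj (half_log z0)" by (simp add: sym_log_def half_log_def fold_cases)
 hence z0b: "sym_log z0 \<in> ball l e" using z0(2) ball_cnj by metis
 show ?thesis
 proof (rule section_has_chart[OF e, of l S])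
  show "continuous_on (exp ` ball l e) S" unfolding S_def
   by (intro continuous_on_compose2[OF homeomorphism_cont2[OF j]] continuous_intros homeomorphism_cont1[OF lc]) (use b in blast)
  show "model (S u) = u" if u: "u \<in> exp ` ball l e" for u
  proof -
   have "S u \<in> H" "sym_log (S u) = l + of_real e * log_chart l e u"
    unfolding S_def using b[OF u] homeomorphism_image2[OF j] homeomorphism_apply2[OF j] by blast+
   thus ?thesis using exp_sym_log[of "S u"] homeomorphism_apply1[OF lc u] by (simp add: H_def)
  qed
  have mz: "model z0 = exp (sym_log z0)" using exp_sym_log z0H by (simp add: H_def)
  thus "z0 \<in> near l e" using z0b by simp
  have "log_chart l e (model z0) = (sym_log z0 - l) / of_real e"
   using log_chart_exp[of "sym_log z0" l 0 e] z0b e(2) unfolding mz by (simp add: dist_norm norm_minus_commute)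
  thus "S (model z0) = z0" using homeomorphism_apply1[OF j z0H] e(1) by (simp add: S_def)
 qed
qed

end

section \<open>Charts at the tips of the slits\<close>

text \<open>A square root with a prescribed sign \<open>q\<close> of its imaginary part. Near the tip of a slit the sign is
  the bank of the slit, which the value \<open>v\<close> alone does not show.\<close>

lemma square_of_half_roots:
 assumes v: "\<bar>q\<bar> = sqrt ((cmod v - Re v) / 2)" "0 <= q * Im v"
 shows "(Complex (sqrt ((cmod v + Re v) / 2)) q)\<^sup>2 = v"
proof -
 have nn: "0 <= (cmod v + Re v) / 2" "0 <= (cmod v - Re v) / 2" using abs_Re_le_cmod[of v] by auto
 have q2: "q\<^sup>2 = (cmod v - Re v) / 2" using v(1) nn(2) by (metis power2_abs real_sqrt_pow2)
 define p where "p = sqrt ((cmod v + Re v) / 2)"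
 have p2: "p\<^sup>2 = (cmod v + Re v) / 2" "0 <= p" using nn(1) by (auto simp: p_def)
 have "(2 * p * q)\<^sup>2 = 4 * p\<^sup>2 * q\<^sup>2" by (simp add: power_mult_distrib)
 also have "... = (cmod v)\<^sup>2 - (Re v)\<^sup>2" unfolding p2 q2 by (simp add: power2_eq_square field_simps)
 also have "... = (Im v)\<^sup>2" by (simp add: cmod_power2)
 finally have "2 * p * q = Im v \<or> 2 * p * q = - Im v" by (simp add: power2_eq_iff)
 moreover have "0 <= (2 * p * q) * Im v" using v(2) p2(2) by (simp add: mult.assoc)
 moreover have "Im v = 0" if "0 <= - Im v * Im v" using that by (auto simp: mult_le_0_iff)
 ultimately have "2 * p * q = Im v" by (metis add.inverse_neutral)
 moreover have "p\<^sup>2 - q\<^sup>2 = Re v" unfolding p2 q2 by (simp add: field_simps)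
 ultimately show ?thesis unfolding p_def[symmetric] by (simp add: complex_eq_iff power2_eq_square)
qed

context even_multiplicities
begin

text \<open>To the left of the tip only the upper bank of the slit can be approached, to the right of it only the
  lower one.\<close>

lemma left_of_tip:
 assumes n: "1 <= n" and z: "0 <= Im z" "z \<notin> zeros" "Re z <= vertex n"
 shows "0 <= Re (hlog z) \<or> comb_height n <= Im (hlog z)" using closed_upper_cover[OF z(1)]
proof (elim disjE exE conjE)
 assume d: "z \<in> cl_disc"
 show ?thesis using z(3) vertex_le[OF n] n abs_Re_le_cmod[of z] d hlog_cl_disc[OF d] by (cases "z = 0") auto
next
 assume "z \<in> cl_outer"
 thus ?thesis using hlog_cl_outer by blast
next
 fix m assume m: "1 <= m" "z \<in> cl_tri m"
 show ?thesis
 proof (cases "n <= m")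
  case True
  thus ?thesis using cl_tri_hlog(1)[OF m z(2)] comb_height_le[OF n True] by linarith
 next
  case False
  hence r: "Re z = vertex n" "vertex n = vertex (Suc m)" using vertex_antimono[of "Suc m" n] cl_tri_Re[OF m] z(3) by auto
  thus ?thesis using z(1) tent_vertex[OF n] cl_tri_norm(1)[OF m] hlog_cl_outer by (simp add: cl_outer_def)
 qed
qed

lemma right_of_tip:
 assumes n: "1 <= n" and z: "0 <= Im z" "z \<notin> zeros" "vertex n <= Re z"
 shows "0 <= Re (hlog z) \<or> Im (hlog z) <= comb_height n" using closed_upper_cover[OF z(1)]
proof (elim disjE exE conjE)
 assume d: "z \<in> cl_disc"
 show ?thesis using z(2) hlog_cl_disc[OF d] ang_range(2)[OF z(1)] comb_height_1[OF n] by (auto simp: zeros_def)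
next
 assume "z \<in> cl_outer"
 thus ?thesis using hlog_cl_outer by blast
next
 fix m assume m: "1 <= m" "z \<in> cl_tri m"
 show ?thesis
 proof (cases "Suc m <= n")
  case True
  thus ?thesis using cl_tri_hlog(2)[OF m z(2)] comb_height_le[of "Suc m" n] by linarith
 next
  case False
  hence r: "Re z = vertex n" using vertex_antimono[of n m] n cl_tri_Re[OF m] z(3) by auto
  thus ?thesis using z(1) tent_vertex[OF n] cl_tri_norm(1)[OF m] hlog_cl_outer by (simp add: cl_outer_def)
 qed
qed

lemma on_tip:
 assumes n: "1 <= n" and z: "0 <= Im z" "Re z = vertex n"
 shows "0 <= Re (hlog z)"
proof -
 have "z \<in> cl_outer" using z(2) vertex_le[OF n] n abs_Re_le_cmod[of z] z tent_vertex[OF n] by (simp add: cl_outer_def)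
 thus ?thesis by (rule hlog_cl_outer)
qed

lemma real_cl_tri_hlog:
 assumes n: "1 <= n" and z: "Im z = 0" "z \<notin> zeros" "z \<in> cl_tri n"
 shows "Re z < center n ==> Im (hlog z) = comb_height (Suc n)" "center n < Re z ==> Im (hlog z) = comb_height n"
  "Re z ~= center n"
proof -
 have dn: "0 < real (d n)" using d_pos[OF n] by simp
 have h: "Im (hlog z) = pi * (1 - center n - (Re z - center n) / (\<bar>Re z - center n\<bar> * 2 / d n))"
  using z(1) by (simp add: hlog_tri[OF n z(3)] inner_log_def inner_radius_def)
 show "Re z ~= center n" using z(1,2) n by (auto simp: zeros_def complex_eq_iff)
 show "Im (hlog z) = comb_height (Suc n)" if "Re z < center n"
 proof -
  have "(Re z - center n) / (\<bar>Re z - center n\<bar> * 2 / d n) = - (d n / 2)" using that dn by (simp add: field_simps)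
  thus ?thesis using center_eq(2)[OF n] by (simp add: h comb_height_vertex)
 qed
 show "Im (hlog z) = comb_height n" if "center n < Re z"
 proof -
  have "(Re z - center n) / (\<bar>Re z - center n\<bar> * 2 / d n) = d n / 2" using that dn by (simp add: field_simps)
  thus ?thesis using center_eq(1)[OF n] by (simp add: h comb_height_vertex)
 qed
qed

lemma comb_height_inj: "[|1 <= m; 1 <= n; comb_height m = comb_height n|] ==> m = n"
 using comb_height_less[of m n] comb_height_less[of n m] by (metis linorder_neqE_nat less_irrefl)

lemma real_left_of_tip:
 assumes n: "1 <= n" and z: "Im z = 0" "z \<notin> zeros" "Im (hlog z) = comb_height n" "Re z <= vertex n"
 shows "z \<in> cl_tri n & center n < Re z"
proof -
 have "Re z <= - 1" using z(4) vertex_le[OF n] n by simp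
 then obtain m where m: "1 <= m" "vertex (Suc m) <= Re z" "Re z <= vertex m" using square_exists by blast
 have "\<bar>Re z - center m\<bar> <= d m / 2" using m center_eq[OF m(1)] unfolding abs_le_iff by linarith
 hence tri: "z \<in> cl_tri m" using z(1) by (simp add: cl_tri_def)
 note h = real_cl_tri_hlog[OF m(1) z(1,2) tri]
 show ?thesis
 proof (cases "center m < Re z")
  case True
  thus ?thesis using h(2) z(3) comb_height_inj[OF m(1) n] True tri by simp
 next
  case False
  thus ?thesis using h(1,3) z(3) comb_height_inj[of "Suc m" n] n m(2) z(4) z(1) center_eq(1)[OF n] center_between(2)[OF n] by (simp add: cl_tri_def)
 qed
qed

lemma real_right_of_tip:
 assumes n: "1 <= n" and z: "Im z = 0" "z \<notin> zeros" "Im (hlog z) = comb_height n" "vertex n <= Re z"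
 shows "(cmod z <= 1 & Re z < 0) & n = 1 \<or> (EX m>=1. n = Suc m & z \<in> cl_tri m & Re z < center m)" using real_cases[OF z(1)]
proof (elim disjE exE conjE)
 assume d: "cmod z <= 1"
 have z0: "z ~= 0" using z(2) by (auto simp: zeros_def)
 have zr: "z = of_real (Re z)" using z(1) by (simp add: complex_eq_iff)
 have "2 * ang z = comb_height n" using hlog_cl_disc[OF _ z0] d z(1,3) by (simp add: cl_disc_def)
 moreover have "2 * pi <= comb_height n" using comb_height_1[OF n] .
 moreover have "ang z = 0" if "0 < Re z" using ang_of_real(1)[OF that] zr by simp
 ultimately have neg: "Re z < 0" using z0 zr pi_gt3 by (metis linorder_neqE_linordered_idom mult_zero_right not_le of_real_0 pi_gt_zero zero_less_mult_iff zero_less_numeral)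
 thus ?thesis using \<open>2 * ang z = comb_height n\<close> ang_of_real(2)[OF neg] zr comb_height_inj[OF n, of 1] d neg by (simp add: comb_height_def)
next
 fix m assume m: "1 <= m" "\<bar>Re z - center m\<bar> + \<bar>Im z\<bar> <= d m / 2"
 hence tri: "z \<in> cl_tri m" using z(1) by (simp add: cl_tri_def)
 note h = real_cl_tri_hlog[OF m(1) z(1,2) tri]
 show ?thesis
 proof (cases "center m < Re z")
  case True
  hence v: "Re z = vertex n" using h(2) z(3) comb_height_inj[OF m(1) n] cl_tri_Re[OF m(1) tri] z(4) by simp
  show ?thesis
  proof (cases "n = 1")
   case True
   thus ?thesis using v cmod_eq_Re[OF z(1)] by (simp add: right_vertex_def)
  next
   case False
   then obtain k where k: "n = Suc k" "1 <= k" using n by (cases n) auto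
   thus ?thesis using v z(1) center_eq(2)[OF k(2)] center_between(1)[OF k(2)] k by (simp_all add: cl_tri_def)
  qed
 next
  case False
  thus ?thesis using h(1,3) z(3) comb_height_inj[of "Suc m" n] n m(1) tri by auto
 qed
next
 assume "1 <= Re z"
 thus ?thesis using outer_real_ge_1[OF z(1)] comb_height_1[OF n] z(3) pi_gt3 by simp
qed

lemma real_square_inj:
 assumes n: "1 <= n" and z: "Im z = 0" "z \<in> cl_tri n" and w: "Im w = 0" "w \<in> cl_tri n"
  and eq: "model z = model w" and side: "0 < (Re z - center n) * (Re w - center n)"
 shows "z = w"
proof -
 have dn: "0 < d n" using d_pos[OF n] .
 have m: "model u = sq_chart n u ^ d n" if "u \<in> cl_tri n" for u
  using that by (intro model_square n) (auto simp: cl_tri_def)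
 have "cmod (sq_chart n z) ^ d n = cmod (sq_chart n w) ^ d n" using eq m[OF z(2)] m[OF w(2)] by (simp flip: norm_power)
 hence "\<bar>Re z - center n\<bar> = \<bar>Re w - center n\<bar>" using dn z(1) w(1) by (auto simp: power_eq_iff_eq_base norm_sq_chart[OF n])
 hence "Re z = Re w" using side by (auto simp: abs_if zero_less_mult_iff split: if_splits)
 thus ?thesis using z(1) w(1) by (simp add: complex_eq_iff)
qed

text \<open>The upper bank of the slit belongs to the right half of the real diameter of \<open>P\<^sub>n\<close>, the lower one to the left half of the
  diameter of the object before it, and the model map is monotone on each.\<close>

lemma slit_side_inj:
 assumes n: "1 <= n" and z: "Im z = 0" "z \<notin> zeros" and w: "Im w = 0" "w \<notin> zeros" and eq: "hlog z = hlog w" and h: "Im (hlog z) = comb_height n"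
  and side: "Re z <= vertex n & Re w <= vertex n \<or> vertex n <= Re z & vertex n <= Re w"
 shows "z = w"
proof -
 have hw: "Im (hlog w) = comb_height n" using eq h by simp
 have meq: "model z = model w" using model_upper z w eq by simp
 from side show ?thesis
 proof
  assume "Re z <= vertex n & Re w <= vertex n"
  thus ?thesis using real_left_of_tip[OF n z h] real_left_of_tip[OF n w hw] real_square_inj[OF n z(1) _ w(1) _ meq] by simp
 next
  assume s: "vertex n <= Re z & vertex n <= Re w"
  note Z = real_right_of_tip[OF n z h conjunct1[OF s]] and W = real_right_of_tip[OF n w hw conjunct2[OF s]]
  show ?thesis
  proof (cases "n = 1")
   case True
   hence "cmod z <= 1" "Re z < 0" "cmod w <= 1" "Re w < 0" using Z W by auto
   moreover from this have "z\<^sup>2 = w\<^sup>2" using meq by (simp add: model_disc)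
   hence "z = w \<or> z = - w" by (simp add: power2_eq_iff)
   ultimately show ?thesis by auto
  next
   case False
   then obtain m where m: "1 <= m" "z \<in> cl_tri m" "Re z < center m" "w \<in> cl_tri m" "Re w < center m" using Z W by auto
   thus ?thesis using real_square_inj[OF m(1) z(1) _ w(1) _ meq] by (simp add: mult_neg_neg)
  qed
 qed
qed

text \<open>The coordinate is \<open>sqrt ((hlog - \<i> h\<^sub>n) / e)\<close>: on the half-plane it is onto the right half of the disc, the two banks of
  the slit become the two halves of the imaginary axis, and reflection fills the left half.
  The exponential then makes the model map the square of this coordinate, so the local
  degree at the vertex is \<open>2\<close>.\<close>

lemma tip_chart:
 assumes n: "1 <= n" and e: "0 < e" "e <= 1" and z0: "z0 \<notin> zeros" "half_log z0 \<in> ball (\<i> * of_real (comb_height n)) e"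
 shows "has_chart 0 e z0"
proof -
 define h where "h = comb_height n"
 define c where "c = \<i> * of_real h"
 define C where "C = {z. z \<notin> zeros & half_log z \<in> ball c e}"
 obtain k :: int where k: "h = 2 * pi * of_int k" using comb_height_multiple[of n] by (auto simp: h_def)
 have ck: "c = 0 + turn k" by (simp add: c_def k)
 have piece: "open C" "C \<subseteq> near 0 e" "open (near 0 e - C)" using symmetric_piece[OF e _ ck C_def] by simp_all
 define V where "V = vertex n"
 define v where "v z = (hlog z - c) / of_real e" for z
 define r where "r z = sqrt ((cmod (v z) - Re (v z)) / 2)" for z
  \<comment> \<open>the imaginary part of the root is positive over the upper bank of the slit, negative over the lower one\<close>
 define q where "q z = (if 0 <= Im (v z) & (Re z <= V \<or> 0 <= Re (v z)) then r z else - r z)" for z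
 define s where "s z = Complex (sqrt ((cmod (v z) + Re (v z)) / 2)) (q z)" for z
 define Cu where "Cu = C \<inter> cuhp"
 have Cu: "0 <= Im z" "z \<notin> zeros" "hlog z \<in> ball c e" "cmod (v z) < 1" if "z \<in> Cu" for z
 proof -
  show z: "0 <= Im z" "z \<notin> zeros" "hlog z \<in> ball c e" using that by (auto simp: Cu_def C_def half_log_def fold_cases)
  thus "cmod (v z) < 1" using e by (simp add: v_def norm_divide dist_norm norm_minus_commute)
 qed
 have v_hlog: "hlog z = c + of_real e * v z" for z using e by (simp add: v_def)
 have Re_v: "Re (hlog z) = e * Re (v z)" "Im (hlog z) = h + e * Im (v z)" for z using v_hlog[of z] by (simp_all add: c_def)
 have Cu_I: "z \<in> Cu" if "0 <= Im z" "z \<notin> zeros" "hlog z = c + of_real e * u" "cmod u < 1" for z u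
  using that e by (simp add: Cu_def C_def half_log_def fold_cases dist_norm norm_mult)
 have left: "0 <= Re (v z) \<or> 0 <= Im (v z)" if "z \<in> Cu" "Re z <= V" for z
  using left_of_tip[OF n Cu(1,2)[OF that(1)]] that(2) e unfolding Re_v V_def h_def[symmetric] by (simp add: zero_le_mult_iff)
 have right: "0 <= Re (v z) \<or> Im (v z) <= 0" if "z \<in> Cu" "V <= Re z" for z
  using right_of_tip[OF n Cu(1,2)[OF that(1)]] that(2) e unfolding Re_v V_def h_def[symmetric] by (simp add: zero_le_mult_iff mult_le_0_iff)
 have on: "0 <= Re (v z)" if "z \<in> Cu" "Re z = V" for z
  using on_tip[OF n Cu(1)[OF that(1)]] that(2) e unfolding Re_v V_def by (simp add: zero_le_mult_iff)
 have r0: "0 <= r z" for z using abs_Re_le_cmod[of "v z"] by (simp add: r_def)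
 have r_zero: "r z = 0" if "0 <= Re (v z)" "Im (v z) = 0" for z
  using that cmod_eq_Re[of "v z"] by (simp add: r_def)
 have sq: "(s z)\<^sup>2 = v z" if "z \<in> Cu" for z
  unfolding s_def
 proof (rule square_of_half_roots)
  show "\<bar>q z\<bar> = sqrt ((cmod (v z) - Re (v z)) / 2)" using r0[of z] by (simp add: q_def flip: r_def)
  show "0 <= q z * Im (v z)"
  proof (cases "0 <= Im (v z) & (Re z <= V \<or> 0 <= Re (v z))")
   case True
   thus ?thesis using r0[of z] by (simp add: q_def)
  next
   case False
   hence "Im (v z) <= 0" using right[OF that] by fastforce
   thus ?thesis using r0[of z] False by (simp add: q_def mult_nonneg_nonpos)
  qed
 qed
 have cont_v: "continuous_on Cu v" unfolding v_def using e Cu by (intro continuous_intros continuous_on_subset[OF continuous_on_hlog]) auto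
 have cont_q: "continuous_on Cu q"
 proof -
  define Ap where "Ap = {z \<in> Cu. 0 <= Im (v z) & (Re z <= V \<or> 0 <= Re (v z))}"
  define Am where "Am = {z \<in> Cu. Im (v z) <= 0 & (V <= Re z \<or> 0 <= Re (v z))}"
  have cov: "Cu = Ap \<union> Am"
  proof
   show "Cu \<subseteq> Ap \<union> Am"
   proof
    fix z assume z: "z \<in> Cu"
    show "z \<in> Ap \<union> Am" using left[OF z] right[OF z] z unfolding Ap_def Am_def by (cases "Re z <= V"; cases "0 <= Im (v z)") auto
   qed
  qed (auto simp: Ap_def Am_def)
  have cl: "closedin (top_of_set Cu) {z \<in> Cu. f z <= g z}" if "continuous_on Cu f" "continuous_on Cu g" for f g :: "complex => real"
  proof -
   have "{z \<in> Cu. f z <= g z} = Cu \<inter> (%z. g z - f z) -` {0..}" by auto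
   thus ?thesis using continuous_closedin_preimage[of Cu "%z. g z - f z" "{0..}"] that by (simp add: continuous_on_diff)
  qed
  have c1: "continuous_on Cu (%z. Re (v z))" "continuous_on Cu (%z. Im (v z))" "continuous_on Cu Re" using cont_v by (auto intro!: continuous_intros)
  have "Ap = {z \<in> Cu. 0 <= Im (v z)} \<inter> ({z \<in> Cu. Re z <= V} \<union> {z \<in> Cu. 0 <= Re (v z)})" by (auto simp: Ap_def)
  hence clp: "closedin (top_of_set Cu) Ap" using c1 by (auto intro!: closedin_Int closedin_Un cl)
  have "Am = {z \<in> Cu. Im (v z) <= 0} \<inter> ({z \<in> Cu. V <= Re z} \<union> {z \<in> Cu. 0 <= Re (v z)})" by (auto simp: Am_def)
  hence clm: "closedin (top_of_set Cu) Am" using c1 by (auto intro!: closedin_Int closedin_Un cl)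
  have cr: "continuous_on Cu r" unfolding r_def using cont_v by (intro continuous_intros) auto
  have "continuous_on (Ap \<union> Am) (%z. if z \<in> Ap then r z else - r z)"
  proof (rule continuous_on_cases_local)
   show "closedin (top_of_set (Ap \<union> Am)) Ap" "closedin (top_of_set (Ap \<union> Am)) Am" using clp clm cov by simp_all
   show "continuous_on Ap r" "continuous_on Am (%z. - r z)" using cr by (auto intro!: continuous_intros continuous_on_subset[OF cr] simp: Ap_def Am_def)
   fix z assume "z \<in> Ap & z \<notin> Ap \<or> z \<in> Am & z \<in> Ap"
   hence z: "z \<in> Cu" "Im (v z) = 0" "Re z <= V \<or> 0 <= Re (v z)" "V <= Re z \<or> 0 <= Re (v z)" by (auto simp: Ap_def Am_def)
   thus "r z = - r z" using on[OF z(1)] r_zero z(2) by (cases "Re z = V") auto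
  qed
  thus ?thesis unfolding cov[symmetric] by (rule continuous_on_eq) (auto simp: q_def Ap_def)
 qed
 have cont_s: "continuous_on Cu s" unfolding s_def Complex_eq using cont_v cont_q by (intro continuous_intros) auto
 have norm_s: "cmod (s z) < 1" if "z \<in> Cu" for z
 proof -
  have "cmod (s z) ^ 2 < 1" using Cu(4)[OF that] sq[OF that] by (metis norm_power)
  thus ?thesis by (simp add: power_less_one_iff)
 qed
 have Re_s: "0 <= Re (s z)" for z using abs_Re_le_cmod[of "v z"] by (simp add: s_def)
 have comb: "c + of_real e * u \<in> comb_domain" if u: "cmod u < 1" "\<not> (Im u = 0 & Re u <= 0)" for u
 proof -
  have "\<bar>e * Im u\<bar> <= 1 * \<bar>Im u\<bar>" using e unfolding abs_mult by (intro mult_right_mono) auto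
  also have "... < 1" using u(1) abs_Im_le_cmod[of u] by simp
  finally have small: "\<bar>e * Im u\<bar> < 1" .
  hence "0 < h + e * Im u" using comb_height_1[OF n] pi_gt3 unfolding h_def by linarith
  moreover have "\<not> (e * Re u <= 0 & h + e * Im u = comb_height j)" for j
  proof
   assume j: "e * Re u <= 0 & h + e * Im u = comb_height j"
   obtain i :: int where i: "comb_height j = 2 * pi * of_int i" using comb_height_multiple by blast
   have "\<bar>2 * pi * of_int i - 2 * pi * of_int k\<bar> < 2" using j small unfolding i[symmetric] k[symmetric] by linarith
   hence "i = k" by (rule multiples_close)
   hence "e * Im u = 0" using j i k by simp
   thus False using u(2) j e by (simp add: mult_le_0_iff)
  qed
  ultimately show ?thesis by (auto simp: comb_domain_def c_def)
 qed
 have s_pos: "0 < Re (s z)" if "z \<in> Cu" "0 < Im z" for z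
 proof (rule ccontr)
  assume "\<not> 0 < Re (s z)"
  hence "v z = - of_real ((Im (s z))\<^sup>2)" using Re_s[of z] sq[OF that(1)] by (simp add: complex_eq_iff power2_eq_square)
  hence "Im (v z) = 0" "Re (v z) <= 0" by simp_all
  hence "Im (hlog z) = comb_height n" "Re (hlog z) <= 0" unfolding Re_v h_def using e by (simp_all add: mult_le_0_iff)
  moreover have "hlog z \<in> comb_domain" using that(2) hlog_image by blast
  ultimately show False using n by (auto simp: comb_domain_def)
 qed
 have s_real: "Re (s z) = 0" "Im (v z) = 0" "Re (v z) <= 0" if "z \<in> Cu" "Im z = 0" for z
 proof -
  show "Im (v z) = 0" "Re (v z) <= 0" using hlog_boundary[OF Cu(1,2)[OF that(1)]] that(2) comb[OF Cu(4)[OF that(1)]] v_hlog[of z] by auto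
  thus "Re (s z) = 0" using cmod_eq_Re[of "v z"] by (simp add: s_def)
 qed
 define \<Phi> where "\<Phi> z = (if 0 <= Im z then s z else - cnj (s (cnj z)))" for z
 have C_cnj: "cnj z \<in> C \<longleftrightarrow> z \<in> C" for z
  by (auto simp: C_def half_log_def fold_def cnj_zeros)
 have C_cases: "z \<in> Cu \<or> cnj z \<in> Cu & Im z < 0" if "z \<in> C" for z
  using that C_cnj[of z] by (auto simp: Cu_def)
 have cont: "continuous_on C \<Phi>"
 proof -
  have "continuous_on ((C \<inter> cuhp) \<union> (C \<inter> {z. Im z <= 0})) \<Phi>" unfolding \<Phi>_def
  proof (rule continuous_on_cases_local)
   have U: "C \<inter> cuhp \<union> C \<inter> {z. Im z <= 0} = C" by auto
   show "closedin (top_of_set (C \<inter> cuhp \<union> C \<inter> {z. Im z <= 0})) (C \<inter> cuhp)"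
    "closedin (top_of_set (C \<inter> cuhp \<union> C \<inter> {z. Im z <= 0})) (C \<inter> {z. Im z <= 0})"
    unfolding U by (intro closedin_closed_Int; simp add: closed_halfspace_Im_ge closed_halfspace_Im_le)+
   show "continuous_on (C \<inter> cuhp) s" using cont_s by (simp add: Cu_def)
   show "continuous_on (C \<inter> {z. Im z <= 0}) (%z. - cnj (s (cnj z)))"
    by (intro continuous_on_minus continuous_on_cnj continuous_on_compose2[OF cont_s] continuous_intros) (use C_cnj in "auto simp: Cu_def")
   fix z assume "z \<in> C \<inter> cuhp & \<not> 0 <= Im z \<or> z \<in> C \<inter> {z. Im z <= 0} & 0 <= Im z"
   hence z: "z \<in> Cu" "Im z = 0" by (auto simp: Cu_def)
   hence "cnj z = z" by (simp add: complex_eq_iff)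
   thus "s z = - cnj (s (cnj z))" using s_real(1)[OF z] unfolding \<open>cnj z = z\<close> by (simp add: complex_eq_iff)
  qed
  moreover have "(C \<inter> cuhp) \<union> (C \<inter> {z. Im z <= 0}) = C" by auto
  ultimately show ?thesis by simp
 qed
 have \<Phi>_up: "\<Phi> z = s z" if "z \<in> Cu" for z using Cu(1)[OF that] by (simp add: \<Phi>_def)
 have \<Phi>_sign: "0 < Re (\<Phi> z) \<longleftrightarrow> 0 < Im z" "Re (\<Phi> z) < 0 \<longleftrightarrow> Im z < 0" if "z \<in> C" for z
  using C_cases[OF that] s_pos[of z] s_real(1)[of z] s_pos[of "cnj z"] Cu(1)[of z] by (cases "Im z = 0"; cases "0 < Im z"; auto simp: \<Phi>_def)+
 have inj: "inj_on \<Phi> C"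
 proof (rule inj_onI)
  fix z w assume zw: "z \<in> C" "w \<in> C" and eq: "\<Phi> z = \<Phi> w"
  have up: "z = w" if "z \<in> Cu" "w \<in> Cu" "0 < Im z" "0 < Im w" "s z = s w" for z w
  proof -
   have "hlog z = hlog w" using sq that v_hlog[of z] v_hlog[of w] by metis
   thus ?thesis using inj_onD[OF hlog_inj] that(3,4) by blast
  qed
  consider "0 < Im z" "0 < Im w" | "Im z < 0" "Im w < 0" | "Im z = 0" "Im w = 0"
   using \<Phi>_sign[OF zw(1)] \<Phi>_sign[OF zw(2)] eq by (metis linorder_neqE_linordered_idom)
  thus "z = w"
  proof cases
   case 1
   thus ?thesis using up[of z w] zw eq by (simp add: Cu_def \<Phi>_def)
  next
   case 2
   thus ?thesis using up[of "cnj z" "cnj w"] zw eq by (simp add: Cu_def \<Phi>_def C_cnj)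
  next
   case 3
   hence u: "z \<in> Cu" "w \<in> Cu" using zw by (auto simp: Cu_def)
   have seq: "s z = s w" using eq 3 by (simp add: \<Phi>_def)
   hence veq: "v z = v w" using sq u by metis
   have hh: "Im (hlog z) = comb_height n" using s_real(2)[OF u(1) 3(1)] unfolding Re_v h_def by simp
   have qeq: "q z = q w" using seq by (simp add: s_def)
   have side: "Re z <= V & Re w <= V \<or> V <= Re z & V <= Re w"
   proof (cases "0 <= Re (v z)")
    case True
    hence v0: "v z = 0" "v w = 0" using s_real(2,3)[OF u(1) 3(1)] veq by (auto simp: complex_eq_iff)
    have "cmod (model x) = 1" if "x \<in> Cu" "v x = 0" for x
     using model_upper[OF Cu(1,2)[OF that(1)]] Re_v(1)[of x] that(2) by simp
    hence one: "cmod (model z) = 1" "cmod (model w) = 1" using u v0 by auto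
    have vert: "x = of_real V" if x: "x \<in> Cu" "Im x = 0" "cmod (model x) = 1" "v x = 0" for x
    proof -
     have hx: "Im (hlog x) = comb_height n" using x(4) unfolding Re_v h_def by simp
     have "\<not> Re x < V"
     proof
      assume a: "Re x < V"
      hence t: "x \<in> cl_tri n" "center n < Re x" using real_left_of_tip[OF n x(2) Cu(2)[OF x(1)] hx] by (auto simp: V_def)
      hence "x \<in> square n" using a x(2) center_eq(1)[OF n] by (simp add: diagonal_square_def V_def abs_if)
      hence "x \<in> model -` ball 0 1" unfolding model_preimage_disc using n by blast
      thus False using x(3) by simp
     qed
     moreover have "\<not> V < Re x"
     proof
      assume a: "V < Re x"
      from real_right_of_tip[OF n x(2) Cu(2)[OF x(1)] hx] a
      consider "cmod x <= 1" "Re x < 0" "n = 1" | m where "1 <= m" "n = Suc m" "x \<in> cl_tri m" "Re x < center m" by (auto simp: V_def)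
      thus False
      proof cases
       case 1
       hence "cmod x < 1" using a cmod_eq_Re[OF x(2)] by (simp add: V_def right_vertex_def)
       thus False using model_disc_lt[of x] x(3) by simp
      next
       case (2 m)
       hence "x \<in> square m" using a x(2) center_eq(2)[of m] by (simp add: diagonal_square_def V_def abs_if)
       hence "x \<in> model -` ball 0 1" unfolding model_preimage_disc using 2(1) by blast
       thus False using x(3) by simp
      qed
     qed
     ultimately show ?thesis using x(2) by (simp add: complex_eq_iff)
    qed
    hence "z = of_real V" "w = of_real V" using u 3 one v0 by auto
    thus ?thesis by simp
   next
    case False
    have "0 < cmod (v z) - Re (v z)" using False norm_ge_zero[of "v z"] by linarith
    hence rpos: "0 < r z" by (simp add: r_def)
    have "r w = r z" using veq by (simp add: r_def)
    show ?thesis using s_real(2) u 3 False veq \<open>r w = r z\<close> qeq rpos by (auto simp: q_def)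
   qed
   have "hlog z = hlog w" using veq v_hlog[of z] v_hlog[of w] by simp
   thus ?thesis using slit_side_inj[OF n 3(1) Cu(2)[OF u(1)] 3(2) Cu(2)[OF u(2)] _ hh] side unfolding V_def by blast
  qed
 qed
 have surj_up: "EX z:Cu. 0 < Im z & s z = t" if t: "cmod t < 1" "0 < Re t" for t
 proof -
  have t2: "cmod (t\<^sup>2) < 1" using t(1) by (simp add: norm_power power_less_one_iff)
  have "\<not> (Im (t\<^sup>2) = 0 & Re (t\<^sup>2) <= 0)" using t(2) by (auto simp: power2_eq_square mult_le_0_iff)
  hence "c + of_real e * t\<^sup>2 \<in> hlog ` uhp" unfolding hlog_image using comb t2 by blast
  then obtain z where z: "z \<in> uhp" "hlog z = c + of_real e * t\<^sup>2" by (metis imageE)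
  have zC: "z \<in> Cu" by (rule Cu_I[OF _ _ z(2) t2]) (use z(1) zeros_real[of z] in auto)
  show ?thesis using z(2) e sq[OF zC] Re_s[of z] t(2) zC z(1) by (auto simp: v_def power2_eq_iff)
 qed
 have surj: "\<Phi> ` C = ball 0 1"
 proof
  show "\<Phi> ` C \<subseteq> ball 0 1"
  proof clarify
   fix z assume "z \<in> C"
   from C_cases[OF this] show "\<Phi> z \<in> ball 0 1" using norm_s[of z] norm_s[of "cnj z"] Cu(1)[of z] by (auto simp: \<Phi>_def)
  qed
  show "ball 0 1 \<subseteq> \<Phi> ` C"
  proof
   fix t :: complex assume "t \<in> ball 0 1"
   hence t: "cmod t < 1" by simp
   consider "0 < Re t" | "Re t < 0" | "Re t = 0" by linarith
   thus "t \<in> \<Phi> ` C"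
   proof cases
    case 1
    then obtain z where "z \<in> Cu" "s z = t" using surj_up[OF t] by blast
    thus ?thesis using \<Phi>_up[of z] by (intro image_eqI[of _ _ z]) (auto simp: Cu_def)
   next
    case 2
    then obtain z where z: "z \<in> Cu" "0 < Im z" "s z = - cnj t" using surj_up[of "- cnj t"] t by auto
    hence "\<Phi> (cnj z) = t" by (simp add: \<Phi>_def)
    moreover have "cnj z \<in> C" using z(1) C_cnj by (simp add: Cu_def)
    ultimately show ?thesis by blast
   next
    case 3
        \<comment> \<open>such a \<open>t\<close> is approached from the right half, and \<open>hlog\<close> being proper, the preimages have a limit\<close>
    define \<delta> where "\<delta> = 1 - cmod t"
    define u where "u i = t + of_real (\<delta> / real (Suc (Suc i)))" for i
    have \<delta>: "0 < \<delta>" using t by (simp add: \<delta>_def)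
    have "EX z:Cu. 0 < Im z & s z = u i" for i
    proof (rule surj_up)
     have "\<delta> / real (Suc (Suc i)) < \<delta>" using \<delta> by (simp add: divide_less_eq)
     hence "cmod (complex_of_real (\<delta> / real (Suc (Suc i)))) < \<delta>" using \<delta> unfolding norm_of_real by simp
     moreover have "cmod (u i) <= cmod t + cmod (complex_of_real (\<delta> / real (Suc (Suc i))))" unfolding u_def by (rule norm_triangle_ineq)
     moreover have "cmod t + \<delta> = 1" by (simp add: \<delta>_def)
     ultimately show "cmod (u i) < 1" by linarith
     show "0 < Re (u i)" using 3 \<delta> by (simp add: u_def)
    qed
    then obtain z where z: "!!i. z i \<in> Cu" "!!i. s (z i) = u i" by metis
    have "(%i. \<delta> * (1 / real (Suc (Suc i)))) ----> \<delta> * 0"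
     by (intro tendsto_mult tendsto_const LIMSEQ_Suc[OF LIMSEQ_Suc[OF lim_1_over_n]])
    hence "(%i. \<delta> / real (Suc (Suc i))) ----> 0" by simp
    hence "(%i. t + of_real (\<delta> / real (Suc (Suc i)))) ----> t + of_real 0" by (intro tendsto_intros)
    hence ut: "u ----> t" unfolding u_def by simp
    have hz: "hlog (z i) = c + of_real e * (u i)\<^sup>2" for i using v_hlog[of "z i"] sq[OF z(1)[of i]] z(2)[of i] by simp
    have "(%i. hlog (z i)) ----> c + of_real e * t\<^sup>2" unfolding hz by (intro tendsto_intros ut)
    moreover have "z i \<in> cuhp - zeros" for i using Cu(1,2)[OF z(1)[of i]] by simp
    ultimately obtain x r where x: "x \<in> cuhp - zeros" "hlog x = c + of_real e * t\<^sup>2" "strict_mono r" "(z \<circ> r) ----> x"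
     using hlog_limit[of z "c + of_real e * t\<^sup>2"] by blast
    have "cmod (t\<^sup>2) < 1" using t by (simp add: norm_power power_less_one_iff)
    hence xC: "x \<in> Cu" using x by (intro Cu_I[OF _ _ x(2)]) auto
    have "(%i. s ((z \<circ> r) i)) ----> s x" using z(1) by (intro continuous_on_lim[OF cont_s _ xC x(4)]) simp
    moreover have "(%i. s ((z \<circ> r) i)) ----> t" using LIMSEQ_subseq_LIMSEQ[OF ut x(3)] z(2) by (simp add: o_def)
    ultimately have "s x = t" by (rule LIMSEQ_unique)
    thus ?thesis using \<Phi>_up[OF xC] xC by (intro image_eqI[of _ _ x]) (auto simp: Cu_def)
   qed
  qed
 qed
 have "disc_chart model (log_chart 0 e) C"
 proof (rule disc_chartI[OF piece(1) cont inj surj, where m = 2])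
  fix z assume z: "z \<in> C"
  have up: "log_chart 0 e (exp (hlog z)) = v z" "log_chart 0 e (cnj (exp (hlog z))) = cnj (v z)" if "z \<in> Cu" for z
  proof -
   have "cmod (hlog z - c) < 1" using Cu(3)[OF that] e by (simp add: dist_norm norm_minus_commute)
   thus "log_chart 0 e (exp (hlog z)) = v z" using log_chart_exp[of "hlog z" 0 k e] unfolding ck[symmetric] v_def by simp
   have "cnj (hlog z) - (0 + turn (- k)) = cnj (hlog z - c)" by (simp add: c_def k)
   moreover from this have "cmod (cnj (hlog z) - (0 + turn (- k))) < 1" using \<open>cmod (hlog z - c) < 1\<close> by (metis complex_mod_cnj)
   ultimately show "log_chart 0 e (cnj (exp (hlog z))) = cnj (v z)" using log_chart_exp[of "cnj (hlog z)" 0 "- k" e] unfolding exp_cnj v_def by simp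
  qed
  from C_cases[OF z] show "log_chart 0 e (model z) = (\<Phi> z)\<^sup>2"
  proof (elim disjE conjE)
   assume u: "z \<in> Cu"
   thus ?thesis using up(1)[OF u] sq[OF u] \<Phi>_up[OF u] model_upper[OF Cu(1,2)[OF u]] by simp
  next
   assume u: "cnj z \<in> Cu" "Im z < 0"
   have "(\<Phi> z)\<^sup>2 = cnj ((s (cnj z))\<^sup>2)" using u(2) by (simp add: \<Phi>_def)
   moreover have "model z = cnj (exp (hlog (cnj z)))" using model_upper[OF Cu(1,2)[OF u(1)]] model_cnj[of "cnj z"] by simp
   ultimately show ?thesis using up(2)[OF u(1)] sq[OF u(1)] by simp
  qed
 qed simp
 thus ?thesis unfolding has_chart_def using piece z0 by (intro exI[of _ C]) (auto simp: C_def c_def h_def)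
qed

end

section \<open>The model is a branched covering\<close>

context even_multiplicities
begin

lemma comb_ballI:
 fixes k :: int
 assumes e: "0 < e" and pos: "!!v. v \<in> ball c e ==> 0 < Im v"
  and slit: "!!v n. [|v \<in> ball c e; 1 <= n; Im v = comb_height n|] ==> 0 < Re v"
 shows "ball c e \<subseteq> comb_domain"
proof
 fix v assume v: "v \<in> ball c e"
 hence "\<not> (Re v <= 0 & (EX n>=1. Im v = comb_height n))" using slit[OF v] by (meson not_le)
 thus "v \<in> comb_domain" using pos[OF v] by (simp add: comb_domain_def)
qed

lemma ball_components:
 assumes "v \<in> ball c e"
 shows "\<bar>Re v - Re c\<bar> < e" "\<bar>Im v - Im c\<bar> < e"
 using assms abs_Re_le_cmod[of "v - c"] abs_Im_le_cmod[of "v - c"] by (auto simp: dist_norm norm_minus_commute)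

lemma preimage_log:
 assumes z: "z \<in> near l e" "0 <= Im z"
 obtains k :: int where "hlog z \<in> ball (l + turn k) e" "z \<notin> zeros" "0 <= Im (hlog z)"
proof -
 have nz: "z \<notin> zeros" using preimage_nonzero z(1) by blast
 have "exp (hlog z) \<in> exp ` ball l e" using z(1) model_upper[OF z(2) nz] by simp
 then obtain k :: int where k: "cmod (hlog z - (l + turn k)) < e" using exp_ball_log by blast
 obtain u where u: "!!i. u i \<in> uhp" "u ----> z" using half_plane_sequence[OF z(2)] by blast
 have uc: "u i \<in> cuhp - zeros" for i using u(1)[of i] zeros_real[of "u i"] by auto
 have "(%i. hlog (u i)) ----> hlog z" using z(2) nz uc u(2) by (intro continuous_on_lim[OF continuous_on_hlog]) auto
 hence "(%i. Im (hlog (u i))) ----> Im (hlog z)" by (rule tendsto_Im)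
 moreover have "0 <= Im (hlog (u i))" for i using Im_hlog_pos[OF u(1)] by (rule less_imp_le)
 ultimately have "0 <= Im (hlog z)" using LIMSEQ_le_const by blast
 thus ?thesis using that k nz by (simp add: dist_norm norm_minus_commute)
qed

text \<open>If \<open>exp l\<close> is not positive, balls around the logarithms avoid the real axis and all slits, whose heights are
  multiples of \<open>2 \<pi>\<close>.\<close>

lemma nonreal_upper_chart:
 assumes l: "\<bar>Im l\<bar> <= pi" "e <= \<bar>Im l\<bar>" and e: "0 < e" "e <= 1" and z: "z \<in> near l e" "0 <= Im z"
 shows "has_chart l e z"
proof -
 obtain k :: int where k: "hlog z \<in> ball (l + turn k) e" and nz: "z \<notin> zeros" and h: "0 <= Im (hlog z)" using preimage_log[OF z] by blast
 define c where "c = l + turn k"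
 have far: "e <= \<bar>Im c - 2 * pi * of_int j\<bar>" for j :: int
 proof (cases "j = k")
  case True
  thus ?thesis using l(2) by (simp add: c_def)
 next
  case False
  hence "2 * pi * 1 <= 2 * pi * \<bar>real_of_int (k - j)\<bar>" by (intro mult_left_mono) auto
  moreover have "\<bar>2 * pi * of_int k - 2 * pi * of_int j\<bar> = 2 * pi * \<bar>real_of_int (k - j)\<bar>"
   by (simp add: abs_mult flip: right_diff_distrib)
  ultimately have "pi <= \<bar>Im l + (2 * pi * of_int k - 2 * pi * of_int j)\<bar>" using l(1) by linarith
  thus ?thesis using e(2) pi_gt3 by (simp add: c_def add_diff_eq)
 qed
 have Im_pos: "0 < Im v" if "v \<in> ball c e" for v
 proof -
  have "e <= \<bar>Im c\<bar>" using far[of 0] by simp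
  moreover have "\<bar>Im (hlog z) - Im c\<bar> < e" by (rule ball_components(2)) (use k in "simp only: c_def")
  ultimately show ?thesis using ball_components(2)[OF that] h by linarith
 qed
 have "ball c e \<subseteq> comb_domain"
 proof (rule comb_ballI[OF e(1) Im_pos])
  fix v n assume v: "v \<in> ball c e" "Im v = comb_height n"
  obtain j :: int where "comb_height n = 2 * pi * of_int j" using comb_height_multiple by blast
  thus "0 < Re v" using far[of j] ball_components(2)[OF v(1)] v(2) by (simp add: abs_minus_commute)
 qed
 moreover from this have "0 < Im z" using hlog_boundary[OF z(2) nz] k unfolding c_def[symmetric] by blast
 ultimately show ?thesis using upper_chart[OF e c_def] k unfolding c_def[symmetric] by blast
qed

text \<open>In the closed upper half-plane the logarithms of a number \<open>\<ge> 1\<close> are real, or inside the comb domain, or,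
  if the number is \<open>1\<close>, possibly tips of slits.\<close>

lemma real_upper_chart:
 assumes l: "Im l = 0" "l = 0 \<or> e <= Re l" and e: "0 < e" "e <= 1" and z: "z \<in> near l e" "0 <= Im z"
 shows "has_chart l e z"
proof -
 obtain k :: int where k: "hlog z \<in> ball (l + turn k) e" and nz: "z \<notin> zeros" and h: "0 <= Im (hlog z)" using preimage_log[OF z] by blast
 define c where "c = l + turn k"
 note k = k[folded c_def]
 have Im_c: "Im c = 2 * pi * of_int k" using l(1) by (simp add: c_def)
 have half: "half_log z = hlog z" using z(2) by (simp add: half_log_def fold_cases)
 consider "k < 0" | "k = 0" | "0 < k" by linarith
 thus ?thesis
 proof cases
  case 1
  have "\<bar>Im (hlog z) - 2 * pi * of_int k\<bar> < 1" using ball_components(2)[OF k] e(2) unfolding Im_c by linarith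
  moreover have "2 * pi * of_int k <= 2 * pi * (- 1)" using 1 by (intro mult_left_mono) auto
  ultimately show ?thesis using h pi_gt3 by linarith
 next
  case 2
  thus ?thesis using k half real_chart[OF e l(1) nz] by (simp add: c_def)
 next
  case 3
  have kpos: "2 * pi * 1 <= 2 * pi * of_int k" using 3 by (intro mult_left_mono) auto
  have Im_pos: "0 < Im v" if "v \<in> ball c e" for v
   using ball_components(2)[OF that] kpos e(2) pi_gt3 unfolding Im_c by linarith
  show ?thesis
  proof (cases "l = 0 & (EX n>=1. comb_height n = 2 * pi * of_int k)")
   case True
   then obtain n where n: "1 <= n" "comb_height n = 2 * pi * of_int k" by blast
   show ?thesis using True n(2) tip_chart[OF n(1) e nz] k half by (simp add: c_def mult.commute)
  next
   case False
   have "ball c e \<subseteq> comb_domain"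
   proof (rule comb_ballI[OF e(1) Im_pos])
    fix v n assume v: "v \<in> ball c e" "1 <= n" "Im v = comb_height n"
    obtain j :: int where j: "comb_height n = 2 * pi * of_int j" using comb_height_multiple by blast
    have "\<bar>2 * pi * of_int j - 2 * pi * of_int k\<bar> < 2" using ball_components(2)[OF v(1)] e(2) unfolding Im_c v(3) j by linarith
    hence "j = k" by (rule multiples_close)
    hence "l ~= 0" using False v(2) j by blast
    thus "0 < Re v" using l(2) ball_components(1)[OF v(1)] by (simp add: c_def)
   qed
   moreover from this have "0 < Im z" using hlog_boundary[OF z(2) nz] k by blast
   ultimately show ?thesis using upper_chart[OF e c_def] k by blast
  qed
 qed
qed

lemma chart_reflection:
 assumes e: "0 < e" "e <= 1" and up: "!!z. [|z \<in> near l e; 0 <= Im z|] ==> has_chart l e z"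
  "!!z. [|z \<in> near (cnj l) e; 0 <= Im z|] ==> has_chart (cnj l) e z"
  and z: "z \<in> near l e"
 shows "has_chart l e z"
proof (cases "0 <= Im z")
 case False
 show ?thesis using cnj_exp_ball[of "model z" l e] z up(2) False has_chart_cnj[OF e] by (simp add: model_cnj del: image_iff)
qed (use up(1) z in blast)

lemma outer_charts:
 assumes w: "1 <= cmod w"
 shows "EX W \<psi> \<psi>'. open W & w \<in> W & homeomorphism W (ball 0 1) \<psi> \<psi>' & \<psi> w = 0 & clopen_charts model \<psi> (model -` W)"
proof -
 have "EX l e. exp l = w & 0 < e & e <= 1 & (ALL z:near l e. has_chart l e z)"
 proof (cases "Im w = 0 & 0 < Re w")
  case True
  define l where "l = complex_of_real (ln (Re w))"
  have w_re: "w = of_real (Re w)" using True by (simp add: complex_eq_iff)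
  have l: "exp l = w" "Im l = 0" "0 <= Re l" using w True cmod_eq_Re[of w] w_re by (auto simp: l_def exp_of_real)
  define e where "e = (if l = 0 then 1 else min 1 (Re l))"
  have l0: "l = 0 \<or> 0 < Re l" using l by (auto simp: complex_eq_iff)
  have e: "0 < e" "e <= 1" "l = 0 \<or> e <= Re l" using l0 by (auto simp: e_def)
  have cl: "cnj l = l" using l(2) by (simp add: complex_eq_iff)
  have "has_chart l e z" if "z \<in> near l e" for z
   using chart_reflection[OF e(1,2) _ _ that] real_upper_chart[OF l(2) e(3) e(1,2)] unfolding cl by blast
  thus ?thesis using l(1) e by blast
 next
  case False
  define l where "l = Ln w"
  have w0: "w ~= 0" using w by auto
  have l: "exp l = w" "\<bar>Im l\<bar> <= pi" using w0 mpi_less_Im_Ln[OF w0] Im_Ln_le_pi[OF w0] by (auto simp: l_def)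
  have "Im l ~= 0"
  proof
   assume "Im l = 0"
   hence "Im w = 0" "0 < Re w" unfolding l(1)[symmetric] Re_exp Im_exp by simp_all
   thus False using False by blast
  qed
  define e where "e = min 1 \<bar>Im l\<bar>"
  have e: "0 < e" "e <= 1" "e <= \<bar>Im l\<bar>" using \<open>Im l ~= 0\<close> by (auto simp: e_def)
  have "has_chart l e z" if "z \<in> near l e" for z
   using chart_reflection[OF e(1,2) nonreal_upper_chart[OF l(2) e(3) e(1,2)] nonreal_upper_chart[of "cnj l" e] that] l(2) e by simp
  thus ?thesis using l(1) e by blast
 qed
 then obtain l e where l: "exp l = w" and e: "0 < e" "e <= 1" and charts: "!!z. z \<in> near l e ==> has_chart l e z" by blast
 have "open (exp ` ball l e)" using exp_ball_open[OF e(2)] .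
 moreover have "w \<in> exp ` ball l e" using l e(1) by (intro image_eqI[of _ _ l]) auto
 moreover have "log_chart l e w = 0" using log_chart_center[of l e] l by simp
 ultimately show ?thesis using log_chart_homeomorphism[OF e, of l] clopen_chartsI[of "near l e" model "log_chart l e"] charts unfolding has_chart_def by blast
qed

text \<open>The disc and the squares under a common index, with the disc as number \<open>0\<close>.\<close>

definition cell :: "nat => complex set" where "cell n = (if n = 0 then ball 0 1 else square n)"
definition cell_chart :: "nat => complex => complex" where "cell_chart n = (if n = 0 then (%z. z) else sq_chart n)"
definition cell_degree :: "nat => nat" where "cell_degree n = (if n = 0 then 2 else d n)"

lemma sq_chart_image: "1 <= n ==> sq_chart n ` square n = ball 0 1"
proof -
 assume n: "1 <= n"
 obtain \<psi> where "homeomorphism (square n) (ball 0 1) (%z. dia ((z - of_real (center n)) * of_real (2 / real (d n)))) \<psi>"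
  using dia_homeomorphism[of "real (d n)" "center n"] d_pos[OF n] by auto
 thus ?thesis using homeomorphism_image1 unfolding sq_chart_def by blast
qed

lemma cell:
 shows "open (cell n)" "continuous_on (cell n) (cell_chart n)" "inj_on (cell_chart n) (cell n)" "cell_chart n ` cell n = ball 0 1"
  "1 <= cell_degree n" "z \<in> cell n ==> model z = cell_chart n z ^ cell_degree n"
 using open_square[of n] continuous_on_sq_chart[of "square n" n] inj_sq_chart[of n "square n"] sq_chart_image[of n] d_pos[of n] square_model[of n z]
 by (auto simp: cell_def cell_chart_def cell_degree_def model_disc)

lemma preimage_cells: "model -` ball 0 1 = (\<Union>n. cell n)"
proof -
 have U: "(UNIV :: nat set) = insert 0 {1..}" by auto
 have "(\<Union>n. cell n) = cell 0 \<union> (\<Union>n\<in>{1..}. cell n)" unfolding U by (simp only: UN_insert)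
 moreover have "cell 0 = ball 0 1" by (simp add: cell_def)
 moreover have "(\<Union>n\<in>{1..}. cell n) = (\<Union>n\<in>{1..}. square n)" by (intro SUP_cong) (auto simp: cell_def)
 ultimately show ?thesis unfolding model_preimage_disc by simp
qed

lemma disjoint_cells: "m ~= n ==> cell m \<inter> cell n = {}"
proof -
 have disc: "square n \<inter> ball 0 1 = {}" if n: "1 <= n" for n
 proof -
  have "1 <= cmod z" if z: "z \<in> square n" for z
  proof -
   have "\<bar>Re z - center n\<bar> < d n / 2" using z by (auto simp: diagonal_square_def)
   thus ?thesis using center_eq(1)[OF n] vertex_le[OF n] abs_Re_le_cmod[of z] n by linarith
  qed
  thus ?thesis by fastforce
 qed
 have sq: "square m \<inter> square n = {}" if m: "1 <= m" "m < n" for m n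
 proof -
  have "vertex n <= vertex (Suc m)" using vertex_antimono[of "Suc m" n] m by simp
  hence "\<not> (\<bar>Re z - center m\<bar> < d m / 2 & \<bar>Re z - center n\<bar> < d n / 2)" for z
   using center_eq(2)[of m] center_eq(1)[of n] m by linarith
  hence not_both: "\<not> (\<bar>Re z - center m\<bar> < d m / 2 & \<bar>Re z - center n\<bar> < d n / 2)" for z .
  have "z \<notin> square n" if z: "z \<in> square m" for z
  proof
   assume "z \<in> square n"
   hence "\<bar>Re z - center m\<bar> < d m / 2" "\<bar>Re z - center n\<bar> < d n / 2"
    using z abs_ge_zero[of "Im z"] unfolding diagonal_square_def mem_Collect_eq by linarith+
   thus False using not_both by blast
  qed
  thus ?thesis by blast
 qed
 have "cell m \<inter> cell n = {}" if "m < n" for m n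
  using disc[of n] sq[of m n] that by (auto simp: cell_def Int_commute)
 moreover assume "m ~= n"
 ultimately show ?thesis using linorder_neqE_nat by (metis Int_commute)
qed

lemma other_cells:
 "model -` ball 0 1 = cell n \<union> \<Union> (cell ` (- {n}))" "cell n \<inter> \<Union> (cell ` (- {n})) = {}" "open (\<Union> (cell ` (- {n})))"
proof -
 have "(\<Union>n. cell n) = (\<Union>n\<in>insert n (- {n}). cell n)" by auto
 thus "model -` ball 0 1 = cell n \<union> \<Union> (cell ` (- {n}))" unfolding preimage_cells by (simp only: UN_insert)
 have "cell n \<inter> cell m = {}" if "m \<in> - {n}" for m using disjoint_cells[of n m] that by simp
 thus "cell n \<inter> \<Union> (cell ` (- {n})) = {}" by blast
 show "open (\<Union> (cell ` (- {n})))" by (intro open_UN ballI cell)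
qed

text \<open>The cells are disjoint open sets, hence each is relatively clopen in the preimage of the disc.\<close>

lemma inner_charts:
 assumes w: "cmod w < 1"
 shows "EX W \<psi> \<psi>'. open W & w \<in> W & homeomorphism W (ball 0 1) \<psi> \<psi>' & \<psi> w = 0 & clopen_charts model \<psi> (model -` W)"
proof -
 obtain W \<psi> \<psi>' where W: "open W" "w \<in> W" "W \<subseteq> ball 0 1" "homeomorphism W (ball 0 1) \<psi> \<psi>'" "\<psi> w = 0"
  and charts: "ALL U \<Phi> f m. open U & continuous_on U \<Phi> & inj_on \<Phi> U & \<Phi> ` U = ball 0 1 & 1 <= m & (ALL z:U. f z = \<Phi> z ^ m)
     --> clopen_charts f \<psi> (U \<inter> f -` W)" using power_charts[of w] w by auto
 have cell_charts: "clopen_charts model \<psi> (cell n \<inter> model -` W)" for n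
  by (rule charts[THEN spec[of _ "cell n"], THEN spec[of _ "cell_chart n"], THEN spec[of _ model], THEN spec[of _ "cell_degree n"], THEN mp])
   (intro conjI ballI cell)
 have "clopen_charts model \<psi> (model -` W)" unfolding clopen_charts_def
 proof
  fix z assume z: "z \<in> model -` W"
  hence "z \<in> model -` ball 0 1" using W(3) by auto
  then obtain n where n: "z \<in> cell n" unfolding preimage_cells by blast
  have op: "openin (top_of_set (model -` W)) (model -` W \<inter> U)" if "open U" for U using that by (rule openin_open_Int)
  have split: "model -` W - cell n \<inter> model -` W = model -` W \<inter> \<Union> (cell ` (- {n}))" using W(3) other_cells(1,2)[of n] by blast
  have "openin (top_of_set (model -` W)) (model -` W - cell n \<inter> model -` W)" unfolding split by (intro op other_cells)
  hence cl: "closedin (top_of_set (model -` W)) (cell n \<inter> model -` W)" by (simp add: closedin_def)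
  have opn: "openin (top_of_set (model -` W)) (cell n \<inter> model -` W)" using op[OF cell(1)[of n]] by (simp add: Int_commute)
  obtain C where C: "z \<in> C" "openin (top_of_set (cell n \<inter> model -` W)) C" "closedin (top_of_set (cell n \<inter> model -` W)) C" "disc_chart model \<psi> C"
   using cell_charts[of n] n z unfolding clopen_charts_def by blast
  show "EX C. z \<in> C & openin (top_of_set (model -` W)) C & closedin (top_of_set (model -` W)) C & disc_chart model \<psi> C"
   by (intro exI[of _ C] conjI C(1,4) openin_trans[OF C(2) opn] closedin_trans[OF C(3) cl])
 qed
 thus ?thesis using W by blast
qed

lemma model_surj: "model ` UNIV = UNIV"
proof -
 have "w \<in> range model" for w
 proof (cases "w = 0")
  case True
  thus ?thesis using model_eq_0[of 0] by (intro image_eqI[of _ _ 0]) (auto simp: zeros_def)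
 next
  case False
  define v where "v = Ln w + turn 1"
  have "Im v = Im (Ln w) + 2 * pi" by (simp add: v_def)
  hence "0 <= Im v" using mpi_less_Im_Ln[OF False] pi_gt_zero by linarith
  then obtain z where z: "z \<in> cuhp - zeros" "hlog z = v" using hlog_onto by blast
  have "model z = exp (Ln w)" using model_upper[of z] z exp_shift[of "Ln w" 1] by (simp add: v_def)
  thus ?thesis using False by (intro image_eqI[of _ _ z]) auto
 qed
 thus ?thesis by blast
qed

theorem model_covering: "branched_covering model UNIV UNIV"
proof (rule branched_coveringI[OF continuous_on_model model_surj])
 fix w :: complex
 show "EX W \<psi> \<psi>'. open W & w \<in> W & W \<subseteq> UNIV & homeomorphism W (ball 0 1) \<psi> \<psi>' & \<psi> w = 0
        & clopen_charts model \<psi> (UNIV \<inter> model -` W)" using inner_charts[of w] outer_charts[of w] by (cases "cmod w < 1") auto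
qed

theorem model_square_covering:
 assumes n: "1 <= n"
 shows "branched_covering_of_degree (d n) model (square n) (ball 0 1)"
proof (rule power_covering_degree[OF open_square continuous_on_sq_chart inj_sq_chart[OF n] sq_chart_image[OF n]])
 show "critical_point model (of_real (center n))" "model (of_real (center n)) = 0" using n critical_iff model_eq_0 by (auto simp: zeros_def)
qed (use n d_pos[OF n] center_in_square[OF n] square_model[OF n] in auto)

section \<open>Asymptotic values\<close>

lemma at_infinity_unbounded:
 fixes \<gamma> :: "real => complex"
 assumes "filterlim \<gamma> at_infinity at_top"
 shows "eventually (%t. R < cmod (\<gamma> t)) at_top" using filterlim_at_infinity_imp_norm_at_top[OF assms] by (simp add: filterlim_at_top_dense)

text \<open>The tail of such a curve would stay in one cell, and cells are bounded.\<close>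

lemma no_asymptotic_in_disc:
 fixes \<gamma> :: "real => complex"
 assumes \<gamma>: "continuous_on {0..} \<gamma>" "filterlim \<gamma> at_infinity at_top" and lim: "((%t. model (\<gamma> t)) \<longlongrightarrow> a) at_top"
 shows "1 <= cmod a"
proof (rule ccontr)
 assume "\<not> 1 <= cmod a"
 hence "eventually (%t. model (\<gamma> t) \<in> ball 0 1) at_top" by (intro topological_tendstoD[OF lim]) auto
 then obtain T where T: "!!t. T <= t ==> model (\<gamma> t) \<in> ball 0 1" unfolding eventually_at_top_linorder by blast
 define T' where "T' = max T 0"
 have sub: "\<gamma> ` {T'..} \<subseteq> (\<Union>n. cell n)" unfolding preimage_cells[symmetric] using T by (auto simp: T'_def)
 have con: "connected (\<gamma> ` {T'..})" by (intro connected_continuous_image continuous_on_subset[OF \<gamma>(1)]) (auto simp: T'_def)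
 obtain n where n: "\<gamma> T' \<in> cell n" using sub by blast
 have "\<gamma> ` {T'..} \<subseteq> cell n"
 proof (rule ccontr)
  assume "\<not> ?thesis"
  moreover have cov: "\<gamma> ` {T'..} \<subseteq> cell n \<union> \<Union> (cell ` (- {n}))" using sub unfolding preimage_cells[symmetric] other_cells(1)[of n] .
  ultimately have "\<Union> (cell ` (- {n})) \<inter> \<gamma> ` {T'..} ~= {}" by blast
  moreover have "cell n \<inter> \<gamma> ` {T'..} ~= {}" using n by auto
  moreover have "cell n \<inter> \<Union> (cell ` (- {n})) \<inter> \<gamma> ` {T'..} = {}" using other_cells(2)[of n] by simp
  ultimately show False using connectedD[OF con cell(1)[of n] other_cells(3)[of n] _ cov] by blast
 qed
 moreover have "bounded (cell n)"
 proof (cases "n = 0")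
  case False
  have "cmod z <= \<bar>center n\<bar> + d n" if "z \<in> square n" for z
  proof -
   have "\<bar>Re z - center n\<bar> + \<bar>Im z\<bar> < d n / 2" using that by (simp add: diagonal_square_def)
   thus ?thesis using cmod_le[of z] by linarith
  qed
  thus ?thesis using False by (auto simp: cell_def bounded_iff)
 qed (simp add: cell_def)
 ultimately obtain R where R: "!!t. T' <= t ==> cmod (\<gamma> t) <= R" unfolding bounded_iff by (metis atLeast_iff image_subset_iff)
 have "eventually (%t. R < cmod (\<gamma> t) & T' <= t) at_top"
  using at_infinity_unbounded[OF \<gamma>(2), of R] eventually_ge_at_top[of T'] by (rule eventually_conj)
 then obtain t where "R < cmod (\<gamma> t)" "T' <= t" using eventually_happens' trivial_limit_at_top_linorder by blast
 thus False using R by fastforce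
qed

text \<open>If the modulus of the value tends to \<open>\<bar>a\<bar> > 0\<close>, the real part of \<open>half_log\<close> is bounded along the curve, so
  its imaginary part, up to sign the argument of the value, tends to infinity and takes all large values.\<close>

theorem no_asymptotic_value: "\<not> asymptotic_value model a"
proof
 assume "asymptotic_value model a"
 then obtain \<gamma> :: "real => complex" where \<gamma>: "continuous_on {0..} \<gamma>" "filterlim \<gamma> at_infinity at_top" and lim: "((%t. model (\<gamma> t)) \<longlongrightarrow> a) at_top"
  unfolding asymptotic_value_def by blast
 have a: "1 <= cmod a" using no_asymptotic_in_disc[OF \<gamma> lim] .
 have nlim: "((%t. cmod (model (\<gamma> t))) \<longlongrightarrow> cmod a) at_top" using lim by (rule tendsto_norm)
 have ev: "eventually (%t. cmod (model (\<gamma> t)) \<in> {0<..<cmod a + 1}) at_top" by (rule topological_tendstoD[OF nlim]) (use a in auto)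
 then obtain T where T: "!!t. T <= t ==> 0 < cmod (model (\<gamma> t)) & cmod (model (\<gamma> t)) < cmod a + 1" unfolding eventually_at_top_linorder by auto
 define T0 where "T0 = max T 0"
 have nz: "\<gamma> t \<notin> zeros" if "T0 <= t" for t using T[of t] that model_eq_0[of "\<gamma> t"] by (auto simp: T0_def)
 have nm: "cmod (model (\<gamma> t)) = exp (Re (half_log (\<gamma> t)))" "Re (model (\<gamma> t)) = cmod (model (\<gamma> t)) * cos (Im (half_log (\<gamma> t)))" if "T0 <= t" for t
  using model_half_log[OF nz[OF that]] by (cases "0 <= Im (\<gamma> t)"; simp add: Re_exp)+
 have cont: "continuous_on {T0..} (%t. Im (half_log (\<gamma> t)))"
  by (intro continuous_intros continuous_on_compose2[OF continuous_on_half_log continuous_on_subset[OF \<gamma>(1)]]) (use nz in "auto simp: T0_def")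
 have unb: "EX t>=S. Im (half_log (\<gamma> t)) = y" if S: "T0 <= S" and y: "Im (half_log (\<gamma> S)) <= y" for S y
 proof -
  define M where "M = max (cmod a + 1) y"
  obtain R where R: "ALL z:cuhp. Re (hlog z) <= M & Im (hlog z) <= M --> cmod z <= R" using hlog_proper by blast
  have "eventually (%t. R < cmod (\<gamma> t) & S <= t) at_top"
   using at_infinity_unbounded[OF \<gamma>(2), of R] eventually_ge_at_top[of S] by (rule eventually_conj)
  then obtain t where t: "R < cmod (\<gamma> t)" "S <= t" using eventually_happens' trivial_limit_at_top_linorder by blast
  have t0: "T0 <= t" using S t(2) by simp
  have "exp (Re (half_log (\<gamma> t))) < cmod a + 1" using nm(1)[OF t0] T[of t] t0 by (simp add: T0_def)
  hence "Re (half_log (\<gamma> t)) <= cmod a + 1" using exp_ge_add_one_self[of "Re (half_log (\<gamma> t))"] by linarith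
  hence "Re (half_log (\<gamma> t)) <= M" unfolding M_def by linarith
  moreover have "cmod (fold (\<gamma> t)) = cmod (\<gamma> t)" by (simp add: fold_cases)
  ultimately have "y <= Im (half_log (\<gamma> t))" using bspec[OF R, of "fold (\<gamma> t)"] t(1) by (auto simp: half_log_def M_def)
  moreover have "continuous_on {S..t} (%t. Im (half_log (\<gamma> t)))" by (rule continuous_on_subset[OF cont]) (use S in auto)
  ultimately obtain x where "S <= x" "x <= t" "Im (half_log (\<gamma> x)) = y" using IVT'[of "%t. Im (half_log (\<gamma> t))" S y t] y t(2) by blast
  thus ?thesis by blast
 qed
  \<comment> \<open>along the curve the argument takes every large value, so the values return to every direction \<open>x\<close> up to conjugation\<close>
 have freq: "EX t>=S. cos (Im (half_log (\<gamma> t))) = cos x" if S: "T0 <= S" for S x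
 proof -
  obtain k :: nat where k: "(Im (half_log (\<gamma> S)) - x) / (2 * pi) <= real k" using real_arch_simple by blast
  hence "Im (half_log (\<gamma> S)) <= x + 2 * real k * pi" by (simp add: pos_divide_le_eq mult_ac)
  then obtain t where "S <= t" "Im (half_log (\<gamma> t)) = x + 2 * real k * pi" using unb[OF S] by blast
  moreover have "cos (x + 2 * real k * pi) = cos x" unfolding cos_add cos_2npi sin_2npi by simp
  ultimately show ?thesis by metis
 qed
 have rlim: "((%t. Re (model (\<gamma> t))) \<longlongrightarrow> Re a) at_top" using lim by (rule tendsto_Re)
 have key: "Re a = cmod a * cos x" for x
 proof (rule ccontr)
  assume ne: "Re a ~= cmod a * cos x"
  have "((%t. Re (model (\<gamma> t)) - cmod (model (\<gamma> t)) * cos x) \<longlongrightarrow> Re a - cmod a * cos x) at_top"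
   by (intro tendsto_intros rlim nlim)
  hence "eventually (%t. Re (model (\<gamma> t)) - cmod (model (\<gamma> t)) * cos x \<in> - {0}) at_top"
   by (rule topological_tendstoD) (use ne in auto)
  then obtain S where S: "!!t. S <= t ==> Re (model (\<gamma> t)) ~= cmod (model (\<gamma> t)) * cos x" unfolding eventually_at_top_linorder by auto
  obtain t where "max S T0 <= t" "cos (Im (half_log (\<gamma> t))) = cos x" using freq[of "max S T0" x] by auto
  thus False using S[of t] nm(2)[of t] by simp
 qed
 have "cmod a * cos 0 = cmod a * cos pi" using key by metis
 thus False using a by simp
qed

end

section \<open>Critical points and the theorem\<close>

context even_multiplicities
begin

lemma model_zeros: "z \<in> zeros ==> model z = 0" using model_eq_0 by blast

lemma vertex_not_zero: "1 <= n ==> complex_of_real (vertex n) \<notin> zeros" using model_vertex[of n] model_zeros by fastforce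

lemma critical_in_square:
 assumes n: "1 <= n"
 shows "{z \<in> square n. critical_point model z} = {of_real (center n)}"
proof (intro equalityI subsetI)
 fix z assume "z \<in> {z \<in> square n. critical_point model z}"
 hence z: "z \<in> square n" "critical_point model z" by auto
 have "z \<in> model -` ball 0 1" unfolding model_preimage_disc using z(1) n by blast
 hence "model z ~= 1" by auto
 hence "z \<in> zeros" using z(2) model_vertex unfolding critical_iff by blast
 thus "z \<in> {of_real (center n)}" using model_zeros square_model[OF n z(1)] sq_chart_0[OF n] by simp
next
 fix z :: complex assume "z \<in> {of_real (center n)}"
 hence "z = of_real (center n)" by simp
 moreover have "of_real (center n) \<in> zeros" using n by (auto simp: zeros_def)
 ultimately show "z \<in> {z \<in> square n. critical_point model z}" using center_in_square[OF n] critical_iff by simp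
qed

lemma vertices_on_axis:
 "(\<Union>n\<in>{1..}. diagonal_square_vertices (center n) (real (d n))) \<inter> negative_real_axis = {of_real (vertex n) | n. 1 <= n}"
proof (intro equalityI subsetI)
 fix z assume "z \<in> (\<Union>n\<in>{1..}. diagonal_square_vertices (center n) (real (d n))) \<inter> negative_real_axis"
 then obtain n where n: "1 <= n" "z \<in> diagonal_square_vertices (center n) (real (d n))" "Im z = 0" by (auto simp: negative_real_axis_def)
 have "z = of_real (vertex n) \<or> z = of_real (vertex (Suc n))" using n(2,3) d_pos[OF n(1)] center_eq[OF n(1)] n(3) by (auto simp: diagonal_square_vertices_def complex_eq_iff)
 moreover have "1 <= Suc n" by simp
 ultimately show "z \<in> {of_real (vertex n) | n. 1 <= n}" using n(1) by blast
next
 fix z :: complex assume "z \<in> {of_real (vertex n) | n. 1 <= n}"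
 then obtain n where n: "1 <= n" "z = of_real (vertex n)" by blast
 have "z \<in> diagonal_square_vertices (center n) (real (d n))" using center_eq(1)[OF n(1)] n(2) by (auto simp: complex_eq_iff diagonal_square_vertices_def)
 moreover have "z \<in> negative_real_axis" using vertex_le[OF n(1)] n by (simp add: negative_real_axis_def)
 ultimately show "z \<in> (\<Union>n\<in>{1..}. diagonal_square_vertices (center n) (real (d n))) \<inter> negative_real_axis" using n(1) by blast
qed

lemma critical_outside_zeros:
 "{z. critical_point model z} - ({0} \<union> {of_real (center n) | n. 1 <= n}) = {of_real (vertex n) | n. 1 <= n}"
proof -
 have "{0} \<union> {of_real (center n) | n. 1 <= n} = zeros" by (auto simp: zeros_def)
 moreover have "{z. critical_point model z} - zeros = {of_real (vertex n) | n. 1 <= n}" using critical_iff vertex_not_zero by blast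
 ultimately show ?thesis by simp
qed

lemma critical_values: "{w. critical_value model w} = {0, 1}"
proof (intro equalityI subsetI)
 fix w assume "w \<in> {w. critical_value model w}"
 then obtain z where "critical_point model z" "model z = w" by (auto simp: critical_value_def)
 thus "w \<in> {0, 1}" using critical_iff model_zeros model_vertex by blast
next
 fix w :: complex assume "w \<in> {0, 1}"
 moreover have "critical_value model 0" unfolding critical_value_def
  using critical_iff model_zeros[of 0] by (intro exI[of _ 0]) (simp add: zeros_def)
 moreover have "critical_value model 1" unfolding critical_value_def
  using critical_iff model_vertex[of 1] by (intro exI[of _ "of_real (vertex 1)"]) auto
 ultimately show "w \<in> {w. critical_value model w}" by auto
qed

end

section \<open>The theorem\<close>

theorem mainTheorem1:
  shows "\<exists>K>1. \<exists>B :: complex set \<Rightarrow> real. (\<forall>X. compact X \<longrightarrow> B X > 0) \<and>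
    (\<forall>(P :: nat \<Rightarrow> complex set) (d :: nat \<Rightarrow> nat). admissible_squares P d \<longrightarrow>
      (\<exists>F :: complex \<Rightarrow> complex.
        quasiregular_plane K F \<and> branched_covering F UNIV UNIV \<and>
        F -` ball 0 1 = ball 0 1 \<union> (\<Union>n\<in>{1..}. P n) \<and>
        \<comment> \<open>(1)\<close>
        (\<forall>z\<in>ball 0 1. F z = z\<^sup>2) \<and>
        (\<forall>z. F (cnj z) = cnj (F z)) \<and>
        \<comment> \<open>(2)\<close>
        (\<forall>n\<ge>1. branched_covering_of_degree (d n) F (P n) (ball 0 1) \<and>
               {z \<in> P n. critical_point F z} = {of_real (square_center d n)} \<and>
               F (of_real (square_center d n)) = 0) \<and>
        \<comment> \<open>(3)\<close>
        {z. critical_point F z} - ({0} \<union> {of_real (square_center d n) | n. n \<ge> 1}) =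
          (\<Union>n\<in>{1..}. diagonal_square_vertices (square_center d n) (real (d n)))
            \<inter> negative_real_axis \<and>
        (\<forall>z \<in> (\<Union>n\<in>{1..}. diagonal_square_vertices (square_center d n) (real (d n)))
            \<inter> negative_real_axis. F z = 1) \<and>
        \<comment> \<open>(4)\<close>
        (\<nexists>a. asymptotic_value F a) \<and>
        {w. critical_value F w} = {0, 1} \<and>
        \<comment> \<open>(5)\<close>
        (\<forall>X. compact X \<longrightarrow> (\<forall>z\<in>X. norm (F z) < B X))))"
proof -
 define B :: "complex set => real" where "B X = 1 + exp (pi * Sup (cmod ` X))" for X
 have B: "cmod z <= Sup (cmod ` X)" if X: "compact X" and z: "z \<in> X" for X and z :: complex
 proof -
  have "bdd_above (cmod ` X)" using compact_imp_bounded[OF X] by (auto simp: bounded_iff bdd_above_def)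
  thus ?thesis using z by (intro cSup_upper) auto
 qed
 have B_pos: "B X > 0" for X by (simp add: B_def add_pos_pos)
 show ?thesis
 proof (rule exI[of _ "5000 :: real"], intro conjI exI[of _ B] allI impI)
  fix P :: "nat => complex set" and d assume adm: "admissible_squares P d"
  interpret even_multiplicities d by unfold_locales (use adm in "auto simp: admissible_squares_def")
  have P: "P n = square n" if "n >= 1" for n using adm that by (simp add: admissible_squares_def)
  have UP: "(\<Union>n\<in>{1..}. P n) = (\<Union>n\<in>{1..}. square n)" using P by (intro SUP_cong) auto
  show "EX F :: complex => complex.
    quasiregular_plane 5000 F & branched_covering F UNIV UNIV &
    F -` ball 0 1 = ball 0 1 \<union> (\<Union>n\<in>{1..}. P n) &
    (ALL z:ball 0 1. F z = z\<^sup>2) &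
    (ALL z. F (cnj z) = cnj (F z)) &
    (ALL n>=1. branched_covering_of_degree (d n) F (P n) (ball 0 1) &
        {z \<in> P n. critical_point F z} = {of_real (square_center d n)} &
        F (of_real (square_center d n)) = 0) &
    {z. critical_point F z} - ({0} \<union> {of_real (square_center d n) | n. n >= 1}) =
     (\<Union>n\<in>{1..}. diagonal_square_vertices (square_center d n) (real (d n)))
      \<inter> negative_real_axis &
    (ALL z: (\<Union>n\<in>{1..}. diagonal_square_vertices (square_center d n) (real (d n)))
      \<inter> negative_real_axis. F z = 1) &
    (\<nexists>a. asymptotic_value F a) &
    {w. critical_value F w} = {0, 1} &
    (ALL X. compact X --> (ALL z:X. norm (F z) < B X))"
  proof (intro exI[of _ model] conjI allI ballI impI)
   show "quasiregular_plane 5000 model" by (rule quasiregular_plane_model)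
   show "branched_covering model UNIV UNIV" by (rule model_covering)
   show "model -` ball 0 1 = ball 0 1 \<union> (\<Union>n\<in>{1..}. P n)" unfolding UP by (rule model_preimage_disc)
   show "model z = z\<^sup>2" if "z \<in> ball 0 1" for z using that by (intro model_disc) simp
   show "model (cnj z) = cnj (model z)" for z by (rule model_cnj)
   show "{z. critical_point model z} - ({0} \<union> {of_real (square_center d n) | n. n >= 1}) =
     (\<Union>n\<in>{1..}. diagonal_square_vertices (square_center d n) (real (d n))) \<inter> negative_real_axis"
    unfolding vertices_on_axis critical_outside_zeros ..
   show "model z = 1" if "z \<in> (\<Union>n\<in>{1..}. diagonal_square_vertices (square_center d n) (real (d n))) \<inter> negative_real_axis" for z
    using that model_vertex unfolding vertices_on_axis by blast
   show "\<nexists>a. asymptotic_value model a" using no_asymptotic_value by blast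
   show "{w. critical_value model w} = {0, 1}" by (rule critical_values)
   fix n :: nat assume n: "1 <= n"
   show "branched_covering_of_degree (d n) model (P n) (ball 0 1)" unfolding P[OF n] by (rule model_square_covering[OF n])
   show "{z \<in> P n. critical_point model z} = {of_real (square_center d n)}" unfolding P[OF n] by (rule critical_in_square[OF n])
   show "model (of_real (square_center d n)) = 0" by (rule model_zeros) (use n in "auto simp: zeros_def")
  next
   fix X and z :: complex assume X: "compact X" "z \<in> X"
   have "cmod (model z) <= exp (pi * cmod z)" by (rule model_bound)
   also have "... <= exp (pi * Sup (cmod ` X))" using B[OF X] by simp
   also have "... < B X" by (simp add: B_def)
   finally show "cmod (model z) < B X" .
  qed
 qed (use B_pos in auto)
qed

end
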